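(* For $a>0$ let $\mathsf R_a=(-\tfrac a2,\tfrac a2)\times(-\tfrac1{2a},\tfrac1{2a})$ be the rectangle of side lengths $a$ and $a^{-1}$. For every $n\in\mathbb N=\{1,2,\dots\}$ there exist constants $c_n,B_n>0$ (depending only on $n$) such that for all $a>0$ and all $B\ge B_n$, \[ \frac{\lambda_n(\mathsf R_a,B)}{\lambda_n(\mathsf R_1,B)}\ \ge\ 1+c_nB\,\frac{(a^2-1)^2}{1+a^4}-\frac{\ln B}{c_n}. \]
   Context: For a bounded simply-connected domain $\Omega\subset\mathbb R^2$ and $B\ge 0$, let $\mathscr L_{\Omega,B}$ be the shifted magnetic Dirichlet Laplacian in $L^2(\Omega)$, \[ \mathscr L_{\Omega,B}u = -(\nabla-i\mathbf A)^2u - Bu,\qquad \mathrm{dom}\,\mathscr L_{\Omega,B}=\{u\in H^1_0(\Omega)\colon \Delta u\in L^2(\Omega)\}, \] where $\mathbf A=(A_1,A_2)^\top$ is a vector potential with $\partial_1A_2-\partial_2A_1=B$; for definiteness take $\mathbf A=(-Bx_2,0)^\top$. This operator is self-adjoint with compact resolvent, and $\lambda_1(\Omega,B)\le\lambda_2(\Omega,B)\le\cdots$ denote its eigenvalues in non-decreasing order, repeated with multiplicity (they are positive). *)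

theory Defs
  imports "HOL-Analysis.Analysis"
begin

text \<open>
  The plane is \<^typ>\<open>real \<times> real\<close>; elements of $L^2(\Omega)$ are represented by functions on the
  plane, only their values on \<open>\<Omega>\<close> up to Lebesgue null sets being relevant. A complex vector field
  has type \<^typ>\<open>real \<times> real \<Rightarrow> complex \<times> complex\<close>.
\<close>

definition sq_integrable :: "(real \<times> real) set \<Rightarrow> (real \<times> real \<Rightarrow> 'b::euclidean_space) \<Rightarrow> bool"
  where "sq_integrable \<Omega> u \<longleftrightarrow>
    u \<in> borel_measurable (lebesgue_on \<Omega>) \<and> integrable (lebesgue_on \<Omega>) (\<lambda>x. (norm (u x))\<^sup>2)"

definition dir_deriv :: "real \<times> real \<Rightarrow> (real \<times> real \<Rightarrow> complex) \<Rightarrow> real \<times> real \<Rightarrow> complex"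
  where "dir_deriv e f = (\<lambda>x. frechet_derivative f (at x) e)"

fun iter_dir_deriv :: "(real \<times> real) list \<Rightarrow> (real \<times> real \<Rightarrow> complex) \<Rightarrow> real \<times> real \<Rightarrow> complex"
  where
    "iter_dir_deriv [] f = f"
  | "iter_dir_deriv (e # es) f = dir_deriv e (iter_dir_deriv es f)"

definition grad :: "(real \<times> real \<Rightarrow> complex) \<Rightarrow> real \<times> real \<Rightarrow> complex \<times> complex"
  where "grad f = (\<lambda>x. (dir_deriv (1, 0) f x, dir_deriv (0, 1) f x))"

text \<open>
  Smoothness: all iterated partial derivatives exist and are differentiable everywhere (hence also
  continuous).
\<close>

definition smooth :: "(real \<times> real \<Rightarrow> complex) \<Rightarrow> bool"
  where "smooth f \<longleftrightarrow>
    (\<forall>es. set es \<subseteq> {(1, 0), (0, 1)} \<longrightarrow> (\<forall>x. iter_dir_deriv es f differentiable (at x)))"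

definition test_functions :: "(real \<times> real) set \<Rightarrow> (real \<times> real \<Rightarrow> complex) set"
  where "test_functions \<Omega> =
    {\<phi>. smooth \<phi> \<and> (\<exists>K. compact K \<and> K \<subseteq> \<Omega> \<and> (\<forall>x. x \<notin> K \<longrightarrow> \<phi> x = 0))}"

text \<open>The bilinear (not sesquilinear) product on $\mathbb{C}^2$.\<close>

definition cdot :: "complex \<times> complex \<Rightarrow> complex \<times> complex \<Rightarrow> complex"
  where "cdot v w = fst v * fst w + snd v * snd w"

definition has_weak_grad ::
    "(real \<times> real) set \<Rightarrow> (real \<times> real \<Rightarrow> complex) \<Rightarrow> (real \<times> real \<Rightarrow> complex \<times> complex) \<Rightarrow> bool"
  where "has_weak_grad \<Omega> u g \<longleftrightarrow> sq_integrable \<Omega> u \<and> sq_integrable \<Omega> g \<and>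
    (\<forall>\<phi>\<in>test_functions \<Omega>.
       (LINT x|lebesgue_on \<Omega>. u x * fst (grad \<phi> x)) = - (LINT x|lebesgue_on \<Omega>. fst (g x) * \<phi> x) \<and>
       (LINT x|lebesgue_on \<Omega>. u x * snd (grad \<phi> x)) = - (LINT x|lebesgue_on \<Omega>. snd (g x) * \<phi> x))"

definition has_weak_div ::
    "(real \<times> real) set \<Rightarrow> (real \<times> real \<Rightarrow> complex \<times> complex) \<Rightarrow> (real \<times> real \<Rightarrow> complex) \<Rightarrow> bool"
  where "has_weak_div \<Omega> v d \<longleftrightarrow> sq_integrable \<Omega> v \<and> sq_integrable \<Omega> d \<and>
    (\<forall>\<phi>\<in>test_functions \<Omega>.
       (LINT x|lebesgue_on \<Omega>. cdot (v x) (grad \<phi> x)) = - (LINT x|lebesgue_on \<Omega>. d x * \<phi> x))"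

text \<open>$H^1_0(\Omega)$ is the closure of the test functions in the norm of $H^1(\Omega)$.\<close>

definition H10 :: "(real \<times> real) set \<Rightarrow> (real \<times> real \<Rightarrow> complex) set"
  where "H10 \<Omega> = {u. \<exists>g. has_weak_grad \<Omega> u g \<and>
    (\<exists>\<phi> :: nat \<Rightarrow> real \<times> real \<Rightarrow> complex. (\<forall>k. \<phi> k \<in> test_functions \<Omega>) \<and>
       (\<lambda>k. LINT x|lebesgue_on \<Omega>. (norm (\<phi> k x - u x))\<^sup>2) \<longlonglongrightarrow> 0 \<and>
       (\<lambda>k. LINT x|lebesgue_on \<Omega>. (norm (grad (\<phi> k) x - g x))\<^sup>2) \<longlonglongrightarrow> 0)}"

definition magnetic_dom :: "(real \<times> real) set \<Rightarrow> (real \<times> real \<Rightarrow> complex) set"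
  where "magnetic_dom \<Omega> = {u \<in> H10 \<Omega>. \<exists>g f. has_weak_grad \<Omega> u g \<and> has_weak_div \<Omega> g f}"

text \<open>A vector potential with $\partial_1 A_2 - \partial_2 A_1 = B$.\<close>

definition vec_pot :: "real \<Rightarrow> real \<times> real \<Rightarrow> complex \<times> complex"
  where "vec_pot B x = (complex_of_real (- B * snd x), 0)"

text \<open>
  \<open>magnetic_op \<Omega> B u f\<close> says that \<open>u\<close> lies in the domain of the shifted magnetic Dirichlet
  Laplacian and is mapped to \<open>f\<close>. Here $v = (\nabla - iA)u$ and
  $(\nabla - iA)^2 u = (\nabla - iA) \cdot v = \mathrm{div}\, v - i A \cdot v$. The relation is
  functional in \<open>f\<close> up to Lebesgue null sets.
\<close>

definition magnetic_op ::
    "(real \<times> real) set \<Rightarrow> real \<Rightarrow> (real \<times> real \<Rightarrow> complex) \<Rightarrow> (real \<times> real \<Rightarrow> complex) \<Rightarrow> bool"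
  where "magnetic_op \<Omega> B u f \<longleftrightarrow> u \<in> magnetic_dom \<Omega> \<and>
    (\<exists>g v d. has_weak_grad \<Omega> u g \<and>
       v = (\<lambda>x. (fst (g x) - \<i> * fst (vec_pot B x) * u x,
                 snd (g x) - \<i> * snd (vec_pot B x) * u x)) \<and>
       has_weak_div \<Omega> v d \<and>
       f = (\<lambda>x. - (d x - \<i> * cdot (vec_pot B x) (v x)) - complex_of_real B * u x))"

text \<open>
  The eigenspace for \<open>t\<close>, consisting of representatives and including the zero function. Real \<open>t\<close>
  suffice because the operator is self-adjoint.
\<close>

definition eigenspace :: "(real \<times> real) set \<Rightarrow> real \<Rightarrow> real \<Rightarrow> (real \<times> real \<Rightarrow> complex) set"
  where "eigenspace \<Omega> B t =
    {u. \<exists>f. magnetic_op \<Omega> B u f \<and> (AE x in lebesgue_on \<Omega>. f x = complex_of_real t * u x)}"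

text \<open>Linear independence over \<open>\<complex>\<close> in $L^2(\Omega)$, that is, modulo equality almost everywhere.\<close>

definition lin_indep :: "(real \<times> real) set \<Rightarrow> (real \<times> real \<Rightarrow> complex) list \<Rightarrow> bool"
  where "lin_indep \<Omega> us \<longleftrightarrow> (\<forall>c :: nat \<Rightarrow> complex.
    (AE x in lebesgue_on \<Omega>. (\<Sum>i<length us. c i * (us ! i) x) = 0) \<longrightarrow> (\<forall>i<length us. c i = 0))"

text \<open>
  The dimension of the eigenspace; it is \<open>0\<close> if and only if \<open>t\<close> is not an eigenvalue.
\<close>

definition multiplicity_eig :: "(real \<times> real) set \<Rightarrow> real \<Rightarrow> real \<Rightarrow> enat"
  where "multiplicity_eig \<Omega> B t =
    (SUP us\<in>{us. set us \<subseteq> eigenspace \<Omega> B t \<and> lin_indep \<Omega> us}. enat (length us))"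

text \<open>The number of eigenvalues in $(-\infty, t]$, counted with multiplicity.\<close>

definition eig_count :: "(real \<times> real) set \<Rightarrow> real \<Rightarrow> real \<Rightarrow> enat"
  where "eig_count \<Omega> B t =
    (SUP S\<in>{S. finite S \<and> S \<subseteq> {..t}}. \<Sum>s\<in>S. multiplicity_eig \<Omega> B s)"

text \<open>
  The \<open>n\<close>-th eigenvalue, \<open>n \<ge> 1\<close>, in the non-decreasing enumeration with multiplicities. As the
  spectrum is discrete and bounded below, the infimum is attained.
\<close>

definition eig :: "nat \<Rightarrow> (real \<times> real) set \<Rightarrow> real \<Rightarrow> real"
  where "eig n \<Omega> B = Inf {t. enat n \<le> eig_count \<Omega> B t}"

definition rectangle :: "real \<Rightarrow> (real \<times> real) set"
  where "rectangle a = {- (a / 2)<..<a / 2} \<times> {- (1 / (2 * a))<..<1 / (2 * a)}"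

end

theory Submission
  imports Defs "HOL-Complex_Analysis.Complex_Analysis" "HOL-Library.Function_Algebras"
begin

text \<open>After the shift by B the quadratic form of the operator is a square: on functions
  vanishing at the boundary it is the squared norm of \<open>cov_bar B\<close>, the magnetic
  Cauchy-Riemann operator (\<open>energy_identity\<close>). If u has Laplacian 1, multiplication by
  a factor of modulus exp(B u) turns this operator into the ordinary Cauchy-Riemann operator
  (\<open>cov_bar_gauge\<close>). The low eigenvalues are therefore exponentially small in B, with
  an exponent given by the oscillation of u. The right u vanishes on the boundary, so it is minus
  the torsion function; on the rectangle with half sides p and q the torsion is largest at the
  center, with value \<open>torsion_max p q\<close>. Write T_a for this value on the rectangle with
  sides a and 1/a.

  Lower bound: a rectangle of area 1 has a side of length at most 1, so the Poincare inequality
  holds with constant 1 after the gauge change, and every eigenvalue is at least exp(-2 B T_a)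
  (\<open>test_lower_bound\<close>, \<open>eig_torsion_bound\<close>). Upper bound on the square:
  the products of exp(-B u), a monomial and a cutoff have energy only in a boundary layer of width
  1/B, while their mass sits near the center. This gives lambda_n <= C B^(4 + 2n) exp(-2 B T_1)
  (\<open>trial_functions\<close>, \<open>square_upper_bound\<close>). The quotient is thus at least
  exp(2 B (T_1 - T_a)) divided by C B^(4 + 2n), and exp x >= 1 + x produces the term linear in B and
  the logarithm.

  What remains is T_1 - T_a >= c (a^2 - 1)^2 / (1 + a^4) (\<open>torsion_gap\<close>). By separation
  of variables the maximal torsion is an explicit series in r = a^2. It is concave for r <= 10/9,
  strongly so near r = 1, and invariant under r -> 1/r because a quarter turn exchanges the sides;
  hence it is largest at r = 1, with a quadratic gap.

  Since the eigenvalues are defined by multiplicities of a weakly defined operator, a variational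
  principle has to be supplied: the form is closed, its domain embeds compactly
  (\<open>rellich\<close>), and successive minimisation yields eigenfunctions below any level
  reached by n trial functions (\<open>min_max_upper\<close>, \<open>eig_count_upper\<close>).
  Conversely every eigenfunction lies in the form domain and so obeys the lower bounds proved for
  test functions (\<open>eigenvalue_lower_bound\<close>).\<close>

subsection \<open>Smooth functions\<close>

abbreviation cplx :: "real \<times> real \<Rightarrow> complex" where "cplx x \<equiv> Complex (fst x) (snd x)"

text \<open>A class of differentiable functions that is closed under both first partials contains
  all iterated partials of its members. Exhibiting such a class replaces every computation with
  higher derivatives.\<close>

lemma smooth_coinduct:
  assumes "h \<in> A"
    and "\<And>h. h \<in> A \<Longrightarrow> (\<forall>x. h differentiable (at x)) \<and> dir_deriv (1, 0) h \<in> A \<and> dir_deriv (0, 1) h \<in> A"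
  shows "smooth h"
proof -
  have "iter_dir_deriv es h \<in> A" if "set es \<subseteq> {(1, 0), (0, 1)}" for es
    using that by (induction es) (use assms in auto)
  then show ?thesis using assms(2) unfolding smooth_def by blast
qed

lemma smooth_differentiable: "smooth h \<Longrightarrow> h differentiable (at x)"
  unfolding smooth_def by (metis empty_subsetI iter_dir_deriv.simps(1) list.set(1))

lemma iter_dir_deriv_append: "iter_dir_deriv es (dir_deriv e h) = iter_dir_deriv (es @ [e]) h"
  by (induction es) auto

lemma smooth_dir_deriv: "smooth h \<Longrightarrow> e \<in> {(1, 0), (0, 1)} \<Longrightarrow> smooth (dir_deriv e h)"
  unfolding smooth_def iter_dir_deriv_append by auto

lemma dir_derivI: "(h has_derivative D) (at x) \<Longrightarrow> dir_deriv e h x = D e"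
  by (simp add: dir_deriv_def frechet_derivative_at[symmetric])

lemma has_derivative_frechet:
  "h differentiable (at x) \<Longrightarrow> (h has_derivative frechet_derivative h (at x)) (at x)"
  by (simp add: frechet_derivative_works)

text \<open>The witness \<open>G\<close> lists all derivatives of \<open>f\<close>, so smoothness on
  the line needs no iterated derivative operator.\<close>

definition smooth1 :: "(real \<Rightarrow> real) \<Rightarrow> bool" where
  "smooth1 f \<longleftrightarrow> (\<exists>G. G 0 = f \<and> (\<forall>n t. (G n has_real_derivative G (Suc n) t) (at t)))"

lemma smooth1_deriv:
  assumes "smooth1 f"
  shows "\<exists>f'. smooth1 f' \<and> (\<forall>t. (f has_real_derivative f' t) (at t))"
proof -
  obtain G where G: "G 0 = f" "\<And>n t. (G n has_real_derivative G (Suc n) t) (at t)"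
    using assms unfolding smooth1_def by blast
  have "smooth1 (G 1)" unfolding smooth1_def
    by (rule exI[of _ "\<lambda>n. G (Suc n)"]) (use G in simp)
  then show ?thesis using G(1) G(2)[of 0] by auto
qed

text \<open>The class fed to \<open>smooth_coinduct\<close>. It contains the smooth functions and
  turns out to equal them, so that its introduction rules become closure rules for
  \<open>smooth\<close>.\<close>

inductive_set smooth_alg :: "(real \<times> real \<Rightarrow> complex) set" where
  base: "smooth f \<Longrightarrow> f \<in> smooth_alg"
| fst: "smooth1 h \<Longrightarrow> (\<lambda>x. of_real (h (fst x))) \<in> smooth_alg"
| snd: "smooth1 h \<Longrightarrow> (\<lambda>x. of_real (h (snd x))) \<in> smooth_alg"
| entire: "F holomorphic_on UNIV \<Longrightarrow> (\<lambda>x. F (cplx x)) \<in> smooth_alg"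
| add: "f \<in> smooth_alg \<Longrightarrow> g \<in> smooth_alg \<Longrightarrow> (\<lambda>x. f x + g x) \<in> smooth_alg"
| mult: "f \<in> smooth_alg \<Longrightarrow> g \<in> smooth_alg \<Longrightarrow> (\<lambda>x. f x * g x) \<in> smooth_alg"
| cnj: "f \<in> smooth_alg \<Longrightarrow> (\<lambda>x. cnj (f x)) \<in> smooth_alg"

lemma cplx_eq: "cplx x = complex_of_real (fst x) + \<i> * complex_of_real (snd x)"
  by (simp add: complex_eq_iff)

lemma has_derivative_cplx: "(cplx has_derivative cplx) (at x)"
  unfolding cplx_eq by (auto intro!: derivative_eq_intros)

lemma has_derivative_entire:
  assumes "F holomorphic_on UNIV"
  shows "((\<lambda>x. F (cplx x)) has_derivative (\<lambda>v. deriv F (cplx x) * cplx v)) (at x)"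
proof -
  have "(F has_field_derivative deriv F (cplx x)) (at (cplx x))"
    using assms holomorphic_derivI by blast
  then have "(F has_derivative (*) (deriv F (cplx x))) (at (cplx x))"
    by (simp add: has_field_derivative_def)
  from has_derivative_compose[OF has_derivative_cplx this] show ?thesis .
qed

lemma smooth_alg_closed:
  assumes "h \<in> smooth_alg"
  shows "(\<forall>x. h differentiable (at x)) \<and> dir_deriv (1, 0) h \<in> smooth_alg \<and> dir_deriv (0, 1) h \<in> smooth_alg"
  using assms
proof induction
  case (base f)
  then show ?case by (auto intro: smooth_alg.base smooth_dir_deriv smooth_differentiable)
next
  case (fst h)
  then obtain h' where h': "smooth1 h'" "\<And>t. (h has_real_derivative h' t) (at t)"
    using smooth1_deriv by blast
  have D: "((\<lambda>x. complex_of_real (h (fst x))) has_derivative (\<lambda>v. of_real (h' (fst x) * fst v))) (at x)" for x :: "real \<times> real"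
    by (intro has_derivative_of_real has_derivative_compose[OF has_derivative_fst[OF has_derivative_ident]])
      (use h'(2) in \<open>auto simp: has_field_derivative_def\<close>)
  \<comment> \<open>The vanishing partial is written as a constant entire function of
    \<open>cplx x\<close>, which puts it into \<open>smooth_alg\<close>.\<close>
  have "dir_deriv (1, 0) (\<lambda>x. complex_of_real (h (fst x))) = (\<lambda>x. of_real (h' (fst x)))"
       "dir_deriv (0, 1) (\<lambda>x. complex_of_real (h (fst x))) = (\<lambda>x. (\<lambda>_. 0) (cplx x))"
    using dir_derivI[OF D] by (auto simp: fun_eq_iff)
  then show ?case using D h'(1) smooth_alg.fst smooth_alg.entire[of "\<lambda>_. 0"]
    by (auto simp: differentiable_def)
next
  case (snd h)
  then obtain h' where h': "smooth1 h'" "\<And>t. (h has_real_derivative h' t) (at t)"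
    using smooth1_deriv by blast
  have D: "((\<lambda>x. complex_of_real (h (snd x))) has_derivative (\<lambda>v. of_real (h' (snd x) * snd v))) (at x)" for x :: "real \<times> real"
    by (intro has_derivative_of_real has_derivative_compose[OF has_derivative_snd[OF has_derivative_ident]])
      (use h'(2) in \<open>auto simp: has_field_derivative_def\<close>)
  have "dir_deriv (0, 1) (\<lambda>x. complex_of_real (h (snd x))) = (\<lambda>x. of_real (h' (snd x)))"
       "dir_deriv (1, 0) (\<lambda>x. complex_of_real (h (snd x))) = (\<lambda>x. (\<lambda>_. 0) (cplx x))"
    using dir_derivI[OF D] by (auto simp: fun_eq_iff)
  then show ?case using D h'(1) smooth_alg.snd smooth_alg.entire[of "\<lambda>_. 0"]
    by (auto simp: differentiable_def)
next
  case (entire F)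
  note D = has_derivative_entire[OF entire]
  have dF: "deriv F holomorphic_on UNIV" using entire by (rule holomorphic_deriv) auto
  have "dir_deriv (1, 0) (\<lambda>x. F (cplx x)) = (\<lambda>x. deriv F (cplx x))"
       "dir_deriv (0, 1) (\<lambda>x. F (cplx x)) = (\<lambda>x. (\<lambda>z. deriv F z * \<i>) (cplx x))"
    using dir_derivI[OF D] by (auto simp: fun_eq_iff complex_eq_iff)
  moreover have "(\<lambda>z. deriv F z * \<i>) holomorphic_on UNIV" by (intro holomorphic_on_mult dF holomorphic_on_const)
  ultimately show ?case using D smooth_alg.entire[OF dF] smooth_alg.entire[of "\<lambda>z. deriv F z * \<i>"]
    unfolding differentiable_def by auto
next
  case (add f g)
  have D: "((\<lambda>x. f x + g x) has_derivative (\<lambda>v. frechet_derivative f (at x) v + frechet_derivative g (at x) v)) (at x)" for x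
    using add.IH by (intro has_derivative_add has_derivative_frechet) blast+
  have "dir_deriv e (\<lambda>x. f x + g x) = (\<lambda>x. dir_deriv e f x + dir_deriv e g x)" for e
    using dir_derivI[OF D] by (auto simp: fun_eq_iff dir_deriv_def[of e f] dir_deriv_def[of e g])
  then show ?case using D add by (auto simp: differentiableI intro!: smooth_alg.add)
next
  case (mult f g)
  have D: "((\<lambda>x. f x * g x) has_derivative (\<lambda>v. f x * frechet_derivative g (at x) v + frechet_derivative f (at x) v * g x)) (at x)" for x
    using mult.IH by (intro has_derivative_mult has_derivative_frechet) blast+
  have "dir_deriv e (\<lambda>x. f x * g x) = (\<lambda>x. f x * dir_deriv e g x + dir_deriv e f x * g x)" for e
    using dir_derivI[OF D] by (auto simp: fun_eq_iff dir_deriv_def[of e f] dir_deriv_def[of e g])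
  then show ?case using D mult by (auto simp: differentiableI intro!: smooth_alg.add smooth_alg.mult)
next
  case (cnj f)
  have D: "((\<lambda>x. cnj (f x)) has_derivative (\<lambda>v. cnj (frechet_derivative f (at x) v))) (at x)" for x
    using cnj.IH by (intro has_derivative_cnj has_derivative_frechet) blast+
  have "dir_deriv e (\<lambda>x. cnj (f x)) = (\<lambda>x. cnj (dir_deriv e f x))" for e
    using dir_derivI[OF D] by (auto simp: fun_eq_iff dir_deriv_def[of e f])
  moreover have "\<forall>x. (\<lambda>x. cnj (f x)) differentiable (at x)" using D differentiableI by blast
  ultimately show ?case using cnj by (auto intro!: smooth_alg.cnj)
qed

lemma smooth_iff_smooth_alg: "smooth h \<longleftrightarrow> h \<in> smooth_alg"
  using smooth_coinduct[of h smooth_alg] smooth_alg_closed smooth_alg.base by blast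

lemmas smooth_add = smooth_alg.add[folded smooth_iff_smooth_alg]
  and smooth_mult = smooth_alg.mult[folded smooth_iff_smooth_alg]
  and smooth_cnj = smooth_alg.cnj[folded smooth_iff_smooth_alg]
  and smooth_entire = smooth_alg.entire[folded smooth_iff_smooth_alg]
  and smooth_fst = smooth_alg.fst[folded smooth_iff_smooth_alg]
  and smooth_snd = smooth_alg.snd[folded smooth_iff_smooth_alg]

lemma smooth_const: "smooth (\<lambda>_. c)"
  using smooth_entire[of "\<lambda>_. c"] by simp

lemma smooth_sum: "(\<And>i. i \<in> I \<Longrightarrow> smooth (f i)) \<Longrightarrow> smooth (\<lambda>x. \<Sum>i\<in>I. f i x)"
  by (induction I rule: infinite_finite_induct) (auto intro: smooth_const smooth_add)

lemma dir_deriv_add: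
  "smooth f \<Longrightarrow> smooth g \<Longrightarrow> dir_deriv e (\<lambda>x. f x + g x) x = dir_deriv e f x + dir_deriv e g x"
  using dir_derivI[OF has_derivative_add[OF has_derivative_frechet has_derivative_frechet], of f x g e]
  by (simp add: smooth_differentiable dir_deriv_def)

lemma dir_deriv_mult:
  "smooth f \<Longrightarrow> smooth g \<Longrightarrow> dir_deriv e (\<lambda>x. f x * g x) x = f x * dir_deriv e g x + dir_deriv e f x * g x"
  using dir_derivI[OF has_derivative_mult[OF has_derivative_frechet has_derivative_frechet], of f x g e]
  by (simp add: smooth_differentiable dir_deriv_def)

lemma dir_deriv_cnj: "smooth f \<Longrightarrow> dir_deriv e (\<lambda>x. cnj (f x)) x = cnj (dir_deriv e f x)"
  using dir_derivI[OF has_derivative_cnj[OF has_derivative_frechet], of f x e]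
  by (simp add: smooth_differentiable dir_deriv_def)

lemma dir_deriv_const: "dir_deriv e (\<lambda>_. c) x = 0"
  using dir_derivI[OF has_derivative_const] .

lemma dir_deriv_entire:
  assumes "F holomorphic_on UNIV"
  shows "dir_deriv (1, 0) (\<lambda>x. F (cplx x)) x = deriv F (cplx x)"
    and "dir_deriv (0, 1) (\<lambda>x. F (cplx x)) x = \<i> * deriv F (cplx x)"
  using dir_derivI[OF has_derivative_entire[OF assms], of _ x] by (auto simp: complex_eq_iff)

lemma dir_deriv_fst:
  assumes "(h has_real_derivative h') (at (fst x))"
  shows "dir_deriv e (\<lambda>x. complex_of_real (h (fst x))) x = of_real (h' * fst e)"
  by (rule dir_derivI, intro has_derivative_of_real has_derivative_compose[OF has_derivative_fst[OF has_derivative_ident]])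
    (use assms in \<open>auto simp: has_field_derivative_def\<close>)

lemma dir_deriv_snd:
  assumes "(h has_real_derivative h') (at (snd x))"
  shows "dir_deriv e (\<lambda>x. complex_of_real (h (snd x))) x = of_real (h' * snd e)"
  by (rule dir_derivI, intro has_derivative_of_real has_derivative_compose[OF has_derivative_snd[OF has_derivative_ident]])
    (use assms in \<open>auto simp: has_field_derivative_def\<close>)

lemma smooth_continuous_on: "smooth f \<Longrightarrow> continuous_on S f"
  using smooth_differentiable differentiable_imp_continuous_within continuous_at_imp_continuous_on by blast

lemma smooth_dir_deriv_1: "smooth f \<Longrightarrow> smooth (dir_deriv (1, 0) f)"
  and smooth_dir_deriv_2: "smooth f \<Longrightarrow> smooth (dir_deriv (0, 1) f)"
  by (simp_all add: smooth_dir_deriv)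

section \<open>A smooth transition from 0 to 1 with bounded derivative\<close>

subsection \<open>A smooth step function\<close>

lemma smooth1_coinduct:
  assumes "h \<in> A" and "\<And>h. h \<in> A \<Longrightarrow> \<exists>h'\<in>A. \<forall>t. (h has_real_derivative h' t) (at t)"
  shows "smooth1 h"
proof -
  obtain d where d: "\<And>h. h \<in> A \<Longrightarrow> d h \<in> A" "\<And>h t. h \<in> A \<Longrightarrow> (h has_real_derivative d h t) (at t)"
    using assms(2) by metis
  have "(d ^^ n) h \<in> A" for n by (induction n) (use assms d in auto)
  then show ?thesis unfolding smooth1_def
    by (intro exI[of _ "\<lambda>n. (d ^^ n) h"]) (use d in auto)
qed

inductive_set smooth1_alg :: "(real \<Rightarrow> real) set" where
  base: "smooth1 h \<Longrightarrow> h \<in> smooth1_alg"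
| add: "f \<in> smooth1_alg \<Longrightarrow> g \<in> smooth1_alg \<Longrightarrow> (\<lambda>t. f t + g t) \<in> smooth1_alg"
| mult: "f \<in> smooth1_alg \<Longrightarrow> g \<in> smooth1_alg \<Longrightarrow> (\<lambda>t. f t * g t) \<in> smooth1_alg"

lemma smooth1_alg_closed: "h \<in> smooth1_alg \<Longrightarrow> \<exists>h'\<in>smooth1_alg. \<forall>t. (h has_real_derivative h' t) (at t)"
proof (induction rule: smooth1_alg.induct)
  case (base h)
  then show ?case using smooth1_deriv smooth1_alg.base by blast
next
  case (add f g)
  then obtain f' g' where *: "f' \<in> smooth1_alg" "\<And>t. (f has_real_derivative f' t) (at t)"
    "g' \<in> smooth1_alg" "\<And>t. (g has_real_derivative g' t) (at t)" by blast
  then show ?case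
    by (intro bexI[of _ "\<lambda>t. f' t + g' t"]) (auto intro!: smooth1_alg.add DERIV_add)
next
  case (mult f g)
  then obtain f' g' where *: "f' \<in> smooth1_alg" "\<And>t. (f has_real_derivative f' t) (at t)"
    "g' \<in> smooth1_alg" "\<And>t. (g has_real_derivative g' t) (at t)" by blast
  then show ?case
    by (intro bexI[of _ "\<lambda>t. f' t * g t + g' t * f t"])
      (use mult in \<open>auto intro!: smooth1_alg.add smooth1_alg.mult DERIV_mult\<close>)
qed

lemma smooth1_iff: "smooth1 h \<longleftrightarrow> h \<in> smooth1_alg"
  using smooth1_coinduct smooth1_alg_closed smooth1_alg.base by blast

lemmas smooth1_mult = smooth1_alg.mult[folded smooth1_iff]

lemma smooth1_affine:
  assumes "smooth1 h"
  shows "smooth1 (\<lambda>t. h (a * t + b))"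
proof -
  obtain G where G: "G 0 = h" "\<And>n t. (G n has_real_derivative G (Suc n) t) (at t)"
    using assms unfolding smooth1_def by blast
  have "((\<lambda>t. a ^ n * G n (a * t + b)) has_real_derivative a ^ Suc n * G (Suc n) (a * t + b)) (at t)" for n t
    by (auto intro!: derivative_eq_intros DERIV_chain2[OF G(2)])
  then show ?thesis unfolding smooth1_def
    by (intro exI[of _ "\<lambda>n t. a ^ n * G n (a * t + b)"]) (use G in auto)
qed

text \<open>The derivatives of exp(-1/x), extended by 0, run through functions of this shape;
  admitting all polynomials makes the class closed under differentiation.\<close>

definition flat :: "real poly \<Rightarrow> real \<Rightarrow> real" where
  "flat P x = (if x > 0 then poly P (1 / x) * exp (- (1 / x)) else 0)"

lemma poly_times_exp_tendsto_0: "((\<lambda>t. poly P t * exp (- t)) \<longlongrightarrow> 0) at_top" for P :: "real poly"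
proof -
  have "((\<lambda>t::real. \<Sum>i\<le>degree P. coeff P i * (t ^ i / exp t)) \<longlongrightarrow> (\<Sum>i\<le>degree P. coeff P i * 0)) at_top"
    by (intro tendsto_intros tendsto_power_div_exp_0)
  then show ?thesis by (simp add: poly_altdef sum_distrib_right exp_minus divide_inverse mult.assoc)
qed

text \<open>With t = 1/x the operator d/dx is -t^2 d/dt, which sends P(t) exp(-t) to t^2 (P - P')(t)
  exp(-t). At 0 the right difference quotient tends to 0 because the exponential beats every
  polynomial, and the left one is constantly 0.\<close>

lemma flat_deriv: "(flat P has_real_derivative flat ([:0, 0, 1:] * (P - pderiv P)) x) (at x)"
proof (cases x "0::real" rule: linorder_cases)
  case less
  have "((\<lambda>_. 0) has_real_derivative flat ([:0, 0, 1:] * (P - pderiv P)) x) (at x)"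
    using less by (simp add: flat_def)
  then show ?thesis
    by (rule has_field_derivative_transform_within_open[where S = "{..<0}"])
      (use less in \<open>auto simp: flat_def\<close>)
next
  case greater
  have "((\<lambda>x. poly P (1 / x) * exp (- (1 / x))) has_real_derivative
      flat ([:0, 0, 1:] * (P - pderiv P)) x) (at x)"
    using greater
    by (auto intro!: derivative_eq_intros DERIV_chain2[OF poly_DERIV] simp: flat_def field_simps power2_eq_square)
  then show ?thesis
    by (rule has_field_derivative_transform_within_open[where S = "{0<..}"])
      (use greater in \<open>auto simp: flat_def\<close>)
next
  case equal
  have "((\<lambda>h. (flat P (0 + h) - flat P 0) / h) \<longlongrightarrow> 0) (at 0)"
    unfolding filterlim_at_split
  proof
    have "\<forall>\<^sub>F h in at_left 0. (flat P (0 + h) - flat P 0) / h = (0::real)"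
      by (rule eventually_at_leftI[of "-1"]) (auto simp: flat_def)
    then show "((\<lambda>h. (flat P (0 + h) - flat P 0) / h) \<longlongrightarrow> 0) (at_left 0)"
      by (rule tendsto_eventually)
    have "((\<lambda>h. poly ([:0, 1:] * P) (inverse h) * exp (- inverse h)) \<longlongrightarrow> 0) (at_right (0::real))"
      by (rule filterlim_compose[OF poly_times_exp_tendsto_0 filterlim_inverse_at_top_right])
    moreover have "\<forall>\<^sub>F h in at_right 0.
        poly ([:0, 1:] * P) (inverse h) * exp (- inverse h) = (flat P (0 + h) - flat P 0) / h"
      by (rule eventually_at_rightI[of _ 1]) (auto simp: flat_def field_simps)
    ultimately show "((\<lambda>h. (flat P (0 + h) - flat P 0) / h) \<longlongrightarrow> 0) (at_right 0)"
      by (rule Lim_transform_eventually)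
  qed
  then show ?thesis using equal by (simp add: DERIV_def flat_def)
qed

lemma smooth1_flat: "smooth1 (flat P)"
  by (rule smooth1_coinduct[of _ "range flat"]) (use flat_deriv in blast)+

lemma smooth1_continuous: "smooth1 h \<Longrightarrow> isCont h t"
  using smooth1_deriv DERIV_isCont by blast

text \<open>The step is the normalised primitive of the bump \<open>flat 1 t\<close> times
  \<open>flat 1 (1 - t)\<close>, which lives on the unit interval. Its derivative is the bump
  divided by a constant, hence bounded by compactness.\<close>

lemma smooth_step_exists:
  "\<exists>h C. smooth1 h \<and> (\<forall>t\<le>0. h t = 0) \<and> (\<forall>t\<ge>1. h t = 1) \<and> (\<forall>t. 0 \<le> h t \<and> h t \<le> 1) \<and>
     (\<forall>t h'. (h has_real_derivative h') (at t) \<longrightarrow> \<bar>h'\<bar> \<le> C)"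
proof -
  define f where "f = (\<lambda>t. flat 1 t * flat 1 ((-1) * t + 1))"
  have f: "smooth1 f" unfolding f_def by (intro smooth1_mult smooth1_affine smooth1_flat)
  have f0: "f t = 0" if "t \<le> 0 \<or> 1 \<le> t" for t using that by (auto simp: f_def flat_def)
  have f_pos: "f t > 0" if "0 < t" "t < 1" for t using that by (auto simp: f_def flat_def)
  have f_nonneg: "f t \<ge> 0" for t using f0[of t] f_pos[of t] by (cases "t \<le> 0 \<or> 1 \<le> t") auto
  obtain F where "\<And>x. (F has_vector_derivative f x) (at x)"
    using einterval_antiderivative[of "-\<infinity>" "\<infinity>" f] smooth1_continuous[OF f] by auto
  then have F: "(F has_real_derivative f x) (at x)" for x
    by (simp add: has_real_derivative_iff_has_vector_derivative)
  have F_cont: "continuous_on S F" for S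
    using F DERIV_isCont continuous_at_imp_continuous_on by blast
  have F01: "F 0 < F 1"
    by (rule DERIV_pos_imp_increasing_open) (use F f_pos F_cont in auto)
  have F_mono: "F s \<le> F t" if "s \<le> t" for s t
    by (rule DERIV_nonneg_imp_nondecreasing[OF that]) (use F f_nonneg in blast)
  have F_left: "F t = F 0" if "t \<le> 0" for t
    using DERIV_isconst_end[of t 0 F] that F f0 F_cont by (cases "t = 0") (auto, metis order_less_imp_le)
  have F_right: "F t = F 1" if "t \<ge> 1" for t
    using DERIV_isconst_end[of 1 t F] that F f0 F_cont by (cases "t = 1") (auto, metis order_less_imp_le)
  define D where "D = F 1 - F 0"
  have D: "D > 0" using F01 by (simp add: D_def)
  define h where "h = (\<lambda>t. (F t - F 0) / D)"
  have h: "(h has_real_derivative f t / D) (at t)" for t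
    unfolding h_def using D by (auto intro!: derivative_eq_intros F)
  have "smooth1 (\<lambda>t. f t * (1 / D))"
  proof -
    have "smooth1 (\<lambda>_. 1 / D)"
      unfolding smooth1_def by (rule exI[of _ "\<lambda>n _. if n = 0 then 1 / D else 0"]) auto
    then show ?thesis using f by (intro smooth1_mult)
  qed
  then obtain G where G: "G 0 = (\<lambda>t. f t * (1 / D))" "\<And>n t. (G n has_real_derivative G (Suc n) t) (at t)"
    unfolding smooth1_def by blast
  have hs: "smooth1 h" unfolding smooth1_def
    by (rule exI[of _ "\<lambda>n. case n of 0 \<Rightarrow> h | Suc n \<Rightarrow> G n"]) (use G h in \<open>auto split: nat.split\<close>)
  have "compact (f ` {0..1})"
    using smooth1_continuous[OF f] by (intro compact_continuous_image continuous_at_imp_continuous_on) auto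
  then obtain C where C: "\<And>t. t \<in> {0..1} \<Longrightarrow> \<bar>f t\<bar> \<le> C"
    using compact_imp_bounded bounded_iff by (metis image_eqI real_norm_def)
  have C: "\<bar>f t\<bar> \<le> C" for t
    using C[of t] C[of 0] f0[of t] by (cases "t \<in> {0..1}") (auto simp: not_le)
  have "\<bar>h'\<bar> \<le> C / D" if "(h has_real_derivative h') (at t)" for t h'
    using DERIV_unique[OF that h] C[of t] D by (simp add: divide_right_mono)
  moreover have "0 \<le> h t \<and> h t \<le> 1" for t
  proof -
    have "0 \<le> F t - F 0" "F t - F 0 \<le> D"
      using F_mono[of 0 t] F_mono[of t 1] F_left[of t] F_right[of t] F01 unfolding D_def by linarith+
    then show ?thesis using D by (simp add: h_def)
  qed
  moreover have "h t = 0" if "t \<le> 0" for t using F_left[OF that] by (simp add: h_def)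
  moreover have "h t = 1" if "t \<ge> 1" for t using F_right[OF that] D by (simp add: h_def D_def)
  ultimately show ?thesis using hs by (intro exI[of _ h] exI[of _ "C / D"]) blast
qed

section \<open>Semidefinite Hermitian forms and the variational principle for eigenvalues\<close>

subsection \<open>Hermitian forms\<close>

text \<open>Gaussian elimination, one equation at a time. It supplies the dimension count of the
  min-max principle: among n vectors some nontrivial combination is orthogonal to k < n given
  ones.\<close>

lemma homogeneous_system_nontrivial:
  fixes A :: "nat \<Rightarrow> nat \<Rightarrow> complex"
  assumes "k < n"
  shows "\<exists>c. (\<exists>j<n. c j \<noteq> 0) \<and> (\<forall>i<k. (\<Sum>j<n. A i j * c j) = 0)"
  using assms
proof (induction k arbitrary: n A)
  case 0
  then show ?case by (intro exI[of _ "\<lambda>_. 1"]) auto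
next
  case (Suc k)
  then obtain n' where n: "n = Suc n'" "k < n'" by (cases n) auto
  show ?case
  proof (cases "\<exists>j<n. A k j \<noteq> 0")
    case False
    obtain c where c: "\<exists>j<n. c j \<noteq> 0" "\<forall>i<k. (\<Sum>j<n. A i j * c j) = 0"
      using Suc.IH[of n A] Suc.prems by auto
    have "\<forall>i<Suc k. (\<Sum>j<n. A i j * c j) = 0"
      using c(2) False by (auto simp: less_Suc_eq)
    then show ?thesis using c(1) by blast
  next
    case True
    then obtain p where p: "p < n" "A k p \<noteq> 0" by blast
    \<comment> \<open>Eliminate the unknown \<open>p\<close>; \<open>\<sigma>\<close> enumerates the others.\<close>
    define \<sigma> where "\<sigma> = (\<lambda>j. if j < p then j else Suc j)"
    have \<sigma>: "bij_betw \<sigma> {..<n'} ({..<n} - {p})"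
    proof (rule bij_betw_imageI)
      show "inj_on \<sigma> {..<n'}" by (auto simp: inj_on_def \<sigma>_def split: if_splits)
      show "\<sigma> ` {..<n'} = {..<n} - {p}"
      proof
        show "\<sigma> ` {..<n'} \<subseteq> {..<n} - {p}" using n by (auto simp: \<sigma>_def)
        show "{..<n} - {p} \<subseteq> \<sigma> ` {..<n'}"
        proof
          fix x assume "x \<in> {..<n} - {p}"
          then have "x = \<sigma> (if x < p then x else x - 1)" "(if x < p then x else x - 1) < n'"
            using n p by (auto simp: \<sigma>_def)
          then show "x \<in> \<sigma> ` {..<n'}" by blast
        qed
      qed
    qed
    define A' where "A' = (\<lambda>i j. A i (\<sigma> j) - A i p * A k (\<sigma> j) / A k p)"
    obtain c where c: "\<exists>j<n'. c j \<noteq> 0" "\<forall>i<k. (\<Sum>j<n'. A' i j * c j) = 0"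
      using Suc.IH[of n' A'] n by auto
    define \<tau> where "\<tau> = the_inv_into {..<n'} \<sigma>"
    have \<tau>: "\<tau> (\<sigma> j) = j" if "j < n'" for j
      using that \<sigma> unfolding \<tau>_def bij_betw_def by (simp add: the_inv_into_f_f)
    define s where "s = (\<Sum>j<n'. A k (\<sigma> j) * c j)"
    define d where "d = (\<lambda>j. if j = p then - s / A k p else c (\<tau> j))"
    have d\<sigma>: "d (\<sigma> j) = c j" if "j < n'" for j
      using that \<tau> by (auto simp: d_def \<sigma>_def)
    have sum: "(\<Sum>j<n. A i j * d j) = (\<Sum>j<n'. A i (\<sigma> j) * c j) - A i p * s / A k p" for i
    proof -
      have "(\<Sum>j<n. A i j * d j) = A i p * d p + (\<Sum>j\<in>{..<n} - {p}. A i j * d j)"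
        using p by (simp add: sum.remove)
      also have "(\<Sum>j\<in>{..<n} - {p}. A i j * d j) = (\<Sum>j<n'. A i (\<sigma> j) * d (\<sigma> j))"
        by (rule sum.reindex_bij_betw[OF \<sigma>, symmetric])
      also have "\<dots> = (\<Sum>j<n'. A i (\<sigma> j) * c j)" by (simp add: d\<sigma>)
      finally show ?thesis by (simp add: d_def)
    qed
    have "(\<Sum>j<n. A i j * d j) = 0" if "i < Suc k" for i
    proof (cases "i = k")
      case True
      then show ?thesis using p by (simp add: sum s_def)
    next
      case False
      then have "0 = (\<Sum>j<n'. A' i j * c j)" using c that by auto
      also have "\<dots> = (\<Sum>j<n'. A i (\<sigma> j) * c j) - A i p * s / A k p"
        by (simp add: A'_def s_def sum_subtractf algebra_simps sum_distrib_left sum_divide_distrib)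
      finally show ?thesis using sum by simp
    qed
    moreover have "\<exists>j<n. d j \<noteq> 0"
      using c(1) d\<sigma> \<sigma> unfolding bij_betw_def by (metis DiffD1 imageI lessThan_iff)
    ultimately show ?thesis by blast
  qed
qed

text \<open>The form is only semidefinite because elements of L^2 are represented by functions, so
  there are nonzero null vectors. The scalar multiplication is a parameter since the vectors will be
  functions and triples of functions over the complex field.\<close>

locale herm_form = vector_space scale
  for scale :: "complex \<Rightarrow> 'v::ab_group_add \<Rightarrow> 'v" +
  fixes H :: "'v set" and m :: "'v \<Rightarrow> 'v \<Rightarrow> complex"
  assumes subspace_H: "subspace H"
    and add_left: "\<lbrakk>u \<in> H; v \<in> H; w \<in> H\<rbrakk> \<Longrightarrow> m (u + v) w = m u w + m v w"
    and scale_left: "\<lbrakk>u \<in> H; w \<in> H\<rbrakk> \<Longrightarrow> m (scale c u) w = c * m u w"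
    and cnj_sym: "\<lbrakk>u \<in> H; w \<in> H\<rbrakk> \<Longrightarrow> m w u = cnj (m u w)"
    and nonneg: "u \<in> H \<Longrightarrow> 0 \<le> Re (m u u)"
begin

lemma H_add: "u \<in> H \<Longrightarrow> v \<in> H \<Longrightarrow> u + v \<in> H"
  and H_diff: "u \<in> H \<Longrightarrow> v \<in> H \<Longrightarrow> u - v \<in> H"
  and H_scale: "u \<in> H \<Longrightarrow> scale c u \<in> H"
  and H_0: "0 \<in> H"
  using subspace_H by (auto intro: subspace_add subspace_diff subspace_scale subspace_0)

lemma H_sum: "(\<And>i. i \<in> I \<Longrightarrow> f i \<in> H) \<Longrightarrow> (\<Sum>i\<in>I. f i) \<in> H"
  using subspace_H by (rule subspace_sum)

lemma zero_left: "w \<in> H \<Longrightarrow> m 0 w = 0"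
  using scale_left[of 0 w 0] H_0 by simp

lemma add_right: "\<lbrakk>u \<in> H; v \<in> H; w \<in> H\<rbrakk> \<Longrightarrow> m w (u + v) = m w u + m w v"
  using cnj_sym[of "u + v" w] cnj_sym[of u w] cnj_sym[of v w] add_left[of u v w] H_add by simp

lemma scale_right: "\<lbrakk>u \<in> H; w \<in> H\<rbrakk> \<Longrightarrow> m w (scale c u) = cnj c * m w u"
  using cnj_sym[of "scale c u" w] cnj_sym[of u w] scale_left[of u w c] H_scale by simp

lemma diff_left: "\<lbrakk>u \<in> H; v \<in> H; w \<in> H\<rbrakk> \<Longrightarrow> m (u - v) w = m u w - m v w"
  using add_left[of "u - v" v w] H_diff by (simp add: algebra_simps)

lemma diff_right: "\<lbrakk>u \<in> H; v \<in> H; w \<in> H\<rbrakk> \<Longrightarrow> m w (u - v) = m w u - m w v"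
  using add_right[of "u - v" v w] H_diff by (simp add: algebra_simps)

lemma sum_left:
  "\<lbrakk>\<And>i. i \<in> I \<Longrightarrow> f i \<in> H; w \<in> H\<rbrakk> \<Longrightarrow> m (\<Sum>i\<in>I. scale (c i) (f i)) w = (\<Sum>i\<in>I. c i * m (f i) w)"
proof (induction I rule: infinite_finite_induct)
  case (insert x F)
  have "(\<Sum>i\<in>F. scale (c i) (f i)) \<in> H" by (intro H_sum H_scale) (use insert in auto)
  then show ?case using insert by (simp add: add_left scale_left H_scale)
qed (auto simp: zero_left)

lemma sum_right:
  assumes "\<And>i. i \<in> I \<Longrightarrow> f i \<in> H" "w \<in> H"
  shows "m w (\<Sum>i\<in>I. scale (c i) (f i)) = (\<Sum>i\<in>I. cnj (c i) * m w (f i))"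
proof -
  have "(\<Sum>i\<in>I. scale (c i) (f i)) \<in> H" by (intro H_sum H_scale) (use assms in auto)
  then have "m w (\<Sum>i\<in>I. scale (c i) (f i)) = cnj (\<Sum>i\<in>I. c i * m (f i) w)"
    using cnj_sym[of "\<Sum>i\<in>I. scale (c i) (f i)" w] sum_left[of I f w c] assms by simp
  also have "\<dots> = (\<Sum>i\<in>I. cnj (c i) * m w (f i))"
    using cnj_sym[OF assms(1) assms(2)] by simp
  finally show ?thesis .
qed

lemma diag_of_real: "u \<in> H \<Longrightarrow> m u u = complex_of_real (Re (m u u))"
  using cnj_sym[of u u] by (simp add: complex_eq_iff)

definition nm :: "'v \<Rightarrow> real" where "nm u = Re (m u u)"

lemma nm_nonneg: "u \<in> H \<Longrightarrow> 0 \<le> nm u" by (simp add: nm_def nonneg)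

lemma nm_scale: "u \<in> H \<Longrightarrow> nm (scale c u) = (cmod c)\<^sup>2 * nm u"
proof -
  assume u: "u \<in> H"
  have "m (scale c u) (scale c u) = (c * cnj c) * m u u"
    using u by (simp add: scale_left scale_right H_scale)
  then show ?thesis unfolding nm_def
    by (subst (asm) diag_of_real[OF u]) (simp add: complex_norm_square[symmetric])
qed

lemma nm_add: "\<lbrakk>u \<in> H; v \<in> H\<rbrakk> \<Longrightarrow> nm (u + v) = nm u + nm v + 2 * Re (m u v)"
  using cnj_sym[of u v] by (simp add: nm_def add_left add_right H_add)

lemma nm_diff: "\<lbrakk>u \<in> H; v \<in> H\<rbrakk> \<Longrightarrow> nm (u - v) = nm u + nm v - 2 * Re (m u v)"
  using cnj_sym[of u v] by (simp add: nm_def diff_left diff_right H_diff)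

lemma parallelogram: "\<lbrakk>u \<in> H; v \<in> H\<rbrakk> \<Longrightarrow> nm (u - v) = 2 * nm u + 2 * nm v - nm (u + v)"
  by (simp add: nm_add nm_diff)

lemma nm_add_le: "\<lbrakk>u \<in> H; v \<in> H\<rbrakk> \<Longrightarrow> nm (u + v) \<le> 2 * nm u + 2 * nm v"
  using parallelogram[of u v] nm_nonneg[of "u - v"] H_diff by fastforce

text \<open>Nonnegativity of the form at u - t m(u,v) v for real t gives a quadratic inequality in
  t. A null vector v leaves a linear one and has to be treated apart.\<close>

lemma cauchy_schwarz:
  assumes u: "u \<in> H" and v: "v \<in> H"
  shows "(cmod (m u v))\<^sup>2 \<le> nm u * nm v"
proof -
  have *: "0 \<le> nm u - 2 * t * (cmod (m u v))\<^sup>2 + t\<^sup>2 * (cmod (m u v))\<^sup>2 * nm v" for t :: real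
  proof -
    define c where "c = complex_of_real t * m u v"
    have "0 \<le> nm (u - scale c v)" using u v by (intro nm_nonneg H_diff H_scale)
    also have "\<dots> = nm u + (cmod c)\<^sup>2 * nm v - 2 * Re (cnj c * m u v)"
      using u v by (simp add: nm_diff nm_scale H_scale scale_right)
    also have "cnj c * m u v = complex_of_real (t * (cmod (m u v))\<^sup>2)"
      unfolding c_def using complex_norm_square[of "m u v"] by (simp add: mult_ac)
    finally show ?thesis by (simp add: c_def norm_mult power_mult_distrib)
  qed
  define a b where "a = (cmod (m u v))\<^sup>2" and "b = nm v"
  have *: "0 \<le> nm u - 2 * t * a + t\<^sup>2 * a * b" for t using * unfolding a_def b_def .
  have ab: "0 \<le> a" "0 \<le> b" using nm_nonneg[OF v] by (auto simp: a_def b_def)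
  show ?thesis
  proof (cases "b = 0")
    case True
    have "a = 0"
    proof (rule ccontr)
      assume "a \<noteq> 0"
      \<comment> \<open>At this t the linear expression \<open>nm u - 2 * t * a\<close> equals
        -1.\<close>
      then show False using *[of "(nm u + 1) / (2 * a)"] True ab by (auto simp: field_simps)
    qed
    then show ?thesis using nm_nonneg[OF u] ab unfolding a_def b_def by simp
  next
    case False
    then have "0 \<le> nm u - a / b" using *[of "1 / b"] by (simp add: power2_eq_square field_simps)
    then show ?thesis using False ab unfolding a_def b_def by (simp add: field_simps)
  qed
qed

lemma null_orth: "\<lbrakk>u \<in> H; v \<in> H; nm u = 0\<rbrakk> \<Longrightarrow> m u v = 0"
  using cauchy_schwarz[of u v] by simp

lemma tendsto_left:
  assumes f: "\<And>j. f j \<in> H" and u: "u \<in> H" and v: "v \<in> H" and lim: "(\<lambda>j. nm (f j - u)) \<longlonglongrightarrow> 0"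
  shows "(\<lambda>j. m (f j) v) \<longlonglongrightarrow> m u v"
proof -
  have le: "norm (m (f j) v - m u v) \<le> sqrt (nm (f j - u)) * sqrt (nm v)" for j
  proof -
    have "(cmod (m (f j - u) v))\<^sup>2 \<le> nm (f j - u) * nm v"
      by (intro cauchy_schwarz H_diff f u v)
    then have "cmod (m (f j - u) v) \<le> sqrt (nm (f j - u) * nm v)" by (simp add: real_le_rsqrt)
    then show ?thesis using f u v by (simp add: diff_left real_sqrt_mult)
  qed
  have "(\<lambda>j. sqrt (nm (f j - u)) * sqrt (nm v)) \<longlonglongrightarrow> sqrt 0 * sqrt (nm v)"
    by (intro tendsto_intros lim)
  then have "(\<lambda>j. m (f j) v - m u v) \<longlonglongrightarrow> 0"
    by (intro Lim_null_comparison[OF _ tendsto_eq_rhs]) (auto intro: le always_eventually)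
  then show ?thesis by (simp add: LIM_zero_iff)
qed

lemma tendsto_nm:
  assumes f: "\<And>j. f j \<in> H" and u: "u \<in> H" and lim: "(\<lambda>j. nm (f j - u)) \<longlonglongrightarrow> 0"
  shows "(\<lambda>j. nm (f j)) \<longlonglongrightarrow> nm u"
proof -
  have "nm (f j) = nm (f j - u) + 2 * Re (m (f j) u) - nm u" for j
    using f u by (simp add: nm_diff)
  moreover have "(\<lambda>j. nm (f j - u) + 2 * Re (m (f j) u) - nm u) \<longlonglongrightarrow> 0 + 2 * Re (m u u) - nm u"
    by (intro tendsto_intros lim tendsto_left f u)
  ultimately show ?thesis by (simp add: nm_def)
qed

text \<open>A positive definite Gram matrix is bounded below by a positive multiple of the identity.
  The induction splits off a combination \<open>w\<close> orthogonal to the first n vectors, as in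
  Gram-Schmidt, so no compactness of the coefficient sphere is used.\<close>

lemma gram_coercive:
  assumes f: "\<And>j. j < n \<Longrightarrow> f j \<in> H"
    and pos: "\<And>c::nat \<Rightarrow> complex. \<exists>j<n. c j \<noteq> 0 \<Longrightarrow> nm (\<Sum>j<n. scale (c j) (f j)) > 0"
  shows "\<exists>\<kappa>>0::real. \<forall>c::nat \<Rightarrow> complex. \<kappa> * (\<Sum>j<n. (cmod (c j))\<^sup>2) \<le> nm (\<Sum>j<n. scale (c j) (f j))"
  using assms
proof (induct n)
  case 0
  then show ?case by (auto intro!: exI[of _ 1] simp: nm_def zero_left H_0)
next
  case (Suc n)
  have fH: "f j \<in> H" if "j < Suc n" for j using Suc.prems(1) that .
  have "nm (\<Sum>j<n. scale (c j) (f j)) > 0" if "\<exists>j<n. c j \<noteq> 0" for c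
  proof -
    have "(\<Sum>j<n. scale (c j) (f j)) = (\<Sum>j<Suc n. scale ((c(n := 0)) j) (f j))" by simp
    moreover have "\<exists>j<Suc n. (c(n := 0)) j \<noteq> 0" using that by (auto intro: less_SucI)
    ultimately show ?thesis using Suc.prems(2) by metis
  qed
  then obtain \<kappa> where \<kappa>: "\<kappa> > 0" "\<And>c. \<kappa> * (\<Sum>j<n. (cmod (c j))\<^sup>2) \<le> nm (\<Sum>j<n. scale (c j) (f j))"
    using Suc.hyps fH less_SucI by blast
  obtain d where d: "\<exists>j<Suc n. d j \<noteq> 0" "\<And>i. i < n \<Longrightarrow> (\<Sum>j<Suc n. m (f j) (f i) * d j) = 0"
    using homogeneous_system_nontrivial[of n "Suc n" "\<lambda>i j. m (f j) (f i)"] by auto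
  define w where "w = (\<Sum>j<Suc n. scale (d j) (f j))"
  have wH: "w \<in> H" unfolding w_def using fH by (intro H_sum H_scale) auto
  have w_orth: "m w (f i) = 0" if "i < n" for i
    unfolding w_def using d(2)[OF that] fH that by (subst sum_left) (auto simp: mult.commute)
  have w_pos: "nm w > 0" using Suc.prems(2) d(1) unfolding w_def by blast
  \<comment> \<open>Otherwise \<open>w\<close> would lie in the span of the vectors it is orthogonal
    to, and its norm would vanish.\<close>
  have dn: "d n \<noteq> 0"
  proof
    assume "d n = 0"
    then have w: "w = (\<Sum>j<n. scale (d j) (f j))" by (simp add: w_def)
    have "m w (\<Sum>j<n. scale (d j) (f j)) = (\<Sum>j<n. cnj (d j) * m w (f j))"
      by (rule sum_right) (use fH wH in auto)
    then have "m w w = (\<Sum>j<n. cnj (d j) * m w (f j))" using w by simp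
    then have "m w w = 0" using w_orth by simp
    then show False using w_pos by (simp add: nm_def)
  qed
  define e where "e = (\<lambda>j. d j / d n)"
  define \<beta> where "\<beta> = nm w / (cmod (d n))\<^sup>2"
  have \<beta>: "\<beta> > 0" using w_pos dn by (simp add: \<beta>_def)
  define E where "E = (\<Sum>j<n. (cmod (e j))\<^sup>2)"
  have E: "E \<ge> 0" by (auto simp: E_def intro: sum_nonneg)
  \<comment> \<open>The squares of the old coefficients are at most twice those of the new ones plus
    (1 + 2 E) times the square of the last one; this minimum makes both contributions fit under the
    split norm.\<close>
  define \<kappa>' where "\<kappa>' = min (\<kappa> / 2) (\<beta> / (1 + 2 * E))"
  have \<kappa>': "\<kappa>' > 0" using \<kappa> \<beta> E by (simp add: \<kappa>'_def)
  have "\<kappa>' * (\<Sum>j<Suc n. (cmod (c j))\<^sup>2) \<le> nm (\<Sum>j<Suc n. scale (c j) (f j))" for c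
  proof -
    define a where "a = c n / d n"
    define c' where "c' = (\<lambda>j. c j - c n * e j)"
    define v where "v = (\<Sum>j<n. scale (c' j) (f j))"
    have vH: "v \<in> H" unfolding v_def using fH by (intro H_sum H_scale) auto
    have split: "(\<Sum>j<Suc n. scale (c j) (f j)) = scale a w + v"
    proof -
      have 1: "scale a w = (\<Sum>j<n. scale (c n * e j) (f j)) + scale (c n) (f n)"
        using dn by (simp add: w_def a_def scale_right_distrib scale_sum_right e_def)
      have "scale (c j) (f j) = scale (c n * e j) (f j) + scale (c' j) (f j)" for j
        unfolding c'_def by (simp add: scale_left_distrib[symmetric])
      then show ?thesis unfolding 1 v_def by (simp add: sum.distrib add_ac)
    qed
    have "m w v = (\<Sum>j<n. cnj (c' j) * m w (f j))" unfolding v_def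
      by (rule sum_right) (use fH wH in auto)
    then have "m w v = 0" using w_orth by simp
    then have nmeq: "nm (scale a w + v) = \<beta> * (cmod (c n))\<^sup>2 + nm v"
      using wH vH dn by (simp add: nm_add H_scale scale_left nm_scale \<beta>_def a_def norm_divide
          power_divide mult.commute)
    have cle: "(cmod (c j))\<^sup>2 \<le> 2 * (cmod (c' j))\<^sup>2 + 2 * (cmod (c n))\<^sup>2 * (cmod (e j))\<^sup>2" for j
    proof -
      have "cmod (c j) \<le> cmod (c' j) + cmod (c n * e j)"
        unfolding c'_def using norm_triangle_ineq[of "c j - c n * e j" "c n * e j"] by simp
      then have "(cmod (c j))\<^sup>2 \<le> (cmod (c' j) + cmod (c n * e j))\<^sup>2" by (simp add: power_mono)
      also have "\<dots> \<le> 2 * (cmod (c' j))\<^sup>2 + 2 * (cmod (c n * e j))\<^sup>2"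
        using sum_squares_bound[of "cmod (c' j)" "cmod (c n * e j)"]
        by (simp add: power2_sum)
      finally show ?thesis by (simp add: norm_mult power_mult_distrib)
    qed
    have "(\<Sum>j<Suc n. (cmod (c j))\<^sup>2) \<le>
        (\<Sum>j<n. 2 * (cmod (c' j))\<^sup>2 + 2 * (cmod (c n))\<^sup>2 * (cmod (e j))\<^sup>2) + (cmod (c n))\<^sup>2"
      by (simp add: sum_mono cle)
    also have "\<dots> = 2 * (\<Sum>j<n. (cmod (c' j))\<^sup>2) + (1 + 2 * E) * (cmod (c n))\<^sup>2"
      by (simp add: sum.distrib sum_distrib_left[symmetric] E_def algebra_simps)
    finally have "\<kappa>' * (\<Sum>j<Suc n. (cmod (c j))\<^sup>2) \<le>
        \<kappa>' * (2 * (\<Sum>j<n. (cmod (c' j))\<^sup>2) + (1 + 2 * E) * (cmod (c n))\<^sup>2)"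
      using \<kappa>' by (intro mult_left_mono) auto
    also have "\<dots> = (\<kappa>' * 2) * (\<Sum>j<n. (cmod (c' j))\<^sup>2) + (\<kappa>' * (1 + 2 * E)) * (cmod (c n))\<^sup>2"
      by (simp add: algebra_simps)
    also have "\<dots> \<le> \<kappa> * (\<Sum>j<n. (cmod (c' j))\<^sup>2) + \<beta> * (cmod (c n))\<^sup>2"
    proof (intro add_mono mult_right_mono)
      show "\<kappa>' * 2 \<le> \<kappa>" by (simp add: \<kappa>'_def min_def)
      have "\<kappa>' \<le> \<beta> / (1 + 2 * E)" by (simp add: \<kappa>'_def)
      then show "\<kappa>' * (1 + 2 * E) \<le> \<beta>" using E by (simp add: pos_le_divide_eq)
    qed (auto intro: sum_nonneg)
    also have "\<dots> \<le> nm v + \<beta> * (cmod (c n))\<^sup>2" using \<kappa>(2)[of c'] by (simp add: v_def)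
    finally show ?thesis using nmeq split by simp
  qed
  then show ?case using \<kappa>' by blast
qed

end

text \<open>This is the Hilbert-space setting reduced to what minimisation needs: \<open>m\<close>
  plays the L^2 product and \<open>q\<close> the energy, \<open>complete\<close> says that the form
  is closed, and \<open>compact\<close> that its domain embeds compactly.\<close>

locale compact_form_pair = m: herm_form scale H m + q: herm_form scale H q
  for scale :: "complex \<Rightarrow> 'v::ab_group_add \<Rightarrow> 'v" and H m q +
  assumes complete: "\<lbrakk>\<And>j. f j \<in> H;
      \<And>e. e > 0 \<Longrightarrow> \<exists>N. \<forall>i\<ge>N. \<forall>j\<ge>N. m.nm (f i - f j) < e \<and> q.nm (f i - f j) < e\<rbrakk> \<Longrightarrow>
      \<exists>u\<in>H. (\<lambda>j::nat. m.nm (f j - u)) \<longlonglongrightarrow> 0 \<and> (\<lambda>j. q.nm (f j - u)) \<longlonglongrightarrow> 0"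
    and compact: "\<lbrakk>\<And>j. f j \<in> H; \<And>j. m.nm (f j) \<le> C; \<And>j. q.nm (f j) \<le> C\<rbrakk> \<Longrightarrow>
      \<exists>r. strict_mono r \<and>
        (\<forall>e>0. \<exists>N::nat. \<forall>i\<ge>N. \<forall>j\<ge>N. m.nm (f (r i :: nat) - f (r j)) < e)"
begin

text \<open>The direct method applied to the Rayleigh quotient q/m on \<open>V\<close>. A compact
  subsequence of a minimizing sequence converges in both norms, and its limit attains the infimum,
  which is at most \<open>U\<close> because of the trial vector \<open>w\<close>. The eigenvalue
  equation holds only against vectors of \<open>V\<close>.\<close>

lemma exists_minimizer:
  assumes sub: "m.subspace V" "V \<subseteq> H"
    and closed: "\<And>f u. \<lbrakk>\<And>j. f j \<in> V; u \<in> H; (\<lambda>j::nat. m.nm (f j - u)) \<longlonglongrightarrow> 0\<rbrakk> \<Longrightarrow> u \<in> V"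
    and w: "w \<in> V" "m.nm w > 0" "q.nm w \<le> U * m.nm w"
  shows "\<exists>u\<in>V. \<exists>l\<le>U. m.nm u = 1 \<and> (\<forall>v\<in>V. q u v = complex_of_real l * m u v)"
proof -
  have VH: "v \<in> H" if "v \<in> V" for v using sub that by auto
  note V_ops = m.subspace_add[OF sub(1)] m.subspace_diff[OF sub(1)] m.subspace_scale[OF sub(1)]
  define S where "S = {q.nm v |v. v \<in> V \<and> m.nm v = 1}"
  have S_in: "q.nm v / m.nm v \<in> S" if "v \<in> V" "m.nm v > 0" for v
  proof -
    define c where "c = complex_of_real (1 / sqrt (m.nm v))"
    have c2: "(cmod c)\<^sup>2 = 1 / m.nm v"
      using that by (simp add: c_def norm_divide power_divide)
    have "m.nm (scale c v) = 1" "q.nm (scale c v) = q.nm v / m.nm v"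
      using that c2 VH by (auto simp: m.nm_scale q.nm_scale)
    then show ?thesis using V_ops(3)[of v c] that unfolding S_def by force
  qed
  define l where "l = Inf S"
  have bdd: "bdd_below S" unfolding S_def bdd_below_def using q.nm_nonneg VH by blast
  have Sne: "S \<noteq> {}" using S_in w by blast
  have "l \<le> q.nm w / m.nm w" unfolding l_def using bdd S_in w by (intro cInf_lower) auto
  also have "\<dots> \<le> U" using w by (simp add: pos_divide_le_eq)
  finally have lU: "l \<le> U" .
  have low: "l * m.nm v \<le> q.nm v" if "v \<in> V" for v
  proof (cases "m.nm v > 0")
    case True
    then have "l \<le> q.nm v / m.nm v" unfolding l_def using bdd S_in that by (intro cInf_lower) auto
    then show ?thesis using True by (simp add: pos_le_divide_eq)
  next
    case False
    then have "m.nm v = 0" using m.nm_nonneg[of v] VH that by (simp add: le_less)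
    then show ?thesis using q.nm_nonneg VH that by simp
  qed
  have "\<exists>v. v \<in> V \<and> m.nm v = 1 \<and> q.nm v < l + 1 / real (Suc j)" for j
  proof -
    have "Inf S < l + 1 / real (Suc j)" by (simp add: l_def)
    then obtain x where "x \<in> S" "x < l + 1 / real (Suc j)" using cInf_lessD[OF Sne] by blast
    then show ?thesis unfolding S_def by blast
  qed
  then obtain f where f: "\<And>j. f j \<in> V" "\<And>j. m.nm (f j) = 1" "\<And>j. q.nm (f j) < l + 1 / real (Suc j)"
    by metis
  have fH: "f j \<in> H" for j using VH f by blast
  have l0: "0 \<le> l" unfolding l_def using Sne q.nm_nonneg VH by (intro cInf_greatest) (auto simp: S_def)
  have "q.nm (f j) \<le> l + 1" for j
    using f(3)[of j] by (rule order_trans[OF less_imp_le]) (simp add: field_simps)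
  moreover have "m.nm (f j) \<le> l + 1" for j using f(2) l0 by simp
  ultimately have "\<exists>r. strict_mono r \<and>
        (\<forall>e>0. \<exists>N::nat. \<forall>i\<ge>N. \<forall>j\<ge>N. m.nm (f (r i :: nat) - f (r j)) < e)"
    by (intro compact[of f "l + 1"] fH) auto
  then obtain r :: "nat \<Rightarrow> nat" where r: "strict_mono r"
    "\<forall>e>0. \<exists>N. \<forall>i\<ge>N. \<forall>j\<ge>N. m.nm (f (r i) - f (r j)) < e"
    by blast
  define g where "g = (\<lambda>j. f (r j))"
  have gV: "g j \<in> V" and gH: "g j \<in> H" and g1: "m.nm (g j) = 1" for j
    using f fH by (auto simp: g_def)
  have gq: "q.nm (g j) < l + 1 / real (Suc j)" for j
  proof -
    have "j \<le> r j" using r(1) by (rule strict_mono_imp_increasing)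
    then have "1 / real (Suc (r j)) \<le> 1 / real (Suc j)" by (intro divide_left_mono) auto
    then show ?thesis using f(3)[of "r j"] unfolding g_def by linarith
  qed
  \<comment> \<open>By the parallelogram law a minimizing sequence that is Cauchy for \<open>m\<close> is Cauchy for \<open>q\<close>.\<close>
  have qdiff: "q.nm (g i - g j) \<le> 2 * (1 / real (Suc i)) + 2 * (1 / real (Suc j)) + l * m.nm (g i - g j)" for i j
  proof -
    have "l * m.nm (g i + g j) \<le> q.nm (g i + g j)" using gV V_ops by (intro low) auto
    moreover have "m.nm (g i + g j) = 4 - m.nm (g i - g j)"
      using m.parallelogram[OF gH gH, of i j] g1 by simp
    moreover have "q.nm (g i - g j) = 2 * q.nm (g i) + 2 * q.nm (g j) - q.nm (g i + g j)"
      by (rule q.parallelogram[OF gH gH])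
    ultimately show ?thesis using gq[of i] gq[of j] by (simp add: algebra_simps)
  qed
  have cauchy: "\<exists>N. \<forall>i\<ge>N. \<forall>j\<ge>N. m.nm (g i - g j) < e \<and> q.nm (g i - g j) < e" if e: "e > 0" for e
  proof -
    define d where "d = min e (e / (2 * (l + 1)))"
    have d: "d > 0" using e l0 by (simp add: d_def)
    obtain N1 where N1: "\<And>i j. i \<ge> N1 \<Longrightarrow> j \<ge> N1 \<Longrightarrow> m.nm (g i - g j) < d"
      using r(2) d unfolding g_def by blast
    obtain N2 where N2: "1 / real (Suc N2) < e / 8" using nat_approx_posE[of "e/8"] e by auto
    have "m.nm (g i - g j) < e \<and> q.nm (g i - g j) < e" if ij: "i \<ge> max N1 N2" "j \<ge> max N1 N2" for i j
    proof
      have md: "m.nm (g i - g j) < d" using N1 ij by simp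
      then show "m.nm (g i - g j) < e" by (simp add: d_def)
      have "l * m.nm (g i - g j) \<le> l * (e / (2 * (l + 1)))"
        using md l0 by (intro mult_left_mono) (auto simp: d_def)
      also have "\<dots> \<le> e / 2" using l0 e by (simp add: field_simps)
      finally have "l * m.nm (g i - g j) \<le> e / 2" .
      moreover have "1 / real (Suc i) \<le> 1 / real (Suc N2)" "1 / real (Suc j) \<le> 1 / real (Suc N2)"
        using ij by (auto intro!: divide_left_mono)
      ultimately show "q.nm (g i - g j) < e" using qdiff[of i j] N2 by linarith
    qed
    then show ?thesis by blast
  qed
  obtain u where u: "u \<in> H" "(\<lambda>j. m.nm (g j - u)) \<longlonglongrightarrow> 0" "(\<lambda>j. q.nm (g j - u)) \<longlonglongrightarrow> 0"
    using complete[of g] gH cauchy by blast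
  have uV: "u \<in> V" using closed[of g u] gV u by blast
  have mu: "m.nm u = 1"
    using m.tendsto_nm[OF gH u(1,2)] g1 by (simp add: LIMSEQ_const_iff)
  have qu: "q.nm u \<le> l"
  proof (rule LIMSEQ_le)
    show "(\<lambda>j. q.nm (g j)) \<longlonglongrightarrow> q.nm u" by (rule q.tendsto_nm[OF gH u(1,3)])
    have "(\<lambda>j. l + 1 / real (Suc j)) \<longlonglongrightarrow> l + 0"
      by (intro tendsto_intros LIMSEQ_Suc[OF lim_1_over_n])
    then show "(\<lambda>j. l + 1 / real (Suc j)) \<longlonglongrightarrow> l" by simp
  qed (use gq in \<open>auto intro: less_imp_le\<close>)
  \<comment> \<open>\<open>u\<close> is a null vector of the semidefinite form \<open>q - l m\<close> on \<open>V\<close>.\<close>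
  interpret p: herm_form scale V "\<lambda>u v. q u v - complex_of_real l * m u v"
    by unfold_locales
      (use sub VH low in \<open>auto simp: m.add_left q.add_left m.scale_left q.scale_left algebra_simps
         q.nm_def m.nm_def q.cnj_sym[symmetric] m.cnj_sym[symmetric]\<close>)
  have "p.nm u = q.nm u - l * m.nm u"
    unfolding p.nm_def q.nm_def m.nm_def by simp
  then have pu: "p.nm u = 0" using low[OF uV] qu mu by simp
  have "\<forall>v\<in>V. q u v = complex_of_real l * m u v"
    using p.null_orth[OF uV _ pu] by auto
  then show ?thesis using uV lU mu by blast
qed

text \<open>The upper half of the Courant-Fischer principle. Eigenvectors are found one after
  another by minimising on the \<open>m\<close>-orthogonal complement of the earlier ones; the
  n-dimensional trial space meets each complement, which keeps all eigenvalues below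
  \<open>U\<close>.\<close>

theorem min_max_upper:
  assumes \<psi>: "\<And>j. j < n \<Longrightarrow> \<psi> j \<in> H"
    and pos: "\<And>c::nat \<Rightarrow> complex. \<exists>j<n. c j \<noteq> 0 \<Longrightarrow> m.nm (\<Sum>j<n. scale (c j) (\<psi> j)) > 0"
    and le: "\<And>c. q.nm (\<Sum>j<n. scale (c j) (\<psi> j)) \<le> U * m.nm (\<Sum>j<n. scale (c j) (\<psi> j))"
  shows "\<exists>u l. \<forall>k<n. u k \<in> H \<and> l k \<le> U \<and> (\<forall>v\<in>H. q (u k) v = complex_of_real (l k) * m (u k) v) \<and>
    (\<forall>i<n. m (u k) (u i) = (if i = k then 1 else 0))"
proof -
  have "\<exists>u l. \<forall>k<N. u k \<in> H \<and> l k \<le> U \<and> (\<forall>v\<in>H. q (u k) v = complex_of_real (l k) * m (u k) v) \<and>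
    (\<forall>i<N. m (u k) (u i) = (if i = k then 1 else 0))" if "N \<le> n" for N
    using that
  proof (induction N)
    case 0
    show ?case by simp
  next
    case (Suc N)
    then obtain u l where "\<forall>k<N. u k \<in> H \<and> l k \<le> U \<and>
        (\<forall>v\<in>H. q (u k) v = complex_of_real (l k) * m (u k) v) \<and>
        (\<forall>i<N. m (u k) (u i) = (if i = k then 1 else 0))"
      using Suc_leD by blast
    then have IH: "\<And>k. k < N \<Longrightarrow> u k \<in> H" "\<And>k. k < N \<Longrightarrow> l k \<le> U"
      "\<And>k v. k < N \<Longrightarrow> v \<in> H \<Longrightarrow> q (u k) v = complex_of_real (l k) * m (u k) v"
      "\<And>k i. k < N \<Longrightarrow> i < N \<Longrightarrow> m (u k) (u i) = (if i = k then 1 else 0)"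
      by auto
    define V where "V = {v \<in> H. \<forall>i<N. m v (u i) = 0}"
    have VH: "V \<subseteq> H" by (auto simp: V_def)
    have sub: "m.subspace V"
      unfolding m.subspace_def V_def
      using IH(1) by (auto simp: m.H_0 m.zero_left m.H_add m.add_left m.H_scale m.scale_left)
    have closed: "v \<in> V" if f: "\<And>j. f j \<in> V" "v \<in> H" "(\<lambda>j::nat. m.nm (f j - v)) \<longlonglongrightarrow> 0" for f v
    proof -
      have "m v (u i) = 0" if "i < N" for i
      proof -
        have "(\<lambda>j. m (f j) (u i)) \<longlonglongrightarrow> m v (u i)"
          using f VH IH(1)[OF that] by (intro m.tendsto_left) auto
        moreover have "m (f j) (u i) = 0" for j using f(1)[of j] that by (auto simp: V_def)
        ultimately show ?thesis by (simp add: LIMSEQ_const_iff)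
      qed
      then show ?thesis using f(2) by (simp add: V_def)
    qed
    \<comment> \<open>There are N < n conditions on n coefficients, so the trial space contains a
      nontrivial vector orthogonal to the eigenvectors found so far.\<close>
    obtain c where c: "\<exists>j<n. c j \<noteq> 0" "\<And>i. i < N \<Longrightarrow> (\<Sum>j<n. m (\<psi> j) (u i) * c j) = 0"
      using homogeneous_system_nontrivial[of N n "\<lambda>i j. m (\<psi> j) (u i)"] Suc.prems by auto
    define w where "w = (\<Sum>j<n. scale (c j) (\<psi> j))"
    have wH: "w \<in> H" unfolding w_def using \<psi> by (intro m.H_sum m.H_scale) auto
    have "m w (u i) = 0" if "i < N" for i
    proof -
      have "m w (u i) = (\<Sum>j<n. c j * m (\<psi> j) (u i))"
        unfolding w_def using \<psi> IH(1)[OF that] by (intro m.sum_left) auto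
      then show ?thesis using c(2)[OF that] by (simp add: mult.commute)
    qed
    then have "w \<in> V" using wH by (simp add: V_def)
    have "\<exists>u\<in>V. \<exists>l\<le>U. m.nm u = 1 \<and> (\<forall>v\<in>V. q u v = complex_of_real l * m u v)"
      by (rule exists_minimizer[OF sub VH, where w = w])
        (use closed \<open>w \<in> V\<close> pos[OF c(1)] le[of c] in \<open>auto simp: w_def\<close>)
    then obtain x L where x: "x \<in> V" "L \<le> U" "m.nm x = 1" "\<And>v. v \<in> V \<Longrightarrow> q x v = complex_of_real L * m x v"
      by blast
    have xH: "x \<in> H" using x VH by blast
    have x_orth: "m x (u i) = 0" if "i < N" for i using x(1) that by (simp add: V_def)
    \<comment> \<open>The equation extends from \<open>V\<close> to \<open>H\<close>: subtract from
      \<open>v\<close> its projection \<open>y\<close> onto the earlier eigenvectors. Both forms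
      vanish between \<open>x\<close> and \<open>y\<close>, because \<open>x\<close> is orthogonal
      to these eigenvectors and they satisfy their own equations.\<close>
    have eq: "q x v = complex_of_real L * m x v" if v: "v \<in> H" for v
    proof -
      define a where "a = (\<lambda>i. m v (u i))"
      define y where "y = (\<Sum>i<N. scale (a i) (u i))"
      have yH: "y \<in> H" unfolding y_def using IH(1) by (intro m.H_sum m.H_scale) auto
      have "m (v - y) (u i) = 0" if "i < N" for i
      proof -
        have "m y (u i) = (\<Sum>k<N. a k * m (u k) (u i))"
          unfolding y_def using IH(1) that by (intro m.sum_left) auto
        also have "\<dots> = (\<Sum>k<N. if k = i then a i else 0)"
          using IH(4) that by (intro sum.cong) auto
        finally have "m y (u i) = a i" using that by simp
        then show ?thesis using v yH IH(1) that by (simp add: m.diff_left a_def)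
      qed
      then have "v - y \<in> V" using v yH by (simp add: V_def m.H_diff)
      then have 1: "q x (v - y) = complex_of_real L * m x (v - y)" by (rule x(4))
      have 2: "m x y = 0"
        unfolding y_def using IH(1) xH x_orth by (subst m.sum_right) auto
      have "q x (u i) = 0" if "i < N" for i
        using q.cnj_sym[OF IH(1)[OF that] xH] IH(3)[OF that xH] m.cnj_sym[OF xH IH(1)[OF that]] x_orth[OF that]
        by simp
      then have "q x y = 0"
        unfolding y_def using IH(1) xH by (subst q.sum_right) auto
      then show ?thesis using 1 2 xH yH v by (simp add: m.diff_right q.diff_right)
    qed
    have "m (u i) x = 0" if "i < N" for i
      using m.cnj_sym[OF xH IH(1)[OF that]] x_orth[OF that] by simp
    moreover have "m x x = 1" using m.diag_of_real[OF xH] x(3) by (simp add: m.nm_def)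
    ultimately have "\<forall>k<Suc N. (u(N := x)) k \<in> H \<and> (l(N := L)) k \<le> U \<and>
        (\<forall>v\<in>H. q ((u(N := x)) k) v = complex_of_real ((l(N := L)) k) * m ((u(N := x)) k) v) \<and>
        (\<forall>i<Suc N. m ((u(N := x)) k) ((u(N := x)) i) = (if i = k then 1 else 0))"
      using IH xH x eq x_orth by (auto simp: less_Suc_eq)
    then show ?case by blast
  qed
  then show ?thesis by blast
qed

end

section \<open>Square integrable functions as a complete semidefinite Hermitian space\<close>

subsection \<open>Square integrable functions\<close>

definition L2 :: "'a measure \<Rightarrow> ('a \<Rightarrow> complex) set" where
  "L2 M = {f \<in> borel_measurable M. integrable M (\<lambda>x. (cmod (f x))\<^sup>2)}"

definition L2_ip :: "'a measure \<Rightarrow> ('a \<Rightarrow> complex) \<Rightarrow> ('a \<Rightarrow> complex) \<Rightarrow> complex" where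
  "L2_ip M f g = (LINT x|M. f x * cnj (g x))"

lemma L2_measurable [measurable_dest]: "f \<in> L2 M \<Longrightarrow> f \<in> borel_measurable M"
  by (simp add: L2_def)

lemma cmod_add_sq_le: "(cmod (a + b))\<^sup>2 \<le> 2 * (cmod a)\<^sup>2 + 2 * (cmod b)\<^sup>2"
proof -
  have "(cmod (a + b))\<^sup>2 \<le> (cmod a + cmod b)\<^sup>2" by (simp add: norm_triangle_ineq power_mono)
  also have "\<dots> \<le> 2 * (cmod a)\<^sup>2 + 2 * (cmod b)\<^sup>2"
    using sum_squares_bound[of "cmod a" "cmod b"] by (simp add: power2_sum)
  finally show ?thesis .
qed

lemma cmod_diff_sq_le: "(cmod (a - b))\<^sup>2 \<le> 2 * (cmod a)\<^sup>2 + 2 * (cmod b)\<^sup>2"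
  using cmod_add_sq_le[of a "- b"] by simp

lemma L2_bound:
  assumes "f \<in> borel_measurable M" "integrable M g" "\<And>x. x \<in> space M \<Longrightarrow> (cmod (f x))\<^sup>2 \<le> g x"
  shows "f \<in> L2 M"
  unfolding L2_def
proof (intro CollectI conjI assms(1) Bochner_Integration.integrable_bound[OF assms(2)])
  show "AE x in M. norm ((cmod (f x))\<^sup>2) \<le> norm (g x)"
    using assms(3) by (intro AE_I2) force
qed (use assms(1) in measurable)

lemma L2_add: "f \<in> L2 M \<Longrightarrow> g \<in> L2 M \<Longrightarrow> (\<lambda>x. f x + g x) \<in> L2 M"
  by (rule L2_bound[where g = "\<lambda>x. 2 * (cmod (f x))\<^sup>2 + 2 * (cmod (g x))\<^sup>2"])
    (auto simp: L2_def cmod_add_sq_le)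

lemma L2_diff: "f \<in> L2 M \<Longrightarrow> g \<in> L2 M \<Longrightarrow> (\<lambda>x. f x - g x) \<in> L2 M"
  by (rule L2_bound[where g = "\<lambda>x. 2 * (cmod (f x))\<^sup>2 + 2 * (cmod (g x))\<^sup>2"])
    (auto simp: L2_def cmod_diff_sq_le)

lemma L2_bounded_mult:
  assumes "f \<in> L2 M" "h \<in> borel_measurable M" "\<And>x. x \<in> space M \<Longrightarrow> cmod (h x) \<le> C"
  shows "(\<lambda>x. h x * f x) \<in> L2 M"
proof (rule L2_bound[where g = "\<lambda>x. C\<^sup>2 * (cmod (f x))\<^sup>2"])
  show "(cmod (h x * f x))\<^sup>2 \<le> C\<^sup>2 * (cmod (f x))\<^sup>2" if "x \<in> space M" for x
    using assms(3)[OF that] by (auto simp: norm_mult power_mult_distrib intro!: mult_right_mono power_mono)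
qed (use assms in \<open>auto simp: L2_def\<close>)

lemma L2_scale: "f \<in> L2 M \<Longrightarrow> (\<lambda>x. c * f x) \<in> L2 M"
  by (rule L2_bounded_mult[where C = "cmod c"]) auto

lemma L2_cnj: "f \<in> L2 M \<Longrightarrow> (\<lambda>x. cnj (f x)) \<in> L2 M"
  by (auto simp: L2_def intro!: borel_measurable_continuous_on[of cnj] continuous_intros)

lemma L2_0: "(\<lambda>_. 0) \<in> L2 M"
  by (simp add: L2_def)

lemma L2_integrable_mult:
  assumes "f \<in> L2 M" "g \<in> L2 M"
  shows "integrable M (\<lambda>x. f x * g x)"
proof (rule Bochner_Integration.integrable_bound)
  show "integrable M (\<lambda>x. (cmod (f x))\<^sup>2 + (cmod (g x))\<^sup>2)" using assms by (simp add: L2_def)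
  show "AE x in M. norm (f x * g x) \<le> norm ((cmod (f x))\<^sup>2 + (cmod (g x))\<^sup>2)"
  proof (intro AE_I2)
    fix x
    have "2 * (cmod (f x) * cmod (g x)) \<le> (cmod (f x))\<^sup>2 + (cmod (g x))\<^sup>2"
      using sum_squares_bound[of "cmod (f x)" "cmod (g x)"] by simp
    moreover have "0 \<le> cmod (f x) * cmod (g x)" by simp
    ultimately have "cmod (f x) * cmod (g x) \<le> (cmod (f x))\<^sup>2 + (cmod (g x))\<^sup>2" by linarith
    then show "norm (f x * g x) \<le> norm ((cmod (f x))\<^sup>2 + (cmod (g x))\<^sup>2)" by (simp add: norm_mult)
  qed
qed (use assms in \<open>auto simp: L2_def\<close>)

lemma L2_ip_integrable: "f \<in> L2 M \<Longrightarrow> g \<in> L2 M \<Longrightarrow> integrable M (\<lambda>x. f x * cnj (g x))"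
  by (intro L2_integrable_mult L2_cnj)

lemma L2_ip_self: "L2_ip M f f = complex_of_real (LINT x|M. (cmod (f x))\<^sup>2)"
  unfolding L2_ip_def complex_norm_square[symmetric] by (rule integral_complex_of_real)

definition fscale :: "complex \<Rightarrow> ('a \<Rightarrow> complex) \<Rightarrow> ('a \<Rightarrow> complex)" where
  "fscale c f = (\<lambda>x. c * f x)"

interpretation fvs: vector_space fscale
  by unfold_locales (auto simp: fscale_def fun_eq_iff algebra_simps)

interpretation L2: herm_form fscale "L2 M" "L2_ip M" for M
proof
  show "fvs.subspace (L2 M)"
    unfolding fvs.subspace_def by (auto simp: plus_fun_def zero_fun_def fscale_def L2_add L2_scale L2_0)
  show "L2_ip M (u + v) w = L2_ip M u w + L2_ip M v w" if "u \<in> L2 M" "v \<in> L2 M" "w \<in> L2 M" for u v w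
    using that by (simp add: L2_ip_def distrib_right L2_ip_integrable)
  show "L2_ip M (fscale c u) w = c * L2_ip M u w" for u w c
    by (simp add: L2_ip_def fscale_def mult.assoc)
  show "L2_ip M w u = cnj (L2_ip M u w)" if "u \<in> L2 M" "w \<in> L2 M" for u w
    using Bochner_Integration.integral_cnj[of M "\<lambda>x. u x * cnj (w x)"]
    by (simp add: L2_ip_def mult.commute)
  show "0 \<le> Re (L2_ip M u u)" for u by (simp add: L2_ip_self)
qed

lemma L2_nm: "L2.nm M f = (LINT x|M. (cmod (f x))\<^sup>2)"
  by (simp add: L2.nm_def L2_ip_self)

text \<open>The Riesz-Fischer argument. A rapidly convergent subsequence converges almost
  everywhere, and Fatou's lemma upgrades this to convergence of the whole sequence in L^2.\<close>

lemma L2_complete: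
  fixes f :: "nat \<Rightarrow> 'a \<Rightarrow> complex"
  assumes fin: "finite_measure M" and f: "\<And>j. f j \<in> L2 M"
    and cauchy: "\<And>e. e > 0 \<Longrightarrow> \<exists>N. \<forall>i\<ge>N. \<forall>j\<ge>N. (LINT x|M. (cmod (f i x - f j x))\<^sup>2) < e"
  shows "\<exists>u\<in>L2 M. (\<lambda>j. LINT x|M. (cmod (f j x - u x))\<^sup>2) \<longlonglongrightarrow> 0"
proof -
  interpret finite_measure M by fact
  have [measurable]: "f j \<in> borel_measurable M" for j using f by (simp add: L2_def)
  have dint: "integrable M (\<lambda>x. (cmod (f i x - f j x))\<^sup>2)" for i j
    using L2_diff[OF f f] by (simp add: L2_def)
  \<comment> \<open>The rate 1/8 leaves a summable (1/4)^k after the weight 2^k that is introduced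
    in \<open>pw\<close>.\<close>
  have "\<forall>k. \<exists>N. \<forall>i\<ge>N. \<forall>j\<ge>N. (LINT x|M. (cmod (f i x - f j x))\<^sup>2) < (1/8) ^ k"
    by (intro allI cauchy) simp
  from choice[OF this] obtain N where
    N: "\<And>k i j. i \<ge> N k \<Longrightarrow> j \<ge> N k \<Longrightarrow> (LINT x|M. (cmod (f i x - f j x))\<^sup>2) < (1/8) ^ k"
    by blast
  \<comment> \<open>Partial sums make the indices monotone while keeping them above both
    \<open>N k\<close> and \<open>k\<close>.\<close>
  define r where "r = (\<lambda>k. (\<Sum>i\<le>k. N i) + k)"
  have rN: "r k \<ge> N k" for k unfolding r_def by (simp add: member_le_sum trans_le_add1)
  have r_mono: "r k \<le> r (Suc k)" for k by (simp add: r_def)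
  have rk: "r k \<ge> k" for k by (simp add: r_def)
  define d where "d = (\<lambda>k x. cmod (f (r (Suc k)) x - f (r k) x))"
  have d_meas [measurable]: "d k \<in> borel_measurable M" for k unfolding d_def by measurable
  have d2: "integrable M (\<lambda>x. (d k x)\<^sup>2)" "(LINT x|M. (d k x)\<^sup>2) \<le> (1/8) ^ k" for k
    using dint N[of k "r (Suc k)" "r k"] rN[of k] r_mono[of k] by (auto simp: d_def)
  define b where "b = (\<lambda>k. (1/2) ^ k * measure M (space M) + (1/4::real) ^ k)"
  have d1: "(\<integral>\<^sup>+x. ennreal (d k x) \<partial>M) \<le> ennreal (b k)" for k
  proof -
    \<comment> \<open>The weighted arithmetic-geometric inequality passes from L^2 to L^1; the
      constant (1/2)^k is integrable because the measure is finite.\<close>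
    have pw: "d k x \<le> (1/2) ^ k + 2 ^ k * (d k x)\<^sup>2" for x
    proof -
      have "0 \<le> (1/2::real) ^ k * (1 - 2 ^ k * d k x)\<^sup>2" by simp
      also have "\<dots> = (1/2) ^ k + 2 ^ k * (d k x)\<^sup>2 - 2 * d k x"
        by (simp add: power2_eq_square algebra_simps power_divide)
      finally show ?thesis by (smt (verit) d_def norm_ge_zero)
    qed
    have "(\<integral>\<^sup>+x. ennreal (d k x) \<partial>M) \<le> (\<integral>\<^sup>+x. ennreal ((1/2) ^ k + 2 ^ k * (d k x)\<^sup>2) \<partial>M)"
      by (intro nn_integral_mono ennreal_leI pw)
    also have "\<dots> = ennreal (LINT x|M. (1/2) ^ k + 2 ^ k * (d k x)\<^sup>2)"
      using d2 by (intro nn_integral_eq_integral) auto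
    also have "(LINT x|M. (1/2) ^ k + 2 ^ k * (d k x)\<^sup>2) = (1/2) ^ k * measure M (space M) + 2 ^ k * (LINT x|M. (d k x)\<^sup>2)"
      using d2 by simp
    also have "\<dots> \<le> (1/2) ^ k * measure M (space M) + 2 ^ k * (1/8) ^ k"
      using d2(2)[of k] by (intro add_left_mono mult_left_mono) auto
    also have "2 ^ k * (1/8) ^ k = (1/4::real) ^ k" by (simp add: power_mult_distrib[symmetric])
    finally show ?thesis by (simp add: b_def ennreal_leI)
  qed
  have b_sum: "summable b" unfolding b_def by (intro summable_add summable_mult2 summable_geometric) auto
  have b0: "b k \<ge> 0" for k by (simp add: b_def)
  have "(\<integral>\<^sup>+x. (\<Sum>k. ennreal (d k x)) \<partial>M) = (\<Sum>k. \<integral>\<^sup>+x. ennreal (d k x) \<partial>M)"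
    by (intro nn_integral_suminf) auto
  also have "\<dots> \<le> (\<Sum>k. ennreal (b k))" by (intro suminf_le d1) auto
  also have "\<dots> < top" using b_sum b0 by (simp add: suminf_ennreal2)
  finally have "AE x in M. (\<Sum>k. ennreal (d k x)) \<noteq> top"
    using nn_integral_noteq_infinite[of "\<lambda>x. \<Sum>k. ennreal (d k x)" M] by (auto simp: less_top)
  then have conv: "AE x in M. convergent (\<lambda>k. f (r k) x)"
  proof eventually_elim
    case (elim x)
    then have "summable (\<lambda>k. d k x)" by (intro summable_suminf_not_top) (auto simp: d_def)
    then have "summable (\<lambda>k. f (r (Suc k)) x - f (r k) x)"
      unfolding d_def by (rule summable_norm_cancel)
    then have "convergent (\<lambda>n. \<Sum>k<n. f (r (Suc k)) x - f (r k) x)" by (simp add: summable_iff_convergent)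
    then have "convergent (\<lambda>n. f (r n) x - f (r 0) x)" using sum_lessThan_telescope[of "\<lambda>k. f (r k) x"] by simp
    then have "convergent (\<lambda>n. (f (r n) x - f (r 0) x) + f (r 0) x)"
      by (intro convergent_add convergent_const)
    then show ?case by simp
  qed
  define u where "u = (\<lambda>x. lim (\<lambda>k. f (r k) x))"
  have u_meas [measurable]: "u \<in> borel_measurable M" unfolding u_def by measurable
  have lim: "AE x in M. (\<lambda>k. f (r k) x) \<longlonglongrightarrow> u x"
    using conv by eventually_elim (simp add: u_def convergent_LIMSEQ_iff)
  \<comment> \<open>Letting the second index run along the subsequence, the Cauchy estimate survives
    in the limit \<open>u\<close>.\<close>
  have fatou: "(\<integral>\<^sup>+x. ennreal ((cmod (f j x - u x))\<^sup>2) \<partial>M) \<le> ennreal e"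
    if "e > 0" and j: "\<And>i. i \<ge> n \<Longrightarrow> (LINT x|M. (cmod (f j x - f i x))\<^sup>2) < e" for e j n
  proof -
    have "(\<integral>\<^sup>+x. ennreal ((cmod (f j x - u x))\<^sup>2) \<partial>M) =
        (\<integral>\<^sup>+x. liminf (\<lambda>k. ennreal ((cmod (f j x - f (r k) x))\<^sup>2)) \<partial>M)"
    proof (rule nn_integral_cong_AE, use lim in eventually_elim)
      case (elim x)
      then have "(\<lambda>k. ennreal ((cmod (f j x - f (r k) x))\<^sup>2)) \<longlonglongrightarrow> ennreal ((cmod (f j x - u x))\<^sup>2)"
        by (intro tendsto_intros)
      then show ?case by (rule lim_imp_Liminf[OF sequentially_bot, symmetric])
    qed
    also have "\<dots> \<le> liminf (\<lambda>k. \<integral>\<^sup>+x. ennreal ((cmod (f j x - f (r k) x))\<^sup>2) \<partial>M)"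
      by (intro nn_integral_liminf) auto
    also have "\<dots> \<le> liminf (\<lambda>k. ennreal e)"
    proof (rule Liminf_mono, rule eventually_sequentiallyI[of n])
      fix k assume "n \<le> k"
      then have "(LINT x|M. (cmod (f j x - f (r k) x))\<^sup>2) < e" using j rk[of k] by auto
      then show "(\<integral>\<^sup>+x. ennreal ((cmod (f j x - f (r k) x))\<^sup>2) \<partial>M) \<le> ennreal e"
        by (subst nn_integral_eq_integral[OF dint]) (auto intro: ennreal_leI)
    qed
    also have "\<dots> = ennreal e" by (simp add: Liminf_const)
    finally show ?thesis .
  qed
  have main: "\<exists>n. \<forall>j\<ge>n. (\<lambda>x. f j x - u x) \<in> L2 M \<and> (LINT x|M. (cmod (f j x - u x))\<^sup>2) \<le> e" if e: "e > 0" for e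
  proof -
    obtain n where n: "\<forall>i\<ge>n. \<forall>j\<ge>n. (LINT x|M. (cmod (f i x - f j x))\<^sup>2) < e" using cauchy[OF e] by blast
    have "(\<lambda>x. f j x - u x) \<in> L2 M \<and> (LINT x|M. (cmod (f j x - u x))\<^sup>2) \<le> e" if j: "j \<ge> n" for j
    proof -
      have le: "(\<integral>\<^sup>+x. ennreal ((cmod (f j x - u x))\<^sup>2) \<partial>M) \<le> ennreal e"
        using n j e by (intro fatou[of e n]) auto
      then have int: "integrable M (\<lambda>x. (cmod (f j x - u x))\<^sup>2)"
        by (intro integrableI_nonneg) (auto simp: order_le_less_trans[OF le])
      moreover have "(LINT x|M. (cmod (f j x - u x))\<^sup>2) \<le> e"
        using le e by (subst (asm) nn_integral_eq_integral[OF int]) auto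
      ultimately show ?thesis by (simp add: L2_def)
    qed
    then show ?thesis by blast
  qed
  obtain n where "(\<lambda>x. f n x - u x) \<in> L2 M" using main[of 1] by auto
  from L2_diff[OF f this, of n] have "u \<in> L2 M" by simp
  moreover have "(\<lambda>j. LINT x|M. (cmod (f j x - u x))\<^sup>2) \<longlonglongrightarrow> 0"
  proof (rule LIMSEQ_I)
    fix e :: real assume "e > 0"
    then obtain n where "\<forall>j\<ge>n. (LINT x|M. (cmod (f j x - u x))\<^sup>2) \<le> e / 2" using main[of "e/2"] by auto
    then show "\<exists>no. \<forall>j\<ge>no. norm ((LINT x|M. (cmod (f j x - u x))\<^sup>2) - 0) < e"
      using \<open>e > 0\<close> by (intro exI[of _ n]) auto
  qed
  ultimately show ?thesis by blast
qed

section \<open>Integration over rectangles, Poincare inequalities and Rellich compactness\<close>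

subsection \<open>Integrals of smooth functions over rectangles\<close>

abbreviation D1 :: "(real \<times> real \<Rightarrow> complex) \<Rightarrow> real \<times> real \<Rightarrow> complex" where "D1 \<equiv> dir_deriv (1, 0)"
abbreviation D2 :: "(real \<times> real \<Rightarrow> complex) \<Rightarrow> real \<times> real \<Rightarrow> complex" where "D2 \<equiv> dir_deriv (0, 1)"

lemma cont_integrable: "continuous_on UNIV f \<Longrightarrow> f integrable_on cbox a b" for f :: "'a::euclidean_space \<Rightarrow> 'b::euclidean_space"
  using continuous_on_subset integrable_continuous by blast

lemma cont_integrable_real: "continuous_on UNIV f \<Longrightarrow> f integrable_on {a..b}" for f :: "real \<Rightarrow> 'b::euclidean_space"
  using cont_integrable[of f a b] by simp

lemma cont_slice1: "continuous_on UNIV f \<Longrightarrow> continuous_on UNIV (\<lambda>x. f (x, y))"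
  and cont_slice2: "continuous_on UNIV f \<Longrightarrow> continuous_on UNIV (\<lambda>y. f (x, y))"
  by (rule continuous_on_compose2[of UNIV f]; (intro continuous_intros | simp))+

lemma fubini_xy:
  fixes f :: "real \<times> real \<Rightarrow> 'b::euclidean_space"
  assumes "continuous_on UNIV f"
  shows "integral (cbox (a, c) (b, d)) f = integral {a..b} (\<lambda>x. integral {c..d} (\<lambda>y. f (x, y)))"
  using integral_prod_continuous[of a c b d f] assms continuous_on_subset by auto

lemma fubini_yx:
  fixes f :: "real \<times> real \<Rightarrow> 'b::euclidean_space"
  assumes "continuous_on UNIV f"
  shows "integral (cbox (a, c) (b, d)) f = integral {c..d} (\<lambda>y. integral {a..b} (\<lambda>x. f (x, y)))"
proof -
  have "integral {a..b} (\<lambda>x. integral {c..d} (\<lambda>y. f (x, y))) = integral {c..d} (\<lambda>y. integral {a..b} (\<lambda>x. f (x, y)))"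
    using integral_swap_continuous[of a c b d "\<lambda>x y. f (x, y)"] assms continuous_on_subset by auto
  then show ?thesis using fubini_xy[OF assms] by metis
qed

lemma cont_integral_x:
  fixes f :: "real \<times> real \<Rightarrow> 'b::euclidean_space"
  assumes "continuous_on UNIV f"
  shows "continuous_on UNIV (\<lambda>y. integral {a..b} (\<lambda>x. f (x, y)))"
proof -
  have "continuous_on (UNIV \<times> {a..b}) (\<lambda>z. f (snd z, fst z))"
    by (rule continuous_on_compose2[OF assms]) (intro continuous_intros | simp)+
  then show ?thesis
    using integral_continuous_on_param[of UNIV a b "\<lambda>y x. f (x, y)"] by (simp add: case_prod_unfold)
qed

lemma cont_integral_y:
  fixes f :: "real \<times> real \<Rightarrow> 'b::euclidean_space"
  assumes "continuous_on UNIV f"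
  shows "continuous_on UNIV (\<lambda>x. integral {c..d} (\<lambda>y. f (x, y)))"
proof -
  have "continuous_on (UNIV \<times> {c..d}) f" by (rule continuous_on_subset[OF assms]) simp
  then show ?thesis
    using integral_continuous_on_param[of UNIV c d "\<lambda>x y. f (x, y)"] by (simp add: case_prod_unfold)
qed

lemma slice_deriv1:
  assumes "smooth f"
  shows "((\<lambda>x. f (x, y)) has_vector_derivative D1 f (x, y)) (at x within S)"
proof -
  have "((\<lambda>x. (x, y)) has_derivative (\<lambda>h. (h, 0))) (at x within S)"
    by (auto intro!: derivative_eq_intros)
  moreover have "(f has_derivative frechet_derivative f (at (x, y))) (at (x, y))"
    using assms by (intro has_derivative_frechet smooth_differentiable)
  ultimately have D: "((\<lambda>x. f (x, y)) has_derivative (\<lambda>h. frechet_derivative f (at (x, y)) (h, 0))) (at x within S)"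
    by (rule has_derivative_compose)
  have lin: "linear (frechet_derivative f (at (x, y)))"
    using assms by (intro linear_frechet_derivative smooth_differentiable)
  have "frechet_derivative f (at (x, y)) (h, 0) = h *\<^sub>R frechet_derivative f (at (x, y)) (1, 0)" for h
    using linear_scale[OF lin, of h "(1, 0)"] by (simp only: scaleR_Pair real_scaleR_def mult_1_right mult_zero_right)
  then have "(\<lambda>h. frechet_derivative f (at (x, y)) (h, 0)) = (\<lambda>h. h *\<^sub>R frechet_derivative f (at (x, y)) (1, 0))"
    by (rule ext)
  with D show ?thesis unfolding has_vector_derivative_def dir_deriv_def by (simp only:)
qed

lemma slice_deriv2:
  assumes "smooth f"
  shows "((\<lambda>y. f (x, y)) has_vector_derivative D2 f (x, y)) (at y within S)"
proof -
  have "((\<lambda>y. (x, y)) has_derivative (\<lambda>h. (0, h))) (at y within S)"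
    by (auto intro!: derivative_eq_intros)
  moreover have "(f has_derivative frechet_derivative f (at (x, y))) (at (x, y))"
    using assms by (intro has_derivative_frechet smooth_differentiable)
  ultimately have D: "((\<lambda>y. f (x, y)) has_derivative (\<lambda>h. frechet_derivative f (at (x, y)) (0, h))) (at y within S)"
    by (rule has_derivative_compose)
  have lin: "linear (frechet_derivative f (at (x, y)))"
    using assms by (intro linear_frechet_derivative smooth_differentiable)
  have "frechet_derivative f (at (x, y)) (0, h) = h *\<^sub>R frechet_derivative f (at (x, y)) (0, 1)" for h
    using linear_scale[OF lin, of h "(0, 1)"] by (simp only: scaleR_Pair real_scaleR_def mult_1_right mult_zero_right)
  then have "(\<lambda>h. frechet_derivative f (at (x, y)) (0, h)) = (\<lambda>h. h *\<^sub>R frechet_derivative f (at (x, y)) (0, 1))"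
    by (rule ext)
  with D show ?thesis unfolding has_vector_derivative_def dir_deriv_def by (simp only:)
qed

lemma ftc1: "smooth f \<Longrightarrow> a \<le> b \<Longrightarrow> integral {a..b} (\<lambda>x. D1 f (x, y)) = f (b, y) - f (a, y)"
  by (intro integral_unique fundamental_theorem_of_calculus slice_deriv1)

lemma ftc2: "smooth f \<Longrightarrow> c \<le> d \<Longrightarrow> integral {c..d} (\<lambda>y. D2 f (x, y)) = f (x, d) - f (x, c)"
  by (intro integral_unique fundamental_theorem_of_calculus slice_deriv2)

lemmas smooth_cont = smooth_continuous_on[of _ UNIV]
lemmas smooth_D1_cont = smooth_cont[OF smooth_dir_deriv_1]
lemmas smooth_D2_cont = smooth_cont[OF smooth_dir_deriv_2]

lemma integral_D1:
  assumes "smooth f" "a \<le> b"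
  shows "integral (cbox (a, c) (b, d)) (D1 f) = integral {c..d} (\<lambda>y. f (b, y) - f (a, y))"
  unfolding fubini_yx[OF smooth_D1_cont[OF assms(1)]] ftc1[OF assms] ..

lemma integral_D2:
  assumes "smooth f" "c \<le> d"
  shows "integral (cbox (a, c) (b, d)) (D2 f) = integral {a..b} (\<lambda>x. f (x, d) - f (x, c))"
  unfolding fubini_xy[OF smooth_D2_cont[OF assms(1)]] ftc2[OF assms] ..

text \<open>On a small square around \<open>z\<close> the function is within e of its value there,
  while its mean is 0.\<close>

lemma zero_if_all_integrals_zero:
  fixes g :: "real \<times> real \<Rightarrow> complex"
  assumes cont: "continuous_on UNIV g"
    and zero: "\<And>a b c d. a < b \<Longrightarrow> c < d \<Longrightarrow> integral (cbox (a, c) (b, d)) g = 0"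
  shows "g z = 0"
proof -
  have "cmod (g z) \<le> e" if e: "e > 0" for e
  proof -
    have "isCont g z" using cont by (meson UNIV_I continuous_on_eq_continuous_at open_UNIV)
    then obtain r where r: "r > 0" "\<And>w. dist w z < r \<Longrightarrow> dist (g w) (g z) < e"
      using e unfolding continuous_at_eps_delta by blast
    obtain x y where z: "z = (x, y)" by (cases z)
    define s where "s = r / 4"
    have s: "s > 0" using r by (simp add: s_def)
    define S where "S = cbox (x - s, y - s) (x + s, y + s)"
    have le: "cmod (g z - g w) \<le> e" if "w \<in> S" for w
    proof -
      obtain x' y' where w: "w = (x', y')" by (cases w)
      have "\<bar>x' - x\<bar> \<le> s" "\<bar>y' - y\<bar> \<le> s" using that by (auto simp: S_def w abs_le_iff)
      then have "norm (x' - x, y' - y) < r"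
        using norm_Pair_le[of "x' - x" "y' - y"] s unfolding s_def by simp
      then have "dist w z < r" by (simp add: w z dist_norm)
      then show ?thesis using r(2) by (metis dist_commute dist_norm less_imp_le)
    qed
    have vol: "Henstock_Kurzweil_Integration.content S = 4 * s\<^sup>2"
      using s by (simp add: S_def content_Pair power2_eq_square)
    have int: "(\<lambda>w. g z - g w) integrable_on S" "g integrable_on S" unfolding S_def
      by (intro cont_integrable continuous_intros cont)+
    have "integral S (\<lambda>w. g z - g w) = integral S (\<lambda>w. g z) - integral S g"
      unfolding S_def by (intro Henstock_Kurzweil_Integration.integral_diff cont_integrable continuous_intros cont)
    moreover have "integral S g = 0" using zero[of "x - s" "x + s" "y - s" "y + s"] s by (simp add: S_def)
    moreover have "integral S (\<lambda>w. g z) = (4 * s\<^sup>2) *\<^sub>R g z" using vol by (simp add: S_def)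
    ultimately have "integral S (\<lambda>w. g z - g w) = (4 * s\<^sup>2) *\<^sub>R g z" by simp
    moreover have "norm (integral S (\<lambda>w. g z - g w)) \<le> integral S (\<lambda>w. e)"
      using int le by (intro integral_norm_bound_integral) (auto simp: S_def)
    moreover have "integral S (\<lambda>w. e) = 4 * s\<^sup>2 * e" using vol by (simp add: S_def)
    ultimately have "4 * s\<^sup>2 * cmod (g z) \<le> 4 * s\<^sup>2 * e" by (simp add: norm_mult)
    then show ?thesis using s by simp
  qed
  then have "cmod (g z) \<le> 0" by (rule field_le_epsilon) simp
  then show ?thesis by simp
qed

text \<open>Both mixed derivatives integrate over any rectangle to the same alternating sum of
  corner values of f, by the fundamental theorem of calculus in the two orders. Continuity then
  forces them to agree.\<close>

lemma mixed_partials: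
  assumes f: "smooth f"
  shows "D1 (D2 f) z = D2 (D1 f) z"
proof -
  note s1 = smooth_dir_deriv_1[OF f] and s2 = smooth_dir_deriv_2[OF f]
  have c: "continuous_on UNIV (D1 (D2 f))" "continuous_on UNIV (D2 (D1 f))"
    using s1 s2 by (auto intro: smooth_D1_cont smooth_D2_cont)
  have sl1: "(\<lambda>x. f (x, y)) integrable_on {a..b}" and sl2: "(\<lambda>y. f (x, y)) integrable_on {a..b}" for a b x y
    by (intro cont_integrable_real cont_slice1 cont_slice2 smooth_cont f)+
  have sl3: "(\<lambda>x. D1 f (x, y)) integrable_on {a..b}" and sl4: "(\<lambda>y. D2 f (x, y)) integrable_on {a..b}" for a b x y
    by (intro cont_integrable_real cont_slice1 cont_slice2 smooth_cont s1 s2)+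
  have "(\<lambda>z. D1 (D2 f) z - D2 (D1 f) z) z = 0"
  proof (rule zero_if_all_integrals_zero)
    fix a b c d :: real assume "a < b" "c < d"
    then show "integral (cbox (a, c) (b, d)) (\<lambda>z. D1 (D2 f) z - D2 (D1 f) z) = 0"
      using s1 s2 f
      by (simp add: Henstock_Kurzweil_Integration.integral_diff cont_integrable[OF \<open>continuous_on UNIV (D1 (D2 f))\<close>]
          cont_integrable[OF \<open>continuous_on UNIV (D2 (D1 f))\<close>] integral_D1 integral_D2 sl3 sl4 ftc1 ftc2)
  qed (intro continuous_intros c)
  then show ?thesis by simp
qed

text \<open>The continuous form of variance = mean square minus squared mean. Its nonnegativity is
  the Cauchy-Schwarz inequality below, and it removes the mean in the Poincare inequality on a
  cell.\<close>

lemma integral_variance: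
  fixes f :: "'a::euclidean_space \<Rightarrow> complex" and c :: complex
  assumes f: "continuous_on UNIV f" and V: "Henstock_Kurzweil_Integration.content (cbox a b) = V" "V > 0"
  shows "integral (cbox a b) (\<lambda>x. (cmod (f x - integral (cbox a b) f / V))\<^sup>2) =
    integral (cbox a b) (\<lambda>x. (cmod (f x))\<^sup>2) - (cmod (integral (cbox a b) f))\<^sup>2 / V"
proof -
  define c where "c = integral (cbox a b) f / V"
  have c: "integral (cbox a b) f = V * c" using V by (simp add: c_def)
  have int: "(\<lambda>x. (cmod (f x))\<^sup>2) integrable_on cbox a b" "(\<lambda>x. cnj c * f x) integrable_on cbox a b"
    by (intro cont_integrable continuous_intros f)+
  have Re_int: "integral (cbox a b) (\<lambda>x. Re (cnj c * f x)) = V * (cmod c)\<^sup>2"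
      "(\<lambda>x. Re (cnj c * f x)) integrable_on cbox a b"
  proof -
    have h: "((\<lambda>x. cnj c * f x) has_integral cnj c * (V * c)) (cbox a b)"
      using has_integral_mult_right[OF integrable_integral[OF cont_integrable[OF f]], of "cnj c" a b] c by simp
    have "cnj c * (V * c) = complex_of_real (V * (cmod c)\<^sup>2)"
      using complex_norm_square[of c] by (simp add: mult_ac)
    with has_integral_linear[OF h bounded_linear_Re]
    have "((\<lambda>x. Re (cnj c * f x)) has_integral V * (cmod c)\<^sup>2) (cbox a b)" by (simp add: o_def)
    then show "integral (cbox a b) (\<lambda>x. Re (cnj c * f x)) = V * (cmod c)\<^sup>2"
      "(\<lambda>x. Re (cnj c * f x)) integrable_on cbox a b" by (auto simp: integral_unique has_integral_integrable)
  qed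
  have pw: "(cmod (z - c))\<^sup>2 = (cmod z)\<^sup>2 - 2 * Re (cnj c * z) + (cmod c)\<^sup>2" for z
    unfolding cmod_power2 by (simp add: power2_eq_square algebra_simps)
  have "integral (cbox a b) (\<lambda>x. (cmod (f x - c))\<^sup>2) =
     integral (cbox a b) (\<lambda>x. (cmod (f x))\<^sup>2 - 2 * Re (cnj c * f x)) + integral (cbox a b) (\<lambda>x. (cmod c)\<^sup>2)"
    unfolding pw by (intro Henstock_Kurzweil_Integration.integral_add integrable_diff integrable_on_mult_right int Re_int) auto
  also have "integral (cbox a b) (\<lambda>x. (cmod (f x))\<^sup>2 - 2 * Re (cnj c * f x)) =
     integral (cbox a b) (\<lambda>x. (cmod (f x))\<^sup>2) - integral (cbox a b) (\<lambda>x. 2 * Re (cnj c * f x))"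
    by (intro Henstock_Kurzweil_Integration.integral_diff integrable_on_mult_right int Re_int)
  also have "integral (cbox a b) (\<lambda>x. 2 * Re (cnj c * f x)) = 2 * (V * (cmod c)\<^sup>2)"
    unfolding Henstock_Kurzweil_Integration.integral_mult_right Re_int(1) ..
  also have "integral (cbox a b) (\<lambda>x. (cmod c)\<^sup>2) = V * (cmod c)\<^sup>2" using V by simp
  also have "V * (cmod c)\<^sup>2 = (cmod (integral (cbox a b) f))\<^sup>2 / V"
    using V by (simp add: c norm_mult power2_eq_square)
  finally show ?thesis unfolding c_def by simp
qed

lemma integral_cauchy_schwarz:
  fixes f :: "'a::euclidean_space \<Rightarrow> complex"
  assumes f: "continuous_on UNIV f"
  shows "(cmod (integral (cbox a b) f))\<^sup>2 \<le> Henstock_Kurzweil_Integration.content (cbox a b) * integral (cbox a b) (\<lambda>x. (cmod (f x))\<^sup>2)"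
proof (cases "Henstock_Kurzweil_Integration.content (cbox a b) = 0")
  case True
  then show ?thesis by (simp add: integral_null)
next
  case False
  then have V: "Henstock_Kurzweil_Integration.content (cbox a b) > 0" by (simp add: content_lt_nz)
  have "0 \<le> integral (cbox a b) (\<lambda>x. (cmod (f x - integral (cbox a b) f / Henstock_Kurzweil_Integration.content (cbox a b)))\<^sup>2)"
    by (intro Henstock_Kurzweil_Integration.integral_nonneg cont_integrable continuous_intros f) auto
  then have "(cmod (integral (cbox a b) f))\<^sup>2 / Henstock_Kurzweil_Integration.content (cbox a b) \<le>
      integral (cbox a b) (\<lambda>x. (cmod (f x))\<^sup>2)"
    unfolding integral_variance[OF f refl V] by simp
  then show ?thesis using V by (simp add: pos_divide_le_eq mult.commute)
qed

lemma integral_cauchy_schwarz_real: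
  fixes f :: "real \<Rightarrow> complex"
  assumes "continuous_on UNIV f" "a \<le> b"
  shows "(cmod (integral {a..b} f))\<^sup>2 \<le> (b - a) * integral {a..b} (\<lambda>x. (cmod (f x))\<^sup>2)"
  using integral_cauchy_schwarz[OF assms(1), of a b] assms(2) by simp

lemma average_bound:
  fixes f :: "real \<Rightarrow> complex"
  assumes f: "continuous_on UNIV f" and ab: "a < b" and L: "\<And>t. t \<in> {a..b} \<Longrightarrow> cmod (v - f t) \<le> L"
  shows "cmod (v - integral {a..b} f / (b - a)) \<le> L"
proof -
  have "integral {a..b} (\<lambda>t. v - f t) = (b - a) *\<^sub>R v - integral {a..b} f"
    using ab by (simp add: Henstock_Kurzweil_Integration.integral_diff cont_integrable_real f)
  also have "\<dots> = (b - a) * (v - integral {a..b} f / (b - a))"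
    using ab by (simp add: field_simps scaleR_conv_of_real)
  finally have "(b - a) * cmod (v - integral {a..b} f / (b - a)) = norm (integral {a..b} (\<lambda>t. v - f t))"
    using ab by (simp add: norm_mult norm_of_real del: of_real_diff)
  also have "\<dots> \<le> integral {a..b} (\<lambda>t. L)"
    by (intro integral_norm_bound_integral cont_integrable_real continuous_intros f L)
  also have "\<dots> = (b - a) * L" using ab by simp
  finally show ?thesis using ab by simp
qed

lemma line_diff1:
  assumes f: "smooth f" and x: "x \<in> {a..b}" "x' \<in> {a..b}"
  shows "(cmod (f (x, y) - f (x', y)))\<^sup>2 \<le> (b - a) * integral {a..b} (\<lambda>s. (cmod (D1 f (s, y)))\<^sup>2)"
proof -
  have c: "continuous_on UNIV (\<lambda>s. D1 f (s, y))" by (intro cont_slice1 smooth_D1_cont f)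
  have c': "continuous_on UNIV (\<lambda>s. (cmod (D1 f (s, y)))\<^sup>2)" by (intro continuous_intros c)
  have *: "(cmod (f (x, y) - f (x', y)))\<^sup>2 \<le> (b - a) * integral {a..b} (\<lambda>s. (cmod (D1 f (s, y)))\<^sup>2)"
    if "x' \<le> x" "x \<in> {a..b}" "x' \<in> {a..b}" for x x'
  proof -
    have "(cmod (f (x, y) - f (x', y)))\<^sup>2 \<le> (x - x') * integral {x'..x} (\<lambda>s. (cmod (D1 f (s, y)))\<^sup>2)"
      using integral_cauchy_schwarz_real[OF c that(1)] ftc1[OF f that(1)] by simp
    also have "\<dots> \<le> (b - a) * integral {a..b} (\<lambda>s. (cmod (D1 f (s, y)))\<^sup>2)"
    proof (rule mult_mono)
      show "integral {x'..x} (\<lambda>s. (cmod (D1 f (s, y)))\<^sup>2) \<le> integral {a..b} (\<lambda>s. (cmod (D1 f (s, y)))\<^sup>2)"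
        using that by (intro integral_subset_le cont_integrable_real c') auto
      show "0 \<le> integral {x'..x} (\<lambda>s. (cmod (D1 f (s, y)))\<^sup>2)"
        by (intro Henstock_Kurzweil_Integration.integral_nonneg cont_integrable_real c') auto
    qed (use that in auto)
    finally show ?thesis .
  qed
  show ?thesis using *[of x' x] *[of x x'] x by (cases "x' \<le> x") (auto simp: norm_minus_commute)
qed

lemma line_diff2:
  assumes f: "smooth f" and y: "y \<in> {c..d}" "y' \<in> {c..d}"
  shows "(cmod (f (x, y) - f (x, y')))\<^sup>2 \<le> (d - c) * integral {c..d} (\<lambda>s. (cmod (D2 f (x, s)))\<^sup>2)"
proof -
  have c: "continuous_on UNIV (\<lambda>s. D2 f (x, s))" by (intro cont_slice2 smooth_D2_cont f)
  have c': "continuous_on UNIV (\<lambda>s. (cmod (D2 f (x, s)))\<^sup>2)" by (intro continuous_intros c)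
  have *: "(cmod (f (x, y) - f (x, y')))\<^sup>2 \<le> (d - c) * integral {c..d} (\<lambda>s. (cmod (D2 f (x, s)))\<^sup>2)"
    if "y' \<le> y" "y \<in> {c..d}" "y' \<in> {c..d}" for y y'
  proof -
    have "(cmod (f (x, y) - f (x, y')))\<^sup>2 \<le> (y - y') * integral {y'..y} (\<lambda>s. (cmod (D2 f (x, s)))\<^sup>2)"
      using integral_cauchy_schwarz_real[OF c that(1)] ftc2[OF f that(1)] by simp
    also have "\<dots> \<le> (d - c) * integral {c..d} (\<lambda>s. (cmod (D2 f (x, s)))\<^sup>2)"
    proof (rule mult_mono)
      show "integral {y'..y} (\<lambda>s. (cmod (D2 f (x, s)))\<^sup>2) \<le> integral {c..d} (\<lambda>s. (cmod (D2 f (x, s)))\<^sup>2)"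
        using that by (intro integral_subset_le cont_integrable_real c') auto
      show "0 \<le> integral {y'..y} (\<lambda>s. (cmod (D2 f (x, s)))\<^sup>2)"
        by (intro Henstock_Kurzweil_Integration.integral_nonneg cont_integrable_real c') auto
    qed (use that in auto)
    finally show ?thesis .
  qed
  show ?thesis using *[of y' y] *[of y y'] y by (cases "y' \<le> y") (auto simp: norm_minus_commute)
qed

text \<open>The function is compared with its mean on the horizontal line, which costs the first
  derivative, and this line mean with the mean over the cell, which costs the second derivative. The
  variance identity then reinstates the mean.\<close>

lemma cell_poincare:
  assumes f: "smooth f" and ab: "a < b" "c < d"
  defines "S \<equiv> cbox (a, c) (b, d)"
  shows "integral S (\<lambda>z. (cmod (f z))\<^sup>2) \<le> (cmod (integral S f))\<^sup>2 / ((b - a) * (d - c)) +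
    2 * (b - a)\<^sup>2 * integral S (\<lambda>z. (cmod (D1 f z))\<^sup>2) + 2 * (d - c)\<^sup>2 * integral S (\<lambda>z. (cmod (D2 f z))\<^sup>2)"
proof -
  define h k where "h = b - a" and "k = d - c"
  have hk: "h > 0" "k > 0" using ab by (auto simp: h_def k_def)
  note c0 = smooth_cont[OF f] and c1 = smooth_D1_cont[OF f] and c2 = smooth_D2_cont[OF f]
  have c1': "continuous_on UNIV (\<lambda>z. (cmod (D1 f z))\<^sup>2)" and c2': "continuous_on UNIV (\<lambda>z. (cmod (D2 f z))\<^sup>2)"
    by (intro continuous_intros c1 c2)+
  define A where "A = (\<lambda>y. integral {a..b} (\<lambda>s. (cmod (D1 f (s, y)))\<^sup>2))"
  define G where "G = integral S (\<lambda>z. (cmod (D2 f z))\<^sup>2)"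
  define m where "m = (\<lambda>y. integral {a..b} (\<lambda>x. f (x, y)))"
  define F where "F = integral S f / (h * k)"
  have A_cont: "continuous_on UNIV A" unfolding A_def using cont_integral_x[OF c1'] by simp
  have A0: "A y \<ge> 0" for y unfolding A_def
    by (intro Henstock_Kurzweil_Integration.integral_nonneg cont_integrable_real cont_slice1[OF c1']) auto
  have m_cont: "continuous_on UNIV m" unfolding m_def by (rule cont_integral_x[OF c0])
  have step1: "(cmod (f (x, y) - m y / h))\<^sup>2 \<le> h * A y" if "x \<in> {a..b}" for x y
  proof -
    have "cmod (f (x, y) - m y / h) \<le> sqrt (h * A y)" unfolding m_def h_def of_real_diff
      by (rule average_bound[OF cont_slice1[OF c0] ab(1), unfolded of_real_diff])
        (use line_diff1[OF f that] in \<open>auto simp: A_def intro!: real_le_rsqrt\<close>)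
    then have "(cmod (f (x, y) - m y / h))\<^sup>2 \<le> (sqrt (h * A y))\<^sup>2" by (intro power_mono) auto
    then show ?thesis using hk A0 by simp
  qed
  have mdiff: "(cmod (m y - m y'))\<^sup>2 \<le> h * k * G" if "y \<in> {c..d}" "y' \<in> {c..d}" for y y'
  proof -
    have cd: "continuous_on UNIV (\<lambda>x. f (x, y) - f (x, y'))" by (intro continuous_intros cont_slice1 c0)
    have "m y - m y' = integral {a..b} (\<lambda>x. f (x, y) - f (x, y'))"
      unfolding m_def by (simp add: Henstock_Kurzweil_Integration.integral_diff cont_integrable_real cont_slice1 c0)
    then have "(cmod (m y - m y'))\<^sup>2 \<le> h * integral {a..b} (\<lambda>x. (cmod (f (x, y) - f (x, y')))\<^sup>2)"
      using integral_cauchy_schwarz_real[OF cd, of a b] ab by (simp add: h_def)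
    also have "\<dots> \<le> h * integral {a..b} (\<lambda>x. k * integral {c..d} (\<lambda>s. (cmod (D2 f (x, s)))\<^sup>2))"
      using hk cont_integral_y[OF c2', of c d]
      by (intro mult_left_mono integral_le cont_integrable_real)
        (auto simp: k_def intro!: continuous_intros cd line_diff2 f that)
    also have "\<dots> = h * k * G" unfolding G_def S_def by (simp add: fubini_xy[OF c2'])
    finally show ?thesis .
  qed
  have G0: "G \<ge> 0" unfolding G_def S_def
    by (intro Henstock_Kurzweil_Integration.integral_nonneg cont_integrable c2') auto
  have F_eq: "F = integral {c..d} (\<lambda>y. m y / h) / k"
    unfolding F_def S_def m_def by (simp add: fubini_yx[OF c0])
  have step2: "(cmod (m y / h - F))\<^sup>2 \<le> k / h * G" if y: "y \<in> {c..d}" for y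
  proof -
    have "cmod (m y / h - m t / h) \<le> sqrt (k / h * G)" if "t \<in> {c..d}" for t
    proof (rule real_le_rsqrt)
      have "m y / h - m t / h = (m y - m t) / h" by (simp add: diff_divide_distrib)
      then have "(cmod (m y / h - m t / h))\<^sup>2 = (cmod (m y - m t))\<^sup>2 / h\<^sup>2"
        by (simp add: norm_divide power_divide)
      also have "\<dots> \<le> h * k * G / h\<^sup>2" using mdiff[OF y that] by (intro divide_right_mono) auto
      also have "\<dots> = k / h * G" using hk by (simp add: power2_eq_square)
      finally show "(cmod (m y / h - m t / h))\<^sup>2 \<le> k / h * G" .
    qed
    moreover have "continuous_on UNIV (\<lambda>y. m y / h)" using hk by (intro continuous_intros m_cont) auto
    ultimately have "cmod (m y / h - F) \<le> sqrt (k / h * G)"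
      unfolding F_eq k_def by (intro average_bound ab(2))
    then have "(cmod (m y / h - F))\<^sup>2 \<le> (sqrt (k / h * G))\<^sup>2" by (intro power_mono) auto
    then show ?thesis using hk G0 by simp
  qed
  have pw: "(cmod (f (x, y) - F))\<^sup>2 \<le> 2 * (h * A y) + 2 * (k / h * G)" if "x \<in> {a..b}" "y \<in> {c..d}" for x y
    using cmod_add_sq_le[of "f (x, y) - m y / h" "m y / h - F"] step1[OF that(1), of y] step2[OF that(2)] by simp
  have cF: "continuous_on UNIV (\<lambda>z. (cmod (f z - F))\<^sup>2)" by (intro continuous_intros c0)
  have "integral S (\<lambda>z. (cmod (f z - F))\<^sup>2) = integral {c..d} (\<lambda>y. integral {a..b} (\<lambda>x. (cmod (f (x, y) - F))\<^sup>2))"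
    unfolding S_def by (rule fubini_yx[OF cF])
  also have "\<dots> \<le> integral {c..d} (\<lambda>y. h * (2 * (h * A y) + 2 * (k / h * G)))"
  proof (intro integral_le cont_integrable_real)
    show "continuous_on UNIV (\<lambda>y. integral {a..b} (\<lambda>x. (cmod (f (x, y) - F))\<^sup>2))" by (rule cont_integral_x[OF cF])
    show "continuous_on UNIV (\<lambda>y. h * (2 * (h * A y) + 2 * (k / h * G)))" by (intro continuous_intros A_cont)
    fix y assume y: "y \<in> {c..d}"
    have "integral {a..b} (\<lambda>x. (cmod (f (x, y) - F))\<^sup>2) \<le> integral {a..b} (\<lambda>x. 2 * (h * A y) + 2 * (k / h * G))"
      using pw y by (intro integral_le cont_integrable_real continuous_on_const cont_slice1[OF cF]) auto
    then show "integral {a..b} (\<lambda>x. (cmod (f (x, y) - F))\<^sup>2) \<le> h * (2 * (h * A y) + 2 * (k / h * G))"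
      using ab by (simp add: h_def)
  qed
  also have "\<dots> = integral {c..d} (\<lambda>y. 2 * h\<^sup>2 * A y + 2 * k * G)"
    using hk by (intro integral_cong) (simp add: power2_eq_square field_simps)
  also have "\<dots> = 2 * h\<^sup>2 * integral {c..d} A + k * (2 * k * G)"
    using ab A_cont
    by (simp add: Henstock_Kurzweil_Integration.integral_add cont_integrable_real continuous_on_mult_left k_def)
  also have "integral {c..d} A = integral S (\<lambda>z. (cmod (D1 f z))\<^sup>2)"
    unfolding S_def A_def by (simp add: fubini_yx[OF c1'])
  finally have *: "integral S (\<lambda>z. (cmod (f z - F))\<^sup>2) \<le>
      2 * h\<^sup>2 * integral S (\<lambda>z. (cmod (D1 f z))\<^sup>2) + 2 * k\<^sup>2 * G" by (simp add: power2_eq_square)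
  have V: "Henstock_Kurzweil_Integration.content S = h * k" "h * k > 0"
    using ab by (simp_all add: S_def content_Pair h_def k_def)
  have "integral S (\<lambda>z. (cmod (f z - F))\<^sup>2) = integral S (\<lambda>z. (cmod (f z))\<^sup>2) - (cmod (integral S f))\<^sup>2 / (h * k)"
    using integral_variance[OF c0, of "(a, c)" "(b, d)" "h * k"] V unfolding S_def F_def by simp
  then show ?thesis using * unfolding h_def k_def G_def by simp
qed


lemma smooth_scale: "smooth f \<Longrightarrow> smooth (\<lambda>x. c * f x)"
  by (intro smooth_mult smooth_const)

lemma dir_deriv_scale: "smooth f \<Longrightarrow> dir_deriv e (\<lambda>x. c * f x) x = c * dir_deriv e f x"
  by (simp add: dir_deriv_mult smooth_const dir_deriv_const)

lemma smooth_diff: "smooth f \<Longrightarrow> smooth g \<Longrightarrow> smooth (\<lambda>x. f x - g x)"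
  using smooth_add[OF _ smooth_scale[of g "-1"], of f] by simp

lemma dir_deriv_diff:
  "smooth f \<Longrightarrow> smooth g \<Longrightarrow> dir_deriv e (\<lambda>x. f x - g x) x = dir_deriv e f x - dir_deriv e g x"
  using dir_deriv_add[OF _ smooth_scale[of g "-1"], of f e x] dir_deriv_scale[of g e "-1" x] by simp

lemma integral_grid:
  fixes g :: "real \<Rightarrow> 'b::euclidean_space"
  assumes g: "continuous_on UNIV g" and h: "h \<ge> 0"
  shows "integral {a..a + real N * h} g = (\<Sum>i<N. integral {a + real i * h..a + (real i + 1) * h} g)"
proof (induction N)
  case (Suc N)
  have "integral {a..a + real N * h} g + integral {a + real N * h..a + (real N + 1) * h} g =
      integral {a..a + (real N + 1) * h} g"
    using h by (intro Henstock_Kurzweil_Integration.integral_combine cont_integrable_real g)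
      (auto intro: mult_nonneg_nonneg mult_right_mono)
  then show ?case using Suc by (simp add: add.commute)
qed simp

definition grid_cell :: "real \<Rightarrow> real \<Rightarrow> nat \<Rightarrow> nat \<Rightarrow> nat \<Rightarrow> (real \<times> real) set" where
  "grid_cell p q N i j =
    cbox (- p + real i * (2 * p / N), - q + real j * (2 * q / N))
         (- p + (real i + 1) * (2 * p / N), - q + (real j + 1) * (2 * q / N))"

lemma integral_grid_cell:
  fixes f :: "real \<times> real \<Rightarrow> 'b::euclidean_space"
  assumes f: "continuous_on UNIV f" and pq: "p > 0" "q > 0" and N: "N > 0"
  shows "integral (cbox (- p, - q) (p, q)) f = (\<Sum>i<N. \<Sum>j<N. integral (grid_cell p q N i j) f)"
proof -
  have ends: "p = - p + real N * (2 * p / N)" "q = - q + real N * (2 * q / N)" using N by auto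
  have h: "2 * p / N \<ge> 0" "2 * q / N \<ge> 0" using pq by auto
  have "integral (cbox (- p, - q) (p, q)) f = integral {- p..p} (\<lambda>x. integral {- q..q} (\<lambda>y. f (x, y)))"
    by (rule fubini_xy[OF f])
  also have "\<dots> = (\<Sum>i<N. integral {- p + real i * (2 * p / N)..- p + (real i + 1) * (2 * p / N)} (\<lambda>x. integral {- q..q} (\<lambda>y. f (x, y))))"
    using integral_grid[OF cont_integral_y[OF f, of "- q" q] h(1), of "- p" N] ends(1) by simp
  also have "\<dots> = (\<Sum>i<N. integral {- q..q} (\<lambda>y. integral {- p + real i * (2 * p / N)..- p + (real i + 1) * (2 * p / N)} (\<lambda>x. f (x, y))))"
    unfolding fubini_xy[OF f, symmetric] fubini_yx[OF f, symmetric] ..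
  also have "\<dots> = (\<Sum>i<N. \<Sum>j<N. integral {- q + real j * (2 * q / N)..- q + (real j + 1) * (2 * q / N)}
      (\<lambda>y. integral {- p + real i * (2 * p / N)..- p + (real i + 1) * (2 * p / N)} (\<lambda>x. f (x, y))))"
    using integral_grid[OF cont_integral_x[OF f] h(2), of "- q" N] ends(2) by simp
  also have "\<dots> = (\<Sum>i<N. \<Sum>j<N. integral (grid_cell p q N i j) f)"
    unfolding grid_cell_def fubini_yx[OF f] ..
  finally show ?thesis .
qed

text \<open>Summing over the cells, the gradient terms gain a factor 1/N^2, and only finitely many
  cell integrals remain. This is the source of compactness.\<close>

lemma grid_poincare:
  assumes f: "smooth f" and pq: "p > 0" "q > 0" and N: "N > 0"
  defines "K \<equiv> cbox (- p, - q) (p, q)"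
  shows "integral K (\<lambda>z. (cmod (f z))\<^sup>2) \<le>
    (\<Sum>i<N. \<Sum>j<N. (cmod (integral (grid_cell p q N i j) f))\<^sup>2) * (real N)\<^sup>2 / (4 * p * q) +
    8 * p\<^sup>2 / (real N)\<^sup>2 * integral K (\<lambda>z. (cmod (D1 f z))\<^sup>2) + 8 * q\<^sup>2 / (real N)\<^sup>2 * integral K (\<lambda>z. (cmod (D2 f z))\<^sup>2)"
proof -
  have c: "continuous_on UNIV (\<lambda>z. (cmod (f z))\<^sup>2)" "continuous_on UNIV (\<lambda>z. (cmod (D1 f z))\<^sup>2)"
    "continuous_on UNIV (\<lambda>z. (cmod (D2 f z))\<^sup>2)"
    by (intro continuous_intros smooth_cont smooth_D1_cont smooth_D2_cont f)+
  have cell: "integral (grid_cell p q N i j) (\<lambda>z. (cmod (f z))\<^sup>2) \<le>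
      (cmod (integral (grid_cell p q N i j) f))\<^sup>2 * ((real N)\<^sup>2 / (4 * p * q)) +
      8 * p\<^sup>2 / (real N)\<^sup>2 * integral (grid_cell p q N i j) (\<lambda>z. (cmod (D1 f z))\<^sup>2) +
      8 * q\<^sup>2 / (real N)\<^sup>2 * integral (grid_cell p q N i j) (\<lambda>z. (cmod (D2 f z))\<^sup>2)" for i j
  proof -
    define a b cc d where "a = - p + real i * (2 * p / N)" and "b = - p + (real i + 1) * (2 * p / N)"
      and "cc = - q + real j * (2 * q / N)" and "d = - q + (real j + 1) * (2 * q / N)"
    have ba: "b - a = 2 * p / N" "d - cc = 2 * q / N" by (auto simp: a_def b_def cc_def d_def algebra_simps add_divide_distrib)
    then have "a < b" "cc < d" using pq N by (metis diff_gt_0_iff_gt divide_pos_pos mult_pos_pos of_nat_0_less_iff zero_less_numeral)+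
    from cell_poincare[OF f this] have "integral (grid_cell p q N i j) (\<lambda>z. (cmod (f z))\<^sup>2) \<le>
      (cmod (integral (grid_cell p q N i j) f))\<^sup>2 / ((2 * p / N) * (2 * q / N)) +
      2 * (2 * p / N)\<^sup>2 * integral (grid_cell p q N i j) (\<lambda>z. (cmod (D1 f z))\<^sup>2) +
      2 * (2 * q / N)\<^sup>2 * integral (grid_cell p q N i j) (\<lambda>z. (cmod (D2 f z))\<^sup>2)"
      unfolding ba unfolding a_def b_def cc_def d_def grid_cell_def .
    then show ?thesis by (simp add: power2_eq_square)
  qed
  have "integral K (\<lambda>z. (cmod (f z))\<^sup>2) = (\<Sum>i<N. \<Sum>j<N. integral (grid_cell p q N i j) (\<lambda>z. (cmod (f z))\<^sup>2))"
    unfolding K_def by (rule integral_grid_cell[OF c(1) pq N])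
  also have "\<dots> \<le> (\<Sum>i<N. \<Sum>j<N. (cmod (integral (grid_cell p q N i j) f))\<^sup>2 * ((real N)\<^sup>2 / (4 * p * q)) +
      8 * p\<^sup>2 / (real N)\<^sup>2 * integral (grid_cell p q N i j) (\<lambda>z. (cmod (D1 f z))\<^sup>2) +
      8 * q\<^sup>2 / (real N)\<^sup>2 * integral (grid_cell p q N i j) (\<lambda>z. (cmod (D2 f z))\<^sup>2))"
    by (intro sum_mono cell)
  also have "\<dots> = (\<Sum>i<N. \<Sum>j<N. (cmod (integral (grid_cell p q N i j) f))\<^sup>2) * ((real N)\<^sup>2 / (4 * p * q)) +
      8 * p\<^sup>2 / (real N)\<^sup>2 * (\<Sum>i<N. \<Sum>j<N. integral (grid_cell p q N i j) (\<lambda>z. (cmod (D1 f z))\<^sup>2)) +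
      8 * q\<^sup>2 / (real N)\<^sup>2 * (\<Sum>i<N. \<Sum>j<N. integral (grid_cell p q N i j) (\<lambda>z. (cmod (D2 f z))\<^sup>2))"
    by (simp only: sum.distrib sum_distrib_left sum_distrib_right)
  also have "(\<Sum>i<N. \<Sum>j<N. integral (grid_cell p q N i j) (\<lambda>z. (cmod (D1 f z))\<^sup>2)) = integral K (\<lambda>z. (cmod (D1 f z))\<^sup>2)"
    unfolding K_def by (rule integral_grid_cell[OF c(2) pq N, symmetric])
  also have "(\<Sum>i<N. \<Sum>j<N. integral (grid_cell p q N i j) (\<lambda>z. (cmod (D2 f z))\<^sup>2)) = integral K (\<lambda>z. (cmod (D2 f z))\<^sup>2)"
    unfolding K_def by (rule integral_grid_cell[OF c(3) pq N, symmetric])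
  finally show ?thesis by simp
qed

lemma grid_cell_subset:
  assumes "p > 0" "q > 0" "i < N" "j < N"
  shows "grid_cell p q N i j \<subseteq> cbox (- p, - q) (p, q)"
proof -
  have le: "- s \<le> - s + real k * (2 * s / N) \<and> - s + (real k + 1) * (2 * s / N) \<le> s"
    if "s > 0" "k < N" for s :: real and k
  proof -
    have "real k + 1 \<le> real N" using that by linarith
    then have "(real k + 1) * (2 * s / N) \<le> real N * (2 * s / N)" using that by (intro mult_right_mono) auto
    then show ?thesis using that by simp
  qed
  show ?thesis unfolding grid_cell_def
    using le[OF assms(1,3)] le[OF assms(2,4)] by (auto simp: cbox_Pair_eq)
qed

text \<open>The cell integrals are bounded numbers and converge along a diagonal subsequence. On a
  fine grid the gradient contribution is small uniformly, so the subsequence is Cauchy in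
  L^2.\<close>

lemma rellich:
  fixes \<phi> :: "nat \<Rightarrow> real \<times> real \<Rightarrow> complex"
  assumes pq: "p > 0" "q > 0"
  defines "K \<equiv> cbox (- p, - q) (p, q)"
  assumes smooth: "\<And>n. smooth (\<phi> n)"
    and C: "\<And>n. integral K (\<lambda>z. (cmod (\<phi> n z))\<^sup>2) \<le> C"
      "\<And>n. integral K (\<lambda>z. (cmod (D1 (\<phi> n) z))\<^sup>2) \<le> C"
      "\<And>n. integral K (\<lambda>z. (cmod (D2 (\<phi> n) z))\<^sup>2) \<le> C"
  shows "\<exists>r::nat \<Rightarrow> nat. strict_mono r \<and>
    (\<forall>e>0. \<exists>N. \<forall>i\<ge>N. \<forall>j\<ge>N. integral K (\<lambda>z. (cmod (\<phi> (r i) z - \<phi> (r j) z))\<^sup>2) < e)"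
proof -
  \<comment> \<open>The cells of all grids at once: a countable set, so one subsequence serves every
    fineness \<open>N\<close>.\<close>
  define I where "I = {(N::nat, i, j). i < N \<and> j < N}"
  define L where "L = (\<lambda>n (N, i, j). integral (grid_cell p q N i j) (\<phi> n))"
  have cont: "continuous_on UNIV (\<phi> n)" for n using smooth by (rule smooth_cont)
  have cont2: "continuous_on UNIV (\<lambda>z. (cmod (f z))\<^sup>2)" if "continuous_on UNIV f" for f :: "real \<times> real \<Rightarrow> complex"
    by (intro continuous_intros that)
  have nonneg: "0 \<le> integral (cbox a b) (\<lambda>z. (cmod (f z))\<^sup>2)" if "continuous_on UNIV f"
    for f :: "real \<times> real \<Rightarrow> complex" and a b
    by (intro Henstock_Kurzweil_Integration.integral_nonneg cont_integrable cont2 that) auto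
  have C0: "C \<ge> 0" using C(1)[of 0] nonneg[OF cont, of "(-p, -q)" "(p, q)" 0] unfolding K_def by linarith
  define M where "M = sqrt (Henstock_Kurzweil_Integration.content K * C)"
  have "norm (L n x) \<le> M" if x: "x \<in> I" for n x
  proof -
    obtain N i j where [simp]: "x = (N, i, j)" by (cases x)
    have ij: "i < N" "j < N" using x by (auto simp: I_def)
    obtain a b where ab: "grid_cell p q N i j = cbox a b" unfolding grid_cell_def by blast
    have sub: "cbox a b \<subseteq> K" using grid_cell_subset[OF pq ij] by (simp add: ab K_def)
    have "(cmod (L n x))\<^sup>2 \<le> Henstock_Kurzweil_Integration.content (cbox a b) * integral (cbox a b) (\<lambda>z. (cmod (\<phi> n z))\<^sup>2)"
      using integral_cauchy_schwarz[OF cont, of a b n] by (simp add: L_def ab)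
    also have "\<dots> \<le> Henstock_Kurzweil_Integration.content K * C"
    proof (intro mult_mono)
      show "Henstock_Kurzweil_Integration.content (cbox a b) \<le> Henstock_Kurzweil_Integration.content K"
        using sub unfolding K_def by (rule content_subset)
      have "integral (cbox a b) (\<lambda>z. (cmod (\<phi> n z))\<^sup>2) \<le> integral K (\<lambda>z. (cmod (\<phi> n z))\<^sup>2)"
        using sub unfolding K_def by (intro integral_subset_le cont_integrable cont2 cont) auto
      then show "integral (cbox a b) (\<lambda>z. (cmod (\<phi> n z))\<^sup>2) \<le> C" using C(1)[of n] by linarith
    qed (auto intro!: nonneg cont)
    finally show ?thesis unfolding M_def by (rule real_le_rsqrt)
  qed
  then obtain r :: "nat \<Rightarrow> nat" where r: "strict_mono r" "\<And>x. x \<in> I \<Longrightarrow> \<exists>l. (\<lambda>n. L (r n) x) \<longlonglongrightarrow> l"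
    using function_convergent_subsequence[of I L M] by blast
  have "\<exists>n. \<forall>i\<ge>n. \<forall>j\<ge>n. integral K (\<lambda>z. (cmod (\<phi> (r i) z - \<phi> (r j) z))\<^sup>2) < e" if e: "e > 0" for e
  proof -
    \<comment> \<open>\<open>D\<close> over N^2 bounds the gradient part for a difference of two
      members, whose squared gradient norms are at most 4 C.\<close>
    define D where "D = 8 * (p\<^sup>2 + q\<^sup>2) * (4 * C)"
    have D0: "D \<ge> 0" using C0 by (simp add: D_def)
    obtain N :: nat where N: "N > 0" "D / (real N)\<^sup>2 < e / 2"
    proof -
      obtain N :: nat where N: "real N > 2 * D / e + 1" using reals_Archimedean2 by blast
      have N1: "real N > 1" using N D0 e by (smt (verit) divide_nonneg_pos)
      have "2 * D / e < real N" using N by simp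
      also have "\<dots> \<le> (real N)\<^sup>2" using N1 by (simp add: power2_eq_square)
      finally have "D / (real N)\<^sup>2 < e / 2" using e N1 by (simp add: field_simps)
      moreover have "N > 0" using N1 by simp
      ultimately show ?thesis by (rule that[rotated])
    qed
    \<comment> \<open>Chosen so that N^2 cells, each with squared integral at most \<open>E\<close>,
      contribute exactly e/2 to the bound of \<open>grid_poincare\<close>.\<close>
    define E where "E = e / 2 * (4 * p * q) / (real N)\<^sup>2 / (real N)\<^sup>2"
    have E: "E > 0" using e pq N by (simp add: E_def)
    have "\<forall>x\<in>{..<N} \<times> {..<N}. \<forall>\<^sub>F n in sequentially. \<forall>m\<ge>n. \<forall>m'\<ge>n.
        (cmod (L (r m) (N, x) - L (r m') (N, x)))\<^sup>2 < E"
    proof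
      fix x assume "x \<in> {..<N} \<times> {..<N}"
      then have "(N, x) \<in> I" by (auto simp: I_def)
      then have "Cauchy (\<lambda>n. L (r n) (N, x))" using r(2) LIMSEQ_imp_Cauchy by blast
      then obtain n0 where n0: "\<And>m m'. m \<ge> n0 \<Longrightarrow> m' \<ge> n0 \<Longrightarrow> cmod (L (r m) (N, x) - L (r m') (N, x)) < sqrt E"
        using E CauchyD[of _ "sqrt E"] by (metis real_sqrt_gt_zero)
      have "(cmod (L (r m) (N, x) - L (r m') (N, x)))\<^sup>2 < E" if "m \<ge> n0" "m' \<ge> n0" for m m'
        using power_strict_mono[OF n0[OF that], of 2] E by simp
      then show "\<forall>\<^sub>F n in sequentially. \<forall>m\<ge>n. \<forall>m'\<ge>n. (cmod (L (r m) (N, x) - L (r m') (N, x)))\<^sup>2 < E"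
        by (intro eventually_sequentiallyI[of n0]) (meson order_trans)
    qed
    then have "\<forall>\<^sub>F n in sequentially. \<forall>x\<in>{..<N} \<times> {..<N}. \<forall>m\<ge>n. \<forall>m'\<ge>n.
        (cmod (L (r m) (N, x) - L (r m') (N, x)))\<^sup>2 < E"
      by (intro eventually_ball_finite) auto
    then obtain n where n: "\<And>x m m'. x \<in> {..<N} \<times> {..<N} \<Longrightarrow> m \<ge> n \<Longrightarrow> m' \<ge> n \<Longrightarrow>
        (cmod (L (r m) (N, x) - L (r m') (N, x)))\<^sup>2 < E"
      unfolding eventually_sequentially by blast
    have "integral K (\<lambda>z. (cmod (\<phi> (r k) z - \<phi> (r l) z))\<^sup>2) < e" if kl: "k \<ge> n" "l \<ge> n" for k l
    proof -
      define f where "f = (\<lambda>z. \<phi> (r k) z - \<phi> (r l) z)"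
      have f: "smooth f" unfolding f_def by (intro smooth_diff smooth)
      have grad: "integral K (\<lambda>z. (cmod (dir_deriv v f z))\<^sup>2) \<le> 4 * C" if v: "v = (1, 0) \<or> v = (0, 1)" for v
      proof -
        have cv: "continuous_on UNIV (dir_deriv v (\<phi> n))" for n
          using v smooth_D1_cont[OF smooth] smooth_D2_cont[OF smooth] by auto
        have Cv: "integral K (\<lambda>z. (cmod (dir_deriv v (\<phi> n) z))\<^sup>2) \<le> C" for n using v C by auto
        have df: "dir_deriv v f = (\<lambda>z. dir_deriv v (\<phi> (r k)) z - dir_deriv v (\<phi> (r l)) z)"
          unfolding f_def by (intro ext dir_deriv_diff smooth)
        have "integral K (\<lambda>z. (cmod (dir_deriv v f z))\<^sup>2) \<le>
            integral K (\<lambda>z. 2 * (cmod (dir_deriv v (\<phi> (r k)) z))\<^sup>2 + 2 * (cmod (dir_deriv v (\<phi> (r l)) z))\<^sup>2)"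
          unfolding df K_def
        proof (intro integral_le cont_integrable)
          show "(cmod (dir_deriv v (\<phi> (r k)) z - dir_deriv v (\<phi> (r l)) z))\<^sup>2 \<le>
             2 * (cmod (dir_deriv v (\<phi> (r k)) z))\<^sup>2 + 2 * (cmod (dir_deriv v (\<phi> (r l)) z))\<^sup>2" for z
            using cmod_add_sq_le[of "dir_deriv v (\<phi> (r k)) z" "- dir_deriv v (\<phi> (r l)) z"] by simp
        qed (intro continuous_intros cv)+
        also have "\<dots> = 2 * integral K (\<lambda>z. (cmod (dir_deriv v (\<phi> (r k)) z))\<^sup>2) + 2 * integral K (\<lambda>z. (cmod (dir_deriv v (\<phi> (r l)) z))\<^sup>2)"
          unfolding K_def
          by (subst Henstock_Kurzweil_Integration.integral_add; (intro cont_integrable continuous_intros cv)?) simp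
        finally show ?thesis using Cv[of "r k"] Cv[of "r l"] by linarith
      qed
      have sumE: "(\<Sum>i<N. \<Sum>j<N. (cmod (integral (grid_cell p q N i j) f))\<^sup>2) \<le> (\<Sum>i<N. \<Sum>j<N. E)"
      proof (intro sum_mono)
        fix i j assume ij: "i \<in> {..<N}" "j \<in> {..<N}"
        obtain a b where ab: "grid_cell p q N i j = cbox a b" unfolding grid_cell_def by blast
        have "integral (cbox a b) f = integral (cbox a b) (\<phi> (r k)) - integral (cbox a b) (\<phi> (r l))"
          unfolding f_def by (intro Henstock_Kurzweil_Integration.integral_diff cont_integrable cont)
        then show "(cmod (integral (grid_cell p q N i j) f))\<^sup>2 \<le> E"
          using n[of "(i, j)" k l] ij kl by (simp add: L_def ab less_imp_le)
      qed
      have "integral K (\<lambda>z. (cmod (f z))\<^sup>2) \<le>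
          (\<Sum>i<N. \<Sum>j<N. (cmod (integral (grid_cell p q N i j) f))\<^sup>2) * (real N)\<^sup>2 / (4 * p * q) +
          8 * p\<^sup>2 / (real N)\<^sup>2 * integral K (\<lambda>z. (cmod (D1 f z))\<^sup>2) + 8 * q\<^sup>2 / (real N)\<^sup>2 * integral K (\<lambda>z. (cmod (D2 f z))\<^sup>2)"
        unfolding K_def by (rule grid_poincare[OF f pq N(1)])
      also have "\<dots> \<le> (\<Sum>i<N. \<Sum>j<N. E) * (real N)\<^sup>2 / (4 * p * q) +
          8 * p\<^sup>2 / (real N)\<^sup>2 * (4 * C) + 8 * q\<^sup>2 / (real N)\<^sup>2 * (4 * C)"
        using pq grad by (intro add_mono divide_right_mono mult_right_mono mult_left_mono sumE) auto
      also have "(\<Sum>i<N. \<Sum>j<N. E) * (real N)\<^sup>2 / (4 * p * q) = e / 2"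
        using N pq by (simp add: E_def power2_eq_square)
      also have "e / 2 + 8 * p\<^sup>2 / (real N)\<^sup>2 * (4 * C) + 8 * q\<^sup>2 / (real N)\<^sup>2 * (4 * C) = e / 2 + D / (real N)\<^sup>2"
        by (simp add: D_def algebra_simps add_divide_distrib)
      also have "\<dots> < e" using N by linarith
      finally show ?thesis by (simp add: f_def)
    qed
    then show ?thesis by blast
  qed
  then show ?thesis using r(1) by blast
qed

section \<open>Test functions, the magnetic Cauchy-Riemann operator and the gauge change\<close>

subsection \<open>Test functions on rectangles\<close>

abbreviation rect :: "real \<Rightarrow> real \<Rightarrow> (real \<times> real) set" where
  "rect p q \<equiv> {- p<..<p} \<times> {- q<..<q}"

abbreviation crect :: "real \<Rightarrow> real \<Rightarrow> (real \<times> real) set" where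
  "crect p q \<equiv> cbox (- p, - q) (p, q)"

lemma rect_eq_box: "rect p q = box (- p, - q) (p, q)"
  by (auto simp: box_def Basis_prod_def)

lemma LINT_rect:
  fixes f :: "real \<times> real \<Rightarrow> 'b::euclidean_space"
  assumes "continuous_on UNIV f"
  shows "integrable (lebesgue_on (rect p q)) f"
    and "(LINT x|lebesgue_on (rect p q). f x) = integral (crect p q) f"
proof -
  have "f absolutely_integrable_on crect p q"
    using assms continuous_on_subset by (intro absolutely_integrable_continuous) blast
  then have "f absolutely_integrable_on box (- p, - q) (p, q)"
    by (rule set_integrable_subset[OF _ _ box_subset_cbox]) simp
  then show int: "integrable (lebesgue_on (rect p q)) f"
    unfolding rect_eq_box by (intro absolutely_integrable_imp_integrable) auto
  then show "(LINT x|lebesgue_on (rect p q). f x) = integral (crect p q) f"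
    using lebesgue_integral_eq_integral[of "box (- p, - q) (p, q)" f]
    by (simp add: rect_eq_box integral_open_interval)
qed

lemma test_smooth: "\<phi> \<in> test_functions \<Omega> \<Longrightarrow> smooth \<phi>"
  by (simp add: test_functions_def)

lemma test_outside: "\<phi> \<in> test_functions \<Omega> \<Longrightarrow> x \<notin> \<Omega> \<Longrightarrow> \<phi> x = 0"
  unfolding test_functions_def by blast

lemma test_mult: "\<phi> \<in> test_functions \<Omega> \<Longrightarrow> smooth h \<Longrightarrow> (\<lambda>x. h x * \<phi> x) \<in> test_functions \<Omega>"
  unfolding test_functions_def by (auto intro: smooth_mult)

lemma test_cnj: "\<phi> \<in> test_functions \<Omega> \<Longrightarrow> (\<lambda>x. cnj (\<phi> x)) \<in> test_functions \<Omega>"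
  unfolding test_functions_def by (auto intro: smooth_cnj)

lemma test_scale: "\<phi> \<in> test_functions \<Omega> \<Longrightarrow> (\<lambda>x. c * \<phi> x) \<in> test_functions \<Omega>"
  by (intro test_mult smooth_const)

lemma test_add:
  assumes "\<phi> \<in> test_functions \<Omega>" "\<psi> \<in> test_functions \<Omega>"
  shows "(\<lambda>x. \<phi> x + \<psi> x) \<in> test_functions \<Omega>"
proof -
  obtain K L where "compact K" "K \<subseteq> \<Omega>" "\<forall>x. x \<notin> K \<longrightarrow> \<phi> x = 0" "compact L" "L \<subseteq> \<Omega>" "\<forall>x. x \<notin> L \<longrightarrow> \<psi> x = 0"
    using assms unfolding test_functions_def by blast
  then have "compact (K \<union> L) \<and> K \<union> L \<subseteq> \<Omega> \<and> (\<forall>x. x \<notin> K \<union> L \<longrightarrow> \<phi> x + \<psi> x = 0)"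
    by (auto intro: compact_Un)
  then show ?thesis using assms unfolding test_functions_def by (blast intro: smooth_add)
qed

lemma test_zero: "(\<lambda>_. 0) \<in> test_functions \<Omega>"
  unfolding test_functions_def using smooth_const by (auto intro!: exI[of _ "{}"])

lemma test_dir_deriv:
  assumes "\<phi> \<in> test_functions \<Omega>" "e \<in> {(1, 0), (0, 1)}"
  shows "dir_deriv e \<phi> \<in> test_functions \<Omega>"
proof -
  obtain K where K: "compact K" "K \<subseteq> \<Omega>" "\<And>x. x \<notin> K \<Longrightarrow> \<phi> x = 0"
    using assms unfolding test_functions_def by blast
  have "dir_deriv e \<phi> x = 0" if "x \<notin> K" for x
  proof (rule dir_derivI[where D = "\<lambda>_. 0", of \<phi> x e])
    have "open (- K)" using K(1) by (simp add: compact_imp_closed open_Compl)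
    moreover have "((\<lambda>_. 0) has_derivative (\<lambda>_. 0)) (at x)" by simp
    ultimately show "(\<phi> has_derivative (\<lambda>_. 0)) (at x)"
      using that K(3) has_derivative_transform_within_open[of "\<lambda>_. 0" "\<lambda>_. 0" x UNIV "- K" \<phi>] by simp
  qed
  then show ?thesis using K assms smooth_dir_deriv test_smooth unfolding test_functions_def by blast
qed

lemma test_D1: "\<phi> \<in> test_functions \<Omega> \<Longrightarrow> D1 \<phi> \<in> test_functions \<Omega>"
  and test_D2: "\<phi> \<in> test_functions \<Omega> \<Longrightarrow> D2 \<phi> \<in> test_functions \<Omega>"
  by (simp_all add: test_dir_deriv)

lemma integral_D1_test:
  assumes "\<phi> \<in> test_functions (rect p q)" "p > 0"
  shows "integral (crect p q) (D1 \<phi>) = 0"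
  using assms integral_D1[OF test_smooth[OF assms(1)], of "- p" p "- q" q]
    test_outside[OF assms(1), of "(p, _)"] test_outside[OF assms(1), of "(- p, _)"] by simp

lemma integral_D2_test:
  assumes "\<phi> \<in> test_functions (rect p q)" "q > 0"
  shows "integral (crect p q) (D2 \<phi>) = 0"
  using assms integral_D2[OF test_smooth[OF assms(1)], of "- q" q "- p" p]
    test_outside[OF assms(1), of "(_, q)"] test_outside[OF assms(1), of "(_, - q)"] by simp

lemma parts_D1:
  assumes "\<phi> \<in> test_functions (rect p q)" "smooth h" "p > 0"
  shows "integral (crect p q) (\<lambda>x. h x * D1 \<phi> x) = - integral (crect p q) (\<lambda>x. D1 h x * \<phi> x)"
proof -
  note s = test_smooth[OF assms(1)]
  note c = smooth_cont[OF assms(2)] smooth_cont[OF s] smooth_D1_cont[OF assms(2)] smooth_D1_cont[OF s]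
  have "0 = integral (crect p q) (D1 (\<lambda>x. h x * \<phi> x))"
    using integral_D1_test[OF test_mult[OF assms(1,2)] assms(3)] by simp
  also have "D1 (\<lambda>x. h x * \<phi> x) = (\<lambda>x. h x * D1 \<phi> x + D1 h x * \<phi> x)"
    using dir_deriv_mult[OF assms(2) s] by auto
  also have "integral (crect p q) \<dots> = integral (crect p q) (\<lambda>x. h x * D1 \<phi> x) + integral (crect p q) (\<lambda>x. D1 h x * \<phi> x)"
    by (intro Henstock_Kurzweil_Integration.integral_add cont_integrable continuous_on_mult c)
  finally show ?thesis by (simp add: eq_neg_iff_add_eq_0)
qed

lemma parts_D2:
  assumes "\<phi> \<in> test_functions (rect p q)" "smooth h" "q > 0"
  shows "integral (crect p q) (\<lambda>x. h x * D2 \<phi> x) = - integral (crect p q) (\<lambda>x. D2 h x * \<phi> x)"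
proof -
  note s = test_smooth[OF assms(1)]
  note c = smooth_cont[OF assms(2)] smooth_cont[OF s] smooth_D2_cont[OF assms(2)] smooth_D2_cont[OF s]
  have "0 = integral (crect p q) (D2 (\<lambda>x. h x * \<phi> x))"
    using integral_D2_test[OF test_mult[OF assms(1,2)] assms(3)] by simp
  also have "D2 (\<lambda>x. h x * \<phi> x) = (\<lambda>x. h x * D2 \<phi> x + D2 h x * \<phi> x)"
    using dir_deriv_mult[OF assms(2) s] by auto
  also have "integral (crect p q) \<dots> = integral (crect p q) (\<lambda>x. h x * D2 \<phi> x) + integral (crect p q) (\<lambda>x. D2 h x * \<phi> x)"
    by (intro Henstock_Kurzweil_Integration.integral_add cont_integrable continuous_on_mult c)
  finally show ?thesis by (simp add: eq_neg_iff_add_eq_0)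
qed

text \<open>On each horizontal line the function vanishes at the left end, so its square is at most
  the length times the integral of the squared derivative. The constant is not sharp, but it is at
  most 1 when the side has length at most 1.\<close>

lemma poincare_test_1:
  assumes \<phi>: "\<phi> \<in> test_functions (rect p q)" and p: "p > 0"
  shows "integral (crect p q) (\<lambda>z. (cmod (\<phi> z))\<^sup>2) \<le> (2 * p)\<^sup>2 * integral (crect p q) (\<lambda>z. (cmod (D1 \<phi> z))\<^sup>2)"
proof -
  note s = test_smooth[OF \<phi>]
  have c: "continuous_on UNIV (\<lambda>z. (cmod (\<phi> z))\<^sup>2)" "continuous_on UNIV (\<lambda>z. (cmod (D1 \<phi> z))\<^sup>2)"
    by (intro continuous_intros smooth_cont smooth_D1_cont s)+
  define A where "A = (\<lambda>y. integral {- p..p} (\<lambda>x. (cmod (D1 \<phi> (x, y)))\<^sup>2))"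
  have A: "continuous_on UNIV A" unfolding A_def by (rule cont_integral_x[OF c(2)])
  have pw: "(cmod (\<phi> (x, y)))\<^sup>2 \<le> 2 * p * A y" if "x \<in> {- p..p}" for x y
    using line_diff1[OF s that, of "- p" y] test_outside[OF \<phi>, of "(- p, y)"] p by (simp add: A_def)
  have "integral (crect p q) (\<lambda>z. (cmod (\<phi> z))\<^sup>2) = integral {- q..q} (\<lambda>y. integral {- p..p} (\<lambda>x. (cmod (\<phi> (x, y)))\<^sup>2))"
    by (rule fubini_yx[OF c(1)])
  also have "\<dots> \<le> integral {- q..q} (\<lambda>y. (2 * p)\<^sup>2 * A y)"
  proof (intro integral_le cont_integrable_real cont_integral_x[OF c(1)] continuous_on_mult_left A)
    fix y
    have "integral {- p..p} (\<lambda>x. (cmod (\<phi> (x, y)))\<^sup>2) \<le> integral {- p..p} (\<lambda>x. 2 * p * A y)"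
      by (intro integral_le cont_integrable_real cont_slice1[OF c(1)] continuous_on_const pw)
    then show "integral {- p..p} (\<lambda>x. (cmod (\<phi> (x, y)))\<^sup>2) \<le> (2 * p)\<^sup>2 * A y"
      using p by (simp add: power2_eq_square)
  qed
  also have "\<dots> = (2 * p)\<^sup>2 * integral (crect p q) (\<lambda>z. (cmod (D1 \<phi> z))\<^sup>2)"
    by (simp add: A_def fubini_yx[OF c(2)])
  finally show ?thesis .
qed

lemma poincare_test_2:
  assumes \<phi>: "\<phi> \<in> test_functions (rect p q)" and q: "q > 0"
  shows "integral (crect p q) (\<lambda>z. (cmod (\<phi> z))\<^sup>2) \<le> (2 * q)\<^sup>2 * integral (crect p q) (\<lambda>z. (cmod (D2 \<phi> z))\<^sup>2)"
proof -
  note s = test_smooth[OF \<phi>]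
  have c: "continuous_on UNIV (\<lambda>z. (cmod (\<phi> z))\<^sup>2)" "continuous_on UNIV (\<lambda>z. (cmod (D2 \<phi> z))\<^sup>2)"
    by (intro continuous_intros smooth_cont smooth_D2_cont s)+
  define A where "A = (\<lambda>x. integral {- q..q} (\<lambda>y. (cmod (D2 \<phi> (x, y)))\<^sup>2))"
  have A: "continuous_on UNIV A" unfolding A_def by (rule cont_integral_y[OF c(2)])
  have pw: "(cmod (\<phi> (x, y)))\<^sup>2 \<le> 2 * q * A x" if "y \<in> {- q..q}" for x y
    using line_diff2[OF s that, of "- q" x] test_outside[OF \<phi>, of "(x, - q)"] q by (simp add: A_def)
  have "integral (crect p q) (\<lambda>z. (cmod (\<phi> z))\<^sup>2) = integral {- p..p} (\<lambda>x. integral {- q..q} (\<lambda>y. (cmod (\<phi> (x, y)))\<^sup>2))"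
    by (rule fubini_xy[OF c(1)])
  also have "\<dots> \<le> integral {- p..p} (\<lambda>x. (2 * q)\<^sup>2 * A x)"
  proof (intro integral_le cont_integrable_real cont_integral_y[OF c(1)] continuous_on_mult_left A)
    fix x
    have "integral {- q..q} (\<lambda>y. (cmod (\<phi> (x, y)))\<^sup>2) \<le> integral {- q..q} (\<lambda>y. 2 * q * A x)"
      by (intro integral_le cont_integrable_real cont_slice2[OF c(1)] continuous_on_const pw)
    then show "integral {- q..q} (\<lambda>y. (cmod (\<phi> (x, y)))\<^sup>2) \<le> (2 * q)\<^sup>2 * A x"
      using q by (simp add: power2_eq_square)
  qed
  also have "\<dots> = (2 * q)\<^sup>2 * integral (crect p q) (\<lambda>z. (cmod (D2 \<phi> z))\<^sup>2)"
    by (simp add: A_def fubini_xy[OF c(2)])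
  finally show ?thesis .
qed

text \<open>This is the first component of the covariant gradient; the sign is plus because the
  potential has first component -B times the second coordinate. The second component is the plain
  \<open>D2\<close>.\<close>

definition cov1 :: "real \<Rightarrow> (real \<times> real \<Rightarrow> complex) \<Rightarrow> real \<times> real \<Rightarrow> complex" where
  "cov1 B \<phi> x = D1 \<phi> x + \<i> * of_real (B * snd x) * \<phi> x"

text \<open>Twice the magnetic version of the operator d/d(conjugate z). For B = 0 it annihilates
  precisely the holomorphic functions among smooth ones.\<close>

definition cov_bar :: "real \<Rightarrow> (real \<times> real \<Rightarrow> complex) \<Rightarrow> real \<times> real \<Rightarrow> complex" where
  "cov_bar B \<phi> x = cov1 B \<phi> x + \<i> * D2 \<phi> x"

lemma smooth1_ident: "smooth1 (\<lambda>t. t)"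
proof -
  have "((if n = 0 then (\<lambda>t::real. t) else if n = 1 then (\<lambda>_. 1) else (\<lambda>_. 0)) has_real_derivative
     (if Suc n = 0 then (\<lambda>t. t) else if Suc n = 1 then (\<lambda>_. 1) else (\<lambda>_. 0)) t) (at t)" for n t
    by auto
  then show ?thesis unfolding smooth1_def
    by (intro exI[of _ "\<lambda>n. if n = 0 then (\<lambda>t::real. t) else if n = 1 then (\<lambda>_. 1) else (\<lambda>_. 0)"]) auto
qed

lemma smooth_snd_linear: "smooth (\<lambda>x. complex_of_real (B * snd x))"
  using smooth_scale[OF smooth_snd[OF smooth1_ident], of "of_real B"] by simp

lemma smooth_cov1: "smooth \<phi> \<Longrightarrow> smooth (cov1 B \<phi>)"
  unfolding cov1_def by (intro smooth_add smooth_mult smooth_const smooth_snd_linear smooth_dir_deriv_1)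

lemma smooth_cov_bar: "smooth \<phi> \<Longrightarrow> smooth (cov_bar B \<phi>)"
  unfolding cov_bar_def by (intro smooth_add smooth_mult smooth_const smooth_cov1 smooth_dir_deriv_2)

text \<open>Expanding the square of \<open>cov1 + \<i> D2\<close> leaves two cross terms. The one
  without B is a Jacobian and integrates to 0; the one with B is integrated by parts in the second
  coordinate and yields exactly the shift by -B. This is why the shifted form is a square.\<close>

lemma energy_identity:
  assumes \<phi>: "\<phi> \<in> test_functions (rect p q)" and pq: "p > 0" "q > 0"
  defines "K \<equiv> crect p q"
  shows "integral K (\<lambda>x. (cmod (cov1 B \<phi> x))\<^sup>2) + integral K (\<lambda>x. (cmod (D2 \<phi> x))\<^sup>2) - B * integral K (\<lambda>x. (cmod (\<phi> x))\<^sup>2) =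
    integral K (\<lambda>x. (cmod (cov_bar B \<phi> x))\<^sup>2)"
proof -
  note s = test_smooth[OF \<phi>]
  note s1 = smooth_dir_deriv_1[OF s] and s2 = smooth_dir_deriv_2[OF s]
  note \<phi>c = test_cnj[OF \<phi>]
  have c: "continuous_on UNIV \<phi>" "continuous_on UNIV (D1 \<phi>)" "continuous_on UNIV (D2 \<phi>)"
      "continuous_on UNIV (cov1 B \<phi>)" "continuous_on UNIV (cov_bar B \<phi>)" "continuous_on UNIV (D1 (D2 \<phi>))"
    by (intro smooth_cont s s1 s2 smooth_cov1 smooth_cov_bar smooth_dir_deriv_1)+
  have dc1: "D1 (\<lambda>x. cnj (\<phi> x)) = (\<lambda>x. cnj (D1 \<phi> x))" and dc2: "D2 (\<lambda>x. cnj (\<phi> x)) = (\<lambda>x. cnj (D2 \<phi> x))"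
    by (intro ext dir_deriv_cnj s)+
  \<comment> \<open>The Jacobian term integrates to zero since the mixed partial derivatives agree.\<close>
  have jac: "integral K (\<lambda>x. D1 \<phi> x * cnj (D2 \<phi> x)) = integral K (\<lambda>x. D2 \<phi> x * cnj (D1 \<phi> x))"
    using parts_D1[OF \<phi>c s2 pq(1)] parts_D2[OF \<phi>c s1 pq(2)] mixed_partials[OF s]
    by (simp add: K_def dc1 dc2)
  have im: "integral K (\<lambda>x. Im (D1 \<phi> x * cnj (D2 \<phi> x))) = 0"
  proof -
    have "integral K (\<lambda>x. D2 \<phi> x * cnj (D1 \<phi> x)) = cnj (integral K (\<lambda>x. D1 \<phi> x * cnj (D2 \<phi> x)))"
      by (simp add: Henstock_Kurzweil_Integration.integral_cnj mult.commute)
    then have "Im (integral K (\<lambda>x. D1 \<phi> x * cnj (D2 \<phi> x))) = 0" using jac by (simp add: complex_eq_iff)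
    moreover have "((\<lambda>x. D1 \<phi> x * cnj (D2 \<phi> x)) has_integral integral K (\<lambda>x. D1 \<phi> x * cnj (D2 \<phi> x))) K"
      unfolding K_def by (intro integrable_integral cont_integrable continuous_intros c)
    note has_integral_linear[OF this bounded_linear_Im]
    ultimately show ?thesis by (simp add: o_def integral_unique)
  qed
  have y: "integral K (\<lambda>x. 2 * B * snd x * Re (\<phi> x * cnj (D2 \<phi> x))) = - B * integral K (\<lambda>x. (cmod (\<phi> x))\<^sup>2)"
  proof -
    define h where "h = (\<lambda>x. complex_of_real (B * snd x) * \<phi> x)"
    have h: "smooth h" unfolding h_def by (intro smooth_mult smooth_snd_linear s)
    have dB: "D2 (\<lambda>x. complex_of_real (B * snd x)) x = of_real B" for x
      using dir_deriv_snd[of "\<lambda>t. B * t" B x "(0, 1)"] by (auto intro!: derivative_eq_intros)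
    have dh: "D2 h = (\<lambda>x. of_real (B * snd x) * D2 \<phi> x + of_real B * \<phi> x)"
      unfolding h_def by (intro ext) (simp only: dir_deriv_mult[OF smooth_snd_linear s] dB)
    have I1: "((\<lambda>x. h x * cnj (D2 \<phi> x)) has_integral integral K (\<lambda>x. h x * cnj (D2 \<phi> x))) K"
      unfolding K_def by (intro integrable_integral cont_integrable continuous_intros c smooth_cont h)
    have I2: "((\<lambda>x. D2 h x * cnj (\<phi> x)) has_integral - integral K (\<lambda>x. h x * cnj (D2 \<phi> x))) K"
      using parts_D2[OF \<phi>c h pq(2)] smooth_D2_cont[OF h] c(1) unfolding K_def dc2
      by (simp add: has_integral_integrable_integral cont_integrable continuous_on_mult continuous_on_cnj)
    have "((\<lambda>x. Re (h x * cnj (D2 \<phi> x) + D2 h x * cnj (\<phi> x))) has_integral 0) K"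
      using has_integral_linear[OF has_integral_add[OF I1 I2] bounded_linear_Re] by (simp add: o_def)
    moreover have "Re (h x * cnj (D2 \<phi> x) + D2 h x * cnj (\<phi> x)) = 2 * B * snd x * Re (\<phi> x * cnj (D2 \<phi> x)) + B * (cmod (\<phi> x))\<^sup>2" for x
      unfolding dh unfolding h_def cmod_power2 by (simp add: algebra_simps power2_eq_square)
    ultimately have "integral K (\<lambda>x. 2 * B * snd x * Re (\<phi> x * cnj (D2 \<phi> x)) + B * (cmod (\<phi> x))\<^sup>2) = 0"
      by (simp add: integral_unique)
    moreover have "integral K (\<lambda>x. 2 * B * snd x * Re (\<phi> x * cnj (D2 \<phi> x)) + B * (cmod (\<phi> x))\<^sup>2) =
      integral K (\<lambda>x. 2 * B * snd x * Re (\<phi> x * cnj (D2 \<phi> x))) + integral K (\<lambda>x. B * (cmod (\<phi> x))\<^sup>2)"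
      unfolding K_def by (intro Henstock_Kurzweil_Integration.integral_add cont_integrable continuous_intros c)
    ultimately show ?thesis by simp
  qed
  have pw: "(cmod (cov_bar B \<phi> x))\<^sup>2 = ((cmod (cov1 B \<phi> x))\<^sup>2 + (cmod (D2 \<phi> x))\<^sup>2) +
      (2 * Im (D1 \<phi> x * cnj (D2 \<phi> x)) + 2 * B * snd x * Re (\<phi> x * cnj (D2 \<phi> x)))" for x
    unfolding cov_bar_def cov1_def cmod_power2 by (simp add: algebra_simps power2_eq_square)
  have int: "(\<lambda>x. (cmod (cov1 B \<phi> x))\<^sup>2) integrable_on K" "(\<lambda>x. (cmod (D2 \<phi> x))\<^sup>2) integrable_on K"
    "(\<lambda>x. 2 * Im (D1 \<phi> x * cnj (D2 \<phi> x))) integrable_on K" "(\<lambda>x. 2 * B * snd x * Re (\<phi> x * cnj (D2 \<phi> x))) integrable_on K"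
    unfolding K_def by (intro cont_integrable continuous_intros c)+
  have "integral K (\<lambda>x. (cmod (cov_bar B \<phi> x))\<^sup>2) =
      (integral K (\<lambda>x. (cmod (cov1 B \<phi> x))\<^sup>2) + integral K (\<lambda>x. (cmod (D2 \<phi> x))\<^sup>2)) +
      (integral K (\<lambda>x. 2 * Im (D1 \<phi> x * cnj (D2 \<phi> x))) + integral K (\<lambda>x. 2 * B * snd x * Re (\<phi> x * cnj (D2 \<phi> x))))"
    unfolding pw using int by (simp only: Henstock_Kurzweil_Integration.integral_add integrable_add)
  also have "integral K (\<lambda>x. 2 * Im (D1 \<phi> x * cnj (D2 \<phi> x))) = 2 * integral K (\<lambda>x. Im (D1 \<phi> x * cnj (D2 \<phi> x)))"
    by (rule Henstock_Kurzweil_Integration.integral_mult_right)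
  finally show ?thesis using im y by simp
qed

lemma smooth1_gaussian: "smooth1 (\<lambda>t. exp (c * t\<^sup>2))"
proof (rule smooth1_coinduct[of _ "range (\<lambda>P t. poly P t * exp (c * t\<^sup>2))"])
  show "(\<lambda>t. exp (c * t\<^sup>2)) \<in> range (\<lambda>P t. poly P t * exp (c * t\<^sup>2))"
    by (rule image_eqI[of _ _ 1]) auto
  fix h :: "real \<Rightarrow> real" assume "h \<in> range (\<lambda>P t. poly P t * exp (c * t\<^sup>2))"
  then obtain P where h: "h = (\<lambda>t. poly P t * exp (c * t\<^sup>2))" by blast
  have "(h has_real_derivative poly (pderiv P + [:0, 2 * c:] * P) t * exp (c * t\<^sup>2)) (at t)" for t
    unfolding h by (auto intro!: derivative_eq_intros poly_DERIV simp: algebra_simps power2_eq_square)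
  then show "\<exists>h'\<in>range (\<lambda>P t. poly P t * exp (c * t\<^sup>2)). \<forall>t. (h has_real_derivative h' t) (at t)"
    by (intro bexI[of _ "\<lambda>t. poly (pderiv P + [:0, 2 * c:] * P) t * exp (c * t\<^sup>2)"] allI
        rangeI[of "\<lambda>P t. poly P t * exp (c * t\<^sup>2)" "pderiv P + [:0, 2 * c:] * P"])
qed

text \<open>
  The gauge factor turns \<open>cov_bar B\<close> into the Cauchy--Riemann operator \<open>cov_bar 0\<close>.
\<close>

definition gauge_factor :: "real \<Rightarrow> (complex \<Rightarrow> complex) \<Rightarrow> real \<times> real \<Rightarrow> complex" where
  "gauge_factor B F x = of_real (exp (B / 2 * (snd x)\<^sup>2)) * exp (of_real B * F (cplx x))"

lemma smooth_gauge:
  assumes "F holomorphic_on UNIV"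
  shows "smooth (gauge_factor B F)"
  unfolding gauge_factor_def
  by (intro smooth_mult smooth_snd smooth1_gaussian smooth_entire[of "\<lambda>z. exp (of_real B * F z)"] holomorphic_intros assms)

lemma cmod_gauge: "cmod (gauge_factor B F x) = exp (B * ((snd x)\<^sup>2 / 2 + Re (F (cplx x))))"
  by (simp add: gauge_factor_def norm_mult exp_add[symmetric] ring_distribs)

text \<open>The Cauchy-Riemann operator annihilates the holomorphic part of the gauge factor and
  acts only on the Gaussian, where it produces the zeroth order term of
  \<open>cov_bar B\<close>.\<close>

lemma cov_bar_gauge:
  assumes F: "F holomorphic_on UNIV" and \<phi>: "smooth \<phi>"
  shows "cov_bar 0 (\<lambda>x. gauge_factor B F x * \<phi> x) x = gauge_factor B F x * cov_bar B \<phi> x"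
proof -
  define E where "E = (\<lambda>z. exp (of_real B * F z))"
  have E: "E holomorphic_on UNIV" unfolding E_def by (intro holomorphic_intros F)
  have s: "smooth (\<lambda>x. complex_of_real (exp (B / 2 * (snd x)\<^sup>2)))" "smooth (\<lambda>x. E (cplx x))"
    by (intro smooth_snd smooth1_gaussian smooth_entire E)+
  have d: "dir_deriv e (\<lambda>x. complex_of_real (exp (B / 2 * (snd x)\<^sup>2))) x = of_real (exp (B / 2 * (snd x)\<^sup>2) * (B * snd x) * snd e)" for e
    by (rule dir_deriv_snd) (auto intro!: derivative_eq_intros)
  have g: "gauge_factor B F = (\<lambda>x. complex_of_real (exp (B / 2 * (snd x)\<^sup>2)) * E (cplx x))"
    by (simp add: gauge_factor_def E_def fun_eq_iff)
  have "D1 (gauge_factor B F) x + \<i> * D2 (gauge_factor B F) x = gauge_factor B F x * (\<i> * of_real (B * snd x))"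
    unfolding g dir_deriv_mult[OF s] d dir_deriv_entire[OF E] by (simp add: algebra_simps)
  moreover have "cov_bar 0 (\<lambda>x. gauge_factor B F x * \<phi> x) x =
      gauge_factor B F x * (D1 \<phi> x + \<i> * D2 \<phi> x) + (D1 (gauge_factor B F) x + \<i> * D2 (gauge_factor B F) x) * \<phi> x"
    unfolding cov_bar_def cov1_def dir_deriv_mult[OF smooth_gauge[OF F] \<phi>]
    by (simp add: algebra_simps)
  ultimately show ?thesis unfolding cov_bar_def cov1_def by (simp add: algebra_simps)
qed

text \<open>After the gauge change the test function \<open>w\<close> has energy equal to its
  Dirichlet integral, which dominates its norm since one side has length at most 1. The squared
  gauge factor lies between exp(2 B l) and exp(2 B u), so undoing the change costs their
  ratio.\<close>

lemma test_lower_bound: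
  assumes \<phi>: "\<phi> \<in> test_functions (rect p q)" and pq: "p > 0" "q > 0" "2 * p \<le> 1 \<or> 2 * q \<le> 1"
    and F: "F holomorphic_on UNIV" and B: "B \<ge> 0"
    and bounds: "\<And>x. x \<in> crect p q \<Longrightarrow> l \<le> (snd x)\<^sup>2 / 2 + Re (F (cplx x)) \<and> (snd x)\<^sup>2 / 2 + Re (F (cplx x)) \<le> u"
  shows "exp (- 2 * B * (u - l)) * integral (crect p q) (\<lambda>x. (cmod (\<phi> x))\<^sup>2) \<le>
    integral (crect p q) (\<lambda>x. (cmod (cov_bar B \<phi> x))\<^sup>2)"
proof -
  define K where "K = crect p q"
  define w where "w = (\<lambda>x. gauge_factor B F x * \<phi> x)"
  have w: "w \<in> test_functions (rect p q)" unfolding w_def by (intro test_mult \<phi> smooth_gauge F)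
  note s = test_smooth[OF \<phi>] and sw = test_smooth[OF w]
  have c: "continuous_on UNIV \<phi>" "continuous_on UNIV w" "continuous_on UNIV (cov_bar B \<phi>)" "continuous_on UNIV (cov_bar 0 w)"
    "continuous_on UNIV (D1 w)" "continuous_on UNIV (D2 w)" "continuous_on UNIV (cov1 0 w)"
    by (intro smooth_cont s sw smooth_cov_bar smooth_dir_deriv_1 smooth_dir_deriv_2 smooth_cov1)+
  have g: "exp (2 * B * l) \<le> (cmod (gauge_factor B F x))\<^sup>2 \<and> (cmod (gauge_factor B F x))\<^sup>2 \<le> exp (2 * B * u)" if "x \<in> K" for x
  proof -
    have "(cmod (gauge_factor B F x))\<^sup>2 = exp (2 * B * ((snd x)\<^sup>2 / 2 + Re (F (cplx x))))"
      unfolding cmod_gauge exp_double[symmetric] by (simp add: mult_ac)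
    then show ?thesis using bounds[of x] that B unfolding K_def by (auto intro!: mult_left_mono)
  qed
  have "exp (2 * B * l) * integral K (\<lambda>x. (cmod (\<phi> x))\<^sup>2) = integral K (\<lambda>x. exp (2 * B * l) * (cmod (\<phi> x))\<^sup>2)" by simp
  also have "\<dots> \<le> integral K (\<lambda>x. (cmod (w x))\<^sup>2)"
    unfolding K_def
    by (intro integral_le cont_integrable continuous_intros c)
      (use g in \<open>auto simp: w_def K_def norm_mult power_mult_distrib intro!: mult_right_mono\<close>)
  also have "\<dots> \<le> integral K (\<lambda>x. (cmod (D1 w x))\<^sup>2) + integral K (\<lambda>x. (cmod (D2 w x))\<^sup>2)"
  proof -
    have n: "0 \<le> integral K (\<lambda>x. (cmod (D1 w x))\<^sup>2)" "0 \<le> integral K (\<lambda>x. (cmod (D2 w x))\<^sup>2)"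
      unfolding K_def by (intro Henstock_Kurzweil_Integration.integral_nonneg cont_integrable continuous_intros c; simp)+
    have le: "a\<^sup>2 * t \<le> t" if "0 < a" "a \<le> 1" "0 \<le> t" for a t :: real
      using that by (simp add: mult_left_le_one_le power_le_one)
    show ?thesis
      using pq(3)
    proof
      assume "2 * p \<le> 1"
      then show ?thesis using poincare_test_1[OF w pq(1)] le[of "2 * p" "integral K (\<lambda>x. (cmod (D1 w x))\<^sup>2)"] n pq
        unfolding K_def by linarith
    next
      assume "2 * q \<le> 1"
      then show ?thesis using poincare_test_2[OF w pq(2)] le[of "2 * q" "integral K (\<lambda>x. (cmod (D2 w x))\<^sup>2)"] n pq
        unfolding K_def by linarith
    qed
  qed
  \<comment> \<open>The energy identity at field strength 0: for functions vanishing at the boundary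
    the Cauchy-Riemann operator has the full Dirichlet integral as squared norm.\<close>
  also have "\<dots> = integral K (\<lambda>x. (cmod (cov_bar 0 w x))\<^sup>2)"
    using energy_identity[OF w pq(1,2), of 0] by (simp add: K_def cov1_def)
  also have "\<dots> \<le> integral K (\<lambda>x. exp (2 * B * u) * (cmod (cov_bar B \<phi> x))\<^sup>2)"
    unfolding K_def
    by (intro integral_le cont_integrable continuous_intros c)
      (use g in \<open>auto simp: w_def K_def cov_bar_gauge[OF F s] norm_mult power_mult_distrib intro!: mult_right_mono\<close>)
  also have "\<dots> = exp (2 * B * u) * integral K (\<lambda>x. (cmod (cov_bar B \<phi> x))\<^sup>2)" by simp
  finally have "exp (- 2 * B * u) * (exp (2 * B * l) * integral K (\<lambda>x. (cmod (\<phi> x))\<^sup>2)) \<le>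
      exp (- 2 * B * u) * (exp (2 * B * u) * integral K (\<lambda>x. (cmod (cov_bar B \<phi> x))\<^sup>2))"
    by (intro mult_left_mono) auto
  moreover have "exp (- 2 * B * u) * exp (2 * B * l) = exp (- 2 * B * (u - l))"
    by (simp add: exp_add[symmetric] algebra_simps)
  moreover have "exp (- 2 * B * u) * exp (2 * B * u) = 1" by (simp add: exp_add[symmetric])
  ultimately show ?thesis unfolding K_def by (simp only: mult.assoc[symmetric] mult_1_left)
qed

section \<open>The form domain: closedness and compact embedding\<close>

subsection \<open>The form domain of the magnetic Laplacian\<close>

lemma sum_fscale_apply: "(\<Sum>i\<in>I. fscale (c i) (f i)) x = (\<Sum>i\<in>I. c i * f i x)"
  by (induction I rule: infinite_finite_induct) (auto simp: fscale_def zero_fun_def plus_fun_def)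

text \<open>An element of the form domain is kept as a triple: the function and its two covariant
  derivatives. The forms then involve L^2 products of components only, with no
  differentiation.\<close>

definition tscale :: "complex \<Rightarrow> ('a \<Rightarrow> complex) \<times> ('a \<Rightarrow> complex) \<times> ('a \<Rightarrow> complex) \<Rightarrow>
    ('a \<Rightarrow> complex) \<times> ('a \<Rightarrow> complex) \<times> ('a \<Rightarrow> complex)" where
  "tscale c T = (fscale c (fst T), fscale c (fst (snd T)), fscale c (snd (snd T)))"

interpretation tvs: vector_space tscale
  by unfold_locales (auto simp: tscale_def fvs.scale_right_distrib fvs.scale_left_distrib)

locale magnetic_rect =
  fixes p q B :: real
  assumes p: "p > 0" and q: "q > 0" and B: "B \<ge> 0"
begin

abbreviation M :: "(real \<times> real) measure" where "M \<equiv> lebesgue_on (rect p q)"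

abbreviation tests :: "(real \<times> real \<Rightarrow> complex) set" where "tests \<equiv> test_functions (rect p q)"

abbreviation ip where "ip \<equiv> L2_ip M"
abbreviation nm where "nm \<equiv> L2.nm M"

lemma finite_M: "finite_measure M"
  unfolding rect_eq_box by (intro finite_measure_lebesgue_on) simp

lemma cont_L2:
  assumes "continuous_on UNIV f"
  shows "f \<in> L2 M"
proof -
  have "continuous_on UNIV (\<lambda>x. (cmod (f x))\<^sup>2)" by (intro continuous_intros assms)
  from LINT_rect(1)[OF this] borel_measurable_integrable[OF LINT_rect(1)[OF assms]]
  show ?thesis unfolding L2_def by (intro CollectI conjI)
qed

lemma nm_cont: "continuous_on UNIV f \<Longrightarrow> nm f = integral (crect p q) (\<lambda>x. (cmod (f x))\<^sup>2)"
  unfolding L2_nm by (intro LINT_rect(2) continuous_intros)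

lemma test_L2:
  assumes "\<phi> \<in> tests"
  shows "\<phi> \<in> L2 M" "cov1 B \<phi> \<in> L2 M" "D1 \<phi> \<in> L2 M" "D2 \<phi> \<in> L2 M"
  using assms by (auto intro!: cont_L2 smooth_cont test_smooth smooth_cov1 smooth_dir_deriv_1 smooth_dir_deriv_2)

definition lift :: "(real \<times> real \<Rightarrow> complex) \<Rightarrow> (real \<times> real \<Rightarrow> complex) \<times> (real \<times> real \<Rightarrow> complex) \<times> (real \<times> real \<Rightarrow> complex)"
  where "lift \<phi> = (\<phi>, cov1 B \<phi>, D2 \<phi>)"

definition approximates where
  "approximates \<phi> T \<longleftrightarrow> (\<forall>k::nat. \<phi> k \<in> tests) \<and> (\<lambda>k. nm (\<phi> k - fst T)) \<longlonglongrightarrow> 0 \<and>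
     (\<lambda>k. nm (cov1 B (\<phi> k) - fst (snd T))) \<longlonglongrightarrow> 0 \<and> (\<lambda>k. nm (D2 (\<phi> k) - snd (snd T))) \<longlonglongrightarrow> 0"

text \<open>This is the closure in L^2 of the graph of the covariant gradient on test functions.
  Keeping the derivatives as components makes limits immediate and spares an appeal to uniqueness of
  weak derivatives.\<close>

definition H where
  "H = {T. fst T \<in> L2 M \<and> fst (snd T) \<in> L2 M \<and> snd (snd T) \<in> L2 M \<and> (\<exists>\<phi>. approximates \<phi> T)}"

definition mf where "mf S T = ip (fst S) (fst T)"

definition qf where
  "qf S T = ip (fst (snd S)) (fst (snd T)) + ip (snd (snd S)) (snd (snd T)) - of_real B * ip (fst S) (fst T)"

lemma H_L2: "T \<in> H \<Longrightarrow> fst T \<in> L2 M" "T \<in> H \<Longrightarrow> fst (snd T) \<in> L2 M" "T \<in> H \<Longrightarrow> snd (snd T) \<in> L2 M"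
  by (auto simp: H_def)

lemma lift_H: "\<phi> \<in> tests \<Longrightarrow> lift \<phi> \<in> H"
  unfolding H_def approximates_def lift_def
  by (auto simp: test_L2 L2_nm zero_fun_def intro!: exI[of _ "\<lambda>_. \<phi>"])

lemma cov1_add: "smooth \<phi> \<Longrightarrow> smooth \<psi> \<Longrightarrow> cov1 B (\<lambda>x. \<phi> x + \<psi> x) = cov1 B \<phi> + cov1 B \<psi>"
  by (auto simp: cov1_def fun_eq_iff dir_deriv_add algebra_simps plus_fun_def)

lemma cov1_scale: "smooth \<phi> \<Longrightarrow> cov1 B (\<lambda>x. c * \<phi> x) = fscale c (cov1 B \<phi>)"
  by (auto simp: cov1_def fun_eq_iff dir_deriv_scale algebra_simps fscale_def)

lemma tendsto_nm_add:
  assumes "\<And>k. f k \<in> L2 M" "\<And>k. g k \<in> L2 M" "(\<lambda>k::nat. nm (f k)) \<longlonglongrightarrow> 0" "(\<lambda>k. nm (g k)) \<longlonglongrightarrow> 0"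
  shows "(\<lambda>k. nm (f k + g k)) \<longlonglongrightarrow> 0"
proof (rule tendsto_sandwich[OF _ _ tendsto_const])
  have "(\<lambda>k. 2 * nm (f k) + 2 * nm (g k)) \<longlonglongrightarrow> 2 * 0 + 2 * 0" by (intro tendsto_intros assms)
  then show "(\<lambda>k. 2 * nm (f k) + 2 * nm (g k)) \<longlonglongrightarrow> 0" by simp
  show "\<forall>\<^sub>F k in sequentially. 0 \<le> nm (f k + g k)"
    by (rule always_eventually) (auto intro!: L2.nm_nonneg L2.H_add assms(1,2))
  show "\<forall>\<^sub>F k in sequentially. nm (f k + g k) \<le> 2 * nm (f k) + 2 * nm (g k)"
    by (rule always_eventually) (auto intro!: L2.nm_add_le assms(1,2))
qed

lemma tendsto_nm_scale:
  assumes "\<And>k. f k \<in> L2 M" "(\<lambda>k::nat. nm (f k)) \<longlonglongrightarrow> 0"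
  shows "(\<lambda>k. nm (fscale c (f k))) \<longlonglongrightarrow> 0"
  using tendsto_mult_left[OF assms(2), of "(cmod c)\<^sup>2"] assms(1) by (simp add: L2.nm_scale)

lemma H_subspace: "tvs.subspace H"
  unfolding tvs.subspace_def
proof (intro conjI ballI allI)
  have "lift (\<lambda>_. 0) = 0"
    by (auto simp: lift_def cov1_def fun_eq_iff dir_deriv_const zero_prod_def)
  then show "0 \<in> H" using lift_H[OF test_zero] by metis
next
  fix S T assume ST: "S \<in> H" "T \<in> H"
  then obtain \<phi> \<psi> where \<phi>: "approximates \<phi> S" and \<psi>: "approximates \<psi> T" by (auto simp: H_def)
  have t: "\<phi> k \<in> tests" "\<psi> k \<in> tests" for k using \<phi> \<psi> by (auto simp: approximates_def)
  note L = H_L2[OF ST(1)] H_L2[OF ST(2)] test_L2[OF t(1)] test_L2[OF t(2)]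
  have "approximates (\<lambda>k. \<phi> k + \<psi> k) (S + T)"
    unfolding approximates_def
  proof (intro conjI allI)
    have eq: "\<phi> k + \<psi> k = (\<lambda>x. \<phi> k x + \<psi> k x)" for k by (simp add: plus_fun_def)
    show "\<phi> k + \<psi> k \<in> tests" for k unfolding eq by (rule test_add[OF t])
    have 1: "(\<phi> k + \<psi> k) - fst (S + T) = (\<phi> k - fst S) + (\<psi> k - fst T)" for k by simp
    have 2: "cov1 B (\<phi> k + \<psi> k) - fst (snd (S + T)) = (cov1 B (\<phi> k) - fst (snd S)) + (cov1 B (\<psi> k) - fst (snd T))" for k
      unfolding eq cov1_add[OF test_smooth[OF t(1)] test_smooth[OF t(2)]] by simp
    have 3: "D2 (\<phi> k + \<psi> k) - snd (snd (S + T)) = (D2 (\<phi> k) - snd (snd S)) + (D2 (\<psi> k) - snd (snd T))" for k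
      unfolding eq by (auto simp: fun_eq_iff dir_deriv_add[OF test_smooth[OF t(1)] test_smooth[OF t(2)]])
    show "(\<lambda>k. nm (\<phi> k + \<psi> k - fst (S + T))) \<longlonglongrightarrow> 0"
      "(\<lambda>k. nm (cov1 B (\<phi> k + \<psi> k) - fst (snd (S + T)))) \<longlonglongrightarrow> 0"
      "(\<lambda>k. nm (D2 (\<phi> k + \<psi> k) - snd (snd (S + T)))) \<longlonglongrightarrow> 0"
      unfolding 1 2 3 using \<phi> \<psi> L by (auto simp: approximates_def intro!: tendsto_nm_add L2.H_diff)
  qed
  then show "S + T \<in> H"
    unfolding H_def mem_Collect_eq fst_add snd_add by (intro conjI exI L2.H_add H_L2 ST)
next
  fix T c assume T: "T \<in> H"
  then obtain \<phi> where \<phi>: "approximates \<phi> T" by (auto simp: H_def)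
  have t: "\<phi> k \<in> tests" for k using \<phi> by (auto simp: approximates_def)
  note L = H_L2[OF T] test_L2[OF t]
  have "approximates (\<lambda>k. fscale c (\<phi> k)) (tscale c T)"
    unfolding approximates_def
  proof (intro conjI allI)
    have eq: "fscale c (\<phi> k) = (\<lambda>x. c * \<phi> k x)" for k by (simp add: fscale_def)
    show "fscale c (\<phi> k) \<in> tests" for k unfolding eq by (rule test_scale[OF t])
    have 1: "fscale c (\<phi> k) - fst (tscale c T) = fscale c (\<phi> k - fst T)" for k
      by (simp add: tscale_def fvs.scale_right_diff_distrib)
    have 2: "cov1 B (fscale c (\<phi> k)) - fst (snd (tscale c T)) = fscale c (cov1 B (\<phi> k) - fst (snd T))" for k
      unfolding eq cov1_scale[OF test_smooth[OF t]] by (simp add: tscale_def fvs.scale_right_diff_distrib)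
    have 3: "D2 (fscale c (\<phi> k)) - snd (snd (tscale c T)) = fscale c (D2 (\<phi> k) - snd (snd T))" for k
      unfolding eq by (auto simp: fun_eq_iff dir_deriv_scale[OF test_smooth[OF t]] tscale_def fscale_def algebra_simps)
    show "(\<lambda>k. nm (fscale c (\<phi> k) - fst (tscale c T))) \<longlonglongrightarrow> 0"
      "(\<lambda>k. nm (cov1 B (fscale c (\<phi> k)) - fst (snd (tscale c T)))) \<longlonglongrightarrow> 0"
      "(\<lambda>k. nm (D2 (fscale c (\<phi> k)) - snd (snd (tscale c T)))) \<longlonglongrightarrow> 0"
      unfolding 1 2 3 using \<phi> L by (auto simp: approximates_def intro!: tendsto_nm_scale L2.H_diff)
  qed
  moreover have "fst (tscale c T) \<in> L2 M" "fst (snd (tscale c T)) \<in> L2 M" "snd (snd (tscale c T)) \<in> L2 M"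
    unfolding tscale_def fst_conv snd_conv by (intro L2.H_scale H_L2 T)+
  ultimately show "tscale c T \<in> H" unfolding H_def by blast
qed

lemma nm_approx:
  assumes "T \<in> H" "approximates \<phi> T"
  shows "(\<lambda>k. nm (\<phi> k)) \<longlonglongrightarrow> nm (fst T)"
    and "(\<lambda>k. nm (cov1 B (\<phi> k))) \<longlonglongrightarrow> nm (fst (snd T))"
    and "(\<lambda>k. nm (D2 (\<phi> k))) \<longlonglongrightarrow> nm (snd (snd T))"
  using assms H_L2[OF assms(1)] by (auto simp: approximates_def intro!: L2.tendsto_nm test_L2)

definition energy :: "(real \<times> real \<Rightarrow> complex) \<Rightarrow> real" where
  "energy \<phi> = integral (crect p q) (\<lambda>x. (cmod (cov_bar B \<phi> x))\<^sup>2)"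

lemma energy_eq: "\<phi> \<in> tests \<Longrightarrow> nm (cov1 B \<phi>) + nm (D2 \<phi>) - B * nm \<phi> = energy \<phi>"
  unfolding energy_def using energy_identity[OF _ p q, of \<phi> B]
  by (simp add: nm_cont smooth_cont test_smooth smooth_cov1 smooth_dir_deriv_2)

text \<open>The three norms converge along an approximating sequence, so inequalities between them
  pass from test functions to \<open>H\<close>. With constant 0 this also shows that
  \<open>qf\<close> is nonnegative.\<close>

lemma form_lower_bound:
  assumes "\<And>\<phi>. \<phi> \<in> tests \<Longrightarrow> \<kappa> * nm \<phi> \<le> energy \<phi>" and T: "T \<in> H"
  shows "\<kappa> * nm (fst T) \<le> nm (fst (snd T)) + nm (snd (snd T)) - B * nm (fst T)"
proof -
  obtain \<phi> where \<phi>: "approximates \<phi> T" using T by (auto simp: H_def)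
  show ?thesis
  proof (rule LIMSEQ_le)
    show "(\<lambda>k. \<kappa> * nm (\<phi> k)) \<longlonglongrightarrow> \<kappa> * nm (fst T)"
      by (intro tendsto_intros nm_approx[OF T \<phi>])
    show "(\<lambda>k. nm (cov1 B (\<phi> k)) + nm (D2 (\<phi> k)) - B * nm (\<phi> k)) \<longlonglongrightarrow>
        nm (fst (snd T)) + nm (snd (snd T)) - B * nm (fst T)"
      by (intro tendsto_intros nm_approx[OF T \<phi>])
    show "\<exists>N. \<forall>n\<ge>N. \<kappa> * nm (\<phi> n) \<le> nm (cov1 B (\<phi> n)) + nm (D2 (\<phi> n)) - B * nm (\<phi> n)"
      using assms(1) energy_eq \<phi> by (auto simp: approximates_def)
  qed
qed

lemma energy_nonneg: "\<phi> \<in> tests \<Longrightarrow> 0 \<le> energy \<phi>"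
  unfolding energy_def
  by (intro Henstock_Kurzweil_Integration.integral_nonneg cont_integrable continuous_intros smooth_cont
      smooth_cov_bar test_smooth) auto

sublocale m: herm_form tscale H mf
proof
  show "tvs.subspace H" by (rule H_subspace)
  show "mf (u + v) w = mf u w + mf v w" if "u \<in> H" "v \<in> H" "w \<in> H" for u v w
    unfolding mf_def fst_add using that by (intro L2.add_left H_L2)
  show "mf (tscale c u) w = c * mf u w" if "u \<in> H" "w \<in> H" for c u w
    unfolding mf_def tscale_def fst_conv using that by (intro L2.scale_left H_L2)
  show "mf w u = cnj (mf u w)" if "u \<in> H" "w \<in> H" for u w
    unfolding mf_def using that by (intro L2.cnj_sym H_L2)
  show "0 \<le> Re (mf u u)" if "u \<in> H" for u
    unfolding mf_def using that by (intro L2.nonneg H_L2)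
qed

lemma Re_qf: "Re (qf T T) = nm (fst (snd T)) + nm (snd (snd T)) - B * nm (fst T)"
  by (simp add: qf_def L2.nm_def)

sublocale q: herm_form tscale H qf
proof
  show "tvs.subspace H" by (rule H_subspace)
  show "qf (u + v) w = qf u w + qf v w" if "u \<in> H" "v \<in> H" "w \<in> H" for u v w
    using H_L2[OF that(1)] H_L2[OF that(2)] H_L2[OF that(3)] by (simp add: qf_def L2.add_left algebra_simps)
  show "qf (tscale c u) w = c * qf u w" if "u \<in> H" "w \<in> H" for c u w
    using H_L2[OF that(1)] H_L2[OF that(2)] by (simp add: qf_def tscale_def L2.scale_left algebra_simps)
  show "qf w u = cnj (qf u w)" if "u \<in> H" "w \<in> H" for u w
    using L2.cnj_sym[OF H_L2(1)[OF that(1)] H_L2(1)[OF that(2)]] L2.cnj_sym[OF H_L2(2)[OF that(1)] H_L2(2)[OF that(2)]]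
      L2.cnj_sym[OF H_L2(3)[OF that(1)] H_L2(3)[OF that(2)]] by (simp add: qf_def)
  show "0 \<le> Re (qf u u)" if "u \<in> H" for u
    using form_lower_bound[of 0, OF _ that] energy_nonneg by (simp add: Re_qf)
qed

lemma m_nm: "m.nm T = nm (fst T)"
  by (simp add: m.nm_def mf_def L2.nm_def)

lemma q_nm: "q.nm T = nm (fst (snd T)) + nm (snd (snd T)) - B * nm (fst T)"
  by (simp add: q.nm_def Re_qf)

lemma exists_close_test:
  assumes T: "T \<in> H" and e: "e > 0"
  shows "\<exists>\<phi>\<in>tests. nm (\<phi> - fst T) < e \<and> nm (cov1 B \<phi> - fst (snd T)) < e \<and> nm (D2 \<phi> - snd (snd T)) < e"
proof -
  obtain \<phi> where \<phi>: "\<And>k. \<phi> k \<in> tests" "(\<lambda>k::nat. nm (\<phi> k - fst T)) \<longlonglongrightarrow> 0"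
     "(\<lambda>k. nm (cov1 B (\<phi> k) - fst (snd T))) \<longlonglongrightarrow> 0" "(\<lambda>k. nm (D2 (\<phi> k) - snd (snd T))) \<longlonglongrightarrow> 0"
    using T by (auto simp: H_def approximates_def)
  have "\<forall>\<^sub>F k in sequentially. nm (\<phi> k - fst T) < e \<and> nm (cov1 B (\<phi> k) - fst (snd T)) < e \<and> nm (D2 (\<phi> k) - snd (snd T)) < e"
    using \<phi>(2,3,4)[THEN order_tendstoD(2), OF e] by (intro eventually_conj)
  then show ?thesis using \<phi>(1) unfolding eventually_sequentially by blast
qed

end

lemma (in herm_form) nm_add3_le:
  assumes "a \<in> H" "b \<in> H" "c \<in> H"
  shows "nm (a + b + c) \<le> 4 * nm a + 4 * nm b + 2 * nm c"
  using nm_add_le[of "a + b" c] nm_add_le[of a b] assms H_add by force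

lemma (in herm_form) nm_minus_commute: "u \<in> H \<Longrightarrow> v \<in> H \<Longrightarrow> nm (u - v) = nm (v - u)"
  using nm_diff[of u v] nm_diff[of v u] cnj_sym[of u v] by simp

context magnetic_rect
begin

lemma tests_near_sequence:
  assumes f: "\<And>j. f j \<in> H"
  shows "\<exists>\<phi>. \<forall>j::nat. \<phi> j \<in> tests \<and> nm (\<phi> j - fst (f j)) < 1 / Suc j \<and>
    nm (cov1 B (\<phi> j) - fst (snd (f j))) < 1 / Suc j \<and> nm (D2 (\<phi> j) - snd (snd (f j))) < 1 / Suc j"
proof -
  have "\<exists>\<phi>. \<phi> \<in> tests \<and> nm (\<phi> - fst (f j)) < 1 / Suc j \<and>
    nm (cov1 B \<phi> - fst (snd (f j))) < 1 / Suc j \<and> nm (D2 \<phi> - snd (snd (f j))) < 1 / Suc j" for j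
    using exists_close_test[OF f[of j], of "1 / Suc j"] unfolding Bex_def by simp
  then show ?thesis by (intro choice allI)
qed

lemma L2_complete_nm:
  assumes "\<And>j::nat. g j \<in> L2 M" "\<And>e. e > 0 \<Longrightarrow> \<exists>N. \<forall>i\<ge>N. \<forall>j\<ge>N. nm (g i - g j) < e"
  shows "\<exists>u\<in>L2 M. (\<lambda>j. nm (g j - u)) \<longlonglongrightarrow> 0"
proof -
  have "\<exists>u\<in>L2 M. (\<lambda>j. LINT x|M. (cmod (g j x - u x))\<^sup>2) \<longlonglongrightarrow> 0"
    by (rule L2_complete[OF finite_M assms(1)]) (use assms(2) in \<open>simp add: L2_nm\<close>)
  then show ?thesis by (simp add: L2_nm)
qed

lemma near_cauchy:
  assumes L: "\<And>j::nat. g j \<in> L2 M" "\<And>j. h j \<in> L2 M" and near: "\<And>j. nm (h j - g j) < 1 / Suc j"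
    and cauchy: "\<And>e. e > 0 \<Longrightarrow> \<exists>N. \<forall>i\<ge>N. \<forall>j\<ge>N. nm (g i - g j) < e" and e: "e > 0"
  shows "\<exists>N. \<forall>i\<ge>N. \<forall>j\<ge>N. nm (h i - h j) < e"
proof -
  obtain N1 where N1: "\<And>i j. i \<ge> N1 \<Longrightarrow> j \<ge> N1 \<Longrightarrow> nm (g i - g j) < e / 16" using cauchy[of "e / 16"] e by auto
  obtain N2 where N2: "1 / real (Suc N2) < e / 16" using nat_approx_posE[of "e / 16"] e by auto
  have "nm (h i - h j) < e" if ij: "i \<ge> max N1 N2" "j \<ge> max N1 N2" for i j
  proof -
    have "1 / real (Suc i) \<le> 1 / real (Suc N2)" "1 / real (Suc j) \<le> 1 / real (Suc N2)"
      using ij by (auto intro!: divide_left_mono)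
    then have small: "1 / real (Suc i) < e / 16" "1 / real (Suc j) < e / 16" using N2 by linarith+
    have eq: "h i - h j = (h i - g i) + (g i - g j) + (g j - h j)" by simp
    have "nm (h i - h j) \<le> 4 * nm (h i - g i) + 4 * nm (g i - g j) + 2 * nm (g j - h j)"
      by (subst eq, rule L2.nm_add3_le) (intro L2.H_diff L)+
    also have "nm (g j - h j) = nm (h j - g j)" by (rule L2.nm_minus_commute[OF L])
    finally have "nm (h i - h j) \<le> 4 * nm (h i - g i) + 4 * nm (g i - g j) + 2 * nm (h j - g j)" .
    moreover have "nm (g i - g j) < e / 16" using N1 ij by simp
    ultimately show ?thesis using near[of i] near[of j] small e by linarith
  qed
  then show ?thesis by blast
qed

lemma near_limit:
  assumes L: "\<And>j::nat. g j \<in> L2 M" "\<And>j. h j \<in> L2 M" "u \<in> L2 M" and near: "\<And>j. nm (h j - g j) < 1 / Suc j"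
    and lim: "(\<lambda>j. nm (h j - u)) \<longlonglongrightarrow> 0"
  shows "(\<lambda>j. nm (g j - u)) \<longlonglongrightarrow> 0"
proof (rule tendsto_sandwich[OF _ _ tendsto_const])
  have "(\<lambda>j. 2 * (1 / real (Suc j)) + 2 * nm (h j - u)) \<longlonglongrightarrow> 2 * 0 + 2 * 0"
    by (intro tendsto_intros lim LIMSEQ_Suc[OF lim_1_over_n])
  then show "(\<lambda>j. 2 * (1 / real (Suc j)) + 2 * nm (h j - u)) \<longlonglongrightarrow> 0" by simp
  show "\<forall>\<^sub>F j in sequentially. 0 \<le> nm (g j - u)"
    by (rule always_eventually) (auto intro!: L2.nm_nonneg L2.H_diff L)
  show "\<forall>\<^sub>F j in sequentially. nm (g j - u) \<le> 2 * (1 / real (Suc j)) + 2 * nm (h j - u)"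
  proof (rule always_eventually, rule allI)
    fix j
    have "nm (g j - u) \<le> 2 * nm (g j - h j) + 2 * nm (h j - u)"
      using L2.nm_add_le[of "g j - h j" M "h j - u"] L by (simp add: L2.H_diff)
    then show "nm (g j - u) \<le> 2 * (1 / real (Suc j)) + 2 * nm (h j - u)"
      using near[of j] L2.nm_minus_commute[OF L(1,2), of j j] by linarith
  qed
qed

text \<open>Each member of the sequence is replaced by a test function at squared distance below
  1/(j + 1). The new sequence is still Cauchy in each component, and it witnesses at once that the
  triple of limits belongs to \<open>H\<close>.\<close>

lemma H_complete:
  assumes f: "\<And>j. f j \<in> H"
    and cauchy: "\<And>e. e > 0 \<Longrightarrow> \<exists>N. \<forall>i\<ge>N. \<forall>j\<ge>N. m.nm (f i - f j) < e \<and> q.nm (f i - f j) < e"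
  shows "\<exists>u\<in>H. (\<lambda>j::nat. m.nm (f j - u)) \<longlonglongrightarrow> 0 \<and> (\<lambda>j. q.nm (f j - u)) \<longlonglongrightarrow> 0"
proof -
  define g1 g2 g3 where "g1 = (\<lambda>j. fst (f j))" and "g2 = (\<lambda>j. fst (snd (f j)))" and "g3 = (\<lambda>j. snd (snd (f j)))"
  have L: "g1 j \<in> L2 M" "g2 j \<in> L2 M" "g3 j \<in> L2 M" for j using H_L2[OF f] by (auto simp: g1_def g2_def g3_def)
  have mnm: "m.nm (f i - f j) = nm (g1 i - g1 j)" for i j by (simp add: m_nm g1_def)
  have qnm: "q.nm (f i - f j) = nm (g2 i - g2 j) + nm (g3 i - g3 j) - B * nm (g1 i - g1 j)" for i j
    by (simp add: q_nm g1_def g2_def g3_def)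
  have c1: "\<exists>N. \<forall>i\<ge>N. \<forall>j\<ge>N. nm (g1 i - g1 j) < e" if "e > 0" for e
    using cauchy[OF that] unfolding mnm by blast
  have c23: "\<exists>N. \<forall>i\<ge>N. \<forall>j\<ge>N. nm (g2 i - g2 j) < e \<and> nm (g3 i - g3 j) < e" if e: "e > 0" for e
  proof -
    \<comment> \<open>The form \<open>qf\<close> subtracts B times the squared L^2 norm; adding it
      back, the derivative components are below d + B d = e.\<close>
    define d where "d = e / (1 + B)"
    have d: "d > 0" using e B by (simp add: d_def)
    obtain N where N: "\<And>i j. i \<ge> N \<Longrightarrow> j \<ge> N \<Longrightarrow> nm (g1 i - g1 j) < d \<and> nm (g2 i - g2 j) + nm (g3 i - g3 j) - B * nm (g1 i - g1 j) < d"
      using cauchy[OF d] unfolding mnm qnm by blast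
    have "nm (g2 i - g2 j) < e \<and> nm (g3 i - g3 j) < e" if "i \<ge> N" "j \<ge> N" for i j
    proof -
      have "B * nm (g1 i - g1 j) \<le> B * d" using N[OF that] B by (intro mult_left_mono) auto
      moreover have "d + B * d = e" using B d_def by (simp add: nonzero_eq_divide_eq algebra_simps)
      moreover have "0 \<le> nm (g2 i - g2 j)" "0 \<le> nm (g3 i - g3 j)" by (intro L2.nm_nonneg L2.H_diff L)+
      ultimately show ?thesis using N[OF that] by linarith
    qed
    then show ?thesis by blast
  qed
  have c2: "\<exists>N. \<forall>i\<ge>N. \<forall>j\<ge>N. nm (g2 i - g2 j) < e" and c3: "\<exists>N. \<forall>i\<ge>N. \<forall>j\<ge>N. nm (g3 i - g3 j) < e" if "e > 0" for e
    using c23[OF that] by blast+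
  obtain \<phi> where \<phi>: "\<And>j. \<phi> j \<in> tests" "\<And>j. nm (\<phi> j - g1 j) < 1 / Suc j"
    "\<And>j. nm (cov1 B (\<phi> j) - g2 j) < 1 / Suc j" "\<And>j. nm (D2 (\<phi> j) - g3 j) < 1 / Suc j"
    using tests_near_sequence[of f, OF f] unfolding g1_def g2_def g3_def by blast
  note tL = test_L2[OF \<phi>(1)]
  obtain u1 where u1: "u1 \<in> L2 M" "(\<lambda>j. nm (\<phi> j - u1)) \<longlonglongrightarrow> 0"
    using L2_complete_nm[OF tL(1) near_cauchy[OF L(1) tL(1) \<phi>(2) c1]] by blast
  obtain u2 where u2: "u2 \<in> L2 M" "(\<lambda>j. nm (cov1 B (\<phi> j) - u2)) \<longlonglongrightarrow> 0"
    using L2_complete_nm[OF tL(2) near_cauchy[OF L(2) tL(2) \<phi>(3) c2]] by blast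
  obtain u3 where u3: "u3 \<in> L2 M" "(\<lambda>j. nm (D2 (\<phi> j) - u3)) \<longlonglongrightarrow> 0"
    using L2_complete_nm[OF tL(4) near_cauchy[OF L(3) tL(4) \<phi>(4) c3]] by blast
  have lim: "(\<lambda>j. nm (g1 j - u1)) \<longlonglongrightarrow> 0" "(\<lambda>j. nm (g2 j - u2)) \<longlonglongrightarrow> 0" "(\<lambda>j. nm (g3 j - u3)) \<longlonglongrightarrow> 0"
    by (rule near_limit[OF L(1) tL(1) u1(1) \<phi>(2) u1(2)] near_limit[OF L(2) tL(2) u2(1) \<phi>(3) u2(2)]
        near_limit[OF L(3) tL(4) u3(1) \<phi>(4) u3(2)])+
  have "(u1, u2, u3) \<in> H"
    unfolding H_def approximates_def using u1 u2 u3 \<phi>(1) by auto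
  moreover have "(\<lambda>j. m.nm (f j - (u1, u2, u3))) \<longlonglongrightarrow> 0" using lim(1) by (simp add: m_nm g1_def)
  moreover have "(\<lambda>j. nm (g2 j - u2) + nm (g3 j - u3) - B * nm (g1 j - u1)) \<longlonglongrightarrow> 0 + 0 - B * 0"
    by (intro tendsto_intros lim)
  then have "(\<lambda>j. q.nm (f j - (u1, u2, u3))) \<longlonglongrightarrow> 0" by (simp add: q_nm g1_def g2_def g3_def)
  ultimately show ?thesis by blast
qed

text \<open>Nearby test functions have bounded ordinary gradients, because the vector potential is
  bounded on the rectangle. \<open>rellich\<close> supplies the subsequence, which is then carried
  back to the original elements.\<close>

lemma H_compact:
  assumes f: "\<And>j. f j \<in> H" and C: "\<And>j. m.nm (f j) \<le> C" "\<And>j. q.nm (f j) \<le> C"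
  shows "\<exists>r. strict_mono r \<and> (\<forall>e>0. \<exists>N::nat. \<forall>i\<ge>N. \<forall>j\<ge>N. m.nm (f (r i :: nat) - f (r j)) < e)"
proof -
  define g1 g2 g3 where "g1 = (\<lambda>j. fst (f j))" and "g2 = (\<lambda>j. fst (snd (f j)))" and "g3 = (\<lambda>j. snd (snd (f j)))"
  have L: "g1 j \<in> L2 M" "g2 j \<in> L2 M" "g3 j \<in> L2 M" for j using H_L2[OF f] by (auto simp: g1_def g2_def g3_def)
  obtain \<phi> where \<phi>: "\<And>j. \<phi> j \<in> tests" "\<And>j. nm (\<phi> j - g1 j) < 1 / Suc j"
    "\<And>j. nm (cov1 B (\<phi> j) - g2 j) < 1 / Suc j" "\<And>j. nm (D2 (\<phi> j) - g3 j) < 1 / Suc j"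
    using tests_near_sequence[of f, OF f] unfolding g1_def g2_def g3_def by blast
  note tL = test_L2[OF \<phi>(1)]
  have nn: "0 \<le> nm (g1 j)" "0 \<le> nm (g2 j)" "0 \<le> nm (g3 j)" for j by (intro L2.nm_nonneg L)+
  have g1C: "nm (g1 j) \<le> C" for j using C(1)[of j] by (simp add: m_nm g1_def)
  have "0 \<le> C" using g1C[of 0] nn(1)[of 0] by linarith
  define E where "E = C + B * C"
  have g23: "nm (g2 j) + nm (g3 j) \<le> E" for j
  proof -
    have "B * nm (g1 j) \<le> B * C" using g1C B by (intro mult_left_mono)
    then show ?thesis using C(2)[of j] by (simp add: q_nm g1_def g2_def g3_def E_def)
  qed
  have close: "nm h \<le> 2 * nm g + 2" if "nm (h - g) < 1 / Suc j" "h \<in> L2 M" "g \<in> L2 M" for h g and j :: nat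
  proof -
    have "nm h \<le> 2 * nm (h - g) + 2 * nm g" using L2.nm_add_le[of "h - g" M g] that by (simp add: L2.H_diff)
    moreover have "1 / real (Suc j) \<le> 1" by simp
    ultimately show ?thesis using that(1) by linarith
  qed
  have b1: "nm (\<phi> j) \<le> 2 * C + 2" for j using close[OF \<phi>(2) tL(1) L(1), of j] g1C[of j] by linarith
  have b2: "nm (cov1 B (\<phi> j)) \<le> 2 * E + 2" for j
    using close[OF \<phi>(3) tL(2) L(2), of j] g23[of j] nn(3)[of j] by linarith
  have b3: "nm (D2 (\<phi> j)) \<le> 2 * E + 2" for j
    using close[OF \<phi>(4) tL(4) L(3), of j] g23[of j] nn(2)[of j] by linarith
  \<comment> \<open>The ordinary derivative is \<open>cov1\<close> minus the potential term, and the
    second coordinate is at most \<open>q\<close> in absolute value.\<close>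
  have b4: "nm (D1 (\<phi> j)) \<le> 2 * (2 * E + 2) + 2 * (B\<^sup>2 * q\<^sup>2 * (2 * C + 2))" for j
  proof -
    note s = test_smooth[OF \<phi>(1), of j]
    define h where "h = (\<lambda>x. \<i> * complex_of_real (B * snd x) * \<phi> j x)"
    have hs: "smooth h" unfolding h_def by (intro smooth_mult smooth_const smooth_snd_linear s)
    have "D1 (\<phi> j) = cov1 B (\<phi> j) - h" by (auto simp: cov1_def h_def)
    then have "nm (D1 (\<phi> j)) \<le> 2 * nm (cov1 B (\<phi> j)) + 2 * nm h"
      using L2.nm_add_le[of "cov1 B (\<phi> j) - h" M h] L2.parallelogram[of "cov1 B (\<phi> j)" M h]
        L2.nm_nonneg[of "cov1 B (\<phi> j) + h" M] tL(2)[of j] cont_L2[OF smooth_cont[OF hs]] by (simp add: L2.H_add)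
    moreover have "nm h \<le> B\<^sup>2 * q\<^sup>2 * nm (\<phi> j)"
    proof -
      have "nm h = integral (crect p q) (\<lambda>x. (cmod (h x))\<^sup>2)" by (rule nm_cont[OF smooth_cont[OF hs]])
      also have "\<dots> \<le> integral (crect p q) (\<lambda>x. B\<^sup>2 * q\<^sup>2 * (cmod (\<phi> j x))\<^sup>2)"
      proof (intro integral_le cont_integrable continuous_intros smooth_cont hs s)
        fix x assume "x \<in> crect p q"
        then have "\<bar>snd x\<bar> \<le> q" by (cases x) auto
        then have "(snd x)\<^sup>2 \<le> q\<^sup>2" using q by (simp add: abs_le_square_iff[symmetric])
        then have "B\<^sup>2 * (snd x)\<^sup>2 * (cmod (\<phi> j x))\<^sup>2 \<le> B\<^sup>2 * q\<^sup>2 * (cmod (\<phi> j x))\<^sup>2"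
          by (intro mult_right_mono mult_left_mono) auto
        then show "(cmod (h x))\<^sup>2 \<le> B\<^sup>2 * q\<^sup>2 * (cmod (\<phi> j x))\<^sup>2"
          by (simp add: h_def norm_mult power_mult_distrib)
      qed
      also have "\<dots> = B\<^sup>2 * q\<^sup>2 * nm (\<phi> j)" by (simp add: nm_cont[OF smooth_cont[OF s]])
      finally show ?thesis .
    qed
    then have "nm h \<le> B\<^sup>2 * q\<^sup>2 * (2 * C + 2)"
      by (rule order_trans) (intro mult_left_mono b1, simp)
    ultimately show ?thesis using b2[of j] by (meson add_mono mult_left_mono order_trans zero_le_numeral)
  qed
  define D where "D = Max {2 * C + 2, 2 * E + 2, 2 * (2 * E + 2) + 2 * (B\<^sup>2 * q\<^sup>2 * (2 * C + 2))}"
  have D: "2 * C + 2 \<le> D" "2 * E + 2 \<le> D" "2 * (2 * E + 2) + 2 * (B\<^sup>2 * q\<^sup>2 * (2 * C + 2)) \<le> D"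
    unfolding D_def by (auto intro!: Max_ge)
  have sm: "smooth (\<phi> j)" for j by (rule test_smooth[OF \<phi>(1)])
  have "\<exists>r::nat \<Rightarrow> nat. strict_mono r \<and>
    (\<forall>e>0. \<exists>N. \<forall>i\<ge>N. \<forall>j\<ge>N. integral (crect p q) (\<lambda>z. (cmod (\<phi> (r i) z - \<phi> (r j) z))\<^sup>2) < e)"
  proof (rule rellich[OF p q sm, where C = D])
    show "integral (crect p q) (\<lambda>z. (cmod (\<phi> n z))\<^sup>2) \<le> D" for n
      using b1[of n] D(1) by (simp add: nm_cont[OF smooth_cont[OF sm], symmetric])
    show "integral (crect p q) (\<lambda>z. (cmod (D1 (\<phi> n) z))\<^sup>2) \<le> D" for n
      using b4[of n] D(3) by (simp add: nm_cont[OF smooth_D1_cont[OF sm], symmetric])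
    show "integral (crect p q) (\<lambda>z. (cmod (D2 (\<phi> n) z))\<^sup>2) \<le> D" for n
      using b3[of n] D(2) by (simp add: nm_cont[OF smooth_D2_cont[OF sm], symmetric])
  qed
  moreover have "integral (crect p q) (\<lambda>z. (cmod (\<phi> i z - \<phi> j z))\<^sup>2) = nm (\<phi> i - \<phi> j)" for i j
    using nm_cont[OF smooth_cont[OF smooth_diff[OF sm sm]], of i j] by (simp add: L2_nm)
  ultimately obtain r :: "nat \<Rightarrow> nat" where r: "strict_mono r"
      "\<forall>e>0. \<exists>N. \<forall>i\<ge>N. \<forall>j\<ge>N. nm (\<phi> (r i) - \<phi> (r j)) < e" by auto
  have near: "nm (g1 (r j) - \<phi> (r j)) < 1 / Suc j" for j
  proof -
    have "j \<le> r j" using r(1) by (rule strict_mono_imp_increasing)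
    then have "1 / real (Suc (r j)) \<le> 1 / real (Suc j)" by (intro divide_left_mono) auto
    then show ?thesis using \<phi>(2)[of "r j"] L2.nm_minus_commute[OF L(1) tL(1), of "r j" "r j"] by linarith
  qed
  have "\<exists>N. \<forall>i\<ge>N. \<forall>j\<ge>N. nm (g1 (r i) - g1 (r j)) < e" if "e > 0" for e
    using near_cauchy[OF tL(1) L(1) near, of e] r(2) that by blast
  then show ?thesis using r(1) by (auto simp: m_nm g1_def)
qed

sublocale compact_form_pair tscale H mf qf
  by unfold_locales (rule H_complete H_compact; assumption)+


section \<open>Eigenvectors of the form versus eigenfunctions of the weakly defined operator\<close>

subsection \<open>Eigenfunctions\<close>

abbreviation \<Omega> :: "(real \<times> real) set" where "\<Omega> \<equiv> rect p q"

lemma ip_cnj: "ip f (\<lambda>x. cnj (g x)) = (LINT x|M. f x * g x)"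
  by (simp add: L2_ip_def)

lemma cont_bounded_rect:
  assumes "continuous_on UNIV h"
  shows "\<exists>C. \<forall>x\<in>\<Omega>. cmod (h x) \<le> C"
proof -
  have "compact (h ` crect p q)"
    by (intro compact_continuous_image continuous_on_subset[OF assms] compact_cbox) simp
  then have "bounded (h ` crect p q)" by (rule compact_imp_bounded)
  then obtain C where C: "\<forall>y\<in>h ` crect p q. cmod y \<le> C" unfolding bounded_iff by blast
  have "\<Omega> \<subseteq> crect p q" unfolding rect_eq_box by (rule box_subset_cbox)
  then show ?thesis using C by blast
qed

lemma L2_smooth_mult:
  assumes "smooth h" "f \<in> L2 M"
  shows "(\<lambda>x. h x * f x) \<in> L2 M"
proof -
  obtain C where C: "\<forall>x\<in>\<Omega>. cmod (h x) \<le> C" using cont_bounded_rect[OF smooth_cont[OF assms(1)]] by blast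
  show ?thesis
    using assms(2) L2_measurable[OF cont_L2[OF smooth_cont[OF assms(1)]]] C
    by (intro L2_bounded_mult[where C = C]) (auto simp: space_restrict_space)
qed

abbreviation By :: "real \<times> real \<Rightarrow> complex" where "By x \<equiv> \<i> * of_real (B * snd x)"

lemma smooth_By: "smooth By"
  by (intro smooth_mult smooth_const smooth_snd_linear)

lemma L2_pair:
  "sq_integrable \<Omega> (\<lambda>x. (f x, g x)) \<longleftrightarrow> f \<in> L2 M \<and> g \<in> L2 M"
proof
  assume a: "sq_integrable \<Omega> (\<lambda>x. (f x, g x))"
  then have m: "(\<lambda>x. (f x, g x)) \<in> borel_measurable M"
    and i: "integrable M (\<lambda>x. (norm (f x, g x))\<^sup>2)" by (auto simp: sq_integrable_def)
  have "(\<lambda>x. fst (f x, g x)) \<in> borel_measurable M" "(\<lambda>x. snd (f x, g x)) \<in> borel_measurable M"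
    by (intro borel_measurable_continuous_on[OF _ m] continuous_intros)+
  then show "f \<in> L2 M \<and> g \<in> L2 M"
    using i by (auto intro!: L2_bound[where g = "\<lambda>x. (norm (f x, g x))\<^sup>2"] simp: norm_Pair)
next
  assume "f \<in> L2 M \<and> g \<in> L2 M"
  then show "sq_integrable \<Omega> (\<lambda>x. (f x, g x))"
    by (auto simp: sq_integrable_def norm_Pair L2_def intro!: borel_measurable_Pair)
qed

lemma sq_integrable_L2: "sq_integrable \<Omega> u \<longleftrightarrow> u \<in> L2 M"
  by (simp add: sq_integrable_def L2_def)

lemma weak_grad_iff:
  "has_weak_grad \<Omega> u (\<lambda>x. (g1 x, g2 x)) \<longleftrightarrow> u \<in> L2 M \<and> g1 \<in> L2 M \<and> g2 \<in> L2 M \<and>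
    (\<forall>\<phi>\<in>tests. (LINT x|M. u x * D1 \<phi> x) = - (LINT x|M. g1 x * \<phi> x) \<and>
       (LINT x|M. u x * D2 \<phi> x) = - (LINT x|M. g2 x * \<phi> x))"
  unfolding has_weak_grad_def grad_def by (auto simp: L2_pair sq_integrable_L2)

lemma tendsto_0_le_nm:
  assumes "\<And>k. f k \<in> L2 M" "\<And>k. nm (f k) \<le> b k" "b \<longlonglongrightarrow> 0"
  shows "(\<lambda>k. nm (f k)) \<longlonglongrightarrow> 0"
proof (rule tendsto_sandwich[OF _ _ tendsto_const assms(3)])
  show "\<forall>\<^sub>F k in sequentially. 0 \<le> nm (f k)" by (intro always_eventually allI L2.nm_nonneg assms(1))
  show "\<forall>\<^sub>F k in sequentially. nm (f k) \<le> b k" by (intro always_eventually allI assms(2))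
qed

lemma nm_mult_le:
  assumes h: "smooth h" and C: "\<forall>x\<in>\<Omega>. cmod (h x) \<le> C" and f: "f \<in> L2 M"
  shows "nm (\<lambda>x. h x * f x) \<le> C\<^sup>2 * nm f"
proof -
  have "nm (\<lambda>x. h x * f x) \<le> (LINT x|M. C\<^sup>2 * (cmod (f x))\<^sup>2)"
    unfolding L2_nm
  proof (rule integral_mono)
    show "integrable M (\<lambda>x. (cmod (h x * f x))\<^sup>2)" using L2_smooth_mult[OF h f] by (simp add: L2_def)
    show "integrable M (\<lambda>x. C\<^sup>2 * (cmod (f x))\<^sup>2)" using f by (simp add: L2_def)
    fix x assume "x \<in> space M"
    then have "x \<in> \<Omega>" by (simp add: space_restrict_space)
    then have "cmod (h x) \<le> C" using C by blast
    then show "(cmod (h x * f x))\<^sup>2 \<le> C\<^sup>2 * (cmod (f x))\<^sup>2"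
      by (auto simp: norm_mult power_mult_distrib intro!: mult_right_mono power_mono)
  qed
  then show ?thesis by (simp add: L2_nm)
qed

text \<open>Convergence of covariant derivatives is convergence of ordinary ones, since
  multiplication by the bounded potential is continuous in L^2. This connects \<open>H\<close> with
  the space \<open>H10\<close>, which is defined by ordinary gradients.\<close>

lemma approximates_D1:
  assumes T: "T \<in> H" "approximates \<phi> T"
  shows "(\<lambda>k. nm (D1 (\<phi> k) - (\<lambda>x. fst (snd T) x - By x * fst T x))) \<longlonglongrightarrow> 0"
proof -
  note L = H_L2[OF T(1)]
  have t: "\<phi> k \<in> tests" for k using T(2) by (auto simp: approximates_def)
  note tL = test_L2[OF t]
  obtain C where C: "\<forall>x\<in>\<Omega>. cmod (By x) \<le> C" using cont_bounded_rect[OF smooth_cont[OF smooth_By]] by blast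
  have Bu: "(\<lambda>x. By x * (\<phi> k - fst T) x) \<in> L2 M" for k
    by (intro L2_smooth_mult smooth_By L2.H_diff tL L)
  have bound: "nm (\<lambda>x. By x * (\<phi> k - fst T) x) \<le> C\<^sup>2 * nm (\<phi> k - fst T)" for k
    by (rule nm_mult_le[OF smooth_By C]) (intro L2.H_diff tL L)
  have "(\<lambda>k. C\<^sup>2 * nm (\<phi> k - fst T)) \<longlonglongrightarrow> C\<^sup>2 * 0"
    using T(2) by (intro tendsto_mult_left) (simp add: approximates_def)
  then have "(\<lambda>k. C\<^sup>2 * nm (\<phi> k - fst T)) \<longlonglongrightarrow> 0" by simp
  from tendsto_0_le_nm[OF Bu bound this]
  have lim: "(\<lambda>k. nm (\<lambda>x. By x * (\<phi> k - fst T) x)) \<longlonglongrightarrow> 0" .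
  have T_lim: "(\<lambda>k. nm (cov1 B (\<phi> k) - fst (snd T))) \<longlonglongrightarrow> 0" using T(2) by (simp add: approximates_def)
  have "(\<lambda>k. nm ((cov1 B (\<phi> k) - fst (snd T)) + fscale (-1) (\<lambda>x. By x * (\<phi> k - fst T) x))) \<longlonglongrightarrow> 0"
  proof (rule tendsto_nm_add)
    show "cov1 B (\<phi> k) - fst (snd T) \<in> L2 M" for k by (intro L2.H_diff tL L)
    show "fscale (-1) (\<lambda>x. By x * (\<phi> k - fst T) x) \<in> L2 M" for k by (rule L2.H_scale[OF Bu])
    show "(\<lambda>k. nm (fscale (-1) (\<lambda>x. By x * (\<phi> k - fst T) x))) \<longlonglongrightarrow> 0" by (rule tendsto_nm_scale[OF Bu lim])
  qed (rule T_lim)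
  moreover have "(cov1 B (\<phi> k) - fst (snd T)) + fscale (-1) (\<lambda>x. By x * (\<phi> k - fst T) x) =
      D1 (\<phi> k) - (\<lambda>x. fst (snd T) x - By x * fst T x)" for k
    by (auto simp: fun_eq_iff cov1_def fscale_def algebra_simps)
  ultimately show ?thesis by simp
qed

lemma H_weak_grad:
  assumes T: "T \<in> H"
  shows "has_weak_grad \<Omega> (fst T) (\<lambda>x. (fst (snd T) x - By x * fst T x, snd (snd T) x))"
proof -
  obtain \<phi> where \<phi>: "approximates \<phi> T" using T by (auto simp: H_def)
  have t: "\<phi> k \<in> tests" for k using \<phi> by (auto simp: approximates_def)
  note L = H_L2[OF T] and tL = test_L2[OF t]
  define g1 where "g1 = (\<lambda>x. fst (snd T) x - By x * fst T x)"
  have g1: "g1 \<in> L2 M" unfolding g1_def by (intro L2_diff L2_smooth_mult smooth_By L)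
  have lim: "(\<lambda>k. nm (\<phi> k - fst T)) \<longlonglongrightarrow> 0" "(\<lambda>k. nm (D1 (\<phi> k) - g1)) \<longlonglongrightarrow> 0" "(\<lambda>k. nm (D2 (\<phi> k) - snd (snd T))) \<longlonglongrightarrow> 0"
    using \<phi> approximates_D1[OF T \<phi>] by (auto simp: approximates_def g1_def)
  have conv: "(\<lambda>k. LINT x|M. f k x * h x) \<longlonglongrightarrow> (LINT x|M. g x * h x)"
    if "\<And>k. f k \<in> L2 M" "g \<in> L2 M" "h \<in> L2 M" "(\<lambda>k::nat. nm (f k - g)) \<longlonglongrightarrow> 0" for f g h
    using L2.tendsto_left[OF that(1,2) L2_cnj[OF that(3)] that(4)] by (simp add: ip_cnj)
  have parts: "(LINT x|M. \<phi> k x * D1 \<psi> x) = - (LINT x|M. D1 (\<phi> k) x * \<psi> x)"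
    "(LINT x|M. \<phi> k x * D2 \<psi> x) = - (LINT x|M. D2 (\<phi> k) x * \<psi> x)" if \<psi>: "\<psi> \<in> tests" for \<psi> k
  proof -
    note s = test_smooth[OF t, of k] test_smooth[OF \<psi>]
    have c: "continuous_on UNIV (\<lambda>x. \<phi> k x * D1 \<psi> x)" "continuous_on UNIV (\<lambda>x. D1 (\<phi> k) x * \<psi> x)"
      "continuous_on UNIV (\<lambda>x. \<phi> k x * D2 \<psi> x)" "continuous_on UNIV (\<lambda>x. D2 (\<phi> k) x * \<psi> x)"
      by (intro continuous_on_mult smooth_cont s smooth_D1_cont smooth_D2_cont)+
    show "(LINT x|M. \<phi> k x * D1 \<psi> x) = - (LINT x|M. D1 (\<phi> k) x * \<psi> x)"
      unfolding LINT_rect(2)[OF c(1)] LINT_rect(2)[OF c(2)] by (rule parts_D1[OF \<psi> s(1) p])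
    show "(LINT x|M. \<phi> k x * D2 \<psi> x) = - (LINT x|M. D2 (\<phi> k) x * \<psi> x)"
      unfolding LINT_rect(2)[OF c(3)] LINT_rect(2)[OF c(4)] by (rule parts_D2[OF \<psi> s(1) q])
  qed
  have "(LINT x|M. fst T x * D1 \<psi> x) = - (LINT x|M. g1 x * \<psi> x) \<and>
      (LINT x|M. fst T x * D2 \<psi> x) = - (LINT x|M. snd (snd T) x * \<psi> x)" if \<psi>: "\<psi> \<in> tests" for \<psi>
  proof
    note pL = test_L2[OF \<psi>]
    show "(LINT x|M. fst T x * D1 \<psi> x) = - (LINT x|M. g1 x * \<psi> x)"
      by (rule LIMSEQ_unique[OF conv[OF tL(1) L(1) pL(3) lim(1)]])
        (unfold parts(1)[OF \<psi>], intro tendsto_minus conv tL g1 pL lim)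
    show "(LINT x|M. fst T x * D2 \<psi> x) = - (LINT x|M. snd (snd T) x * \<psi> x)"
      by (rule LIMSEQ_unique[OF conv[OF tL(1) L(1) pL(4) lim(1)]])
        (unfold parts(2)[OF \<psi>], intro tendsto_minus conv tL L pL lim)
  qed
  then show ?thesis unfolding weak_grad_iff using L g1 by (auto simp: g1_def)
qed

lemma H_H10:
  assumes T: "T \<in> H"
  shows "fst T \<in> H10 \<Omega>"
proof -
  obtain \<phi> where \<phi>: "approximates \<phi> T" using T by (auto simp: H_def)
  have t: "\<phi> k \<in> tests" for k using \<phi> by (auto simp: approximates_def)
  note L = H_L2[OF T] and tL = test_L2[OF t]
  define g1 where "g1 = (\<lambda>x. fst (snd T) x - By x * fst T x)"
  have g1: "g1 \<in> L2 M" unfolding g1_def by (intro L2_diff L2_smooth_mult smooth_By L)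
  have lim: "(\<lambda>k. nm (\<phi> k - fst T)) \<longlonglongrightarrow> 0" "(\<lambda>k. nm (D1 (\<phi> k) - g1)) \<longlonglongrightarrow> 0" "(\<lambda>k. nm (D2 (\<phi> k) - snd (snd T))) \<longlonglongrightarrow> 0"
    using \<phi> approximates_D1[OF T \<phi>] by (auto simp: approximates_def g1_def)
  have "(LINT x|M. (norm (grad (\<phi> k) x - (g1 x, snd (snd T) x)))\<^sup>2) = nm (D1 (\<phi> k) - g1) + nm (D2 (\<phi> k) - snd (snd T))" for k
  proof -
    have "D1 (\<phi> k) - g1 \<in> L2 M" "D2 (\<phi> k) - snd (snd T) \<in> L2 M" by (intro L2.H_diff tL g1 L)+
    then show ?thesis by (simp add: L2_nm grad_def norm_Pair L2_def)
  qed
  then have "(\<lambda>k. LINT x|M. (norm (grad (\<phi> k) x - (g1 x, snd (snd T) x)))\<^sup>2) \<longlonglongrightarrow> 0"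
    using tendsto_add[OF lim(2,3)] by simp
  moreover have "(\<lambda>k. LINT x|M. (norm (\<phi> k x - fst T x))\<^sup>2) \<longlonglongrightarrow> 0" using lim(1) by (simp add: L2_nm)
  moreover have "has_weak_grad \<Omega> (fst T) (\<lambda>x. (g1 x, snd (snd T) x))"
    using H_weak_grad[OF T] by (simp add: g1_def)
  ultimately show ?thesis unfolding H10_def using t by blast
qed

text \<open>The variational equation against lifted test functions is exactly the weak divergence
  equation for the covariant gradient of u. Membership in the operator domain needs in addition a
  weak divergence of the ordinary gradient, obtained by correcting for the potential.\<close>

lemma eigenvector_in_eigenspace:
  assumes T: "T \<in> H" and eq: "\<And>S. S \<in> H \<Longrightarrow> qf T S = of_real l * mf T S"
  shows "fst T \<in> eigenspace \<Omega> B l"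
proof -
  define u v w where "u = fst T" and "v = fst (snd T)" and "w = snd (snd T)"
  have L: "u \<in> L2 M" "v \<in> L2 M" "w \<in> L2 M" using H_L2[OF T] by (auto simp: u_def v_def w_def)
  define g1 where "g1 = (\<lambda>x. v x - By x * u x)"
  have g1: "g1 \<in> L2 M" unfolding g1_def by (intro L2_diff L2_smooth_mult smooth_By L)
  have wg: "has_weak_grad \<Omega> u (\<lambda>x. (g1 x, w x))" using H_weak_grad[OF T] by (simp add: u_def v_def w_def g1_def)
  \<comment> \<open>Solving -(div V + \<open>By\<close> v) - B u = l u, with V = (v, w) the
    covariant gradient, for the divergence.\<close>
  define d where "d = (\<lambda>x. - (By x * v x) - of_real (l + B) * u x)"
  have d: "d \<in> L2 M"
    using L2_diff[OF L2_scale[OF L2_smooth_mult[OF smooth_By L(2)], of "-1"] L2_scale[OF L(1), of "of_real (l + B)"]]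
    by (simp add: d_def)
  have weak: "(LINT x|M. (v x * D1 \<psi> x + w x * D2 \<psi> x)) = - (LINT x|M. d x * \<psi> x)" if \<psi>: "\<psi> \<in> tests" for \<psi>
  proof -
    \<comment> \<open>The weak divergence is bilinear and the forms are sesquilinear, so the
      variational equation is tested with the conjugate.\<close>
    define \<eta> where "\<eta> = (\<lambda>x. cnj (\<psi> x))"
    have \<eta>: "\<eta> \<in> tests" unfolding \<eta>_def by (rule test_cnj[OF \<psi>])
    note s = test_smooth[OF \<psi>] and pL = test_L2[OF \<psi>]
    have "qf T (lift \<eta>) = of_real l * mf T (lift \<eta>)" by (rule eq[OF lift_H[OF \<eta>]])
    then have 1: "ip v (cov1 B \<eta>) + ip w (D2 \<eta>) = of_real (l + B) * ip u \<eta>"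
      by (simp add: qf_def mf_def lift_def u_def v_def w_def algebra_simps)
    have c1: "cov1 B \<eta> = (\<lambda>x. cnj (D1 \<psi> x - By x * \<psi> x))"
      by (auto simp: cov1_def \<eta>_def fun_eq_iff dir_deriv_cnj[OF s])
    have c2: "D2 \<eta> = (\<lambda>x. cnj (D2 \<psi> x))" by (auto simp: \<eta>_def fun_eq_iff dir_deriv_cnj[OF s])
    have i: "integrable M (\<lambda>x. v x * D1 \<psi> x)" "integrable M (\<lambda>x. w x * D2 \<psi> x)" "integrable M (\<lambda>x. v x * (By x * \<psi> x))"
      "integrable M (\<lambda>x. u x * \<psi> x)"
      by (intro L2_integrable_mult L pL L2_smooth_mult smooth_By)+
    have e1: "ip v (cov1 B \<eta>) = (LINT x|M. v x * D1 \<psi> x) - (LINT x|M. v x * (By x * \<psi> x))"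
      unfolding c1 ip_cnj right_diff_distrib by (rule Bochner_Integration.integral_diff[OF i(1) i(3)])
    have e2: "ip w (D2 \<eta>) = (LINT x|M. w x * D2 \<psi> x)" unfolding c2 ip_cnj ..
    have e3: "ip u \<eta> = (LINT x|M. u x * \<psi> x)" unfolding \<eta>_def ip_cnj ..
    have "(LINT x|M. v x * D1 \<psi> x) - (LINT x|M. v x * (By x * \<psi> x)) + (LINT x|M. w x * D2 \<psi> x) =
        of_real (l + B) * (LINT x|M. u x * \<psi> x)"
      using 1 unfolding e1 e2 e3 .
    moreover have "(LINT x|M. d x * \<psi> x) = - (LINT x|M. v x * (By x * \<psi> x)) - of_real (l + B) * (LINT x|M. u x * \<psi> x)"
    proof -
      have "d x * \<psi> x = - (v x * (By x * \<psi> x)) - of_real (l + B) * (u x * \<psi> x)" for x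
        by (simp add: d_def algebra_simps)
      then have "(LINT x|M. d x * \<psi> x) = (LINT x|M. - (v x * (By x * \<psi> x)) - of_real (l + B) * (u x * \<psi> x))" by simp
      also have "\<dots> = - (LINT x|M. v x * (By x * \<psi> x)) - of_real (l + B) * (LINT x|M. u x * \<psi> x)"
        using i by (subst Bochner_Integration.integral_diff) (auto simp del: of_real_add)
      finally show ?thesis .
    qed
    moreover have "a + c = - d" if "a - x + c = y" "d = - x - y" for a c d x y :: complex
    proof -
      have "a + c = x + y" using that(1) by (simp add: algebra_simps)
      moreover have "- d = x + y" using that(2) by simp
      ultimately show ?thesis by simp
    qed
    ultimately show ?thesis unfolding Bochner_Integration.integral_add[OF i(1,2)] by blast
  qed
  have div_v: "has_weak_div \<Omega> (\<lambda>x. (v x, w x)) d"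
    unfolding has_weak_div_def using weak L d by (simp add: L2_pair sq_integrable_L2 cdot_def grad_def)
  \<comment> \<open>The ordinary and covariant gradients differ by \<open>By\<close> u in the first
    component. As \<open>By\<close> does not depend on the first coordinate, this changes the
    divergence by \<open>By\<close> times the weak derivative \<open>g1\<close>.\<close>
  define d' where "d' = (\<lambda>x. d x - By x * g1 x)"
  have d': "d' \<in> L2 M" unfolding d'_def by (intro L2_diff d L2_smooth_mult smooth_By g1)
  have div_g: "has_weak_div \<Omega> (\<lambda>x. (g1 x, w x)) d'"
    unfolding has_weak_div_def
  proof (intro conjI ballI)
    show "sq_integrable \<Omega> (\<lambda>x. (g1 x, w x))" "sq_integrable \<Omega> d'" using g1 L d' by (simp_all add: L2_pair sq_integrable_L2)
    fix \<psi> assume \<psi>: "\<psi> \<in> tests"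
    note pL = test_L2[OF \<psi>] and s = test_smooth[OF \<psi>]
    have By\<psi>: "(\<lambda>x. By x * \<psi> x) \<in> tests" by (rule test_mult[OF \<psi> smooth_By])
    have "dir_deriv (1, 0) By x = 0" for x
      using dir_deriv_scale[OF smooth_snd_linear, of "(1, 0)" \<i> B x] dir_deriv_snd[of "\<lambda>t. B * t" B x "(1, 0)"]
      by (auto intro!: derivative_eq_intros)
    then have "D1 (\<lambda>x. By x * \<psi> x) x = By x * D1 \<psi> x" for x
      using dir_deriv_mult[OF smooth_By s, of "(1, 0)" x] by (simp only: mult_zero_left add_0_right)
    then have D1By: "D1 (\<lambda>x. By x * \<psi> x) = (\<lambda>x. By x * D1 \<psi> x)" by (rule ext)
    have "\<forall>\<phi>\<in>tests. (LINT x|M. u x * D1 \<phi> x) = - (LINT x|M. g1 x * \<phi> x)"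
      using wg unfolding weak_grad_iff by blast
    from bspec[OF this By\<psi>]
    have 1: "(LINT x|M. u x * (By x * D1 \<psi> x)) = - (LINT x|M. g1 x * (By x * \<psi> x))"
      unfolding D1By .
    have i: "integrable M (\<lambda>x. v x * D1 \<psi> x + w x * D2 \<psi> x)" "integrable M (\<lambda>x. u x * (By x * D1 \<psi> x))"
      "integrable M (\<lambda>x. d x * \<psi> x)" "integrable M (\<lambda>x. g1 x * (By x * \<psi> x))"
      by (intro Bochner_Integration.integrable_add L2_integrable_mult L pL L2_smooth_mult smooth_By g1 d)+
    have "(LINT x|M. cdot (g1 x, w x) (grad \<psi> x)) = (LINT x|M. (v x * D1 \<psi> x + w x * D2 \<psi> x) - u x * (By x * D1 \<psi> x))"
      by (intro Bochner_Integration.integral_cong) (auto simp: cdot_def grad_def g1_def algebra_simps)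
    also have "\<dots> = - (LINT x|M. d x * \<psi> x) + (LINT x|M. g1 x * (By x * \<psi> x))"
      using i weak[OF \<psi>] 1 by (subst Bochner_Integration.integral_diff) auto
    also have "\<dots> = - (LINT x|M. d x * \<psi> x - g1 x * (By x * \<psi> x))"
      using i by (subst Bochner_Integration.integral_diff) auto
    also have "(LINT x|M. d x * \<psi> x - g1 x * (By x * \<psi> x)) = (LINT x|M. d' x * \<psi> x)"
      by (intro Bochner_Integration.integral_cong) (auto simp: d'_def algebra_simps)
    finally show "(LINT x|M. cdot (g1 x, w x) (grad \<psi> x)) = - (LINT x|M. d' x * \<psi> x)" .
  qed
  have dom: "u \<in> magnetic_dom \<Omega>"
    unfolding magnetic_dom_def using H_H10[OF T] wg div_g by (auto simp: u_def)
  have "magnetic_op \<Omega> B u (\<lambda>x. - (d x - \<i> * cdot (vec_pot B x) (v x, w x)) - complex_of_real B * u x)"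
    unfolding magnetic_op_def
  proof (intro conjI exI)
    show "(\<lambda>x. (v x, w x)) = (\<lambda>x. (fst (g1 x, w x) - \<i> * fst (vec_pot B x) * u x, snd (g1 x, w x) - \<i> * snd (vec_pot B x) * u x))"
      by (auto simp: g1_def vec_pot_def algebra_simps)
  qed (fact dom wg div_v refl)+
  moreover have "- (d x - \<i> * cdot (vec_pot B x) (v x, w x)) - complex_of_real B * u x = of_real l * u x" for x
    by (simp add: d_def cdot_def vec_pot_def algebra_simps)
  ultimately show ?thesis unfolding eigenspace_def u_def by auto
qed

text \<open>An eigenfunction lies in the form domain, so its equation may be tested with itself.
  This gives (t + B) times the squared norm of u as squared norm of its covariant gradient, and the
  bound for test functions extends to it by density.\<close>

lemma eigenvalue_lower_bound:
  assumes low: "\<And>\<phi>. \<phi> \<in> tests \<Longrightarrow> \<kappa> * nm \<phi> \<le> energy \<phi>"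
    and u: "u \<in> eigenspace \<Omega> B t" and nz: "\<not> (AE x in M. u x = 0)"
  shows "\<kappa> \<le> t"
proof -
  obtain f where f: "magnetic_op \<Omega> B u f" "AE x in M. f x = complex_of_real t * u x"
    using u unfolding eigenspace_def by blast
  then obtain g v d where op: "u \<in> magnetic_dom \<Omega>" "has_weak_grad \<Omega> u g"
     "v = (\<lambda>x. (fst (g x) - \<i> * fst (vec_pot B x) * u x, snd (g x) - \<i> * snd (vec_pot B x) * u x))"
     "has_weak_div \<Omega> v d" "f = (\<lambda>x. - (d x - \<i> * cdot (vec_pot B x) (v x)) - complex_of_real B * u x)"
    unfolding magnetic_op_def by blast
  define g1 g2 where "g1 = (\<lambda>x. fst (g x))" and "g2 = (\<lambda>x. snd (g x))"
  have g: "g = (\<lambda>x. (g1 x, g2 x))" by (simp add: g1_def g2_def)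
  note wg = op(2)[unfolded g weak_grad_iff]
  define v1 where "v1 = (\<lambda>x. g1 x + By x * u x)"
  have v: "v = (\<lambda>x. (v1 x, g2 x))" by (auto simp: op(3) v1_def g1_def g2_def vec_pot_def)
  obtain h \<phi> where h: "has_weak_grad \<Omega> u h" and \<phi>: "\<And>k::nat. \<phi> k \<in> tests"
    "(\<lambda>k. LINT x|M. (norm (\<phi> k x - u x))\<^sup>2) \<longlonglongrightarrow> 0" "(\<lambda>k. LINT x|M. (norm (grad (\<phi> k) x - h x))\<^sup>2) \<longlonglongrightarrow> 0"
    using op(1) unfolding magnetic_dom_def H10_def by blast
  define h1 h2 where "h1 = (\<lambda>x. fst (h x))" and "h2 = (\<lambda>x. snd (h x))"
  have h_eq: "h = (\<lambda>x. (h1 x, h2 x))" by (simp add: h1_def h2_def)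
  note wh = h[unfolded h_eq weak_grad_iff]
  note tL = test_L2[OF \<phi>(1)]
  \<comment> \<open>Two weak gradients of u are in play: \<open>g\<close> from the operator relation
    and \<open>h\<close> from the approximation in \<open>H10\<close>. The triple placed in
    \<open>H\<close> is built from \<open>h\<close>.\<close>
  define w1 where "w1 = (\<lambda>x. h1 x + By x * u x)"
  have L: "u \<in> L2 M" "g1 \<in> L2 M" "g2 \<in> L2 M" "h1 \<in> L2 M" "h2 \<in> L2 M" using wg wh by auto
  have L': "v1 \<in> L2 M" "w1 \<in> L2 M" unfolding v1_def w1_def by (intro L2_add L2_smooth_mult smooth_By L)+
  have dL: "d \<in> L2 M" using op(4) by (simp add: has_weak_div_def sq_integrable_L2)
  have lim0: "(\<lambda>k. nm (\<phi> k - u)) \<longlonglongrightarrow> 0" using \<phi>(2) by (simp add: L2_nm)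
  have grad_nm: "(LINT x|M. (norm (grad (\<phi> k) x - h x))\<^sup>2) = nm (D1 (\<phi> k) - h1) + nm (D2 (\<phi> k) - h2)" for k
  proof -
    have "D1 (\<phi> k) - h1 \<in> L2 M" "D2 (\<phi> k) - h2 \<in> L2 M" by (intro L2.H_diff tL L)+
    then show ?thesis by (simp add: L2_nm grad_def norm_Pair L2_def h_eq)
  qed
  have nn: "0 \<le> nm (D1 (\<phi> k) - h1)" "0 \<le> nm (D2 (\<phi> k) - h2)" for k by (intro L2.nm_nonneg L2.H_diff tL L)+
  have lim1: "(\<lambda>k. nm (D1 (\<phi> k) - h1)) \<longlonglongrightarrow> 0"
    by (rule tendsto_0_le_nm[OF _ _ \<phi>(3)]) (intro L2.H_diff tL L, use nn in \<open>simp add: grad_nm\<close>)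
  have lim2: "(\<lambda>k. nm (D2 (\<phi> k) - h2)) \<longlonglongrightarrow> 0"
    by (rule tendsto_0_le_nm[OF _ _ \<phi>(3)]) (intro L2.H_diff tL L, use nn in \<open>simp add: grad_nm\<close>)
  have lim1': "(\<lambda>k. nm (cov1 B (\<phi> k) - w1)) \<longlonglongrightarrow> 0"
  proof -
    obtain C where C: "\<forall>x\<in>\<Omega>. cmod (By x) \<le> C" using cont_bounded_rect[OF smooth_cont[OF smooth_By]] by blast
    have nb: "nm (\<lambda>x. By x * (\<phi> k - u) x) \<le> C\<^sup>2 * nm (\<phi> k - u)" for k
      by (rule nm_mult_le[OF smooth_By C]) (intro L2.H_diff tL L)
    have Bu: "(\<lambda>x. By x * (\<phi> k - u) x) \<in> L2 M" for k by (intro L2_smooth_mult smooth_By L2.H_diff tL L)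
    have "(\<lambda>k. C\<^sup>2 * nm (\<phi> k - u)) \<longlonglongrightarrow> C\<^sup>2 * 0" by (intro tendsto_mult_left lim0)
    then have "(\<lambda>k. C\<^sup>2 * nm (\<phi> k - u)) \<longlonglongrightarrow> 0" by simp
    from tendsto_0_le_nm[OF Bu nb this] have "(\<lambda>k. nm (\<lambda>x. By x * (\<phi> k - u) x)) \<longlonglongrightarrow> 0" .
    then have "(\<lambda>k. nm ((D1 (\<phi> k) - h1) + (\<lambda>x. By x * (\<phi> k - u) x))) \<longlonglongrightarrow> 0"
      by (rule tendsto_nm_add[OF L2.H_diff[OF tL(3) L(4)] Bu lim1])
    moreover have "(D1 (\<phi> k) - h1) + (\<lambda>x. By x * (\<phi> k - u) x) = cov1 B (\<phi> k) - w1" for k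
      by (auto simp: fun_eq_iff cov1_def w1_def algebra_simps)
    ultimately show ?thesis by simp
  qed
  define T where "T = (u, w1, h2)"
  have T: "T \<in> H" unfolding H_def approximates_def T_def using L L' \<phi>(1) lim0 lim1' lim2 by auto
  \<comment> \<open>Test the eigenvalue equation with the conjugates of the approximating functions.\<close>
  have d_eq: "AE x in M. d x = - (By x * v1 x) - of_real (t + B) * u x"
    using f(2)
  proof eventually_elim
    case (elim x)
    then have "- d x - By x * v1 x - of_real B * u x = of_real t * u x"
      by (simp add: op(5) v cdot_def vec_pot_def algebra_simps)
    then have "d x = - (By x * v1 x) - (of_real t + of_real B) * u x" by algebra
    then show ?case by simp
  qed
  have test_eq: "ip v1 (cov1 B \<eta>) + ip g2 (D2 \<eta>) = of_real (t + B) * ip u \<eta>" if \<eta>: "\<eta> \<in> tests" for \<eta>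
  proof -
    define \<psi> where "\<psi> = (\<lambda>x. cnj (\<eta> x))"
    have \<psi>: "\<psi> \<in> tests" unfolding \<psi>_def by (rule test_cnj[OF \<eta>])
    note s = test_smooth[OF \<psi>] and pL = test_L2[OF \<psi>]
    have \<eta>_eq: "\<eta> = (\<lambda>x. cnj (\<psi> x))" by (simp add: \<psi>_def)
    have c1: "cov1 B \<eta> = (\<lambda>x. cnj (D1 \<psi> x - By x * \<psi> x))"
      by (auto simp: cov1_def \<eta>_eq fun_eq_iff dir_deriv_cnj[OF s])
    have c2: "D2 \<eta> = (\<lambda>x. cnj (D2 \<psi> x))" by (auto simp: \<eta>_eq fun_eq_iff dir_deriv_cnj[OF s])
    have i: "integrable M (\<lambda>x. v1 x * D1 \<psi> x)" "integrable M (\<lambda>x. g2 x * D2 \<psi> x)" "integrable M (\<lambda>x. v1 x * (By x * \<psi> x))"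
      "integrable M (\<lambda>x. u x * \<psi> x)"
      by (intro L2_integrable_mult L L' pL L2_smooth_mult smooth_By)+
    have e1: "ip v1 (cov1 B \<eta>) = (LINT x|M. v1 x * D1 \<psi> x) - (LINT x|M. v1 x * (By x * \<psi> x))"
      unfolding c1 ip_cnj right_diff_distrib by (rule Bochner_Integration.integral_diff[OF i(1) i(3)])
    have e2: "ip g2 (D2 \<eta>) = (LINT x|M. g2 x * D2 \<psi> x)" unfolding c2 ip_cnj ..
    have e3: "ip u \<eta> = (LINT x|M. u x * \<psi> x)" unfolding \<eta>_eq ip_cnj ..
    have "(LINT x|M. v1 x * D1 \<psi> x) + (LINT x|M. g2 x * D2 \<psi> x) = (LINT x|M. cdot (v x) (grad \<psi> x))"
      unfolding Bochner_Integration.integral_add[OF i(1,2), symmetric] by (simp add: v cdot_def grad_def)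
    also have "\<dots> = - (LINT x|M. d x * \<psi> x)" using op(4) \<psi> by (simp add: has_weak_div_def)
    also have "(LINT x|M. d x * \<psi> x) = (LINT x|M. - (v1 x * (By x * \<psi> x)) - of_real (t + B) * (u x * \<psi> x))"
    proof (rule integral_cong_AE)
      show "AE x in M. d x * \<psi> x = - (v1 x * (By x * \<psi> x)) - of_real (t + B) * (u x * \<psi> x)"
        using d_eq
      proof eventually_elim
        case (elim x)
        show ?case unfolding elim by (simp add: algebra_simps)
      qed
      show "(\<lambda>x. d x * \<psi> x) \<in> borel_measurable M" by (intro borel_measurable_integrable L2_integrable_mult dL pL)
      show "(\<lambda>x. - (v1 x * (By x * \<psi> x)) - of_real (t + B) * (u x * \<psi> x)) \<in> borel_measurable M"
        using i by (intro borel_measurable_diff borel_measurable_uminus borel_measurable_times borel_measurable_const borel_measurable_integrable)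
    qed
    also have "\<dots> = - (LINT x|M. v1 x * (By x * \<psi> x)) - of_real (t + B) * (LINT x|M. u x * \<psi> x)"
      using i by (subst Bochner_Integration.integral_diff) (auto simp del: of_real_add)
    finally show ?thesis unfolding e1 e2 e3 by (simp add: algebra_simps)
  qed
  have lim_ip: "(\<lambda>k. ip a (b k)) \<longlonglongrightarrow> ip a c" if "\<And>k. b k \<in> L2 M" "c \<in> L2 M" "a \<in> L2 M" "(\<lambda>k::nat. nm (b k - c)) \<longlonglongrightarrow> 0" for a b c
  proof -
    have "(\<lambda>k. cnj (ip (b k) a)) \<longlonglongrightarrow> cnj (ip c a)"
      by (intro tendsto_cnj L2.tendsto_left that)
    then show ?thesis using L2.cnj_sym[OF that(1) that(3)] L2.cnj_sym[OF that(2,3)] by simp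
  qed
  have eq1: "ip v1 w1 + ip g2 h2 = of_real (t + B) * ip u u"
  proof (rule LIMSEQ_unique)
    show "(\<lambda>k. ip v1 (cov1 B (\<phi> k)) + ip g2 (D2 (\<phi> k))) \<longlonglongrightarrow> ip v1 w1 + ip g2 h2"
      by (intro tendsto_add lim_ip tL L L' lim1' lim2)
    show "(\<lambda>k. ip v1 (cov1 B (\<phi> k)) + ip g2 (D2 (\<phi> k))) \<longlonglongrightarrow> of_real (t + B) * ip u u"
      unfolding test_eq[OF \<phi>(1)] by (intro tendsto_mult_left lim_ip tL L lim0)
  qed
  \<comment> \<open>The two gradients are shown to agree only against test functions. This suffices,
    as \<open>w1\<close> and \<open>h2\<close> are L^2 limits of test functions.\<close>
  have same: "ip g1 \<eta> = ip h1 \<eta>" "ip g2 \<eta> = ip h2 \<eta>" if \<eta>: "\<eta> \<in> tests" for \<eta>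
  proof -
    have c: "(\<lambda>x. cnj (\<eta> x)) \<in> tests" by (rule test_cnj[OF \<eta>])
    have "(LINT x|M. u x * D1 (\<lambda>x. cnj (\<eta> x)) x) = - (LINT x|M. g1 x * cnj (\<eta> x))"
      "(LINT x|M. u x * D2 (\<lambda>x. cnj (\<eta> x)) x) = - (LINT x|M. g2 x * cnj (\<eta> x))"
      using wg c by blast+
    moreover have "(LINT x|M. u x * D1 (\<lambda>x. cnj (\<eta> x)) x) = - (LINT x|M. h1 x * cnj (\<eta> x))"
      "(LINT x|M. u x * D2 (\<lambda>x. cnj (\<eta> x)) x) = - (LINT x|M. h2 x * cnj (\<eta> x))"
      using wh c by blast+
    ultimately show "ip g1 \<eta> = ip h1 \<eta>" "ip g2 \<eta> = ip h2 \<eta>" unfolding L2_ip_def by simp_all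
  qed
  have eq2: "ip (v1 - w1) w1 = 0"
  proof (rule LIMSEQ_unique)
    show "(\<lambda>k. ip (v1 - w1) (cov1 B (\<phi> k))) \<longlonglongrightarrow> ip (v1 - w1) w1"
      by (intro lim_ip tL L' lim1' L2.H_diff)
    have "ip (v1 - w1) (cov1 B (\<phi> k)) = 0" for k
    proof -
      have e: "v1 - w1 = g1 - h1" by (auto simp: v1_def w1_def fun_eq_iff)
      have "cov1 B (\<phi> k) \<in> tests"
        unfolding cov1_def by (intro test_add test_D1 \<phi> test_mult smooth_By)
      then show ?thesis unfolding e using same tL L by (simp add: L2.diff_left)
    qed
    then show "(\<lambda>k. ip (v1 - w1) (cov1 B (\<phi> k))) \<longlonglongrightarrow> 0" by simp
  qed
  have eq3: "ip (g2 - h2) h2 = 0"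
  proof (rule LIMSEQ_unique)
    show "(\<lambda>k. ip (g2 - h2) (D2 (\<phi> k))) \<longlonglongrightarrow> ip (g2 - h2) h2"
      by (intro lim_ip tL L lim2 L2.H_diff)
    have "ip (g2 - h2) (D2 (\<phi> k)) = 0" for k
      using same(2)[OF test_D2[OF \<phi>(1)]] tL L by (simp add: L2.diff_left)
    then show "(\<lambda>k. ip (g2 - h2) (D2 (\<phi> k))) \<longlonglongrightarrow> 0" by simp
  qed
  have "ip w1 w1 + ip h2 h2 = of_real (t + B) * ip u u"
    using eq1 eq2 eq3 L L' by (simp add: L2.diff_left)
  moreover have "ip f f = of_real (nm f)" for f by (simp add: L2_ip_self L2_nm)
  ultimately have "complex_of_real (nm w1 + nm h2) = of_real ((t + B) * nm u)"
    by (simp only: of_real_add of_real_mult)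
  then have "nm w1 + nm h2 = (t + B) * nm u" by (simp only: of_real_eq_iff)
  moreover have "\<kappa> * nm u \<le> nm w1 + nm h2 - B * nm u" using form_lower_bound[OF low T] by (simp add: T_def)
  ultimately have "\<kappa> * nm u \<le> t * nm u" by (simp add: distrib_right)
  moreover have "nm u > 0"
  proof (rule ccontr)
    assume "\<not> nm u > 0"
    then have "nm u = 0" using L2.nm_nonneg[OF L(1)] by linarith
    then have "(LINT x|M. (cmod (u x))\<^sup>2) = 0" unfolding L2_nm .
    then have "AE x in M. (cmod (u x))\<^sup>2 = 0" using L(1) by (subst (asm) integral_nonneg_eq_0_iff_AE) (auto simp: L2_def)
    then show False using nz by simp
  qed
  ultimately show ?thesis by simp
qed


section \<open>From eigenfunctions to the counting function and the n-th eigenvalue\<close>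

subsection \<open>Counting eigenvalues\<close>

text \<open>A count of at least 1 forces a nonempty independent list in some eigenspace with
  parameter at most t, hence an eigenfunction that is not almost everywhere 0.\<close>

lemma eig_count_lower:
  assumes low: "\<And>\<phi>. \<phi> \<in> tests \<Longrightarrow> \<kappa> * nm \<phi> \<le> energy \<phi>"
    and n: "n \<ge> 1" "enat n \<le> eig_count \<Omega> B t"
  shows "\<kappa> \<le> t"
proof -
  have "0 < enat n" using n(1) by (simp add: zero_enat_def)
  then have "0 < eig_count \<Omega> B t" using n(2) by (rule less_le_trans)
  then obtain S where S: "finite S" "S \<subseteq> {..t}" "0 < (\<Sum>s\<in>S. multiplicity_eig \<Omega> B s)"
    unfolding eig_count_def less_SUP_iff by blast
  have "\<exists>s\<in>S. multiplicity_eig \<Omega> B s \<noteq> 0"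
  proof (rule ccontr)
    assume "\<not> ?thesis"
    then have "(\<Sum>s\<in>S. multiplicity_eig \<Omega> B s) = 0" by (intro sum.neutral) blast
    then show False using S(3) by simp
  qed
  then obtain s where s: "s \<in> S" "multiplicity_eig \<Omega> B s \<noteq> 0" by blast
  then have "0 < multiplicity_eig \<Omega> B s" by (simp add: zero_less_iff_neq_zero)
  then obtain us where us: "set us \<subseteq> eigenspace \<Omega> B s" "lin_indep \<Omega> us" "0 < enat (length us)"
    unfolding multiplicity_eig_def less_SUP_iff by blast
  then have len: "0 < length us" by (simp add: zero_enat_def)
  have "\<not> (AE x in M. (us ! 0) x = 0)"
  proof
    assume ae: "AE x in M. (us ! 0) x = 0"
    define c where "c = (\<lambda>i::nat. if i = 0 then 1 else (0::complex))"
    have "(\<Sum>i<length us. c i * (us ! i) x) = (us ! 0) x" for x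
      using len by (simp add: c_def if_distrib[of "\<lambda>z. z * _"] sum.delta cong: if_cong)
    then have "AE x in M. (\<Sum>i<length us. c i * (us ! i) x) = 0" using ae by simp
    then have "\<forall>i<length us. c i = 0" using us(2) unfolding lin_indep_def by blast
    then have "c 0 = 0" using len by blast
    then show False by (simp add: c_def)
  qed
  moreover have "us ! 0 \<in> eigenspace \<Omega> B s" using us(1) len by auto
  ultimately have "\<kappa> \<le> s" using eigenvalue_lower_bound[OF low] by blast
  then show ?thesis using S(2) s(1) by auto
qed

lemma lin_indep_orthonormal:
  assumes L: "set us \<subseteq> L2 M" and o: "\<And>i j. i < length us \<Longrightarrow> j < length us \<Longrightarrow> ip (us ! i) (us ! j) = (if i = j then 1 else 0)"
  shows "lin_indep \<Omega> us"
  unfolding lin_indep_def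
proof (intro allI impI)
  fix c :: "nat \<Rightarrow> complex" and j
  assume ae: "AE x in M. (\<Sum>i<length us. c i * (us ! i) x) = 0" and j: "j < length us"
  define f where "f = (\<Sum>i<length us. fscale (c i) (us ! i))"
  have usL: "us ! i \<in> L2 M" if "i < length us" for i using L that by auto
  have fL: "f \<in> L2 M" unfolding f_def by (intro L2.H_sum L2.H_scale usL) simp
  have "ip f (us ! j) = (\<Sum>i<length us. c i * ip (us ! i) (us ! j))"
    unfolding f_def using usL j by (intro L2.sum_left) auto
  also have "\<dots> = (\<Sum>i<length us. if i = j then c i else 0)"
    using o j by (intro sum.cong) auto
  also have "\<dots> = c j" using j by simp
  finally have "ip f (us ! j) = c j" .
  moreover have "ip f (us ! j) = 0"
  proof -
    have "AE x in M. f x * cnj ((us ! j) x) = 0"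
      using ae by eventually_elim (simp add: f_def sum_fscale_apply)
    then show ?thesis unfolding L2_ip_def by (rule integral_eq_zero_AE)
  qed
  ultimately show "c j = 0" by simp
qed

text \<open>The test functions are lifted to the form domain, where the min-max principle produces n
  orthonormal eigenvectors with eigenvalues at most \<open>U\<close>. Grouping them by eigenvalue
  shows that the multiplicities add up to at least n.\<close>

lemma eig_count_upper:
  assumes \<psi>: "\<And>j. j < n \<Longrightarrow> \<psi> j \<in> tests"
    and pos: "\<And>c. \<exists>j<n. c j \<noteq> 0 \<Longrightarrow> nm (\<lambda>x. \<Sum>j<n. c j * \<psi> j x) > 0"
    and le: "\<And>c. energy (\<lambda>x. \<Sum>j<n. c j * \<psi> j x) \<le> U * nm (\<lambda>x. \<Sum>j<n. c j * \<psi> j x)"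
  shows "enat n \<le> eig_count \<Omega> B U"
proof -
  define F where "F = (\<lambda>c x. \<Sum>j<n. c j * \<psi> j x)"
  have tests_sum: "(\<lambda>x. \<Sum>j<k. c j * \<psi> j x) \<in> tests \<and> (\<Sum>j<k. tscale (c j) (lift (\<psi> j))) = lift (\<lambda>x. \<Sum>j<k. c j * \<psi> j x)"
    if "k \<le> n" for k and c :: "nat \<Rightarrow> complex"
    using that
  proof (induction k)
    case 0
    have "lift (\<lambda>_. 0) = 0"
      by (auto simp: lift_def cov1_def fun_eq_iff dir_deriv_const zero_prod_def)
    then show ?case by (simp add: test_zero)
  next
    case (Suc k)
    then have IH: "(\<lambda>x. \<Sum>j<k. c j * \<psi> j x) \<in> tests"
      "(\<Sum>j<k. tscale (c j) (lift (\<psi> j))) = lift (\<lambda>x. \<Sum>j<k. c j * \<psi> j x)" and k: "\<psi> k \<in> tests"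
      using \<psi> by auto
    have s: "smooth (\<lambda>x. \<Sum>j<k. c j * \<psi> j x)" "smooth (\<lambda>x. c k * \<psi> k x)" "smooth (\<psi> k)"
      using IH(1) k by (auto intro!: test_smooth test_scale)
    have "lift (\<lambda>x. (\<Sum>j<k. c j * \<psi> j x) + c k * \<psi> k x) = lift (\<lambda>x. \<Sum>j<k. c j * \<psi> j x) + tscale (c k) (lift (\<psi> k))"
      unfolding lift_def tscale_def cov1_add[OF s(1,2)] cov1_scale[OF s(3)]
      by (auto simp: fun_eq_iff fscale_def dir_deriv_add[OF s(1,2)] dir_deriv_scale[OF s(3)])
    then show ?case using IH test_add[OF IH(1) test_scale[OF k, of "c k"]] by simp
  qed
  have sum_lift: "(\<Sum>j<n. tscale (c j) (lift (\<psi> j))) = lift (F c)" and F: "F c \<in> tests" for c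
    using tests_sum[of n c] by (auto simp: F_def)
  have mF: "m.nm (lift (F c)) = nm (F c)" for c by (simp add: m_nm lift_def)
  have qF: "q.nm (lift (F c)) = energy (F c)" for c
    using energy_eq[OF F] by (simp add: q_nm lift_def)
  have "\<exists>u l. \<forall>k<n. u k \<in> H \<and> l k \<le> U \<and> (\<forall>v\<in>H. qf (u k) v = complex_of_real (l k) * mf (u k) v) \<and>
    (\<forall>i<n. mf (u k) (u i) = (if i = k then 1 else 0))"
  proof (rule min_max_upper[of n "\<lambda>j. lift (\<psi> j)"])
    show "lift (\<psi> j) \<in> H" if "j < n" for j by (rule lift_H[OF \<psi>[OF that]])
    show "m.nm (\<Sum>j<n. tscale (c j) (lift (\<psi> j))) > 0" if "\<exists>j<n. c j \<noteq> 0" for c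
      unfolding sum_lift mF unfolding F_def by (rule pos[OF that])
    show "q.nm (\<Sum>j<n. tscale (c j) (lift (\<psi> j))) \<le> U * m.nm (\<Sum>j<n. tscale (c j) (lift (\<psi> j)))" for c
      unfolding sum_lift mF qF unfolding F_def by (rule le)
  qed
  then obtain u l where "\<forall>k<n. u k \<in> H \<and> l k \<le> U \<and> (\<forall>v\<in>H. qf (u k) v = complex_of_real (l k) * mf (u k) v) \<and>
    (\<forall>i<n. mf (u k) (u i) = (if i = k then 1 else 0))" by blast
  then have ul: "\<And>k. k < n \<Longrightarrow> u k \<in> H" "\<And>k. k < n \<Longrightarrow> l k \<le> U"
    "\<And>k v. k < n \<Longrightarrow> v \<in> H \<Longrightarrow> qf (u k) v = complex_of_real (l k) * mf (u k) v"
    "\<And>k i. k < n \<Longrightarrow> i < n \<Longrightarrow> mf (u k) (u i) = (if i = k then 1 else 0)"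
    by blast+
  define S where "S = l ` {..<n}"
  have S: "finite S" "S \<subseteq> {..U}" using ul(2) by (auto simp: S_def)
  \<comment> \<open>Indices sharing the eigenvalue \<open>s\<close>; orthonormality makes the
    corresponding eigenfunctions independent, so the multiplicity of \<open>s\<close> is at least
    the size of \<open>A s\<close>.\<close>
  define A where "A = (\<lambda>s. {k. k < n \<and> l k = s})"
  have mult: "enat (card (A s)) \<le> multiplicity_eig \<Omega> B s" for s
  proof -
    define ks where "ks = sorted_list_of_set (A s)"
    have fin: "finite (A s)" by (simp add: A_def)
    have ks: "set ks = A s" "distinct ks" "length ks = card (A s)" using fin by (auto simp: ks_def)
    define us where "us = map (\<lambda>k. fst (u k)) ks"
    have ksn: "ks ! i < n" "l (ks ! i) = s" if "i < length ks" for i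
      using ks(1) nth_mem[OF that] by (auto simp: A_def)
    have "set us \<subseteq> eigenspace \<Omega> B s"
    proof
      fix f assume "f \<in> set us"
      then obtain k where k: "k \<in> A s" "f = fst (u k)" using ks(1) by (auto simp: us_def)
      then show "f \<in> eigenspace \<Omega> B s"
        using eigenvector_in_eigenspace[OF ul(1), of k "l k"] ul(3)[of k] by (auto simp: A_def)
    qed
    moreover have "lin_indep \<Omega> us"
    proof (rule lin_indep_orthonormal)
      show "set us \<subseteq> L2 M" using ks(1) by (auto simp: us_def A_def intro!: H_L2(1) ul(1))
      fix i j assume ij: "i < length us" "j < length us"
      then have "ip (us ! i) (us ! j) = mf (u (ks ! i)) (u (ks ! j))" by (simp add: us_def mf_def)
      also have "\<dots> = (if ks ! j = ks ! i then 1 else 0)" using ul(4) ksn ij by (simp add: us_def)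
      also have "\<dots> = (if i = j then 1 else 0)" using nth_eq_iff_index_eq[OF ks(2)] ij by (auto simp: us_def)
      finally show "ip (us ! i) (us ! j) = (if i = j then 1 else 0)" .
    qed
    moreover have "length us = card (A s)" using ks(3) by (simp add: us_def)
    ultimately show ?thesis unfolding multiplicity_eig_def
      by (intro SUP_upper2[where i = us]) auto
  qed
  have "n = (\<Sum>s\<in>S. card (A s))"
  proof -
    have "{..<n} = (\<Union>s\<in>S. A s)" by (auto simp: S_def A_def)
    then have "card {..<n} = card (\<Union>s\<in>S. A s)" by simp
    also have "\<dots> = (\<Sum>s\<in>S. card (A s))" using S(1) by (intro card_UN_disjoint) (auto simp: A_def)
    finally show ?thesis by simp
  qed
  moreover have "enat (\<Sum>s\<in>S. card (A s)) = (\<Sum>s\<in>S. enat (card (A s)))"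
    using S(1) by (induction S rule: finite_induct) (auto simp: zero_enat_def plus_enat_simps(1)[symmetric] simp del: plus_enat_simps)
  ultimately have "enat n = (\<Sum>s\<in>S. enat (card (A s)))" by metis
  also have "\<dots> \<le> (\<Sum>s\<in>S. multiplicity_eig \<Omega> B s)" by (intro sum_mono mult)
  also have "\<dots> \<le> eig_count \<Omega> B U" unfolding eig_count_def by (rule SUP_upper) (use S in auto)
  finally show ?thesis .
qed

text \<open>A reached count makes the set under \<open>Inf\<close> nonempty; without this the
  infimum of reals carries no information.\<close>

lemma eig_ge:
  assumes low: "\<And>\<phi>. \<phi> \<in> tests \<Longrightarrow> \<kappa> * nm \<phi> \<le> energy \<phi>"
    and n: "n \<ge> 1" "enat n \<le> eig_count \<Omega> B U"
  shows "\<kappa> \<le> eig n \<Omega> B"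
  unfolding eig_def using eig_count_lower[OF low n(1)] n(2) by (intro cInf_greatest) auto

lemma eig_le:
  assumes low: "\<And>\<phi>. \<phi> \<in> tests \<Longrightarrow> \<kappa> * nm \<phi> \<le> energy \<phi>"
    and n: "n \<ge> 1" "enat n \<le> eig_count \<Omega> B U"
  shows "eig n \<Omega> B \<le> U"
  unfolding eig_def
proof (rule cInf_lower)
  show "bdd_below {t. enat n \<le> eig_count \<Omega> B t}"
    unfolding bdd_below_def using eig_count_lower[OF low n(1)] by blast
qed (use n(2) in simp)

end

section \<open>Uniform convergence of the sine series of s (pi - s)\<close>

subsection \<open>The Fourier series of a parabola\<close>

lemma dirichlet_kernel_odd: "2 * sin s * (\<Sum>j<N. cos ((2 * real j + 1) * s)) = sin (2 * real N * s)"
proof (induction N)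
  case (Suc N)
  have "2 * sin s * cos ((2 * real N + 1) * s) = sin (2 * real (Suc N) * s) - sin (2 * real N * s)"
  proof -
    have a: "2 * real (Suc N) * s = (2 * real N + 1) * s + s" "2 * real N * s = (2 * real N + 1) * s - s"
      by (simp_all add: algebra_simps)
    show ?thesis unfolding a sin_add sin_diff by simp
  qed
  then show ?case using Suc by (simp add: distrib_left)
qed simp

text \<open>For exponent 1, 2, 3 the sine and cosine sums are partial sums of a square wave, a
  triangle wave and a parabola, each obtained from the previous one by integration up to
  sign.\<close>

definition sine_sum :: "nat \<Rightarrow> nat \<Rightarrow> real \<Rightarrow> real" where
  "sine_sum m N s = (\<Sum>j<N. sin ((2 * real j + 1) * s) / (2 * real j + 1) ^ m)"

definition cosine_sum :: "nat \<Rightarrow> nat \<Rightarrow> real \<Rightarrow> real" where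
  "cosine_sum m N s = (\<Sum>j<N. cos ((2 * real j + 1) * s) / (2 * real j + 1) ^ m)"

lemma odd_power_cancel: "(2 * real j + 1) * a / (2 * real j + 1) ^ Suc m = a / (2 * real j + 1) ^ m"
  unfolding power_Suc by (rule mult_divide_mult_cancel_left) linarith

lemma sine_sum_deriv: "(sine_sum (Suc m) N has_real_derivative cosine_sum m N s) (at s)"
proof -
  have "((\<lambda>s. \<Sum>j<N. sin ((2 * real j + 1) * s) / (2 * real j + 1) ^ Suc m) has_real_derivative
      (\<Sum>j<N. (2 * real j + 1) * cos ((2 * real j + 1) * s) / (2 * real j + 1) ^ Suc m)) (at s)"
    by (intro DERIV_sum DERIV_cdivide) (auto intro!: derivative_eq_intros)
  then show ?thesis unfolding sine_sum_def cosine_sum_def odd_power_cancel .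
qed

lemma cosine_sum_deriv: "(cosine_sum (Suc m) N has_real_derivative - sine_sum m N s) (at s)"
proof -
  have "((\<lambda>s. \<Sum>j<N. cos ((2 * real j + 1) * s) / (2 * real j + 1) ^ Suc m) has_real_derivative
      (\<Sum>j<N. (2 * real j + 1) * (- sin ((2 * real j + 1) * s)) / (2 * real j + 1) ^ Suc m)) (at s)"
    by (intro DERIV_sum DERIV_cdivide) (auto intro!: derivative_eq_intros)
  then show ?thesis unfolding odd_power_cancel sine_sum_def cosine_sum_def by (simp add: sum_negf)
qed

lemma deriv_bound_diff:
  fixes f :: "real \<Rightarrow> real"
  assumes "a \<le> b" "\<And>x. a \<le> x \<Longrightarrow> x \<le> b \<Longrightarrow> (f has_real_derivative f' x) (at x)"
    and "\<And>x. a \<le> x \<Longrightarrow> x \<le> b \<Longrightarrow> \<bar>f' x\<bar> \<le> c"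
  shows "\<bar>f b - f a\<bar> \<le> c * (b - a)"
proof (cases "a = b")
  case False
  then obtain z where z: "a < z" "z < b" "f b - f a = (b - a) * f' z"
    using MVT2[of a b f f'] assms(1,2) by auto
  then show ?thesis using assms(3)[of z] assms(1) by (simp add: abs_mult mult.commute mult_left_mono)
qed simp

lemma sin_odd_half_pi: "sin ((2 * real j + 1) * (pi / 2)) = (-1) ^ j"
proof -
  have "(2 * real j + 1) * (pi / 2) = pi / 2 + real j * pi" by (simp add: algebra_simps)
  then show ?thesis by (simp only: sin_add) (simp add: cos_npi sin_npi)
qed

lemma cos_odd_half_pi: "cos ((2 * real j + 1) * (pi / 2)) = 0"
proof -
  have "(2 * real j + 1) * (pi / 2) = pi / 2 + real j * pi" by (simp add: algebra_simps)
  then show ?thesis by (simp only: cos_add) (simp add: cos_npi sin_npi)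
qed

lemma cosine_sum_half_pi: "cosine_sum m N (pi / 2) = 0"
  by (simp add: cosine_sum_def cos_odd_half_pi del: times_divide_eq_right)

text \<open>At pi/2 the square wave series is the Leibniz series for pi/4.\<close>

lemma sine_sum_half_pi: "(\<lambda>N. sine_sum 1 N (pi / 2)) \<longlonglongrightarrow> pi / 4"
proof -
  have "summable (\<lambda>k. (-1) ^ k * (1 / real (k * 2 + 1) * 1 ^ (k * 2 + 1)) :: real)"
    by (rule summable_arctan_series) simp
  then have "(\<lambda>k. (-1) ^ k * 1 / real (k * 2 + 1)) sums (pi / 4)"
    unfolding pi_series by (intro summable_sums) simp
  then show ?thesis unfolding sums_def sine_sum_def sin_odd_half_pi by (simp add: mult.commute add.commute)
qed

text \<open>
  By Dirichlet's kernel \<open>2 sin s * cosine_sum 0 N s = sin (2 N s)\<close>; adding \<open>cos (2 N s) / (4 N sin s)\<close>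
  to the partial sum of the square wave leaves a function with derivative of order \<open>1/N\<close>.
\<close>

lemma square_wave_error:
  assumes N: "N > 0" and d: "0 < d" and s: "d \<le> s" "s \<le> pi / 2"
  shows "\<bar>sine_sum 1 N s - pi / 4\<bar> \<le> \<bar>sine_sum 1 N (pi / 2) - pi / 4\<bar> + (1 + pi) / (real N * (sin d)\<^sup>2)"
proof -
  define h where "h = (\<lambda>s. sine_sum 1 N s - pi / 4 + cos (2 * real N * s) / (4 * real N * sin s))"
  define h' where "h' = (\<lambda>s. - (cos (2 * real N * s) * cos s) / (4 * real N * (sin s)\<^sup>2))"
  have "d \<le> pi / 2" using s by simp
  then have sd: "0 < sin d" using d by (intro sin_gt_zero) auto
  have sge: "sin d \<le> sin x" "0 < sin x" if "d \<le> x" "x \<le> pi / 2" for x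
  proof -
    show "sin d \<le> sin x" using that d by (intro sin_monotone_2pi_le) auto
    then show "0 < sin x" using sd by linarith
  qed
  have cs0: "cosine_sum 0 N x = sin (2 * real N * x) / (2 * sin x)" if "0 < sin x" for x
    using dirichlet_kernel_odd[of x N] that by (simp add: cosine_sum_def field_simps)
  have deriv: "(h has_real_derivative h' x) (at x)" if x: "d \<le> x" "x \<le> pi / 2" for x
  proof -
    note sx = sge(2)[OF x]
    have "(h has_real_derivative cosine_sum 0 N x - 0 + (- sin (2 * real N * x) * (2 * real N) * (4 * real N * sin x) -
        cos (2 * real N * x) * (4 * real N * cos x)) / (4 * real N * sin x)\<^sup>2) (at x)"
      unfolding h_def using sx N sine_sum_deriv[of 0 N x]
      by (auto intro!: derivative_eq_intros simp: power2_eq_square)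
    moreover have "cosine_sum 0 N x - 0 + (- sin (2 * real N * x) * (2 * real N) * (4 * real N * sin x) -
        cos (2 * real N * x) * (4 * real N * cos x)) / (4 * real N * sin x)\<^sup>2 = h' x"
      unfolding cs0[OF sx] h'_def using sx N by (simp add: field_simps power2_eq_square)
    ultimately show ?thesis by simp
  qed
  have bound: "\<bar>h' x\<bar> \<le> 1 / (real N * (sin d)\<^sup>2)" if x: "d \<le> x" "x \<le> pi / 2" for x
  proof -
    have "\<bar>cos (2 * real N * x) * cos x\<bar> \<le> 1 * 1" unfolding abs_mult by (intro mult_mono) auto
    then have "\<bar>h' x\<bar> \<le> 1 / (4 * real N * (sin x)\<^sup>2)"
      using N sge(2)[OF x] by (simp add: h'_def abs_mult divide_right_mono)
    also have "\<dots> \<le> 1 / (real N * (sin d)\<^sup>2)"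
    proof (rule divide_left_mono)
      have "(sin d)\<^sup>2 \<le> (sin x)\<^sup>2" using sge[OF x] sd by (intro power_mono) auto
      then have "real N * (sin d)\<^sup>2 \<le> 4 * (real N * (sin x)\<^sup>2)"
        using N by (smt (verit) mult_left_mono of_nat_0_le_iff zero_le_mult_iff zero_le_power2)
      then show "real N * (sin d)\<^sup>2 \<le> 4 * real N * (sin x)\<^sup>2" by simp
    qed (use N sd sge(2)[OF x] in auto)
    finally show ?thesis .
  qed
  have "\<bar>h (pi / 2) - h s\<bar> \<le> 1 / (real N * (sin d)\<^sup>2) * (pi / 2 - s)"
    using s by (intro deriv_bound_diff[where f' = h'] deriv bound) auto
  also have "\<dots> \<le> 1 / (real N * (sin d)\<^sup>2) * (pi / 2)"
    using d s N sd by (intro mult_left_mono) auto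
  finally have 1: "\<bar>h (pi / 2) - h s\<bar> \<le> (pi / 2) / (real N * (sin d)\<^sup>2)" by simp
  have small: "\<bar>cos (2 * real N * x) / (4 * real N * sin x)\<bar> \<le> (1 / 4) / (real N * (sin d)\<^sup>2)" if x: "d \<le> x" "x \<le> pi / 2" for x
  proof -
    have "\<bar>cos (2 * real N * x) / (4 * real N * sin x)\<bar> \<le> 1 / (4 * real N * sin x)"
      using N sge(2)[OF x] by (simp add: abs_mult divide_right_mono)
    also have "\<dots> \<le> 1 / (4 * real N * (sin d)\<^sup>2)"
    proof (rule divide_left_mono)
      have "(sin d)\<^sup>2 \<le> sin d" using sd by (simp add: power2_eq_square mult_left_le_one_le)
      then show "4 * real N * (sin d)\<^sup>2 \<le> 4 * real N * sin x" using sge(1)[OF x] N by (intro mult_left_mono) auto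
    qed (use N sd sge(2)[OF x] in auto)
    finally show ?thesis by simp
  qed
  have "\<bar>sine_sum 1 N s - pi / 4\<bar> \<le> \<bar>sine_sum 1 N (pi / 2) - pi / 4\<bar> + \<bar>h (pi / 2) - h s\<bar> +
      \<bar>cos (2 * real N * s) / (4 * real N * sin s)\<bar> + \<bar>cos (2 * real N * (pi / 2)) / (4 * real N * sin (pi / 2))\<bar>"
    unfolding h_def by linarith
  also have "\<dots> \<le> \<bar>sine_sum 1 N (pi / 2) - pi / 4\<bar> + (pi / 2) / (real N * (sin d)\<^sup>2) +
      (1 / 4) / (real N * (sin d)\<^sup>2) + (1 / 4) / (real N * (sin d)\<^sup>2)"
    using s \<open>d \<le> pi / 2\<close> by (intro add_mono 1 small order_refl) auto
  also have "\<dots> = \<bar>sine_sum 1 N (pi / 2) - pi / 4\<bar> + (pi / 2 + 1 / 4 + 1 / 4) / (real N * (sin d)\<^sup>2)"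
    by (simp add: add_divide_distrib)
  also have "\<dots> \<le> \<bar>sine_sum 1 N (pi / 2) - pi / 4\<bar> + (1 + pi) / (real N * (sin d)\<^sup>2)"
    using N sd pi_ge_two by (intro add_left_mono divide_right_mono) auto
  finally show ?thesis .
qed

lemma inverse_odd_squares_le: "(\<Sum>j<N. 1 / (2 * real j + 1)\<^sup>2) \<le> 2"
proof -
  have "(\<Sum>j<Suc n. 1 / (2 * real j + 1)\<^sup>2) \<le> 2 - 1 / real (Suc n)" for n
  proof (induction n)
    case (Suc n)
    have "1 / (2 * real (Suc n) + 1)\<^sup>2 \<le> 1 / (real (Suc n) * real (Suc (Suc n)))"
    proof (intro frac_le)
      have "0 \<le> real n * real n" by simp
      then show "real (Suc n) * real (Suc (Suc n)) \<le> (2 * real (Suc n) + 1)\<^sup>2"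
        by (simp add: power2_eq_square algebra_simps)
    qed auto
    also have "\<dots> = 1 / real (Suc n) - 1 / real (Suc (Suc n))" by (simp add: field_simps)
    finally show ?case using Suc by simp
  qed simp
  from this[of "N - 1"] show ?thesis by (cases N) (auto intro: order_trans)
qed

text \<open>The square wave error is integrated twice. Away from the endpoints it is uniformly
  small; near 0 a crude bound on a short interval suffices, and the other half follows from the
  symmetry s -> pi - s.\<close>

lemma parabola_series_uniform:
  assumes e: "e > 0"
  shows "\<exists>N0. \<forall>N\<ge>N0. \<forall>s\<in>{0..pi}. \<bar>sine_sum 3 N s - pi / 8 * s * (pi - s)\<bar> \<le> e"
proof -
  \<comment> \<open>On [0, d] the error \<open>C\<close> is only known to be at most 8 in absolute
    value, which contributes 8 d <= e/2.\<close>
  define d where "d = min (e / 16) (pi / 2)"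
  have d: "0 < d" "d \<le> pi / 2" "8 * d \<le> e / 2" using e by (auto simp: d_def min_def)
  have sd: "0 < sin d" using d by (intro sin_gt_zero) auto
  define err where "err = (\<lambda>N. \<bar>sine_sum 1 N (pi / 2) - pi / 4\<bar> + (1 + pi) / (real N * (sin d)\<^sup>2))"
  have "(\<lambda>N. \<bar>sine_sum 1 N (pi / 2) - pi / 4\<bar> + (1 + pi) / (sin d)\<^sup>2 * (1 / real N)) \<longlonglongrightarrow> \<bar>pi / 4 - pi / 4\<bar> + (1 + pi) / (sin d)\<^sup>2 * 0"
    by (intro tendsto_intros sine_sum_half_pi lim_1_over_n)
  then have "err \<longlonglongrightarrow> 0" unfolding err_def by (simp add: mult.commute)
  then have "\<forall>\<^sub>F N in sequentially. err N < e / 8" using e by (intro order_tendstoD(2)) auto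
  then obtain N1 where N1: "\<And>N. N \<ge> N1 \<Longrightarrow> err N < e / 8" unfolding eventually_sequentially by blast
  have "\<bar>sine_sum 3 N s - pi / 8 * s * (pi - s)\<bar> \<le> e" if N: "N \<ge> max 1 N1" and s: "s \<in> {0..pi}" for N s
  proof -
    \<comment> \<open>\<open>C\<close> and \<open>G\<close> are the successive integrals of the
      square wave error. The constants are chosen so that \<open>C\<close> vanishes at pi/2 and
      \<open>G\<close> at 0, the base points of the two integrations.\<close>
    define C where "C = (\<lambda>s. cosine_sum 2 N s + pi / 4 * s - pi\<^sup>2 / 8)"
    define G where "G = (\<lambda>s. sine_sum 3 N s - pi / 8 * s * (pi - s))"
    have dC: "(C has_real_derivative - (sine_sum 1 N x - pi / 4)) (at x)" for x
      unfolding C_def numeral_2_eq_2 using cosine_sum_deriv[of 1 N x]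
      by (auto intro!: derivative_eq_intros)
    have dG: "(G has_real_derivative C x) (at x)" for x
    proof -
      have "(G has_real_derivative cosine_sum 2 N x - (pi / 8 * x * (- 1) + pi / 8 * (pi - x))) (at x)"
        unfolding G_def using sine_sum_deriv[of 2 N x] by (auto intro!: derivative_eq_intros simp: eval_nat_numeral field_simps)
      moreover have "cosine_sum 2 N x - (pi / 8 * x * (- 1) + pi / 8 * (pi - x)) = C x"
        by (simp add: C_def field_simps power2_eq_square)
      ultimately show ?thesis by simp
    qed
    have C_half: "C (pi / 2) = 0" by (simp add: C_def cosine_sum_half_pi power2_eq_square)
    have C_far: "\<bar>C x\<bar> \<le> e / 4" if x: "d \<le> x" "x \<le> pi / 2" for x
    proof -
      have "\<bar>C (pi / 2) - C x\<bar> \<le> e / 8 * (pi / 2 - x)"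
      proof (intro deriv_bound_diff[where f' = "\<lambda>x. - (sine_sum 1 N x - pi / 4)"] dC)
        fix y assume "x \<le> y" "y \<le> pi / 2"
        then have "\<bar>sine_sum 1 N y - pi / 4\<bar> \<le> err N"
          unfolding err_def using N x d by (intro square_wave_error) auto
        moreover have "err N < e / 8" using N1 N by simp
        ultimately show "\<bar>- (sine_sum 1 N y - pi / 4)\<bar> \<le> e / 8" by linarith
      qed (use x in auto)
      also have "\<dots> \<le> e / 8 * 2" using x d e pi_less_4 by (intro mult_left_mono) auto
      finally show ?thesis using C_half by simp
    qed
    have C_near: "\<bar>C x\<bar> \<le> 8" if x: "0 \<le> x" "x \<le> pi / 2" for x
    proof -
      have "\<bar>cosine_sum 2 N x\<bar> \<le> (\<Sum>j<N. \<bar>cos ((2 * real j + 1) * x) / (2 * real j + 1)\<^sup>2\<bar>)"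
        unfolding cosine_sum_def by (rule sum_abs)
      also have "\<dots> \<le> (\<Sum>j<N. 1 / (2 * real j + 1)\<^sup>2)"
        by (intro sum_mono) (auto simp: abs_divide divide_right_mono)
      also have "\<dots> \<le> 2" by (rule inverse_odd_squares_le)
      finally have 1: "\<bar>cosine_sum 2 N x\<bar> \<le> 2" .
      have "pi / 4 * x \<le> 1 * 2" using x pi_less_4 by (intro mult_mono) auto
      moreover have "0 \<le> pi / 4 * x" using x by simp
      moreover have "pi\<^sup>2 \<le> 16" using power_mono[of pi 4 2] pi_less_4 by simp
      moreover have "0 \<le> pi\<^sup>2" by simp
      ultimately show ?thesis using 1 unfolding C_def abs_le_iff by linarith
    qed
    have G0: "G 0 = 0" by (simp add: G_def sine_sum_def)
    have G_half: "\<bar>G x\<bar> \<le> e" if x: "0 \<le> x" "x \<le> pi / 2" for x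
    proof (cases "x \<le> d")
      case True
      have "\<bar>G x - G 0\<bar> \<le> 8 * (x - 0)"
        using x by (intro deriv_bound_diff[where f' = C] dG C_near) auto
      then show ?thesis using G0 True d e by simp
    next
      case False
      have "\<bar>G d - G 0\<bar> \<le> 8 * (d - 0)"
        using d by (intro deriv_bound_diff[where f' = C] dG C_near) auto
      moreover have "\<bar>G x - G d\<bar> \<le> e / 4 * (x - d)"
        using x d False by (intro deriv_bound_diff[where f' = C] dG C_far) auto
      moreover have "e / 4 * (x - d) \<le> e / 4 * 2" using x d e pi_less_4 by (intro mult_left_mono) auto
      then have "e / 4 * (x - d) \<le> e / 2" by simp
      ultimately have "\<bar>G d\<bar> \<le> 8 * d" "\<bar>G x - G d\<bar> \<le> e / 2" using G0 by simp_all
      then show ?thesis using d(3) by linarith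
    qed
    have sym: "G (pi - x) = G x" for x
    proof -
      have "sin ((2 * real j + 1) * (pi - x)) = sin ((2 * real j + 1) * x)" for j
      proof -
        have "(2 * real j + 1) * (pi - x) = (pi - (2 * real j + 1) * x) + 2 * real j * pi" by (simp add: algebra_simps)
        then show ?thesis by (simp only: sin_add cos_2npi sin_2npi) simp
      qed
      then show ?thesis by (simp add: G_def sine_sum_def mult.commute)
    qed
    show ?thesis
    proof (cases "s \<le> pi / 2")
      case True
      then show ?thesis using G_half[of s] s by (simp add: G_def)
    next
      case False
      then show ?thesis using G_half[of "pi - s"] sym[of s] s by (simp add: G_def)
    qed
  qed
  then show ?thesis by blast
qed

section \<open>Approximate torsion functions: maximum principle, center value and Fourier
  representation\<close>

subsection \<open>Approximate torsion functions\<close>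

text \<open>
  For an entire function \<open>F\<close> the potential \<open>potential F\<close> solves \<open>\<Delta>u = 1\<close>. If it vanishes on the boundary
  of the rectangle, it is minus the torsion function.
\<close>

definition potential :: "(complex \<Rightarrow> complex) \<Rightarrow> real \<times> real \<Rightarrow> real" where
  "potential F x = (snd x)\<^sup>2 / 2 + Re (F (cplx x))"

text \<open>Vanishing on the boundary is demanded only up to \<open>e\<close>, so that finite
  Fourier sums, which are entire, qualify. The maximum principle turns this into errors of a few
  multiples of \<open>e\<close> inside.\<close>

definition small_on_boundary :: "real \<Rightarrow> real \<Rightarrow> real \<Rightarrow> (complex \<Rightarrow> complex) \<Rightarrow> bool" where
  "small_on_boundary p q e F \<longleftrightarrow> F holomorphic_on UNIV \<and>
    (\<forall>x y. \<bar>x\<bar> \<le> p \<longrightarrow> \<bar>y\<bar> \<le> q \<longrightarrow> \<bar>x\<bar> = p \<or> \<bar>y\<bar> = q \<longrightarrow> \<bar>potential F (x, y)\<bar> \<le> e)"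

lemma entire_compose:
  "f holomorphic_on UNIV \<Longrightarrow> g holomorphic_on UNIV \<Longrightarrow> (\<lambda>z. g (f z)) holomorphic_on UNIV"
  using holomorphic_on_compose_gen[of f UNIV g UNIV] by (simp add: o_def)

lemma max_principle:
  assumes G: "G holomorphic_on UNIV"
    and bd: "\<And>x y. a \<le> x \<Longrightarrow> x \<le> b \<Longrightarrow> c \<le> y \<Longrightarrow> y \<le> d \<Longrightarrow> x = a \<or> x = b \<or> y = c \<or> y = d \<Longrightarrow> Re (G (Complex x y)) \<le> k"
    and xy: "a \<le> x" "x \<le> b" "c \<le> y" "y \<le> d"
  shows "Re (G (Complex x y)) \<le> k"
proof (rule maximum_real_frontier[of G "cbox (Complex a c) (Complex b d)"])
  show "G holomorphic_on interior (cbox (Complex a c) (Complex b d))" using G holomorphic_on_subset by blast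
  show "continuous_on (closure (cbox (Complex a c) (Complex b d))) G"
    using holomorphic_on_imp_continuous_on[OF G] continuous_on_subset by blast
  show "Complex x y \<in> cbox (Complex a c) (Complex b d)" using xy by (simp add: in_cbox_complex_iff)
  fix z assume "z \<in> frontier (cbox (Complex a c) (Complex b d))"
  then have "z \<in> cbox (Complex a c) (Complex b d)" "z \<notin> box (Complex a c) (Complex b d)"
    unfolding frontier_def by (simp_all add: interior_cbox)
  then have "Re (G (Complex (Re z) (Im z))) \<le> k"
    by (intro bd) (auto simp: in_cbox_complex_iff in_box_complex_iff)
  then show "Re (G z) \<le> k" by simp
qed (rule bounded_cbox)

lemma max_principle_symmetric:
  assumes G: "G holomorphic_on UNIV" and pq: "p > 0" "q > 0"
    and bd: "\<And>x y. \<bar>x\<bar> \<le> p \<Longrightarrow> \<bar>y\<bar> \<le> q \<Longrightarrow> \<bar>x\<bar> = p \<or> \<bar>y\<bar> = q \<Longrightarrow> Re (G (Complex x y)) \<le> k"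
    and xy: "\<bar>x\<bar> \<le> p" "\<bar>y\<bar> \<le> q"
  shows "Re (G (Complex x y)) \<le> k"
  by (rule max_principle[OF G, of "- p" p "- q" q]) (use assms in \<open>auto simp: abs_le_iff intro!: bd\<close>)

lemma potential_le:
  assumes F: "small_on_boundary p q e F" and pq: "p > 0" "q > 0" and xy: "\<bar>x\<bar> \<le> p" "\<bar>y\<bar> \<le> q"
  shows "potential F (x, y) \<le> e"
proof -
  \<comment> \<open>Replace the convex term by its tangent at \<open>y\<close>, which is harmonic.\<close>
  define G where "G = (\<lambda>z. F z - of_real (y\<^sup>2 / 2) - \<i> * of_real y * z)"
  have G: "G holomorphic_on UNIV" using F unfolding G_def small_on_boundary_def by (intro holomorphic_intros) auto
  have ReG: "Re (G (Complex u v)) = Re (F (Complex u v)) - y\<^sup>2 / 2 + y * v" for u v by (simp add: G_def)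
  have "Re (G (Complex x y)) \<le> e"
  proof (rule max_principle_symmetric[OF G pq _ xy])
    fix u v assume uv: "\<bar>u\<bar> \<le> p" "\<bar>v\<bar> \<le> q" "\<bar>u\<bar> = p \<or> \<bar>v\<bar> = q"
    have "0 \<le> (v - y)\<^sup>2" by simp
    then have "y * v - y\<^sup>2 / 2 \<le> v\<^sup>2 / 2" by (simp add: power2_diff field_simps)
    then have "Re (G (Complex u v)) \<le> potential F (u, v)" unfolding ReG by (simp add: potential_def)
    also have "\<dots> \<le> \<bar>potential F (u, v)\<bar>" by simp
    also have "\<dots> \<le> e" using F uv unfolding small_on_boundary_def by blast
    finally show "Re (G (Complex u v)) \<le> e" .
  qed
  then show ?thesis unfolding ReG by (simp add: potential_def power2_eq_square)
qed

text \<open>The quadratic terms cancel in the difference of two potentials, which is therefore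
  harmonic and bounded by 2 e on the boundary.\<close>

lemma potential_center_unique:
  assumes F: "small_on_boundary p q e F" and G: "small_on_boundary p q e G" and pq: "p > 0" "q > 0"
  shows "\<bar>potential F (0, 0) - potential G (0, 0)\<bar> \<le> 2 * e"
proof -
  have *: "potential F (0, 0) - potential G (0, 0) \<le> 2 * e"
    if F: "small_on_boundary p q e F" and G: "small_on_boundary p q e G" for F G
  proof -
    have "Re ((\<lambda>z. F z - G z) (Complex 0 0)) \<le> 2 * e"
    proof (rule max_principle_symmetric[OF _ pq])
      show "(\<lambda>z. F z - G z) holomorphic_on UNIV"
        using F G unfolding small_on_boundary_def by (intro holomorphic_intros) auto
      fix u v assume uv: "\<bar>u\<bar> \<le> p" "\<bar>v\<bar> \<le> q" "\<bar>u\<bar> = p \<or> \<bar>v\<bar> = q"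
      then have "\<bar>potential F (u, v)\<bar> \<le> e" "\<bar>potential G (u, v)\<bar> \<le> e"
        using F G unfolding small_on_boundary_def by blast+
      then show "Re (F (Complex u v) - G (Complex u v)) \<le> 2 * e" by (simp add: potential_def)
    qed (use pq in auto)
    then show ?thesis by (simp add: potential_def)
  qed
  show ?thesis using *[OF F G] *[OF G F] by linarith
qed

lemma small_on_boundary_uminus:
  assumes "small_on_boundary p q e F"
  shows "small_on_boundary p q e (\<lambda>z. F (- z))" and "potential (\<lambda>z. F (- z)) (x, y) = potential F (- x, - y)"
proof -
  show pot: "potential (\<lambda>z. F (- z)) (x, y) = potential F (- x, - y)" for x y
  proof -
    have "- Complex x y = Complex (- x) (- y)" by (simp add: complex_eq_iff)
    then show ?thesis by (simp add: potential_def)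
  qed
  have "(\<lambda>z. F (- z)) holomorphic_on UNIV"
    using assms unfolding small_on_boundary_def by (intro entire_compose[of uminus F] holomorphic_intros) auto
  then show "small_on_boundary p q e (\<lambda>z. F (- z))"
    using assms unfolding small_on_boundary_def pot by simp
qed

text \<open>The added square trades y^2/2 for x^2/2, so the potential is carried along by a quarter
  turn. Statements about one coordinate direction thereby give the other.\<close>

lemma small_on_boundary_rotate:
  assumes "small_on_boundary p q e F"
  shows "small_on_boundary q p e (\<lambda>z. z\<^sup>2 / 2 + F (\<i> * z))"
    and "potential (\<lambda>z. z\<^sup>2 / 2 + F (\<i> * z)) (x, y) = potential F (- y, x)"
proof -
  show pot: "potential (\<lambda>z. z\<^sup>2 / 2 + F (\<i> * z)) (x, y) = potential F (- y, x)" for x y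
  proof -
    have "\<i> * Complex x y = Complex (- y) x" by (simp add: complex_eq_iff)
    then show ?thesis by (simp add: potential_def power2_eq_square field_simps)
  qed
  have "(\<lambda>z. F (\<i> * z)) holomorphic_on UNIV"
    using assms unfolding small_on_boundary_def by (intro entire_compose[of "\<lambda>z. \<i> * z" F] holomorphic_intros) auto
  then have "(\<lambda>z. z\<^sup>2 / 2 + F (\<i> * z)) holomorphic_on UNIV" by (intro holomorphic_intros) auto
  then show "small_on_boundary q p e (\<lambda>z. z\<^sup>2 / 2 + F (\<i> * z))"
    using assms unfolding small_on_boundary_def pot by auto
qed

text \<open>The reflection argument of the moving plane method.\<close>

lemma potential_ge_axis_pos:
  assumes F: "small_on_boundary p q e F" and pq: "p > 0" "q > 0" and xy: "0 \<le> x" "x \<le> p" "\<bar>y\<bar> \<le> q"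
  shows "potential F (0, y) - 2 * e \<le> potential F (x, y)"
proof -
  have Fh: "F holomorphic_on UNIV" using F by (simp add: small_on_boundary_def)
  \<comment> \<open>Reflection in the vertical line through x/2, made holomorphic by a double
    conjugation; it sends the point (x, y) to (0, y).\<close>
  define R where "R = (\<lambda>z. cnj (F (cnj (of_real x - z))))"
  have "(\<lambda>z. cnj (F (cnj z))) holomorphic_on UNIV"
    using holomorphic_on_compose_cnj_cnj[of F UNIV] Fh holomorphic_on_subset by (auto simp: o_def)
  then have R: "R holomorphic_on UNIV"
    unfolding R_def by (intro entire_compose[of "\<lambda>z. of_real x - z" "\<lambda>z. cnj (F (cnj z))"] holomorphic_intros)
  have ReR: "Re (R (Complex u v)) = Re (F (Complex (x - u) v))" for u v
  proof -
    have "cnj (of_real x - Complex u v) = Complex (x - u) v" by (simp add: complex_eq_iff)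
    then show ?thesis by (simp add: R_def)
  qed
  have "Re ((\<lambda>z. R z - F z) (Complex x y)) \<le> 2 * e"
  \<comment> \<open>On the part to the right of the mirror line the difference of the reflected and
    the original function is harmonic. It vanishes on the mirror; on the other sides the original is
    small and the reflected potential is at most \<open>e\<close>.\<close>
  proof (rule max_principle[where a = "x / 2" and b = p and c = "- q" and d = q])
    show "(\<lambda>z. R z - F z) holomorphic_on UNIV" by (intro holomorphic_intros R Fh)
    fix u v assume uv: "x / 2 \<le> u" "u \<le> p" "- q \<le> v" "v \<le> q" "u = x / 2 \<or> u = p \<or> v = - q \<or> v = q"
    have e0: "e \<ge> 0" using F pq unfolding small_on_boundary_def
      by (metis abs_ge_zero abs_of_pos dual_order.refl order_trans)
    have eq: "Re (R (Complex u v) - F (Complex u v)) = potential F (x - u, v) - potential F (u, v)"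
      by (simp add: ReR potential_def)
    show "Re (R (Complex u v) - F (Complex u v)) \<le> 2 * e"
    proof (cases "u = x / 2")
      case True
      then have "x - u = u" by simp
      then show ?thesis unfolding eq using e0 by simp
    next
      case False
      have "potential F (x - u, v) \<le> e" by (rule potential_le[OF F pq]) (use uv xy in auto)
      moreover have "\<bar>potential F (u, v)\<bar> \<le> e"
        using F uv xy False unfolding small_on_boundary_def by (auto simp: abs_le_iff)
      ultimately show ?thesis unfolding eq by linarith
    qed
  qed (use xy in auto)
  then show ?thesis by (simp add: ReR potential_def)
qed

lemma potential_ge_axis:
  assumes F: "small_on_boundary p q e F" and pq: "p > 0" "q > 0" and xy: "\<bar>x\<bar> \<le> p" "\<bar>y\<bar> \<le> q"
  shows "potential F (0, y) - 2 * e \<le> potential F (x, y)"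
proof (cases "0 \<le> x")
  case True
  then show ?thesis using potential_ge_axis_pos[OF F pq True, of y] xy by auto
next
  case False
  then show ?thesis
    using potential_ge_axis_pos[OF small_on_boundary_uminus(1)[OF F] pq, of "- x" "- y"] xy
    by (simp add: small_on_boundary_uminus(2)[OF F])
qed

text \<open>Reflection in both directions, the second one through the quarter turn: up to 4 e the
  potential is lowest at the center, so the torsion is largest there.\<close>

lemma potential_ge_center:
  assumes F: "small_on_boundary p q e F" and pq: "p > 0" "q > 0" and xy: "\<bar>x\<bar> \<le> p" "\<bar>y\<bar> \<le> q"
  shows "potential F (0, 0) - 4 * e \<le> potential F (x, y)"
proof -
  have "potential F (0, 0) - 2 * e \<le> potential F (0, y)"
    using potential_ge_axis[OF small_on_boundary_rotate(1)[OF F] pq(2,1), of y 0] xy pq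
    by (simp add: small_on_boundary_rotate(2)[OF F])
  then show ?thesis using potential_ge_axis[OF F pq xy] by linarith
qed

text \<open>Comparison with -(p^2 - x^2)/2, minus the torsion function of the strip. Near the
  vertical sides the potential is therefore no lower than a multiple of the distance to them, up to
  \<open>e\<close>.\<close>

lemma potential_barrier_x:
  assumes F: "small_on_boundary p q e F" and pq: "p > 0" "q > 0" and xy: "\<bar>x\<bar> \<le> p" "\<bar>y\<bar> \<le> q"
  shows "- (p\<^sup>2 - x\<^sup>2) / 2 - e \<le> potential F (x, y)"
proof -
  define G where "G = (\<lambda>z. z\<^sup>2 / 2 - of_real (p\<^sup>2 / 2) - F z)"
  have G: "G holomorphic_on UNIV" using F unfolding G_def small_on_boundary_def by (intro holomorphic_intros) auto
  have ReG: "Re (G (Complex u v)) = - (p\<^sup>2 - u\<^sup>2) / 2 - potential F (u, v)" for u v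
    by (simp add: G_def potential_def power2_eq_square field_simps)
  have "Re (G (Complex x y)) \<le> e"
  proof (rule max_principle_symmetric[OF G pq _ xy])
    fix u v assume uv: "\<bar>u\<bar> \<le> p" "\<bar>v\<bar> \<le> q" "\<bar>u\<bar> = p \<or> \<bar>v\<bar> = q"
    have "u\<^sup>2 \<le> p\<^sup>2" using uv(1) by (simp add: abs_le_square_iff[symmetric])
    moreover have "\<bar>potential F (u, v)\<bar> \<le> e" using F uv unfolding small_on_boundary_def by blast
    then have "- potential F (u, v) \<le> e" by (simp add: abs_le_iff)
    ultimately show "Re (G (Complex u v)) \<le> e" unfolding ReG by (simp add: field_simps)
  qed
  then show ?thesis unfolding ReG by (simp add: field_simps)
qed

lemma potential_barrier_y:
  assumes F: "small_on_boundary p q e F" and pq: "p > 0" "q > 0" and xy: "\<bar>x\<bar> \<le> p" "\<bar>y\<bar> \<le> q"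
  shows "- (q\<^sup>2 - y\<^sup>2) / 2 - e \<le> potential F (x, y)"
  using potential_barrier_x[OF small_on_boundary_rotate(1)[OF F] pq(2,1), of y "- x"] xy
  by (simp add: small_on_boundary_rotate(2)[OF F])

text \<open>The cosine coefficients of 1 - (x/p)^2 on [-p, p] with respect to the frequencies
  \<open>freq p j\<close>.\<close>

definition torsion_coeff :: "nat \<Rightarrow> real" where
  "torsion_coeff j = (-1) ^ j * (32 / (pi ^ 3 * (2 * real j + 1) ^ 3))"

definition freq :: "real \<Rightarrow> nat \<Rightarrow> real" where
  "freq p j = (2 * real j + 1) * pi / (2 * p)"

text \<open>Separation of variables: -(p^2 - x^2)/2 already vanishes on the vertical sides and has
  Laplacian 1. The harmonic products cos times cosh correct it on the horizontal sides; here they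
  are the real parts of complex cosines.\<close>

definition torsion_fun :: "real \<Rightarrow> real \<Rightarrow> nat \<Rightarrow> complex \<Rightarrow> complex" where
  "torsion_fun p q N z = z\<^sup>2 / 2 - of_real (p\<^sup>2 / 2) +
    of_real (p\<^sup>2 / 2) * (\<Sum>j<N. of_real (torsion_coeff j / cosh (freq p j * q)) * cos (of_real (freq p j) * z))"

text \<open>The value of the full torsion series at the center of the rectangle.\<close>

definition torsion_max :: "real \<Rightarrow> real \<Rightarrow> real" where
  "torsion_max p q = p\<^sup>2 / 2 * (1 - (\<Sum>j. torsion_coeff j / cosh (freq p j * q)))"

lemma abs_torsion_coeff: "\<bar>torsion_coeff j\<bar> \<le> 4 / (2 * real j + 1) ^ 3"
proof -
  have "(2::real) ^ 3 \<le> pi ^ 3" using pi_ge_two by (intro power_mono) auto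
  then have "32 / (pi ^ 3 * (2 * real j + 1) ^ 3) \<le> 32 / (8 * (2 * real j + 1) ^ 3)"
    by (intro divide_left_mono mult_right_mono) auto
  then show ?thesis by (simp add: torsion_coeff_def abs_mult)
qed

lemma abs_torsion_coeff': "\<bar>torsion_coeff j\<bar> * (2 * real j + 1) \<le> 4 * (1 / (2 * real j + 1)\<^sup>2)"
proof -
  have "\<bar>torsion_coeff j\<bar> * (2 * real j + 1) \<le> 4 / (2 * real j + 1) ^ 3 * (2 * real j + 1)"
    by (intro mult_right_mono abs_torsion_coeff) auto
  moreover have eq: "4 / k ^ 3 * k = 4 * (1 / k\<^sup>2)" if "k > 0" for k :: real
    using that by (simp add: power3_eq_cube power2_eq_square)
  have "4 / (2 * real j + 1) ^ 3 * (2 * real j + 1) = 4 * (1 / (2 * real j + 1)\<^sup>2)" by (rule eq) simp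
  ultimately show ?thesis by (simp only:)
qed

lemma torsion_coeff_sum_le: "(\<Sum>j<N. \<bar>torsion_coeff j\<bar> * (2 * real j + 1)) \<le> 8"
proof -
  have "(\<Sum>j<N. \<bar>torsion_coeff j\<bar> * (2 * real j + 1)) \<le> 4 * (\<Sum>j<N. 1 / (2 * real j + 1)\<^sup>2)"
    unfolding sum_distrib_left by (intro sum_mono abs_torsion_coeff')
  then show ?thesis using inverse_odd_squares_le[of N] by linarith
qed

lemma summable_torsion:
  assumes "\<And>j. \<bar>f j\<bar> \<le> 1"
  shows "summable (\<lambda>j. torsion_coeff j * f j)"
proof (rule summable_comparison_test')
  show "summable (\<lambda>j. \<bar>torsion_coeff j\<bar> * (2 * real j + 1))"
    by (rule summableI_nonneg_bounded[OF _ torsion_coeff_sum_le]) auto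
  show "norm (torsion_coeff j * f j) \<le> \<bar>torsion_coeff j\<bar> * (2 * real j + 1)" for j
    unfolding real_norm_def abs_mult by (intro mult_left_mono order_trans[OF assms]) auto
qed

lemma summable_torsion_max: "summable (\<lambda>j. torsion_coeff j / cosh (f j))"
  using summable_torsion[of "\<lambda>j. 1 / cosh (f j)"] by (simp add: cosh_real_ge_1)

lemma torsion_fun_entire: "torsion_fun p q N holomorphic_on UNIV"
  unfolding torsion_fun_def by (intro holomorphic_intros) auto

lemma potential_torsion_fun:
  "potential (torsion_fun p q N) (x, y) = - (p\<^sup>2 - x\<^sup>2) / 2 +
    p\<^sup>2 / 2 * (\<Sum>j<N. torsion_coeff j / cosh (freq p j * q) * (cos (freq p j * x) * cosh (freq p j * y)))"
proof -
  have "Re (cos (of_real c * Complex x y)) = cos (c * x) * cosh (c * y)" for c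
    by (simp add: Re_cos cosh_def)
  moreover have Rm: "Re (complex_of_real r * z) = r * Re z" for r z by simp
  moreover have sq: "Re ((Complex x y)\<^sup>2 / 2) = (x\<^sup>2 - y\<^sup>2) / 2" by (simp add: power2_eq_square)
  ultimately have "Re (torsion_fun p q N (Complex x y)) = (x\<^sup>2 - y\<^sup>2) / 2 - p\<^sup>2 / 2 +
    p\<^sup>2 / 2 * (\<Sum>j<N. torsion_coeff j / cosh (freq p j * q) * (cos (freq p j * x) * cosh (freq p j * y)))"
    unfolding torsion_fun_def plus_complex.sel minus_complex.sel Re_complex_of_real Rm Re_sum sq by simp
  then show ?thesis by (simp add: potential_def field_simps)
qed

text \<open>On the vertical sides all cosines vanish, so the value is exactly 0. On the horizontal
  sides the quotients of cosh are 1, and what is left is the truncation error of the parabola series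
  times p^2/2 and 32/pi^3 <= 4.\<close>

lemma torsion_fun_boundary:
  assumes p: "p > 0" and q: "q > 0"
    and N: "\<And>s. s \<in> {0..pi} \<Longrightarrow> \<bar>sine_sum 3 N s - pi / 8 * s * (pi - s)\<bar> \<le> e"
  shows "small_on_boundary p q (2 * p\<^sup>2 * e) (torsion_fun p q N)"
  unfolding small_on_boundary_def
proof (intro conjI allI impI torsion_fun_entire)
  fix x y assume xy: "\<bar>x\<bar> \<le> p" "\<bar>y\<bar> \<le> q" "\<bar>x\<bar> = p \<or> \<bar>y\<bar> = q"
  have e: "e \<ge> 0" using N[of 0] by simp
  show "\<bar>potential (torsion_fun p q N) (x, y)\<bar> \<le> 2 * p\<^sup>2 * e"
  proof (cases "\<bar>x\<bar> = p")
    case True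
    have "cos (freq p j * x) = 0" for j
    proof -
      have "cos (freq p j * x) = cos (freq p j * \<bar>x\<bar>)" by (cases "0 \<le> x") auto
      also have "freq p j * \<bar>x\<bar> = (2 * real j + 1) * (pi / 2)" using True p by (simp add: freq_def)
      finally show ?thesis using cos_odd_half_pi by simp
    qed
    moreover have "x\<^sup>2 = p\<^sup>2" using True by (metis power2_abs)
    ultimately show ?thesis using e by (simp add: potential_torsion_fun)
  next
    case False
    \<comment> \<open>This maps [-p, p] onto [0, pi] and turns the alternating cosines into the
      sines of \<open>sine_sum\<close>.\<close>
    define s where "s = pi / 2 - pi * x / (2 * p)"
    have cosy: "cosh (freq p j * y) = cosh (freq p j * q)" for j
    proof -
      have "cosh (freq p j * y) = cosh (freq p j * \<bar>y\<bar>)" by (cases "0 \<le> y") auto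
      then show ?thesis using xy False by simp
    qed
    have "- 1 \<le> x / p" "x / p \<le> 1" using xy p by (auto simp: field_simps abs_le_iff)
    then have "pi / 2 * (- 1) \<le> pi / 2 * (x / p)" "pi / 2 * (x / p) \<le> pi / 2 * 1"
      using mult_left_mono[of "- 1" "x / p" "pi / 2"] mult_left_mono[of "x / p" 1 "pi / 2"] pi_ge_zero by linarith+
    then have s: "s \<in> {0..pi}" by (simp add: s_def)
    have sin_s: "sin ((2 * real j + 1) * s) = (-1) ^ j * cos (freq p j * x)" for j
    proof -
      have "(2 * real j + 1) * s = (2 * real j + 1) * (pi / 2) - freq p j * x"
        by (simp add: s_def freq_def right_diff_distrib)
      then show ?thesis by (simp only: sin_diff sin_odd_half_pi cos_odd_half_pi)
    qed
    have "torsion_coeff j / cosh (freq p j * q) * (cos (freq p j * x) * cosh (freq p j * y)) =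
        32 / pi ^ 3 * (sin ((2 * real j + 1) * s) / (2 * real j + 1) ^ 3)" for j
      unfolding cosy sin_s by (simp add: torsion_coeff_def)
    then have "potential (torsion_fun p q N) (x, y) = - (p\<^sup>2 - x\<^sup>2) / 2 + p\<^sup>2 / 2 * (32 / pi ^ 3 * sine_sum 3 N s)"
      unfolding potential_torsion_fun sine_sum_def sum_distrib_left by simp
    moreover have "(p\<^sup>2 - x\<^sup>2) / 2 = p\<^sup>2 / 2 * (32 / pi ^ 3 * (pi / 8 * s * (pi - s)))"
    proof -
      have "s * (pi - s) = pi\<^sup>2 / 4 * (1 - x\<^sup>2 / p\<^sup>2)"
        using p by (simp add: s_def field_simps power2_eq_square)
      then have "32 / pi ^ 3 * (pi / 8 * s * (pi - s)) = 32 / pi ^ 3 * (pi / 8 * (pi\<^sup>2 / 4 * (1 - x\<^sup>2 / p\<^sup>2)))"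
        by (simp only: mult.assoc)
      also have "\<dots> = 1 - x\<^sup>2 / p\<^sup>2" by (simp add: power3_eq_cube power2_eq_square)
      finally show ?thesis using p by (simp add: field_simps)
    qed
    moreover have "a = c * k * (u - v)" if "a = - b / 2 + c * (k * u)" "b / 2 = c * (k * v)" for a b c k u v :: real
      using that by (simp add: algebra_simps)
    ultimately have "potential (torsion_fun p q N) (x, y) =
        p\<^sup>2 / 2 * (32 / pi ^ 3) * (sine_sum 3 N s - pi / 8 * s * (pi - s))" by blast
    then have "\<bar>potential (torsion_fun p q N) (x, y)\<bar> = p\<^sup>2 / 2 * (32 / pi ^ 3) * \<bar>sine_sum 3 N s - pi / 8 * s * (pi - s)\<bar>"
      by (simp add: abs_mult)
    also have "\<dots> \<le> p\<^sup>2 / 2 * 4 * e"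
    proof (intro mult_mono N s order_refl)
      have "(2::real) ^ 3 \<le> pi ^ 3" using pi_ge_two by (intro power_mono) auto
      then show "32 / pi ^ 3 \<le> 4" by (simp add: field_simps)
    qed auto
    finally show ?thesis by simp
  qed
qed

lemma norm_sin_le_cosh: "cmod (sin z) \<le> cosh (Im z)"
proof -
  have "cmod (sin z) = cmod (exp (\<i> * z) - exp (- (\<i> * z))) / 2"
    by (simp add: sin_exp_eq norm_divide norm_mult)
  also have "\<dots> \<le> (cmod (exp (\<i> * z)) + cmod (exp (- (\<i> * z)))) / 2"
    by (intro divide_right_mono norm_triangle_ineq4) auto
  finally show ?thesis by (simp add: cosh_def add.commute)
qed

text \<open>Differentiating a term gains a factor 2 j + 1, and the cubic decay of the coefficients
  leaves a convergent sum; the quotients of sin and cosh are at most 1. The bound is thus uniform in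
  \<open>N\<close>, which allows a core of size 1/B later on.\<close>

lemma potential_torsion_lipschitz:
  assumes p: "p > 0" and q: "q > 0" and xy: "\<bar>x\<bar> \<le> p" "\<bar>y\<bar> \<le> q"
  shows "potential (torsion_fun p q N) (x, y) \<le> potential (torsion_fun p q N) (0, 0) + (9 * p + 2 * q) * (\<bar>x\<bar> + \<bar>y\<bar>)"
proof -
  define S where "S = cbox (Complex (- p) (- q)) (Complex p q)"
  define F' :: "complex \<Rightarrow> complex" where "F' = (\<lambda>z. z + of_real (p\<^sup>2 / 2) *
      (\<Sum>j<N. of_real (torsion_coeff j / cosh (freq p j * q)) * (- sin (of_real (freq p j) * z) * of_real (freq p j))))"
  have deriv: "(torsion_fun p q N has_field_derivative F' z) (at z within S)" for z
    unfolding torsion_fun_def F'_def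
    by (auto intro!: derivative_eq_intros simp: mult_ac)
  have bound: "cmod (F' z) \<le> 9 * p + q" if z: "z \<in> S" for z
  proof -
    have z': "\<bar>Re z\<bar> \<le> p" "\<bar>Im z\<bar> \<le> q" using z by (auto simp: S_def in_cbox_complex_iff)
    have fp: "freq p j > 0" for j using p by (simp add: freq_def)
    have summand: "cmod (of_real (torsion_coeff j / cosh (freq p j * q)) * (- sin (of_real (freq p j) * z) * of_real (freq p j)))
        \<le> 2 / p * (\<bar>torsion_coeff j\<bar> * (2 * real j + 1))" for j
    proof -
      have "cmod (sin (of_real (freq p j) * z)) \<le> cosh (freq p j * Im z)"
        using norm_sin_le_cosh[of "of_real (freq p j) * z"] by simp
      also have "\<dots> = cosh (freq p j * \<bar>Im z\<bar>)" by (cases "0 \<le> Im z") auto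
      also have "\<dots> \<le> cosh (freq p j * q)" using fp[of j] z' by (intro cosh_real_nonneg_le_iff[THEN iffD2] mult_left_mono) (auto simp: q less_imp_le)
      finally have s: "cmod (sin (of_real (freq p j) * z)) \<le> cosh (freq p j * q)" .
      have "cmod (of_real (torsion_coeff j / cosh (freq p j * q)) * (- sin (of_real (freq p j) * z) * of_real (freq p j))) =
          \<bar>torsion_coeff j\<bar> * freq p j * (cmod (sin (of_real (freq p j) * z)) / cosh (freq p j * q))"
        using fp[of j] by (simp add: norm_mult norm_divide abs_mult del: of_real_divide)
      also have "\<dots> \<le> \<bar>torsion_coeff j\<bar> * freq p j * 1"
        using fp[of j] s by (intro mult_left_mono) (auto simp: pos_divide_le_eq)
      also have "\<dots> = pi / (2 * p) * (\<bar>torsion_coeff j\<bar> * (2 * real j + 1))" by (simp add: freq_def)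
      also have "\<dots> \<le> 2 / p * (\<bar>torsion_coeff j\<bar> * (2 * real j + 1))"
        using p pi_less_4 by (intro mult_right_mono) (auto simp: field_simps)
      finally show ?thesis .
    qed
    have "cmod (F' z) \<le> cmod z + p\<^sup>2 / 2 * cmod (\<Sum>j<N. of_real (torsion_coeff j / cosh (freq p j * q)) * (- sin (of_real (freq p j) * z) * of_real (freq p j)))"
      unfolding F'_def by (intro norm_triangle_le) (simp add: norm_mult norm_divide norm_power)
    also have "\<dots> \<le> (p + q) + p\<^sup>2 / 2 * (2 / p * 8)"
    proof (intro add_mono mult_left_mono)
      show "cmod z \<le> p + q" using cmod_le[of z] z' by linarith
      have "cmod (\<Sum>j<N. of_real (torsion_coeff j / cosh (freq p j * q)) * (- sin (of_real (freq p j) * z) * of_real (freq p j)))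
          \<le> (\<Sum>j<N. 2 / p * (\<bar>torsion_coeff j\<bar> * (2 * real j + 1)))"
        by (intro sum_norm_le summand)
      also have "\<dots> \<le> 2 / p * 8"
        unfolding sum_distrib_left[symmetric] using p by (intro mult_left_mono torsion_coeff_sum_le) auto
      finally show "cmod (\<Sum>j<N. of_real (torsion_coeff j / cosh (freq p j * q)) * (- sin (of_real (freq p j) * z) * of_real (freq p j)))
          \<le> 2 / p * 8" .
    qed auto
    also have "\<dots> = 9 * p + q" using p by (simp add: power2_eq_square)
    finally show ?thesis .
  qed
  have "cmod (torsion_fun p q N (Complex x y) - torsion_fun p q N 0) \<le> (9 * p + q) * cmod (Complex x y - 0)"
    by (rule field_differentiable_bound[OF _ deriv bound])
      (use xy p q in \<open>auto simp: S_def in_cbox_complex_iff abs_le_iff\<close>)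
  then have "Re (torsion_fun p q N (Complex x y)) - Re (torsion_fun p q N 0) \<le> (9 * p + q) * cmod (Complex x y)"
    using complex_Re_le_cmod[of "torsion_fun p q N (Complex x y) - torsion_fun p q N 0"] by simp
  also have "\<dots> \<le> (9 * p + q) * (\<bar>x\<bar> + \<bar>y\<bar>)"
    using cmod_le[of "Complex x y"] p q by (intro mult_left_mono) auto
  finally have 1: "Re (torsion_fun p q N (Complex x y)) - Re (torsion_fun p q N 0) \<le> (9 * p + q) * (\<bar>x\<bar> + \<bar>y\<bar>)" .
  have "y\<^sup>2 = \<bar>y\<bar> * \<bar>y\<bar>" by (simp add: power2_eq_square)
  also have "\<dots> \<le> q * (\<bar>x\<bar> + \<bar>y\<bar>)" using xy q by (intro mult_mono) auto
  finally have "y\<^sup>2 / 2 \<le> q * (\<bar>x\<bar> + \<bar>y\<bar>)" by (smt (verit) field_sum_of_halves zero_le_power2)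
  moreover have "(9 * p + 2 * q) * (\<bar>x\<bar> + \<bar>y\<bar>) = (9 * p + q) * (\<bar>x\<bar> + \<bar>y\<bar>) + q * (\<bar>x\<bar> + \<bar>y\<bar>)"
    by (simp add: algebra_simps)
  moreover have "Complex 0 0 = 0" by (simp add: complex_eq_iff)
  ultimately show ?thesis using 1 by (simp add: potential_def)
qed

lemma torsion_approx:
  assumes p: "p > 0" and q: "q > 0" and e: "e > 0"
  shows "\<exists>F. small_on_boundary p q e F \<and> \<bar>potential F (0, 0) + torsion_max p q\<bar> \<le> e \<and>
    (\<forall>x y. \<bar>x\<bar> \<le> p \<longrightarrow> \<bar>y\<bar> \<le> q \<longrightarrow> potential F (x, y) \<le> potential F (0, 0) + (9 * p + 2 * q) * (\<bar>x\<bar> + \<bar>y\<bar>))"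
proof -
  obtain N0 where N0: "\<And>N s. N \<ge> N0 \<Longrightarrow> s \<in> {0..pi} \<Longrightarrow> \<bar>sine_sum 3 N s - pi / 8 * s * (pi - s)\<bar> \<le> e / (2 * p\<^sup>2)"
  proof -
    have "e / (2 * p\<^sup>2) > 0" using e p by simp
    from parabola_series_uniform[OF this] show ?thesis using that by blast
  qed
  have "(\<lambda>N. \<Sum>j<N. torsion_coeff j / cosh (freq p j * q)) \<longlonglongrightarrow> (\<Sum>j. torsion_coeff j / cosh (freq p j * q))"
    by (rule summable_LIMSEQ[OF summable_torsion_max])
  then have "(\<lambda>N. p\<^sup>2 / 2 * (1 - (\<Sum>j<N. torsion_coeff j / cosh (freq p j * q)))) \<longlonglongrightarrow> torsion_max p q"
    unfolding torsion_max_def by (intro tendsto_intros)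
  from LIMSEQ_D[OF this e] obtain N1 where
    N1: "\<And>N. N \<ge> N1 \<Longrightarrow> \<bar>p\<^sup>2 / 2 * (1 - (\<Sum>j<N. torsion_coeff j / cosh (freq p j * q))) - torsion_max p q\<bar> < e"
    by auto
  define N where "N = max N0 N1"
  have "small_on_boundary p q (2 * p\<^sup>2 * (e / (2 * p\<^sup>2))) (torsion_fun p q N)"
    by (rule torsion_fun_boundary[OF p q N0]) (auto simp: N_def)
  then have "small_on_boundary p q e (torsion_fun p q N)" using p by simp
  moreover have "potential (torsion_fun p q N) (0, 0) = - (p\<^sup>2 / 2 * (1 - (\<Sum>j<N. torsion_coeff j / cosh (freq p j * q))))"
    by (simp add: potential_torsion_fun algebra_simps)
  then have "\<bar>potential (torsion_fun p q N) (0, 0) + torsion_max p q\<bar> \<le> e"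
    using N1[of N] by (simp add: N_def)
  ultimately show ?thesis using potential_torsion_lipschitz[OF p q] by blast
qed

text \<open>The two sides are different series. They agree because approximate torsion functions of
  a rectangle and of its quarter turn have nearly the same center value.\<close>

lemma torsion_max_commute:
  assumes p: "p > 0" and q: "q > 0"
  shows "torsion_max p q = torsion_max q p"
proof -
  have "\<bar>torsion_max p q - torsion_max q p\<bar> \<le> e" if e: "e > 0" for e
  proof -
    obtain F where F: "small_on_boundary p q (e / 4) F" "\<bar>potential F (0, 0) + torsion_max p q\<bar> \<le> e / 4"
      using torsion_approx[OF p q, of "e / 4"] e by auto
    obtain G where G: "small_on_boundary q p (e / 4) G" "\<bar>potential G (0, 0) + torsion_max q p\<bar> \<le> e / 4"
      using torsion_approx[OF q p, of "e / 4"] e by auto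
    have "\<bar>potential F (0, 0) - potential (\<lambda>z. z\<^sup>2 / 2 + G (\<i> * z)) (0, 0)\<bar> \<le> 2 * (e / 4)"
      by (rule potential_center_unique[OF F(1) small_on_boundary_rotate(1)[OF G(1)] p q])
    moreover have "potential (\<lambda>z. z\<^sup>2 / 2 + G (\<i> * z)) (0, 0) = potential G (0, 0)"
      using small_on_boundary_rotate(2)[OF G(1), of 0 0] by simp
    ultimately show ?thesis using F(2) G(2) by linarith
  qed
  then have "\<bar>torsion_max p q - torsion_max q p\<bar> \<le> 0" by (rule field_le_epsilon[of _ 0, simplified])
  then show ?thesis by simp
qed

section \<open>The maximal torsion as a concave function of the side ratio r = a^2\<close>

subsection \<open>The torsion of rectangles of unit area\<close>

definition square_freq :: "nat \<Rightarrow> real" where "square_freq j = (2 * real j + 1) * pi / 2"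

text \<open>The factor r is kept inside the sum because the second derivative of r f(k/r) has the
  simple form (k^2/r^3) f''(k/r).\<close>

definition rect_torsion_approx :: "nat \<Rightarrow> real \<Rightarrow> real" where
  "rect_torsion_approx N r = (r - (\<Sum>j<N. torsion_coeff j * (r / cosh (square_freq j / r)))) / 8"

definition rect_torsion :: "real \<Rightarrow> real" where
  "rect_torsion r = (r - (\<Sum>j. torsion_coeff j * (r / cosh (square_freq j / r)))) / 8"

lemma rect_torsion_eq: "a > 0 \<Longrightarrow> torsion_max (a / 2) (1 / (2 * a)) = rect_torsion (a\<^sup>2)"
proof -
  assume a: "a > 0"
  have f: "freq (a / 2) j * (1 / (2 * a)) = square_freq j / a\<^sup>2" for j
    using a by (simp add: freq_def square_freq_def power2_eq_square)
  have "(\<Sum>j. torsion_coeff j * (a\<^sup>2 / cosh (square_freq j / a\<^sup>2))) =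
      a\<^sup>2 * (\<Sum>j. torsion_coeff j / cosh (square_freq j / a\<^sup>2))"
    using suminf_mult[OF summable_torsion_max[of "\<lambda>j. square_freq j / a\<^sup>2"], of "a\<^sup>2"] by (simp add: mult_ac)
  then show ?thesis unfolding torsion_max_def rect_torsion_def f
    by (simp add: power2_eq_square right_diff_distrib diff_divide_distrib)
qed

lemma rect_torsion_inverse:
  assumes r: "r > 0"
  shows "rect_torsion (1 / r) = rect_torsion r"
proof -
  define a where "a = sqrt r"
  have a: "a > 0" "a\<^sup>2 = r" using r by (auto simp: a_def)
  have "rect_torsion r = torsion_max (a / 2) (1 / (2 * a))" using rect_torsion_eq[OF a(1)] a(2) by simp
  also have "\<dots> = torsion_max (1 / (2 * a)) (a / 2)" using a by (intro torsion_max_commute) auto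
  also have "\<dots> = torsion_max ((1 / a) / 2) (1 / (2 * (1 / a)))" by (simp add: mult.commute)
  also have "\<dots> = rect_torsion ((1 / a)\<^sup>2)" using a by (intro rect_torsion_eq) auto
  also have "(1 / a)\<^sup>2 = 1 / r" using a by (simp add: power_divide)
  finally show ?thesis by simp
qed

lemma rect_torsion_limit: "r > 0 \<Longrightarrow> (\<lambda>N. rect_torsion_approx N r) \<longlonglongrightarrow> rect_torsion r"
  unfolding rect_torsion_approx_def rect_torsion_def
  using summable_mult[OF summable_torsion_max[of "\<lambda>j. square_freq j / r"], of r]
  by (intro tendsto_intros summable_LIMSEQ) (simp_all add: mult_ac)

lemma cosh_ge_half_square: "x\<^sup>2 / 2 \<le> cosh (x::real)" and cosh_ge_quartic: "1 + x\<^sup>2 / 2 + x ^ 4 / 24 \<le> cosh (x::real)"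
proof -
  have s: "(\<lambda>n. if even n then x ^ n /\<^sub>R fact n else 0) sums cosh x" by (rule cosh_converges)
  have five: "{..<5} = {0, 1, 2, 3, 4::nat}" by auto
  have "(\<Sum>n<5. if even n then x ^ n /\<^sub>R fact n else 0) \<le> (\<Sum>n. if even n then x ^ n /\<^sub>R fact n else 0)"
    using s by (intro sum_le_suminf sums_summable) (auto simp: zero_le_even_power)
  also have "\<dots> = cosh x" using s by (simp add: sums_iff)
  finally show *: "1 + x\<^sup>2 / 2 + x ^ 4 / 24 \<le> cosh x" unfolding five by (simp add: fact_numeral field_simps)
  have "0 \<le> x ^ 4" by simp
  then show "x\<^sup>2 / 2 \<le> cosh x" using * by linarith
qed

lemma inverse_squares_sum_le: "(\<Sum>j = 1..<N. 1 / (real j)\<^sup>2) \<le> 2"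
proof -
  have "(\<Sum>j = 1..<Suc (Suc n). 1 / (real j)\<^sup>2) \<le> 2 - 1 / real (Suc n)" for n
  proof (induction n)
    case (Suc n)
    have "1 / (real (Suc (Suc n)))\<^sup>2 \<le> 1 / (real (Suc n) * real (Suc (Suc n)))"
      by (intro frac_le) (auto simp: power2_eq_square)
    also have "\<dots> = 1 / real (Suc n) - 1 / real (Suc (Suc n))" by (simp add: field_simps)
    finally show ?case using Suc by (simp add: sum.atLeastLessThan_Suc)
  qed simp
  note * = this
  show ?thesis
  proof (cases "N \<le> 1")
    case False
    then obtain n where n: "N = Suc (Suc n)" by (metis One_nat_def not_less_eq_eq old.nat.exhaust le0)
    have "0 \<le> 1 / real (Suc n)" by simp
    then show ?thesis using *[of n] unfolding n by linarith
  qed simp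
qed

text \<open>The second derivative of the hyperbolic secant.\<close>

definition sech_deriv2 :: "real \<Rightarrow> real" where "sech_deriv2 s = 1 / cosh s - 2 / cosh s ^ 3"

lemma sech_deriv2_bounds: "\<bar>sech_deriv2 s\<bar> \<le> 1 / cosh s" "cosh s \<ge> 2 \<Longrightarrow> 1 / (2 * cosh s) \<le> sech_deriv2 s"
proof -
  define t where "t = 1 / cosh s"
  have t: "0 < t" "t \<le> 1" using cosh_real_ge_1[of s] by (auto simp: t_def)
  have eq: "sech_deriv2 s = t * (1 - 2 * t\<^sup>2)" by (simp add: sech_deriv2_def t_def power3_eq_cube power2_eq_square algebra_simps)
  have "t\<^sup>2 \<le> 1" using t by (simp add: power_le_one)
  moreover have "0 \<le> t\<^sup>2" by simp
  ultimately have "\<bar>1 - 2 * t\<^sup>2\<bar> \<le> 1" by linarith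
  then have "t * \<bar>1 - 2 * t\<^sup>2\<bar> \<le> t * 1" using t by (intro mult_left_mono) auto
  then show "\<bar>sech_deriv2 s\<bar> \<le> 1 / cosh s" unfolding eq using t by (simp add: abs_mult t_def[symmetric])
  assume "cosh s \<ge> 2"
  then have "t \<le> 1 / 2" unfolding t_def by (intro frac_le) auto
  then have "t\<^sup>2 \<le> (1 / 2)\<^sup>2" using t by (intro power_mono) auto
  then have "t * (1 / 2) \<le> t * (1 - 2 * t\<^sup>2)" using t by (intro mult_left_mono) (auto simp: power2_eq_square)
  then show "1 / (2 * cosh s) \<le> sech_deriv2 s" unfolding eq by (simp add: t_def)
qed

lemma scaled_sech_deriv:
  assumes r: "r > (0::real)"
  shows "((\<lambda>r. r / cosh (k / r)) has_real_derivative (1 / cosh (k / r) + k / r * sinh (k / r) / (cosh (k / r))\<^sup>2)) (at r)"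
    and "((\<lambda>r. 1 / cosh (k / r) + k / r * sinh (k / r) / (cosh (k / r))\<^sup>2) has_real_derivative
      (k / r)\<^sup>2 / r * sech_deriv2 (k / r)) (at r)"
proof -
  have c: "cosh x \<noteq> 0" "cosh x > 0" for x :: real using cosh_real_pos[of x] by auto
  show "((\<lambda>r. r / cosh (k / r)) has_real_derivative (1 / cosh (k / r) + k / r * sinh (k / r) / (cosh (k / r))\<^sup>2)) (at r)"
    using r c by (auto intro!: derivative_eq_intros simp: field_simps power2_eq_square)
  have sc: "sinh (k / r) * sinh (k / r) = cosh (k / r) * cosh (k / r) - 1"
    using cosh_square_eq[of "k / r"] by (simp add: power2_eq_square)
  show "((\<lambda>r. 1 / cosh (k / r) + k / r * sinh (k / r) / (cosh (k / r))\<^sup>2) has_real_derivative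
      (k / r)\<^sup>2 / r * sech_deriv2 (k / r)) (at r)"
  proof (rule DERIV_cong)
    define C S where "C = cosh (k / r)" and "S = sinh (k / r)"
    have C: "C \<noteq> 0" using c by (simp add: C_def)
    show "((\<lambda>r. 1 / cosh (k / r) + k / r * sinh (k / r) / (cosh (k / r))\<^sup>2) has_real_derivative
       (k / r\<^sup>2 * S / C\<^sup>2 + ((- (k / r\<^sup>2) * S + k / r * (C * (- (k / r\<^sup>2)))) * C\<^sup>2 - k / r * S * (2 * C * (S * (- (k / r\<^sup>2))))) / (C\<^sup>2)\<^sup>2)) (at r)"
      using r c unfolding C_def S_def
      by (auto intro!: derivative_eq_intros simp: field_simps power2_eq_square)
    have "S * S = C * C - 1" using sc by (simp add: C_def S_def)
    then have SS: "C * (S * S) = C * C\<^sup>2 - C" unfolding power2_eq_square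
      by (metis mult.right_neutral right_diff_distrib)
    have "2 * x * y * (C * (S * S)) - x * y * (C * C\<^sup>2) = x * y * (C * C\<^sup>2 - 2 * C)" for x y
      unfolding SS by (simp add: algebra_simps)
    note this[of "k / r" "k / r\<^sup>2"]
    moreover have "k / r\<^sup>2 * S / C\<^sup>2 + ((- (k / r\<^sup>2) * S + k / r * (C * (- (k / r\<^sup>2)))) * C\<^sup>2 - k / r * S * (2 * C * (S * (- (k / r\<^sup>2))))) / (C\<^sup>2)\<^sup>2
       = (2 * (k / r) * (k / r\<^sup>2) * (C * (S * S)) - k / r * (k / r\<^sup>2) * (C * C\<^sup>2)) / (C\<^sup>2)\<^sup>2"
      using C r by (simp add: field_simps power2_eq_square)
    moreover have "k / r * (k / r\<^sup>2) * (C * C\<^sup>2 - 2 * C) / (C\<^sup>2)\<^sup>2 = (k / r)\<^sup>2 / r * (1 / C - 2 / C ^ 3)"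
      using C r by (simp add: field_simps power2_eq_square power3_eq_cube)
    ultimately show "k / r\<^sup>2 * S / C\<^sup>2 + ((- (k / r\<^sup>2) * S + k / r * (C * (- (k / r\<^sup>2)))) * C\<^sup>2 - k / r * S * (2 * C * (S * (- (k / r\<^sup>2))))) / (C\<^sup>2)\<^sup>2
       = (k / r)\<^sup>2 / r * sech_deriv2 (k / r)" by (simp add: sech_deriv2_def C_def)
  qed
qed

definition rect_torsion_deriv2 :: "nat \<Rightarrow> real \<Rightarrow> real" where
  "rect_torsion_deriv2 N r = (\<Sum>j<N. torsion_coeff j * ((square_freq j / r)\<^sup>2 / r * sech_deriv2 (square_freq j / r)))"

lemma rect_torsion_approx_deriv:
  assumes "r > 0"
  shows "\<exists>f'. \<forall>r>0. ((\<lambda>r. - 8 * rect_torsion_approx N r) has_real_derivative f' r) (at r) \<and>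
    (f' has_real_derivative rect_torsion_deriv2 N r) (at r)"
proof -
  define f' where "f' = (\<lambda>r. (\<Sum>j<N. torsion_coeff j * (1 / cosh (square_freq j / r) +
      square_freq j / r * sinh (square_freq j / r) / (cosh (square_freq j / r))\<^sup>2)) - 1)"
  have "((\<lambda>r. (\<Sum>j<N. torsion_coeff j * (r / cosh (square_freq j / r))) - r) has_real_derivative f' r) (at r)" if "r > 0" for r
    unfolding f'_def by (intro DERIV_diff DERIV_sum DERIV_cmult scaled_sech_deriv that DERIV_ident)
  moreover have "(\<lambda>r. - 8 * rect_torsion_approx N r) = (\<lambda>r. (\<Sum>j<N. torsion_coeff j * (r / cosh (square_freq j / r))) - r)"
    by (simp add: rect_torsion_approx_def fun_eq_iff)
  moreover have "(f' has_real_derivative rect_torsion_deriv2 N r - 0) (at r)" if "r > 0" for r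
    unfolding f'_def rect_torsion_deriv2_def by (intro DERIV_diff DERIV_sum DERIV_cmult scaled_sech_deriv that DERIV_const)
  ultimately show ?thesis by (intro exI[of _ f']) simp
qed

text \<open>The term with j = 0 alone gives at least half of its size computed with 1/cosh s in
  place of the second derivative. The alternating tail is at most a quarter of that, since the
  argument of cosh grows with j.\<close>

lemma rect_torsion_deriv2_ge:
  assumes N: "N \<ge> 1" and r: "0 < r" "r \<le> 10 / 9"
  defines "s \<equiv> pi / (2 * r)"
  shows "torsion_coeff 0 * (s\<^sup>2 / r) / (4 * cosh s) \<le> rect_torsion_deriv2 N r"
proof -
  \<comment> \<open>The bound 10/9 on r enters here. With pi > 3 it gives s >= 1.35, just enough for
    cosh s >= 2, where the second derivative of sech is positive and comparable to sech.\<close>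
  have sr: "27 / 20 \<le> s"
  proof -
    have "27 / 20 = 3 / (2 * (10 / 9 :: real))" by simp
    also have "\<dots> \<le> pi / (2 * (10/9))" using pi_gt3 by (intro divide_right_mono) auto
    also have "\<dots> \<le> s" unfolding s_def using r by (intro divide_left_mono) auto
    finally show ?thesis .
  qed
  have s2: "(27/20)\<^sup>2 \<le> s\<^sup>2" using sr by (intro power_mono) auto
  have c2: "cosh s \<ge> 2"
  proof -
    have "(27/20) ^ 4 \<le> s ^ 4" using sr by (intro power_mono) auto
    then show ?thesis using cosh_ge_quartic[of s] s2 by (simp add: power2_eq_square eval_nat_numeral)
  qed
  define b where "b = torsion_coeff 0"
  have b: "b > 0" by (simp add: b_def torsion_coeff_def)
  define T where "T = (\<lambda>j. torsion_coeff j * ((square_freq j / r)\<^sup>2 / r * sech_deriv2 (square_freq j / r)))"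
  have sf: "square_freq j / r = (2 * real j + 1) * s" for j using r by (simp add: square_freq_def s_def)
  have tail: "\<bar>T j\<bar> \<le> b * (s\<^sup>2 / r) / cosh s * (1 / 10 * (1 / (real j)\<^sup>2))" if j: "j \<ge> 1" for j
  proof -
    define k where "k = 2 * real j + 1"
    have k: "k \<ge> 3" using j by (simp add: k_def)
    have "cosh (k * s) = cosh s * cosh (2 * real j * s) + sinh s * sinh (2 * real j * s)"
      using cosh_add[of s "2 * real j * s"] by (simp add: k_def algebra_simps)
    moreover have "0 \<le> sinh s * sinh (2 * real j * s)" using sr by simp
    moreover have "cosh s * ((2 * real j * s)\<^sup>2 / 2) \<le> cosh s * cosh (2 * real j * s)"
      by (intro mult_left_mono cosh_ge_half_square) auto
    moreover have "cosh s * ((2 * real j * s)\<^sup>2 / 2) = cosh s * (2 * (real j)\<^sup>2 * s\<^sup>2)"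
      by (simp add: power2_eq_square)
    ultimately have "cosh s * (2 * (real j)\<^sup>2 * s\<^sup>2) \<le> cosh (k * s)" by linarith
    moreover have "cosh s * (2 * (real j)\<^sup>2 * (27/20)\<^sup>2) \<le> cosh s * (2 * (real j)\<^sup>2 * s\<^sup>2)"
      using s2 by (intro mult_left_mono) auto
    ultimately have ck: "cosh s * (2 * (real j)\<^sup>2 * (27/20)\<^sup>2) \<le> cosh (k * s)" by linarith
    have "k * cosh (k * s) \<ge> 3 * (cosh s * (2 * (real j)\<^sup>2 * (27/20)\<^sup>2))"
      using k ck by (intro mult_mono) auto
    moreover have "10 * (cosh s * (real j)\<^sup>2) \<le> 3 * (cosh s * (2 * (real j)\<^sup>2 * (27/20)\<^sup>2))"
    proof -
      have "0 \<le> cosh s * (real j)\<^sup>2" by simp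
      then show ?thesis by (simp add: power2_eq_square)
    qed
    ultimately have kc: "10 * (cosh s * (real j)\<^sup>2) \<le> k * cosh (k * s)" by linarith
    have "\<bar>T j\<bar> = b / k ^ 3 * ((k * s)\<^sup>2 / r) * \<bar>sech_deriv2 (k * s)\<bar>"
      using r b k unfolding T_def sf by (simp add: k_def[symmetric] torsion_coeff_def b_def abs_mult)
    also have "\<dots> \<le> b / k ^ 3 * ((k * s)\<^sup>2 / r) * (1 / cosh (k * s))"
      using r b k by (intro mult_left_mono sech_deriv2_bounds) auto
    also have "\<dots> = b * (s\<^sup>2 / r) * (1 / (k * cosh (k * s)))"
      using k by (simp add: power2_eq_square power3_eq_cube)
    also have "\<dots> \<le> b * (s\<^sup>2 / r) * (1 / (10 * (cosh s * (real j)\<^sup>2)))"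
      using r b kc j by (intro mult_left_mono divide_left_mono) (auto intro!: mult_pos_pos simp: k_def add_pos_pos)
    also have "\<dots> = b * (s\<^sup>2 / r) / cosh s * (1 / 10 * (1 / (real j)\<^sup>2))" by simp
    finally show ?thesis .
  qed
  have "{..<N} = insert 0 {1..<N}" using N by auto
  then have split: "rect_torsion_deriv2 N r = T 0 + (\<Sum>j = 1..<N. T j)"
    by (simp add: rect_torsion_deriv2_def T_def)
  have "\<bar>\<Sum>j = 1..<N. T j\<bar> \<le> (\<Sum>j = 1..<N. b * (s\<^sup>2 / r) / cosh s * (1 / 10 * (1 / (real j)\<^sup>2)))"
    by (rule order_trans[OF sum_abs]) (intro sum_mono tail, auto)
  also have "\<dots> = b * (s\<^sup>2 / r) / cosh s * (1 / 10 * (\<Sum>j = 1..<N. 1 / (real j)\<^sup>2))"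
    by (simp add: sum_distrib_left)
  also have "\<dots> \<le> b * (s\<^sup>2 / r) / cosh s * (1 / 10 * 2)"
    using b r by (intro mult_left_mono inverse_squares_sum_le) auto
  also have "\<dots> \<le> b * (s\<^sup>2 / r) / cosh s * (1 / 4)" using b r by (intro mult_left_mono) auto
  finally have 1: "\<bar>\<Sum>j = 1..<N. T j\<bar> \<le> b * (s\<^sup>2 / r) / cosh s * (1 / 4)" .
  have "b * (s\<^sup>2 / r) / cosh s * (1 / 2) = b * (s\<^sup>2 / r * (1 / (2 * cosh s)))" by simp
  also have "\<dots> \<le> b * (s\<^sup>2 / r * sech_deriv2 s)"
    using b r by (intro mult_left_mono sech_deriv2_bounds c2) auto
  also have "\<dots> = T 0" unfolding T_def sf by (simp add: b_def)
  finally have 2: "b * (s\<^sup>2 / r) / cosh s * (1 / 2) \<le> T 0" .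
  have "X \<le> y + z" if "X = u * (1 / 2) - u * (1 / 4)" "\<bar>z\<bar> \<le> u * (1 / 4)" "u * (1 / 2) \<le> y" for X u y z :: real
    using that by linarith
  note * = this
  show ?thesis unfolding split by (rule *[OF _ 1 2]) (simp add: b_def)
qed

lemma convex_rect_torsion_approx:
  assumes N: "N \<ge> 1" and C: "convex C" "C \<subseteq> {0<..10/9}" and m: "\<And>r. r \<in> C \<Longrightarrow> 16 * m \<le> rect_torsion_deriv2 N r"
  shows "convex_on C (\<lambda>r. - rect_torsion_approx N r - m * r\<^sup>2)"
proof -
  obtain f' where f': "\<And>r. r > 0 \<Longrightarrow> ((\<lambda>r. - 8 * rect_torsion_approx N r) has_real_derivative f' r) (at r)"
    "\<And>r. r > 0 \<Longrightarrow> (f' has_real_derivative rect_torsion_deriv2 N r) (at r)"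
    using rect_torsion_approx_deriv[of 1 N] by auto
  have "convex_on C (\<lambda>r. (- 8 * rect_torsion_approx N r) / 8 - m * r\<^sup>2)"
  proof (rule f''_ge0_imp_convex[OF C(1)])
    fix r assume r: "r \<in> C"
    then have r0: "r > 0" using C by auto
    show "((\<lambda>r. (- 8 * rect_torsion_approx N r) / 8 - m * r\<^sup>2) has_real_derivative (f' r / 8 - m * (2 * r))) (at r)"
      by (intro DERIV_diff DERIV_cdivide f' r0 DERIV_cmult) (auto intro!: derivative_eq_intros)
    show "((\<lambda>r. f' r / 8 - m * (2 * r)) has_real_derivative (rect_torsion_deriv2 N r / 8 - m * 2)) (at r)"
      by (intro DERIV_diff DERIV_cdivide f' r0 DERIV_cmult) (auto intro!: derivative_eq_intros)
    show "0 \<le> rect_torsion_deriv2 N r / 8 - m * 2" using m[OF r] by simp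
  qed
  then show ?thesis by simp
qed

text \<open>Convexity of the truncated sums, with constants independent of \<open>N\<close>,
  survives the pointwise limit. In this way the infinite series is never differentiated.\<close>

lemma rect_torsion_convex_combination:
  assumes C: "convex C" "C \<subseteq> {0<..10/9}" and m: "\<And>N r. N \<ge> 1 \<Longrightarrow> r \<in> C \<Longrightarrow> 16 * m \<le> rect_torsion_deriv2 N r"
    and xy: "x \<in> C" "y \<in> C" and t: "0 \<le> t" "t \<le> 1"
  shows "- rect_torsion ((1 - t) * x + t * y) - m * ((1 - t) * x + t * y)\<^sup>2 \<le>
    (1 - t) * (- rect_torsion x - m * x\<^sup>2) + t * (- rect_torsion y - m * y\<^sup>2)"
proof (rule LIMSEQ_le)
  have z: "(1 - t) * x + t * y \<in> C" using convexD_alt[OF C(1) xy t] by simp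
  then have pos: "x > 0" "y > 0" "(1 - t) * x + t * y > 0" using C(2) xy by auto
  show "(\<lambda>N. - rect_torsion_approx N ((1 - t) * x + t * y) - m * ((1 - t) * x + t * y)\<^sup>2) \<longlonglongrightarrow>
      - rect_torsion ((1 - t) * x + t * y) - m * ((1 - t) * x + t * y)\<^sup>2"
    by (intro tendsto_diff tendsto_minus tendsto_const rect_torsion_limit pos)
  show "(\<lambda>N. (1 - t) * (- rect_torsion_approx N x - m * x\<^sup>2) + t * (- rect_torsion_approx N y - m * y\<^sup>2)) \<longlonglongrightarrow>
      (1 - t) * (- rect_torsion x - m * x\<^sup>2) + t * (- rect_torsion y - m * y\<^sup>2)"
    by (intro tendsto_add tendsto_mult tendsto_diff tendsto_minus tendsto_const rect_torsion_limit pos)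
  have "- rect_torsion_approx N ((1 - t) * x + t * y) - m * ((1 - t) * x + t * y)\<^sup>2 \<le>
      (1 - t) * (- rect_torsion_approx N x - m * x\<^sup>2) + t * (- rect_torsion_approx N y - m * y\<^sup>2)" if "N \<ge> 1" for N
    using convex_onD[OF convex_rect_torsion_approx[OF that C m[OF that]] t xy] by simp
  then show "\<exists>n0. \<forall>N\<ge>n0. - rect_torsion_approx N ((1 - t) * x + t * y) - m * ((1 - t) * x + t * y)\<^sup>2 \<le>
      (1 - t) * (- rect_torsion_approx N x - m * x\<^sup>2) + t * (- rect_torsion_approx N y - m * y\<^sup>2)" by blast
qed

text \<open>
  Near the square, \<open>1\<close> is a convex combination of \<open>r\<close> and \<open>1/r\<close>, where the torsion takes the same
  value; strong concavity gives the quadratic gap. Further away concavity suffices.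
\<close>

lemma rect_torsion_gap: "\<exists>c>0. \<forall>r. 0 < r \<longrightarrow> r \<le> 1 \<longrightarrow> c * (1 - r)\<^sup>2 \<le> rect_torsion 1 - rect_torsion r"
proof -
  \<comment> \<open>For r in [9/10, 10/9] the second derivative is at least (1/2) / (4 * 27) =
    1/216, using cosh s <= exp 3 <= 27.\<close>
  define m :: real where "m = 1 / 16 / 216"
  have b: "1 / 2 \<le> torsion_coeff 0"
  proof -
    have "pi ^ 3 \<le> 4 ^ 3" using pi_less_4 by (intro power_mono) auto
    then show ?thesis by (simp add: torsion_coeff_def field_simps)
  qed
  have weak: "16 * 0 \<le> rect_torsion_deriv2 N r" if "N \<ge> 1" "r \<in> {0<..10/9}" for N r
  proof -
    have "0 \<le> torsion_coeff 0 * ((pi / (2 * r))\<^sup>2 / r) / (4 * cosh (pi / (2 * r)))"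
      using b that by simp
    then show ?thesis using rect_torsion_deriv2_ge[of N r] that by auto
  qed
  have strong: "16 * m \<le> rect_torsion_deriv2 N r" if N: "N \<ge> 1" and r: "r \<in> {9/10..10/9}" for N r
  proof -
    define s where "s = pi / (2 * r)"
    have "3 / (2 * (10/9)) \<le> s" unfolding s_def using r pi_gt3 by (intro frac_le) auto
    then have sr: "27/20 \<le> s" by simp
    have "s \<le> 4 / (2 * (9/10))" unfolding s_def using r pi_less_4 by (intro frac_le) auto
    then have s3: "s \<le> 3" by simp
    have "cosh s \<le> exp s" using sr by (simp add: cosh_def field_simps)
    also have "\<dots> \<le> exp (1 + 1 + 1)" using s3 by simp
    also have "\<dots> \<le> 3 * 3 * 3" unfolding exp_add using exp_le by (intro mult_mono) auto
    finally have cs: "cosh s \<le> 27" by simp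
    have "1 \<le> s\<^sup>2 / r"
    proof -
      have "(27/20)\<^sup>2 \<le> s\<^sup>2" using sr by (intro power_mono) auto
      then show ?thesis using r by (simp add: power2_eq_square pos_le_divide_eq)
    qed
    then have half: "1 / 2 * 1 \<le> torsion_coeff 0 * (s\<^sup>2 / r)" using b by (intro mult_mono) auto
    have "(1 / 2) / (4 * 27) \<le> torsion_coeff 0 * (s\<^sup>2 / r) / (4 * cosh s)"
    proof (rule frac_le)
      show "0 \<le> torsion_coeff 0 * (s\<^sup>2 / r)" "1 / 2 \<le> torsion_coeff 0 * (s\<^sup>2 / r)" using half by linarith+
      show "0 < 4 * cosh s" using cosh_real_pos[of s] by simp
      show "4 * cosh s \<le> 4 * 27" using cs by simp
    qed
    also have "\<dots> \<le> rect_torsion_deriv2 N r" using rect_torsion_deriv2_ge[OF N, of r] r by (simp add: s_def)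
    finally show ?thesis by (simp add: m_def)
  qed
  have near: "m * (1 - r)\<^sup>2 \<le> rect_torsion 1 - rect_torsion r" if r: "9/10 \<le> r" "r \<le> 1" for r
  proof -
    \<comment> \<open>The weight for which (1 - t) r + t / r = 1.\<close>
    define t where "t = r / (1 + r)"
    have t: "0 \<le> t" "t \<le> 1" "1 - t = 1 / (1 + r)" using r by (auto simp: t_def field_simps)
    have one: "(1 - t) * r + t * (1 / r) = 1" unfolding t(3) using r by (simp add: t_def field_simps)
    have "1 / r \<le> 10 / 9" using r by (simp add: field_simps)
    moreover have "9 / 10 \<le> 1 / r" using r by (simp add: field_simps)
    ultimately have "- rect_torsion 1 - m * 1\<^sup>2 \<le>
        (1 - t) * (- rect_torsion r - m * r\<^sup>2) + t * (- rect_torsion (1 / r) - m * (1 / r)\<^sup>2)"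
      using rect_torsion_convex_combination[of "{9/10..10/9}" m r "1 / r" t, OF _ _ strong] t r unfolding one
      by (simp add: subset_eq)
    also have "\<dots> = - rect_torsion r - m * ((1 - t) * r\<^sup>2 + t * (1 / r)\<^sup>2)"
      using rect_torsion_inverse[of r] r by (simp add: algebra_simps)
    \<comment> \<open>The excess of the averaged squares over 1 is the quantity that strong
      concavity converts into a gap.\<close>
    also have "(1 - t) * r\<^sup>2 + t * (1 / r)\<^sup>2 = 1 + (1 - r)\<^sup>2 / r"
      
    proof -
      have "1 + r > 0" "r \<noteq> 0" using r by auto
      then have "1 / (1 + r) * r\<^sup>2 + r / (1 + r) * (1 / r)\<^sup>2 = (r ^ 3 + 1) / (r * (1 + r))"
        by (simp add: divide_simps power2_eq_square power3_eq_cube)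
      also have "r ^ 3 + 1 = (r + (1 - r)\<^sup>2) * (1 + r)" by (simp add: power2_eq_square power3_eq_cube algebra_simps)
      also have "(r + (1 - r)\<^sup>2) * (1 + r) / (r * (1 + r)) = 1 + (1 - r)\<^sup>2 / r"
        using \<open>1 + r > 0\<close> \<open>r \<noteq> 0\<close> by (simp add: add_divide_distrib)
      finally show ?thesis unfolding t(3) by (simp add: t_def)
    qed
    finally have "m * ((1 - r)\<^sup>2 / r) \<le> rect_torsion 1 - rect_torsion r" by (simp add: algebra_simps)
    moreover have "m * (1 - r)\<^sup>2 \<le> m * ((1 - r)\<^sup>2 / r)"
      using r by (intro mult_left_mono) (auto simp: m_def pos_le_divide_eq mult_left_le)
    ultimately show ?thesis by linarith
  qed
  have far: "m / 10 * (1 - r)\<^sup>2 \<le> rect_torsion 1 - rect_torsion r" if r: "0 < r" "r < 9/10" for r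
  proof -
    \<comment> \<open>Places 9/10 between r and 1, so that the gap already known at 9/10 spreads to
      r by concavity.\<close>
    define t where "t = (9/10 - r) / (1 - r)"
    have t: "0 \<le> t" "t \<le> 1" "1 - t = (1/10) / (1 - r)" using r by (auto simp: t_def field_simps)
    have "(1 - t) * (1 - r) = 1 / 10" unfolding t(3) using r by simp
    then have e: "(1 - t) * r + t * 1 = 9/10" by (simp add: algebra_simps)
    have "- rect_torsion (9/10) - 0 * (9/10)\<^sup>2 \<le> (1 - t) * (- rect_torsion r - 0 * r\<^sup>2) + t * (- rect_torsion 1 - 0 * 1\<^sup>2)"
      using rect_torsion_convex_combination[of "{0<..10/9}" 0 r 1 t, OF _ _ weak] t r unfolding e by auto
    then have "rect_torsion 1 - rect_torsion (9/10) \<le> (1 - t) * (rect_torsion 1 - rect_torsion r)"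
      by (simp add: algebra_simps)
    moreover have "m / 100 \<le> rect_torsion 1 - rect_torsion (9/10)" using near[of "9/10"] by (simp add: power2_eq_square)
    ultimately have "m / 100 \<le> (1/10) / (1 - r) * (rect_torsion 1 - rect_torsion r)" unfolding t(3) by linarith
    then have "m / 10 * (1 - r) \<le> rect_torsion 1 - rect_torsion r" using r by (simp add: field_simps)
    moreover have "m / 10 * (1 - r)\<^sup>2 \<le> m / 10 * (1 - r)"
      using r by (intro mult_left_mono) (auto simp: m_def power2_eq_square mult_left_le)
    ultimately show ?thesis by linarith
  qed
  have "m / 10 * (1 - r)\<^sup>2 \<le> rect_torsion 1 - rect_torsion r" if r: "0 < r" "r \<le> 1" for r
  proof (cases "r < 9/10")
    case False
    have "m / 10 * (1 - r)\<^sup>2 \<le> m * (1 - r)\<^sup>2" by (intro mult_right_mono) (auto simp: m_def)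
    then show ?thesis using near[of r] False r by auto
  qed (use far r in auto)
  then show ?thesis by (intro exI[of _ "m / 10"]) (auto simp: m_def)
qed

text \<open>For a > 1 the gap is applied to 1/a^2. The quotient on the left is bounded both by (1 -
  r)^2 and by (1 - 1/r)^2, where r = a^2.\<close>

lemma torsion_gap: "\<exists>c>0. \<forall>a>0. c * ((a\<^sup>2 - 1)\<^sup>2 / (1 + a ^ 4)) \<le>
    torsion_max (1 / 2) (1 / 2) - torsion_max (a / 2) (1 / (2 * a))"
proof -
  obtain c where c: "c > 0" "\<And>r. 0 < r \<Longrightarrow> r \<le> 1 \<Longrightarrow> c * (1 - r)\<^sup>2 \<le> rect_torsion 1 - rect_torsion r"
    using rect_torsion_gap by blast
  have "c * ((a\<^sup>2 - 1)\<^sup>2 / (1 + a ^ 4)) \<le> torsion_max (1 / 2) (1 / 2) - torsion_max (a / 2) (1 / (2 * a))" if a: "a > 0" for a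
  proof -
    define r where "r = a\<^sup>2"
    have r: "r > 0" "a ^ 4 = r\<^sup>2" using a by (auto simp: r_def power_mult[symmetric])
    have t: "torsion_max (1 / 2) (1 / 2) = rect_torsion 1" "torsion_max (a / 2) (1 / (2 * a)) = rect_torsion r"
      using rect_torsion_eq[of 1] rect_torsion_eq[OF a] by (auto simp: r_def)
    have "c * ((r - 1)\<^sup>2 / (1 + r\<^sup>2)) \<le> rect_torsion 1 - rect_torsion r"
    proof (cases "r \<le> 1")
      case True
      have "(r - 1)\<^sup>2 / (1 + r\<^sup>2) \<le> (r - 1)\<^sup>2 / 1" by (intro divide_left_mono) (auto simp: add_pos_nonneg)
      then have "c * ((r - 1)\<^sup>2 / (1 + r\<^sup>2)) \<le> c * (1 - r)\<^sup>2" using c(1) by (intro mult_left_mono) (auto simp: power2_commute)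
      then show ?thesis using c(2)[OF r(1) True] by linarith
    next
      case False
      have "(r - 1)\<^sup>2 / (1 + r\<^sup>2) \<le> (r - 1)\<^sup>2 / r\<^sup>2" using r by (intro divide_left_mono) (auto intro!: mult_pos_pos add_pos_nonneg)
      also have "\<dots> = (1 - 1 / r)\<^sup>2" using r by (simp add: power_divide[symmetric] diff_divide_distrib)
      finally have "c * ((r - 1)\<^sup>2 / (1 + r\<^sup>2)) \<le> c * (1 - 1 / r)\<^sup>2" using c(1) by (intro mult_left_mono) auto
      also have "\<dots> \<le> rect_torsion 1 - rect_torsion (1 / r)" using False r by (intro c(2)) auto
      finally show ?thesis using rect_torsion_inverse[OF r(1)] by simp
    qed
    then show ?thesis unfolding t r(2) r_def .
  qed
  then show ?thesis using c(1) by blast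
qed

section \<open>Trial functions, two-sided eigenvalue bounds and the conclusion\<close>

subsection \<open>Trial functions\<close>

text \<open>The product of a rescaled step and its mirror image. The constant \<open>C\<close> comes
  from the step alone, so it depends neither on the interval nor on the scale
  \<open>s\<close>.\<close>

lemma plateau_exists:
  "\<exists>C\<ge>0. \<forall>p s::real. s > 0 \<longrightarrow> (\<exists>b b'. smooth1 b \<and> (\<forall>t. (b has_real_derivative b' t) (at t)) \<and>
     (\<forall>t. 0 \<le> b t \<and> b t \<le> 1 \<and> \<bar>b' t\<bar> \<le> C * s) \<and> (\<forall>t. p - 1 / (2 * s) \<le> \<bar>t\<bar> \<longrightarrow> b t = 0) \<and>
     (\<forall>t. \<bar>t\<bar> \<le> p - 1 / s \<longrightarrow> b t = 1 \<and> b' t = 0))"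
proof -
  obtain h C where h: "smooth1 h" "\<And>t. t \<le> 0 \<Longrightarrow> h t = 0" "\<And>t. 1 \<le> t \<Longrightarrow> h t = 1" "\<And>t. 0 \<le> h t \<and> h t \<le> 1"
    and C: "\<And>t h'. (h has_real_derivative h') (at t) \<Longrightarrow> \<bar>h'\<bar> \<le> C"
    using smooth_step_exists by metis
  obtain h' where h': "\<And>t. (h has_real_derivative h' t) (at t)" using smooth1_deriv[OF h(1)] by blast
  have C0: "\<bar>h' t\<bar> \<le> C" for t using C[OF h'] .
  have "C \<ge> 0" using C0[of 0] by linarith
  have "\<exists>b b'. smooth1 b \<and> (\<forall>t. (b has_real_derivative b' t) (at t)) \<and>
     (\<forall>t. 0 \<le> b t \<and> b t \<le> 1 \<and> \<bar>b' t\<bar> \<le> (4 * C) * s) \<and> (\<forall>t. p - 1 / (2 * s) \<le> \<bar>t\<bar> \<longrightarrow> b t = 0) \<and>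
     (\<forall>t. \<bar>t\<bar> \<le> p - 1 / s \<longrightarrow> b t = 1 \<and> b' t = 0)" if s: "s > 0" for p s :: real
  proof -
    define k where "k = 2 * s * p - 1"
    define b where "b = (\<lambda>t. h (- (2 * s) * t + k) * h (2 * s * t + k))"
    define b' where "b' = (\<lambda>t. h' (- (2 * s) * t + k) * (- (2 * s)) * h (2 * s * t + k) +
        h' (2 * s * t + k) * (2 * s) * h (- (2 * s) * t + k))"
    have sb: "smooth1 b" unfolding b_def by (intro smooth1_mult smooth1_affine h(1))
    have d: "(b has_real_derivative b' t) (at t)" for t
    proof -
      have d1: "((\<lambda>t. h (- (2 * s) * t + k)) has_real_derivative h' (- (2 * s) * t + k) * (- (2 * s))) (at t)"
        by (rule DERIV_chain2[OF h']) (auto intro!: derivative_eq_intros)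
      have d2: "((\<lambda>t. h (2 * s * t + k)) has_real_derivative h' (2 * s * t + k) * (2 * s)) (at t)"
        by (rule DERIV_chain2[OF h']) (auto intro!: derivative_eq_intros)
      show ?thesis unfolding b_def b'_def by (rule DERIV_mult[OF d1 d2])
    qed
    have b01: "0 \<le> b t \<and> b t \<le> 1" for t unfolding b_def using h(4) by (auto intro: mult_le_one)
    have b'_le: "\<bar>b' t\<bar> \<le> (4 * C) * s" for t
    proof -
      have m: "\<bar>h' u * (2 * s) * h v\<bar> \<le> C * (2 * s) * 1" for u v
        unfolding abs_mult using C0 h(4)[of v] s \<open>C \<ge> 0\<close> by (intro mult_mono) auto
      have "\<bar>b' t\<bar> \<le> \<bar>h' (- (2 * s) * t + k) * (2 * s) * h (2 * s * t + k)\<bar> + \<bar>h' (2 * s * t + k) * (2 * s) * h (- (2 * s) * t + k)\<bar>"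
        unfolding b'_def by simp
      also have "\<dots> \<le> C * (2 * s) * 1 + C * (2 * s) * 1" by (intro add_mono m)
      finally show ?thesis by simp
    qed
    have b0: "b t = 0" if "p - 1 / (2 * s) \<le> \<bar>t\<bar>" for t
    proof -
      have "2 * s * (p - 1 / (2 * s)) \<le> 2 * s * \<bar>t\<bar>" using that s by (intro mult_left_mono) auto
      moreover have "2 * s * (p - 1 / (2 * s)) = k" using s by (simp add: k_def right_diff_distrib)
      ultimately have "k \<le> 2 * s * \<bar>t\<bar>" by simp
      then have "- (2 * s) * t + k \<le> 0 \<or> 2 * s * t + k \<le> 0" by (cases "t \<ge> 0") auto
      then show ?thesis unfolding b_def using h(2) by auto
    qed
    have b1: "b t = 1" if "\<bar>t\<bar> \<le> p - 1 / s" for t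
    proof -
      have "2 * s * \<bar>t\<bar> \<le> 2 * s * (p - 1 / s)" using that s by (intro mult_left_mono) auto
      moreover have "2 * s * (p - 1 / s) = k - 1" using s by (simp add: k_def right_diff_distrib)
      ultimately have "2 * s * \<bar>t\<bar> \<le> k - 1" by simp
      moreover have "2 * s * t \<le> 2 * s * \<bar>t\<bar>" "2 * s * (- t) \<le> 2 * s * \<bar>t\<bar>" using s by (intro mult_left_mono; simp)+
      ultimately have "1 \<le> - (2 * s) * t + k" "1 \<le> 2 * s * t + k" by auto
      then show ?thesis unfolding b_def using h(3) by simp
    qed
    \<comment> \<open>On the plateau \<open>b\<close> attains its maximum 1, so its derivative
      vanishes there, endpoints included.\<close>
    have b'0: "b' t = 0" if "\<bar>t\<bar> \<le> p - 1 / s" for t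
      by (rule DERIV_local_max[OF d, of 1]) (use b1[OF that] b01 in auto)
    show ?thesis using sb d b01 b'_le b0 b1 b'0 by blast
  qed
  then show ?thesis using \<open>C \<ge> 0\<close> by (intro exI[of _ "4 * C"]) simp
qed

text \<open>Only the Cauchy-Riemann derivative of the cutoff is controlled: the other factors of a
  trial function are annihilated by the gauged operator, so the energy sees nothing else.\<close>

definition cutoff :: "real \<Rightarrow> real \<Rightarrow> real \<Rightarrow> real \<Rightarrow> (real \<times> real \<Rightarrow> complex) \<Rightarrow> bool" where
  "cutoff p q s C \<eta> \<longleftrightarrow> smooth \<eta> \<and>
     (\<forall>x y. p - 1 / (2 * s) \<le> \<bar>x\<bar> \<or> q - 1 / (2 * s) \<le> \<bar>y\<bar> \<longrightarrow> \<eta> (x, y) = 0) \<and>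
     (\<forall>x y. \<bar>x\<bar> \<le> p - 1 / s \<longrightarrow> \<bar>y\<bar> \<le> q - 1 / s \<longrightarrow> \<eta> (x, y) = 1 \<and> D1 \<eta> (x, y) + \<i> * D2 \<eta> (x, y) = 0) \<and>
     (\<forall>x. cmod (D1 \<eta> x + \<i> * D2 \<eta> x) \<le> C * s)"

lemma cutoff_exists:
  "\<exists>C\<ge>0. \<forall>p q s. s > 0 \<longrightarrow> (\<exists>\<eta>. cutoff p q s C \<eta>)"
proof -
  obtain C where C0: "C \<ge> 0" and C: "\<forall>p s::real. s > 0 \<longrightarrow> (\<exists>b b'. smooth1 b \<and> (\<forall>t. (b has_real_derivative b' t) (at t)) \<and>
     (\<forall>t. 0 \<le> b t \<and> b t \<le> 1 \<and> \<bar>b' t\<bar> \<le> C * s) \<and> (\<forall>t. p - 1 / (2 * s) \<le> \<bar>t\<bar> \<longrightarrow> b t = 0) \<and>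
     (\<forall>t. \<bar>t\<bar> \<le> p - 1 / s \<longrightarrow> b t = 1 \<and> b' t = 0))"
    using plateau_exists by blast
  have "\<exists>\<eta>. cutoff p q s (2 * C) \<eta>" if s: "s > 0" for p q s :: real
  proof -
    obtain a a' where a: "smooth1 a" "\<And>t. (a has_real_derivative a' t) (at t)" "\<And>t. 0 \<le> a t \<and> a t \<le> 1 \<and> \<bar>a' t\<bar> \<le> C * s"
      "\<And>t. p - 1 / (2 * s) \<le> \<bar>t\<bar> \<Longrightarrow> a t = 0" "\<And>t. \<bar>t\<bar> \<le> p - 1 / s \<Longrightarrow> a t = 1 \<and> a' t = 0"
      using C[rule_format, OF s, of p] by metis
    obtain b b' where b: "smooth1 b" "\<And>t. (b has_real_derivative b' t) (at t)" "\<And>t. 0 \<le> b t \<and> b t \<le> 1 \<and> \<bar>b' t\<bar> \<le> C * s"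
      "\<And>t. q - 1 / (2 * s) \<le> \<bar>t\<bar> \<Longrightarrow> b t = 0" "\<And>t. \<bar>t\<bar> \<le> q - 1 / s \<Longrightarrow> b t = 1 \<and> b' t = 0"
      using C[rule_format, OF s, of q] by metis
    define \<eta> where "\<eta> = (\<lambda>x. complex_of_real (a (fst x)) * complex_of_real (b (snd x)))"
    have sm: "smooth (\<lambda>x. complex_of_real (a (fst x)))" "smooth (\<lambda>x. complex_of_real (b (snd x)))"
      by (intro smooth_fst smooth_snd a(1) b(1))+
    have d: "D1 \<eta> x + \<i> * D2 \<eta> x = of_real (a' (fst x) * b (snd x)) + \<i> * of_real (a (fst x) * b' (snd x))" for x
      unfolding \<eta>_def dir_deriv_mult[OF sm] dir_deriv_fst[OF a(2)] dir_deriv_snd[OF b(2)] by simp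
    have le: "cmod (D1 \<eta> x + \<i> * D2 \<eta> x) \<le> (2 * C) * s" for x
    proof -
      have "cmod (D1 \<eta> x + \<i> * D2 \<eta> x) \<le> \<bar>a' (fst x)\<bar> * \<bar>b (snd x)\<bar> + \<bar>a (fst x)\<bar> * \<bar>b' (snd x)\<bar>"
        unfolding d by (rule order_trans[OF norm_triangle_ineq]) (simp add: norm_mult)
      also have "\<dots> \<le> C * s * 1 + 1 * (C * s)"
        using a(3)[of "fst x"] b(3)[of "snd x"] C0 s by (intro add_mono mult_mono) auto
      finally show ?thesis by simp
    qed
    have "smooth \<eta>" unfolding \<eta>_def by (intro smooth_mult sm)
    moreover have "\<eta> (x, y) = 0" if "p - 1 / (2 * s) \<le> \<bar>x\<bar> \<or> q - 1 / (2 * s) \<le> \<bar>y\<bar>" for x y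
      using that a(4)[of x] b(4)[of y] by (auto simp: \<eta>_def)
    moreover have "\<eta> (x, y) = 1 \<and> D1 \<eta> (x, y) + \<i> * D2 \<eta> (x, y) = 0" if "\<bar>x\<bar> \<le> p - 1 / s" "\<bar>y\<bar> \<le> q - 1 / s" for x y
      unfolding d using a(5)[OF that(1)] b(5)[OF that(2)] by (simp add: \<eta>_def)
    ultimately show ?thesis unfolding cutoff_def using le by blast
  qed
  then show ?thesis using C0 by (intro exI[of _ "2 * C"]) simp
qed

lemma monomials_independent:
  fixes c :: "nat \<Rightarrow> complex"
  assumes "infinite Z" "\<And>z. z \<in> Z \<Longrightarrow> (\<Sum>j<n. c j * z ^ j) = 0" "j < n"
  shows "c j = 0"
proof -
  define P where "P = (\<Sum>j<n. monom (c j) j)"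
  have "poly P z = (\<Sum>j<n. c j * z ^ j)" for z by (simp add: P_def poly_sum poly_monom)
  then have "Z \<subseteq> {z. poly P z = 0}" using assms(2) by auto
  then have "P = 0" using poly_roots_finite[of P] assms(1) finite_subset by blast
  moreover have "coeff P j = c j" using assms(3) by (simp add: P_def coeff_sum)
  ultimately show ?thesis by simp
qed

text \<open>A combination of monomials with vanishing norm vanishes on the square, in particular at
  infinitely many real points, so it is the zero polynomial. The resulting constant depends only on
  n and is transported to small squares by scaling.\<close>

lemma monomials_coercive:
  "\<exists>\<kappa>>0. \<forall>c. \<kappa> * (\<Sum>j<n. (cmod (c j))\<^sup>2) \<le> integral (crect 1 1) (\<lambda>x. (cmod (\<Sum>j<n. c j * cplx x ^ j))\<^sup>2)"
proof -
  interpret unit: magnetic_rect 1 1 0 by unfold_locales auto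
  define f where "f = (\<lambda>j x. cplx x ^ j)"
  have sm: "smooth (\<lambda>x. \<Sum>j<n. c j * cplx x ^ j)" for c n
    by (rule smooth_entire[of "\<lambda>z. \<Sum>j<n. c j * z ^ j"]) (intro holomorphic_intros)
  have sf: "smooth (f j)" for j unfolding f_def by (rule smooth_entire[of "\<lambda>z. z ^ j"]) (intro holomorphic_intros)
  have fL: "f j \<in> L2 unit.M" for j by (intro unit.cont_L2 smooth_continuous_on sf)
  have sum: "(\<Sum>j<n. fscale (c j) (f j)) = (\<lambda>x. \<Sum>j<n. c j * cplx x ^ j)" for c
    by (rule ext) (simp add: sum_fscale_apply f_def)
  have nm: "unit.nm (\<Sum>j<n. fscale (c j) (f j)) = integral (crect 1 1) (\<lambda>x. (cmod (\<Sum>j<n. c j * cplx x ^ j))\<^sup>2)" for c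
    unfolding sum by (intro unit.nm_cont smooth_continuous_on sm)
  have "unit.nm (\<Sum>j<n. fscale (c j) (f j)) > 0" if c: "\<exists>j<n. c j \<noteq> 0" for c
  proof (rule ccontr)
    assume a: "\<not> ?thesis"
    have cont: "continuous_on (crect 1 1) (\<lambda>x. (cmod (\<Sum>j<n. c j * cplx x ^ j))\<^sup>2)"
      by (intro continuous_intros smooth_continuous_on sm)
    have "0 \<le> integral (crect 1 1) (\<lambda>x. (cmod (\<Sum>j<n. c j * cplx x ^ j))\<^sup>2)"
      by (intro integral_nonneg integrable_continuous cont) auto
    then have z: "integral (crect 1 1) (\<lambda>x. (cmod (\<Sum>j<n. c j * cplx x ^ j))\<^sup>2) = 0" using a unfolding nm by linarith
    have ne: "box (- 1, - 1) (1, 1) \<noteq> ({} :: (real \<times> real) set)" unfolding rect_eq_box[symmetric] by auto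
    have "(\<Sum>j<n. c j * cplx x ^ j) = 0" if "x \<in> crect 1 1" for x
    proof -
      have "(cmod (\<Sum>j<n. c j * cplx x ^ j))\<^sup>2 = 0"
        using integral_cbox_eq_0_iff[OF cont, THEN iffD1, OF ne _ z] that by simp
      then show ?thesis by simp
    qed
    then have "(\<Sum>j<n. c j * z ^ j) = 0" if "z \<in> complex_of_real ` {0..1}" for z
      using that by (auto simp: cbox_Pair_eq complex_of_real_def)
    moreover have "infinite (complex_of_real ` {0..1})"
      by (subst finite_image_iff) (auto simp: inj_on_def)
    ultimately have "c j = 0" if "j < n" for j using monomials_independent[where n = n and c = c and j = j] that by blast
    then show False using c by blast
  qed
  from L2.gram_coercive[OF fL this] show ?thesis unfolding nm by blast
qed

lemma integral_rescale:
  assumes s: "s > 0" and f: "continuous_on UNIV f"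
  shows "integral (crect (1 / s) (1 / s)) (\<lambda>x. f (s *\<^sub>R x)) = (integral (crect 1 1) f :: real) / s\<^sup>2"
proof -
  have "f integrable_on crect 1 1" using f continuous_on_subset by (intro integrable_continuous) blast
  then have "(f has_integral integral (crect 1 1) f) (crect 1 1)" by (rule integrable_integral)
  from has_integral_affinity[OF this, of s 0] s
  have "((\<lambda>x. f (s *\<^sub>R x)) has_integral integral (crect 1 1) f / s\<^sup>2) ((\<lambda>x. (1 / s) *\<^sub>R x) ` crect 1 1)"
    by (simp add: power2_eq_square)
  moreover have "(\<lambda>x. (1 / s) *\<^sub>R x) ` crect 1 1 = crect (1 / s) (1 / s)"
    using s by (subst image_smult_cbox) (auto simp: cbox_Pair_eq)
  ultimately show ?thesis by (simp add: integral_unique)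
qed

text \<open>The base 1 + R is at least 1, so its n-th power dominates all lower powers whatever the
  size of R.\<close>

lemma polynomial_le:
  fixes c :: "nat \<Rightarrow> complex"
  assumes w: "cmod w \<le> R"
  shows "(cmod (\<Sum>j<n. c j * w ^ j))\<^sup>2 \<le> real n * (1 + R) ^ (2 * n) * (\<Sum>j<n. (cmod (c j))\<^sup>2)"
proof -
  have R: "0 \<le> R" using w norm_ge_zero order_trans by blast
  have "cmod (\<Sum>j<n. c j * w ^ j) \<le> (\<Sum>j<n. cmod (c j) * (1 + R) ^ n)"
  proof (rule sum_norm_le)
    fix j assume "j \<in> {..<n}"
    have "cmod w ^ j \<le> (1 + R) ^ j" using w by (intro power_mono) auto
    also have "\<dots> \<le> (1 + R) ^ n" using R \<open>j \<in> {..<n}\<close> by (intro power_increasing) auto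
    finally show "cmod (c j * w ^ j) \<le> cmod (c j) * (1 + R) ^ n"
      by (simp add: norm_mult norm_power mult_left_mono)
  qed
  then have "(cmod (\<Sum>j<n. c j * w ^ j))\<^sup>2 \<le> ((\<Sum>j<n. cmod (c j)) * (1 + R) ^ n)\<^sup>2"
    by (intro power_mono) (auto simp: sum_distrib_right)
  also have "\<dots> = (\<Sum>j<n. cmod (c j))\<^sup>2 * (1 + R) ^ (2 * n)" by (simp add: power_mult_distrib power_mult[symmetric] mult.commute)
  also have "\<dots> \<le> ((\<Sum>j<n. (cmod (c j))\<^sup>2) * real (card {..<n})) * (1 + R) ^ (2 * n)"
    using R by (intro mult_right_mono sum_squared_le_sum_of_squares) auto
  finally show ?thesis by (simp add: mult_ac)
qed

lemma cov_bar_zero_mult: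
  assumes "smooth \<eta>" "P holomorphic_on UNIV"
  shows "cov_bar 0 (\<lambda>x. \<eta> x * P (cplx x)) x = (D1 \<eta> x + \<i> * D2 \<eta> x) * P (cplx x)"
  using dir_deriv_mult[OF assms(1) smooth_entire[OF assms(2)]]
  unfolding cov_bar_def cov1_def by (simp add: dir_deriv_entire[OF assms(2)] algebra_simps)

context magnetic_rect
begin

text \<open>The trial functions are the inverse gauge factor times the cutoff times (s z)^j. The
  gauged operator falls only on the cutoff, so their energy lives in the layer of width 1/s, where
  the inverse gauge factor squared is at most exp(2 B l). Their mass is bounded below on the central
  square, where it is at least exp(-2 B m).\<close>

lemma trial_functions:
  assumes s: "s > 0" "2 \<le> s * p" "2 \<le> s * q" and F: "F holomorphic_on UNIV"
    and layer: "\<And>x y. \<bar>x\<bar> \<le> p \<Longrightarrow> \<bar>y\<bar> \<le> q \<Longrightarrow> p - 1 / s \<le> \<bar>x\<bar> \<or> q - 1 / s \<le> \<bar>y\<bar> \<Longrightarrow> - l \<le> potential F (x, y)"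
    and core: "\<And>x y. \<bar>x\<bar> \<le> 1 / s \<Longrightarrow> \<bar>y\<bar> \<le> 1 / s \<Longrightarrow> potential F (x, y) \<le> m"
    and \<kappa>: "\<kappa> > 0" "\<And>c. \<kappa> * (\<Sum>j<n. (cmod (c j))\<^sup>2) \<le> integral (crect 1 1) (\<lambda>x. (cmod (\<Sum>j<n. c j * cplx x ^ j))\<^sup>2)"
    and cut: "cutoff p q s C \<eta>" and C: "C \<ge> 0"
  shows "enat n \<le> eig_count \<Omega> B (4 * C\<^sup>2 / \<kappa> * real n * (p * q) * s ^ 4 * (1 + s * (p + q)) ^ (2 * n) * exp (2 * B * (l + m)))"
    (is "_ \<le> eig_count \<Omega> B ?U")
proof -
  have \<eta>: "smooth \<eta>" "\<And>x y. p - 1 / (2 * s) \<le> \<bar>x\<bar> \<or> q - 1 / (2 * s) \<le> \<bar>y\<bar> \<Longrightarrow> \<eta> (x, y) = 0"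
    "\<And>x y. \<bar>x\<bar> \<le> p - 1 / s \<Longrightarrow> \<bar>y\<bar> \<le> q - 1 / s \<Longrightarrow> \<eta> (x, y) = 1 \<and> D1 \<eta> (x, y) + \<i> * D2 \<eta> (x, y) = 0"
    "\<And>x. cmod (D1 \<eta> x + \<i> * D2 \<eta> x) \<le> C * s"
    using cut unfolding cutoff_def by blast+
  define Q where "Q = (\<lambda>c z. \<Sum>j<n. c j * (of_real s * z) ^ j :: complex)"
  define \<psi> where "\<psi> = (\<lambda>j x. gauge_factor (- B) F x * (\<eta> x * (of_real s * cplx x) ^ j))"
  have Q: "Q c holomorphic_on UNIV" for c unfolding Q_def by (intro holomorphic_intros)
  have sg: "smooth (gauge_factor (- B) F)" by (rule smooth_gauge[OF F])
  have \<psi>_sum: "(\<lambda>x. \<Sum>j<n. c j * \<psi> j x) = (\<lambda>x. gauge_factor (- B) F x * (\<eta> x * Q c (cplx x)))" for c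
    by (rule ext) (simp add: \<psi>_def Q_def sum_distrib_left mult_ac)
  have \<eta>_test: "\<eta> \<in> tests"
  proof -
    define K where "K = crect (p - 1 / (2 * s)) (q - 1 / (2 * s))"
    have "\<eta> z = 0" if "z \<notin> K" for z
    proof -
      obtain x y where z: "z = (x, y)" by (cases z)
      have "p - 1 / (2 * s) \<le> \<bar>x\<bar> \<or> q - 1 / (2 * s) \<le> \<bar>y\<bar>"
        using that unfolding z K_def cbox_Pair_eq by simp linarith
      then show ?thesis unfolding z by (rule \<eta>(2))
    qed
    moreover have "crect (p - d) (q - d) \<subseteq> rect p q" if "d > 0" for d :: real
      using that by (auto simp: cbox_Pair_eq)
    from this[of "1 / (2 * s)"] have "K \<subseteq> rect p q" using s by (simp add: K_def)
    moreover have "compact K" by (simp add: K_def)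
    ultimately show ?thesis using \<eta>(1) unfolding test_functions_def by blast
  qed
  have \<psi>_test: "\<psi> j \<in> tests" for j
  proof -
    have "smooth (\<lambda>x. (of_real s * cplx x) ^ j)"
      by (rule smooth_entire[of "\<lambda>z. (of_real s * z) ^ j"]) (intro holomorphic_intros)
    then have "smooth (\<lambda>x. gauge_factor (- B) F x * (of_real s * cplx x) ^ j)" by (intro smooth_mult sg)
    from test_mult[OF \<eta>_test this] show ?thesis unfolding \<psi>_def by (simp add: mult_ac)
  qed
  have sm: "smooth (\<lambda>x. \<Sum>j<n. c j * \<psi> j x)" for c
    by (intro smooth_sum smooth_mult smooth_const test_smooth[OF \<psi>_test])
  define N where "N = (\<lambda>c::nat \<Rightarrow> complex. \<Sum>j<n. (cmod (c j))\<^sup>2)"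
  have N0: "N c \<ge> 0" for c unfolding N_def by (intro sum_nonneg) simp
  \<comment> \<open>\<open>a\<close> bounds the squared norm from below and \<open>b\<close> the
    energy from above, both relative to the sum of squared coefficients; the claimed level is b /
    a.\<close>
  define a where "a = exp (- 2 * B * m) * (\<kappa> / s\<^sup>2)"
  have a: "a > 0" using \<kappa> s by (simp add: a_def)
  define A where "A = real n * (1 + s * (p + q)) ^ (2 * n)"
  define b where "b = 4 * (p * q) * (exp (2 * B * l) * ((C * s)\<^sup>2 * A))"
  have denom: "a * N c \<le> nm (\<lambda>x. \<Sum>j<n. c j * \<psi> j x)" for c
  proof -
    define f where "f = (\<lambda>x. (cmod (\<Sum>j<n. c j * \<psi> j x))\<^sup>2)"
    define g where "g = (\<lambda>x. (cmod (\<Sum>j<n. c j * cplx x ^ j))\<^sup>2)"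
    have cf: "continuous_on X f" for X unfolding f_def by (intro continuous_intros smooth_continuous_on sm)
    have cg: "continuous_on X g" for X unfolding g_def
      by (intro continuous_intros smooth_continuous_on smooth_entire[of "\<lambda>z. \<Sum>j<n. c j * z ^ j"] holomorphic_intros)
    have cgs: "continuous_on X (\<lambda>x. g (s *\<^sub>R x))" for X
      by (rule continuous_on_compose2[OF cg[of UNIV]]) (auto intro!: continuous_intros)
    have "crect d d \<subseteq> crect p q" if "d \<le> p" "d \<le> q" for d
      using that by (auto simp: cbox_Pair_eq)
    then have sub: "crect (1 / s) (1 / s) \<subseteq> crect p q" using s by (simp add: pos_divide_le_eq mult.commute)
    have "a * N c = exp (- 2 * B * m) * (\<kappa> * N c / s\<^sup>2)" by (simp add: a_def)
    also have "\<dots> \<le> exp (- 2 * B * m) * (integral (crect 1 1) g / s\<^sup>2)"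
      using \<kappa>(2)[of c] unfolding g_def N_def by (intro mult_left_mono divide_right_mono) auto
    also have "\<dots> = integral (crect (1 / s) (1 / s)) (\<lambda>x. exp (- 2 * B * m) * g (s *\<^sub>R x))"
      using integral_rescale[OF s(1) cg] by simp
    also have "\<dots> \<le> integral (crect (1 / s) (1 / s)) f"
    proof (rule integral_le)
      fix z assume z: "z \<in> crect (1 / s) (1 / s)"
      obtain x y where xy: "z = (x, y)" by (cases z)
      have x: "\<bar>x\<bar> \<le> 1 / s" "\<bar>y\<bar> \<le> 1 / s" using z by (auto simp: xy cbox_Pair_eq)
      \<comment> \<open>This uses 2 <= s p and 2 <= s q: the central square lies where the cutoff is
        1.\<close>
      have "1 / s \<le> p - 1 / s" "1 / s \<le> q - 1 / s" using s by (auto simp: field_simps)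
      then have "\<eta> z = 1" using \<eta>(3)[of x y] x unfolding xy by linarith
      moreover have "Q c (cplx z) = (\<Sum>j<n. c j * cplx (s *\<^sub>R z) ^ j)"
      proof -
        have "of_real s * cplx z = cplx (s *\<^sub>R z)" by (simp add: complex_eq_iff)
        then show ?thesis by (simp add: Q_def)
      qed
      ultimately have "f z = (cmod (gauge_factor (- B) F z))\<^sup>2 * g (s *\<^sub>R z)"
        unfolding f_def fun_cong[OF \<psi>_sum] g_def by (simp add: norm_mult power_mult_distrib)
      moreover have "exp (- 2 * B * m) \<le> (cmod (gauge_factor (- B) F z))\<^sup>2"
      proof -
        have "B * potential F z \<le> B * m" unfolding xy using core[OF x] B by (intro mult_left_mono)
        then show ?thesis unfolding cmod_gauge exp_double[symmetric] by (simp add: potential_def)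
      qed
      ultimately show "exp (- 2 * B * m) * g (s *\<^sub>R z) \<le> f z" by (simp add: mult_right_mono g_def)
    qed (intro integrable_continuous cf continuous_intros cgs)+
    also have "\<dots> \<le> integral (crect p q) f"
      by (intro integral_subset_le sub integrable_continuous cf) (simp add: f_def)
    also have "\<dots> = nm (\<lambda>x. \<Sum>j<n. c j * \<psi> j x)"
      unfolding f_def by (rule nm_cont[symmetric], intro smooth_continuous_on sm)
    finally show ?thesis .
  qed
  have numer: "energy (\<lambda>x. \<Sum>j<n. c j * \<psi> j x) \<le> b * N c" for c
  proof -
    define \<phi> where "\<phi> = (\<lambda>x. \<Sum>j<n. c j * \<psi> j x)"
    have s\<phi>: "smooth \<phi>" unfolding \<phi>_def by (rule sm)
    \<comment> \<open>The gauge factors for B and -B are inverse to each other, so the gauge change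
      of a trial function leaves the cutoff times a polynomial.\<close>
    have gg: "gauge_factor B F x * gauge_factor (- B) F x = 1" for x
      by (simp add: gauge_factor_def exp_minus of_real_inverse[symmetric] field_simps)
    have w: "(\<lambda>x. gauge_factor B F x * \<phi> x) = (\<lambda>x. \<eta> x * Q c (cplx x))"
      unfolding \<phi>_def \<psi>_sum by (rule ext) (simp add: mult.assoc[symmetric] gg)
    have D: "gauge_factor B F x * cov_bar B \<phi> x = (D1 \<eta> x + \<i> * D2 \<eta> x) * Q c (cplx x)" for x
      using cov_bar_gauge[OF F s\<phi>, of B x] unfolding w cov_bar_zero_mult[OF \<eta>(1) Q] by simp
    have "energy \<phi> \<le> integral (crect p q) (\<lambda>x. exp (2 * B * l) * ((C * s)\<^sup>2 * (A * N c)))"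
      unfolding energy_def
    proof (rule integral_le)
      fix z assume z: "z \<in> crect p q"
      obtain x y where xy: "z = (x, y)" by (cases z)
      have x: "\<bar>x\<bar> \<le> p" "\<bar>y\<bar> \<le> q" using z by (auto simp: xy cbox_Pair_eq)
      show "(cmod (cov_bar B \<phi> z))\<^sup>2 \<le> exp (2 * B * l) * ((C * s)\<^sup>2 * (A * N c))"
      proof (cases "p - 1 / s \<le> \<bar>x\<bar> \<or> q - 1 / s \<le> \<bar>y\<bar>")
        case True
        have "(cmod (gauge_factor B F z))\<^sup>2 * (cmod (cov_bar B \<phi> z))\<^sup>2 = (cmod (D1 \<eta> z + \<i> * D2 \<eta> z))\<^sup>2 * (cmod (Q c (cplx z)))\<^sup>2"
          unfolding power_mult_distrib[symmetric] norm_mult[symmetric] D ..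
        also have "\<dots> \<le> (C * s)\<^sup>2 * (A * N c)"
        proof (intro mult_mono power_mono \<eta>(4))
          have "cmod (of_real s * cplx z) \<le> s * (p + q)"
            using cmod_le[of "cplx z"] x s by (simp add: norm_mult xy)
          from polynomial_le[OF this] show "(cmod (Q c (cplx z)))\<^sup>2 \<le> A * N c" by (simp add: Q_def A_def N_def)
        qed auto
        finally have le: "(cmod (gauge_factor B F z))\<^sup>2 * (cmod (cov_bar B \<phi> z))\<^sup>2 \<le> (C * s)\<^sup>2 * (A * N c)" .
        have "1 \<le> exp (2 * B * l) * (cmod (gauge_factor B F z))\<^sup>2"
        proof -
          have "B * (- l) \<le> B * potential F z" unfolding xy using layer[OF x True] B by (intro mult_left_mono)
          then show ?thesis unfolding cmod_gauge exp_double[symmetric] exp_add[symmetric]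
            by (simp add: potential_def)
        qed
        then have "1 * (cmod (cov_bar B \<phi> z))\<^sup>2 \<le> exp (2 * B * l) * (cmod (gauge_factor B F z))\<^sup>2 * (cmod (cov_bar B \<phi> z))\<^sup>2"
          by (intro mult_right_mono) auto
        also have "\<dots> \<le> exp (2 * B * l) * ((C * s)\<^sup>2 * (A * N c))"
          unfolding mult.assoc[of "exp _"] using le by (intro mult_left_mono) auto
        finally show ?thesis by simp
      next
        case False
        then have "D1 \<eta> z + \<i> * D2 \<eta> z = 0" unfolding xy using \<eta>(3)[of x y] by auto
        then have "gauge_factor B F z * cov_bar B \<phi> z = 0" unfolding D by simp
        moreover have "gauge_factor B F z \<noteq> 0" by (simp add: gauge_factor_def)
        ultimately show ?thesis using N0 s p q by (simp add: A_def)
      qed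
    qed (intro integrable_continuous continuous_intros smooth_continuous_on smooth_cov_bar s\<phi>)+
    also have "\<dots> = b * N c" using p q by (simp add: b_def content_Pair)
    finally show ?thesis unfolding \<phi>_def .
  qed
  have U: "?U = b / a"
  proof -
    have e: "exp (2 * B * (l + m)) = exp (2 * B * l) / exp (- 2 * B * m)" by (simp add: exp_diff[symmetric] ring_distribs)
    show ?thesis unfolding e using \<kappa> s by (simp add: b_def a_def A_def power_mult_distrib field_simps eval_nat_numeral)
  qed
  show ?thesis unfolding U
  proof (rule eig_count_upper[of n \<psi>])
    show "nm (\<lambda>x. \<Sum>j<n. c j * \<psi> j x) > 0" if c: "\<exists>j<n. c j \<noteq> 0" for c
    proof -
      obtain j where "j < n" "c j \<noteq> 0" using c by blast
      then have "0 < (cmod (c j))\<^sup>2" "(cmod (c j))\<^sup>2 \<le> N c"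
        unfolding N_def by (auto intro!: member_le_sum)
      then have "0 < N c" by linarith
      then have "0 < a * N c" using a by (intro mult_pos_pos)
      then show ?thesis using denom[of c] by linarith
    qed
    have b0: "b \<ge> 0" using p q s by (simp add: b_def A_def)
    show "energy (\<lambda>x. \<Sum>j<n. c j * \<psi> j x) \<le> b / a * nm (\<lambda>x. \<Sum>j<n. c j * \<psi> j x)" for c
    proof -
      have "b * N c = b / a * (a * N c)" using a by simp
      also have "\<dots> \<le> b / a * nm (\<lambda>x. \<Sum>j<n. c j * \<psi> j x)" using a b0 denom[of c] by (intro mult_left_mono) auto
      finally show ?thesis using numer[of c] by linarith
    qed
  qed (rule \<psi>_test)
qed


text \<open>Any entire function serves when only some finite level is wanted; with F = 0 the
  potential is y^2/2 >= 0. The level makes the sets in the definition of \<open>eig\<close>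
  nonempty.\<close>

lemma eig_count_attained: "\<exists>U. enat n \<le> eig_count \<Omega> B U"
proof -
  obtain \<kappa> where \<kappa>: "\<kappa> > 0" "\<And>c. \<kappa> * (\<Sum>j<n. (cmod (c j))\<^sup>2) \<le> integral (crect 1 1) (\<lambda>x. (cmod (\<Sum>j<n. c j * cplx x ^ j))\<^sup>2)"
    using monomials_coercive[of n] by blast
  define s where "s = 2 / min p q"
  have s: "s > 0" "2 \<le> s * p" "2 \<le> s * q" using p q by (auto simp: s_def field_simps min_def)
  obtain C where C: "C \<ge> 0" "\<forall>p q s. s > 0 \<longrightarrow> (\<exists>\<eta>. cutoff p q s C \<eta>)"
    using cutoff_exists by blast
  obtain \<eta> where \<eta>: "cutoff p q s C \<eta>"
    using C(2) s(1) by blast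
  have core: "potential (\<lambda>_. 0) (x, y) \<le> (1 / s)\<^sup>2" if "\<bar>x\<bar> \<le> 1 / s" "\<bar>y\<bar> \<le> 1 / s" for x y
  proof -
    have "y\<^sup>2 \<le> (1 / s)\<^sup>2" using power_mono[OF that(2), of 2] by simp
    then have "y\<^sup>2 / 2 \<le> (1 / s)\<^sup>2" using zero_le_power2[of y] by linarith
    then show ?thesis by (simp add: potential_def)
  qed
  show ?thesis
    by (rule exI, rule trial_functions[of s "\<lambda>_. 0" 0 "(1 / s)\<^sup>2" \<kappa> n C \<eta>, OF s _ _ core \<kappa> \<eta> C(1)])
      (auto simp: potential_def)
qed

text \<open>The approximate torsion potential ranges between -(T + 5 e) and e, with T the maximal
  torsion: e above by the maximum principle, 4 e from the reflections and e from the center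
  value.\<close>

lemma test_torsion_bound:
  assumes small: "2 * p \<le> 1 \<or> 2 * q \<le> 1" and e: "e > 0" and \<phi>: "\<phi> \<in> tests"
  shows "exp (- 2 * B * (torsion_max p q + 6 * e)) * nm \<phi> \<le> energy \<phi>"
proof -
  obtain F where F: "small_on_boundary p q e F" "\<bar>potential F (0, 0) + torsion_max p q\<bar> \<le> e"
    using torsion_approx[OF p q e] by blast
  have Fh: "F holomorphic_on UNIV" using F(1) by (simp add: small_on_boundary_def)
  have bounds: "- (torsion_max p q + 5 * e) \<le> (snd x)\<^sup>2 / 2 + Re (F (cplx x)) \<and> (snd x)\<^sup>2 / 2 + Re (F (cplx x)) \<le> e"
    if "x \<in> crect p q" for x
  proof -
    obtain u v where x: "x = (u, v)" by (cases x)
    have uv: "\<bar>u\<bar> \<le> p" "\<bar>v\<bar> \<le> q" using that by (auto simp: x cbox_Pair_eq)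
    show ?thesis using potential_le[OF F(1) p q uv] potential_ge_center[OF F(1) p q uv] F(2)
      by (simp add: potential_def x abs_le_iff)
  qed
  have "nm \<phi> = integral (crect p q) (\<lambda>x. (cmod (\<phi> x))\<^sup>2)" by (intro nm_cont smooth_continuous_on test_smooth[OF \<phi>])
  with test_lower_bound[OF \<phi> p q small Fh B bounds] show ?thesis
    unfolding energy_def by (simp add: add.commute)
qed

text \<open>The error e tends to 0 because the eigenvalue does not depend on it. The same bound
  serves every n, since all eigenvalues dominate the bottom of the form.\<close>

lemma eig_torsion_bound:
  assumes small: "2 * p \<le> 1 \<or> 2 * q \<le> 1" and n: "n \<ge> 1"
  shows "exp (- 2 * B * torsion_max p q) \<le> eig n \<Omega> B"
proof (rule tendsto_upperbound)
  show "((\<lambda>e. exp (- 2 * B * (torsion_max p q + 6 * e))) \<longlongrightarrow> exp (- 2 * B * torsion_max p q)) (at_right 0)"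
    by (auto intro!: tendsto_eq_intros)
  obtain U where U: "enat n \<le> eig_count \<Omega> B U" using eig_count_attained by blast
  have "exp (- 2 * B * (torsion_max p q + 6 * e)) \<le> eig n \<Omega> B" if "e > 0" for e
    by (rule eig_ge[OF test_torsion_bound[OF small that] n U])
  then show "\<forall>\<^sub>F e in at_right 0. exp (- 2 * B * (torsion_max p q + 6 * e)) \<le> eig n \<Omega> B"
    using eventually_at_right_less by (rule eventually_mono[rotated])
qed simp

end

text \<open>Layer width, core size and boundary accuracy are all taken to be 1/B. The potential then
  errs by O(1/B) in layer and core, which costs only the bounded factor exp 27, while the
  derivatives of the cutoff and the rescaled monomials cost powers of B.\<close>

lemma square_upper_bound:
  assumes n: "n \<ge> 1"
  shows "\<exists>C>0. \<forall>B\<ge>4. eig n (rect (1 / 2) (1 / 2)) B \<le> C * B ^ (4 + 2 * n) * exp (- 2 * B * torsion_max (1 / 2) (1 / 2))"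
proof -
  obtain \<kappa> where \<kappa>: "\<kappa> > 0" "\<And>c. \<kappa> * (\<Sum>j<n. (cmod (c j))\<^sup>2) \<le> integral (crect 1 1) (\<lambda>x. (cmod (\<Sum>j<n. c j * cplx x ^ j))\<^sup>2)"
    using monomials_coercive[of n] by blast
  obtain C where C: "C \<ge> 0" "\<forall>p q s. s > 0 \<longrightarrow> (\<exists>\<eta>. cutoff p q s C \<eta>)"
    using cutoff_exists by blast
  define K where "K = C\<^sup>2 / \<kappa> * real n * 4 ^ n * exp 27"
  have K: "K \<ge> 0" using \<kappa>(1) by (simp add: K_def)
  have "eig n (rect (1 / 2) (1 / 2)) B \<le> (K + 1) * B ^ (4 + 2 * n) * exp (- 2 * B * torsion_max (1 / 2) (1 / 2))" if B: "B \<ge> 4" for B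
  proof -
    define T where "T = torsion_max (1 / 2) (1 / 2)"
    interpret sq: magnetic_rect "1 / 2" "1 / 2" B using B by unfold_locales auto
    have B0: "B > 0" "1 / B > 0" using B by auto
    obtain F where F: "small_on_boundary (1 / 2) (1 / 2) (1 / B) F" "\<bar>potential F (0, 0) + T\<bar> \<le> 1 / B"
      "\<And>x y. \<bar>x\<bar> \<le> 1 / 2 \<Longrightarrow> \<bar>y\<bar> \<le> 1 / 2 \<Longrightarrow> potential F (x, y) \<le> potential F (0, 0) + (9 * (1 / 2) + 2 * (1 / 2)) * (\<bar>x\<bar> + \<bar>y\<bar>)"
      using torsion_approx[of "1 / 2" "1 / 2" "1 / B"] B0 unfolding T_def by force
    have Fh: "F holomorphic_on UNIV" using F(1) by (simp add: small_on_boundary_def)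
    obtain \<eta> where \<eta>: "cutoff (1 / 2) (1 / 2) B C \<eta>"
      using C(2) B0(1) by blast
    have barrier: "- (3 / 2 * e) \<le> u" if "d \<le> e" "- d / 2 - e \<le> u" for d e u :: real
      using that by linarith
    have half: "0 < 1 / (2::real)" by simp
    have near: "(1 / 2)\<^sup>2 - t\<^sup>2 \<le> 1 / B" if "\<bar>t\<bar> \<le> 1 / 2" "1 / 2 - 1 / B \<le> \<bar>t\<bar>" for t
    proof -
      have "(1 / 2)\<^sup>2 - t\<^sup>2 = (1 / 2 - \<bar>t\<bar>) * (1 / 2 + \<bar>t\<bar>)" by (simp add: power2_eq_square algebra_simps)
      also have "\<dots> \<le> (1 / B) * 1" using that B0 by (intro mult_mono) auto
      finally show ?thesis by simp
    qed
    \<comment> \<open>The strip barrier gives half of 1/B and the boundary accuracy another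
      1/B.\<close>
    have layer: "- (3 / 2 * (1 / B)) \<le> potential F (x, y)"
      if "\<bar>x\<bar> \<le> 1 / 2" "\<bar>y\<bar> \<le> 1 / 2" "1 / 2 - 1 / B \<le> \<bar>x\<bar> \<or> 1 / 2 - 1 / B \<le> \<bar>y\<bar>" for x y
      using that(3)
    proof
      assume "1 / 2 - 1 / B \<le> \<bar>x\<bar>"
      from barrier[OF near[OF that(1) this] potential_barrier_x[OF F(1) half half that(1,2)]] show ?thesis .
    next
      assume "1 / 2 - 1 / B \<le> \<bar>y\<bar>"
      from barrier[OF near[OF that(2) this] potential_barrier_y[OF F(1) half half that(1,2)]] show ?thesis .
    qed
    \<comment> \<open>The 12 is 1 for the accuracy at the center plus 11/2 times |x| + |y| <= 2/B
      from the Lipschitz bound.\<close>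
    have core: "potential F (x, y) \<le> - T + 12 * (1 / B)" if xy: "\<bar>x\<bar> \<le> 1 / B" "\<bar>y\<bar> \<le> 1 / B" for x y
    proof -
      have "1 / B \<le> 1 / 2" using B by simp
      then have "potential F (x, y) \<le> potential F (0, 0) + (9 * (1 / 2) + 2 * (1 / 2)) * (\<bar>x\<bar> + \<bar>y\<bar>)"
        using xy by (intro F(3)) auto
      moreover have "9 * (1 / 2) + 2 * (1 / 2) = (11 / 2 :: real)" by simp
      ultimately have "potential F (x, y) \<le> potential F (0, 0) + (11 / 2 * \<bar>x\<bar> + 11 / 2 * \<bar>y\<bar>)" by (metis distrib_left)
      then show ?thesis using F(2) xy by linarith
    qed
    define U where "U = 4 * C\<^sup>2 / \<kappa> * real n * ((1 / 2) * (1 / 2)) * B ^ 4 * (1 + B * (1 / 2 + 1 / 2)) ^ (2 * n) *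
        exp (2 * B * (3 / 2 * (1 / B) + (- T + 12 * (1 / B))))"
    have sB: "2 \<le> B * (1 / 2)" using B by simp
    have cnt: "enat n \<le> eig_count (rect (1 / 2) (1 / 2)) B U"
      unfolding U_def
      by (rule sq.trial_functions[of B F "3 / 2 * (1 / B)" "- T + 12 * (1 / B)" \<kappa> n C \<eta>, OF B0(1) sB sB Fh layer core \<kappa> \<eta> C(1)])
    have "eig n (rect (1 / 2) (1 / 2)) B \<le> U"
      by (rule sq.eig_le[OF _ n cnt, of 0]) (simp add: sq.energy_nonneg)
    also have "U \<le> K * B ^ (4 + 2 * n) * exp (- 2 * B * T)"
    proof -
      have "2 * B * (3 / 2 * (1 / B) + (- T + 12 * (1 / B))) = 27 + - 2 * B * T"
        using B0 by (simp add: field_simps)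
      then have e: "exp (2 * B * (3 / 2 * (1 / B) + (- T + 12 * (1 / B)))) = exp 27 * exp (- 2 * B * T)"
        by (simp only: exp_add)
      have U: "U = C\<^sup>2 / \<kappa> * real n * B ^ 4 * exp 27 * exp (- 2 * B * T) * (1 + B) ^ (2 * n)"
        unfolding U_def e by simp
      \<comment> \<open>Replacing 1 + B by 2 B separates the power of B; the remaining 4^n belongs
        to \<open>K\<close>.\<close>
      have "(1 + B) ^ (2 * n) \<le> (2 * B) ^ (2 * n)" using B by (intro power_mono) auto
      also have "\<dots> = 4 ^ n * B ^ (2 * n)" by (simp add: power_mult_distrib power_mult)
      finally have "U \<le> C\<^sup>2 / \<kappa> * real n * B ^ 4 * exp 27 * exp (- 2 * B * T) * (4 ^ n * B ^ (2 * n))"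
        unfolding U using \<kappa>(1) B by (intro mult_left_mono) auto
      then show ?thesis by (simp add: K_def power_add mult_ac)
    qed
    also have "\<dots> \<le> (K + 1) * B ^ (4 + 2 * n) * exp (- 2 * B * T)" using B by (intro mult_right_mono) auto
    finally show ?thesis unfolding T_def .
  qed
  then show ?thesis using K by (intro exI[of _ "K + 1"]) auto
qed

lemma rectangle_eq_rect: "rectangle a = rect (a / 2) (1 / (2 * a))"
  by (simp add: rectangle_def)

theorem theorem2:
  fixes n :: nat
  assumes "n \<ge> 1"
  shows "\<exists>c B0 :: real. c > 0 \<and> B0 > 0 \<and>
    (\<forall>a B :: real. a > 0 \<longrightarrow> B \<ge> B0 \<longrightarrow>
      eig n (rectangle a) B / eig n (rectangle 1) B
        \<ge> 1 + c * B * ((a\<^sup>2 - 1)\<^sup>2 / (1 + a ^ 4)) - ln B / c)"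
proof -
  obtain c1 where c1: "c1 > 0" "\<And>a. a > 0 \<Longrightarrow> c1 * ((a\<^sup>2 - 1)\<^sup>2 / (1 + a ^ 4)) \<le>
      torsion_max (1 / 2) (1 / 2) - torsion_max (a / 2) (1 / (2 * a))"
    using torsion_gap by blast
  obtain C where C: "C > 0" "\<And>B. B \<ge> 4 \<Longrightarrow>
      eig n (rect (1 / 2) (1 / 2)) B \<le> C * B ^ (4 + 2 * n) * exp (- 2 * B * torsion_max (1 / 2) (1 / 2))"
    using square_upper_bound[OF assms] by blast
  define k where "k = real (4 + 2 * n)"
  \<comment> \<open>The first entry makes the linear term fit under twice the torsion gap; the
    second makes k ln B + ln C fit under ln B / c once ln B >= 1.\<close>
  define c where "c = min (2 * c1) (1 / (k + \<bar>ln C\<bar>))"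
  have k: "k + \<bar>ln C\<bar> > 0" by (simp add: k_def add_pos_nonneg)
  have c: "c > 0" "c \<le> 2 * c1" "c \<le> 1 / (k + \<bar>ln C\<bar>)" using c1(1) k by (auto simp: c_def)
  have "1 + c * B * ((a\<^sup>2 - 1)\<^sup>2 / (1 + a ^ 4)) - ln B / c \<le> eig n (rectangle a) B / eig n (rectangle 1) B"
    if a: "a > 0" and B: "B \<ge> 4" for a B
  proof -
    define \<delta> where "\<delta> = (a\<^sup>2 - 1)\<^sup>2 / (1 + a ^ 4)"
    define T1 where "T1 = torsion_max (1 / 2) (1 / 2)"
    define Ta where "Ta = torsion_max (a / 2) (1 / (2 * a))"
    have B0: "B > 0" using B by simp
    have \<delta>: "0 \<le> \<delta>" "c1 * \<delta> \<le> T1 - Ta" using c1(2)[OF a] by (auto simp: \<delta>_def T1_def Ta_def)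
    interpret R: magnetic_rect "a / 2" "1 / (2 * a)" B using a B by unfold_locales auto
    interpret S: magnetic_rect "1 / 2" "1 / 2" B using B by unfold_locales auto
    \<comment> \<open>The sides a and 1/a cannot both exceed 1.\<close>
    have "2 * (a / 2) \<le> 1 \<or> 2 * (1 / (2 * a)) \<le> 1" using a by (auto simp: field_simps)
    from R.eig_torsion_bound[OF this assms] have low: "exp (- 2 * B * Ta) \<le> eig n (rectangle a) B"
      by (simp add: rectangle_eq_rect Ta_def)
    have "exp (- 2 * B * T1) \<le> eig n (rectangle 1) B"
      using S.eig_torsion_bound[OF _ assms] by (simp add: rectangle_eq_rect T1_def)
    then have pos: "0 < eig n (rectangle 1) B" using exp_gt_zero less_le_trans by blast
    have up: "eig n (rectangle 1) B \<le> C * B ^ (4 + 2 * n) * exp (- 2 * B * T1)"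
      using C(2)[OF B] by (simp add: rectangle_eq_rect T1_def)
    have "c * B * \<delta> \<le> 2 * B * (T1 - Ta)"
    proof -
      have "c * B * \<delta> \<le> (2 * c1) * B * \<delta>" using c B0 \<delta> by (intro mult_right_mono) auto
      also have "\<dots> = 2 * B * (c1 * \<delta>)" by simp
      also have "\<dots> \<le> 2 * B * (T1 - Ta)" using \<delta>(2) B0 by (intro mult_left_mono) auto
      finally show ?thesis .
    qed
    moreover have "k * ln B + ln C \<le> ln B / c"
    proof -
      have "exp 1 \<le> B" using exp_le B by linarith
      then have "1 \<le> ln B" using B0 by (simp add: ln_ge_iff)
      then have "\<bar>ln C\<bar> * 1 \<le> \<bar>ln C\<bar> * ln B" by (intro mult_left_mono) auto
      then have "k * ln B + ln C \<le> (k + \<bar>ln C\<bar>) * ln B" by (simp add: algebra_simps abs_le_iff)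
      also have "\<dots> \<le> (1 / c) * ln B"
        using c k \<open>1 \<le> ln B\<close> by (intro mult_right_mono) (auto simp: field_simps)
      finally show ?thesis by simp
    qed
    ultimately have "1 + c * B * \<delta> - ln B / c \<le> 1 + (2 * B * (T1 - Ta) - (k * ln B + ln C))" by linarith
    \<comment> \<open>Here the exponential ratio is weakened to the linear bound of the
      statement.\<close>
    also have "\<dots> \<le> exp (2 * B * (T1 - Ta) - (k * ln B + ln C))" by (rule exp_ge_add_one_self)
    also have "\<dots> = exp (- 2 * B * Ta) / (C * B ^ (4 + 2 * n) * exp (- 2 * B * T1))"
    proof -
      have "exp (k * ln B) = B ^ (4 + 2 * n)" unfolding k_def using B0 by (simp only: exp_of_nat_mult exp_ln)
      then have "C * B ^ (4 + 2 * n) * exp (- 2 * B * T1) = exp (ln C + k * ln B + - 2 * B * T1)"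
        using C(1) by (simp only: exp_add exp_ln)
      then show ?thesis by (simp only: exp_diff[symmetric]) (simp add: algebra_simps)
    qed
    also have "\<dots> \<le> eig n (rectangle a) B / eig n (rectangle 1) B"
      by (rule frac_le[OF order_trans[OF exp_ge_zero low] low pos up])
    finally show ?thesis unfolding \<delta>_def .
  qed
  then show ?thesis using c(1) by (intro exI[of _ c] exI[of _ 4]) auto
qed

end
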